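(* Let $\omega\ge1$ be an integer and consider the FNO $G_\theta(\boldsymbol{x},\boldsymbol{y})$ of depth $L\ge1$ defined in the context, with the specific basis functions $\psi_j$ and index set $\mathcal{A}$ given there. Suppose there are positive sequences $(R_\ell)_{\ell\ge1}$, $(\beta_j)_{j\ge1}$ and $\xi,\tau>0$ with $\|\psi_j\|_\infty\le\beta_j$ ($1\le j\le s$), $\|W_\ell\|_\infty+\sum_{\boldsymbol{h}\in\mathcal{A}}\|\widehat{\kappa_\ell}(\boldsymbol{h})\|_\infty\le R_\ell$ ($1\le\ell\le L$), $\|\sigma^{(n)}\|_\infty\le\xi\tau^nn!$ ($n\ge1$), and $\sum_{j\ge1}\beta_j^{p^*}<\infty$ for some $p^*\in(0,1)$. With $$\Pi_k:=\prod_{t=1}^k(\xi\tau R_t),\quad S_L:=\frac1\xi\sum_{k=1}^L\Pi_k,\quad C_L:=\max\Big\{\|G_\theta\|_\infty,\|Q\|_\infty\frac{\Pi_L}{S_L}\Big\},$$ $$J:=2\eta\sum_{\boldsymbol{h}\in\mathcal{A}}\frac{\prod_{p\in\mathrm{supp}(\boldsymbol{h})}|h_p|^\omega}{\mathfrak{r}(\boldsymbol{h})},\quad\widetilde S_L:=1+\frac{\|P\|_\infty J}\xi\sum_{k=1}^L\Pi_k,\quad\widetilde C_L:=\max\Big\{\|G_\theta\|_\infty,\|Q\|_\infty\frac{\xi\Pi_L}{\sum_{k=1}^L\Pi_k}\Big\},$$ suppose $C_L\le C$, $\|P\|_\infty S_L\le T$, $\widetilde C_L\le\widetilde C$, $\widetilde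 S_L\le\widetilde T$ for some positive constants $C,T,\widetilde C,\widetilde T$. Let $G(\boldsymbol{x},\boldsymbol{y})$ be a target function with $d_u$ components such that $G_p(\cdot,\boldsymbol{y})\in\mathcal{H}^\omega_D$ and, for all $\boldsymbol{\nu}\in\mathbb{N}_0^d$ with $\|\boldsymbol{\nu}\|_\infty\le\omega$, all $\boldsymbol{y}\in Y$ and $1\le p\le d_u$, $\|\partial^{\boldsymbol{\nu}}_{\boldsymbol{x}}G_p(\cdot,\boldsymbol{y})\|_{L_4(D)}\le\widetilde C(2\pi)^{|\boldsymbol{\nu}|}|\boldsymbol{\nu}|!\,\widetilde T^{|\boldsymbol{\nu}|}$. Let $\epsilon\in(0,\frac12)$ and let $\{\boldsymbol{x}_k\}_{k=1}^m\subset D$ be the $m$-point lattice whose generating vector is good for $\mathcal{H}^\omega_D$ with weights $$\rho_{\mathfrak{u}}:=(2\pi)^{2\omega|\mathfrak{u}|}\Big((\omega|\mathfrak{u}|+1)!\Big(\frac{\widetilde T^\omega}{\sqrt{2\zeta(2\omega\lambda)}}\Big)^{|\mathfrak{u}|}\Big)^{\frac2{1+\lambda}},\qquad\lambda=\frac1{2(\omega-\epsilon)}.$$ (a) Let $a$ be the affine field and suppose additionally $\|\partial^{\boldsymbol{\nu}}_{\boldsymbol{y}}G_p(\cdot,\boldsymbol{y})\|_{L_2(D)}\le C\,|\boldsymbol{\nu}|!\,(T\boldsymbol{\beta})^{\boldsymbol{\nu}}$ for all $\boldsymbol{\nu}\in\mathbb{N}_0^s$, $\boldsymbol{y}\in Y$,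 $1\le p\le d_u$. Let $\delta\in(0,\frac12)$ and let $\{\boldsymbol{y}_i\}_{i=1}^n\subset Y$ be a randomly-shifted lattice whose generating vector is good for $\mathcal{H}^1_Y$ with weights $$\gamma_{\mathfrak{u}}:=\Big((|\mathfrak{u}|+1)!\prod_{j\in\mathfrak{u}}\Big(\sqrt{\tfrac{(2\pi)^{2\lambda}}{2\zeta(2\lambda)2^\lambda}}\;T\beta_j\Big)\Big)^{\frac2{1+\lambda}},\quad\lambda=\tfrac1{2-2\delta}\text{ if }p^*\in(0,\tfrac23],\quad\lambda=\tfrac{p^*}{2-p^*}\text{ if }p^*\in(\tfrac23,1).$$ If the FNO is trained using these points $\{\boldsymbol{y}_i\}$ and $\{\boldsymbol{x}_k\}$, and the training error reaches the threshold $\mathtt{tol}\in(0,1)$ (i.e. $\mathcal{E}_T\le\mathtt{tol}$), then the generalization error is bounded by $$\mathcal{E}_G\le\mathtt{tol}+\mathcal{O}\big(n^{-r/2}+m^{-(\omega-\epsilon)/2}\big),\qquad r:=\min\big(1-\delta,\tfrac1{p^*}-\tfrac12\big).$$ (b) Let $a$ be the Chebyshev field and suppose additionally $\|\partial^{\boldsymbol{\nu}}_{\boldsymbol{y}}G_p(\cdot,\boldsymbol{y})\|_{L_2(D)}\le C(2\pi)^{|\boldsymbol{\nu}|}\sum_{\boldsymbol{m}\le\boldsymbol{\nu}}|\boldsymbol{m}|!\,(T\boldsymbol{\beta})^{\boldsymbol{m}}\mathcal{S}(\boldsymbol{\nu},\boldsymbol{m})$ for all $\boldsymbol{\nu}\in\mathbb{N}_0^s$,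 $\boldsymbol{y}\in Y$, $1\le p\le d_u$, where $G$ depends on $\boldsymbol{y}$ 1-periodically in each variable. Let $\{\boldsymbol{y}_i\}_{i=1}^n\subset Y$ be a lattice (without shift) whose generating vector is good for $\mathcal{H}^\alpha_Y$ with $$\gamma_{\mathfrak{u}}:=(2\pi)^{2\alpha|\mathfrak{u}|}\sum_{\boldsymbol{m}_{\mathfrak{u}}\le\boldsymbol{\alpha}_{\mathfrak{u}}}\Big((|\boldsymbol{m}_{\mathfrak{u}}|+1)!\prod_{j\in\mathfrak{u}}\frac{(T\beta_j)^{m_j}\mathcal{S}(\alpha,m_j)}{\sqrt{2\zeta(2\alpha\lambda)}}\Big)^{\frac2{1+\lambda}},\quad\alpha=\Big\lfloor\tfrac1{p^*}+\tfrac12\Big\rfloor,\quad\lambda=\tfrac{p^*}{2-p^*}.$$ If the FNO is trained using these points $\{\boldsymbol{y}_i\}$ and $\{\boldsymbol{x}_k\}$, and the training error reaches the threshold $\mathtt{tol}\in(0,1)$ (i.e. $\mathcal{E}_T\le\mathtt{tol}$), then the generalization error is bounded by $$\mathcal{E}_G\le\mathtt{tol}+\mathcal{O}\big(n^{-r/2}+m^{-(\omega-\epsilon)/2}\big),\qquad r:=\tfrac1{p^*}-\tfrac12.$$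
   Context: **Errors.** The generalization error $\mathcal{E}_G\ge0$ and training error $\mathcal{E}_T\ge0$ are given by $$\mathcal{E}_G^2=\int_Y\int_D\|G(\boldsymbol{x},\boldsymbol{y})-G_\theta(\boldsymbol{x},\boldsymbol{y})\|_2^2\,\mathrm{d}\boldsymbol{x}\,\mathrm{d}\boldsymbol{y},\qquad\mathcal{E}_T^2=\frac1n\sum_{i=1}^n\frac1m\sum_{k=1}^m\|G(\boldsymbol{x}_k,\boldsymbol{y}_i)-G_\theta(\boldsymbol{x}_k,\boldsymbol{y}_i)\|_2^2.$$ Implied constants in $\mathcal{O}$ do not depend on $n$, $m$. **Index set and fields.** $D=[0,1]^d$ (viewed as a torus). Let $\mathfrak{r}:\mathbb{Z}^d\to(0,\infty)$ be a function such that $\mathbb{Z}^d$ can be enumerated as $\{\boldsymbol{h}_j:j\ge1\}$ with $1/\mathfrak{r}(\boldsymbol{h}_1)\ge1/\mathfrak{r}(\boldsymbol{h}_2)\ge\cdots$; $\mathcal{A}=\{\boldsymbol{h}\in\mathbb{Z}^d:\mathfrak{r}(\boldsymbol{h})\le M\}$ for some $M>0$, a finite set. The parametric dimension is $s=2|\mathcal{A}|$ and $Y=[0,1]^s$. The basis functions are $\psi_0=1$, $\psi_{2j-1}(\boldsymbol{x})=\eta\,e^{2\pi\mathrm{i}\boldsymbol{h}_j\cdot\boldsymbol{x}}/\mathfrak{r}(\boldsymbol{h}_j)$, $\psi_{2j}(\boldsymbol{x})=\mathrm{i}\,\psi_{2j-1}(\boldsymbol{x})$ ($j\ge1$), where $\eta>0$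 is a scaling factor chosen so that $\mathrm{Re}\,a(\boldsymbol{x},\boldsymbol{y})\ge a_{\min}>0$ on $D\times Y$. (One can take $\beta_{2j-1}=\beta_{2j}=\eta/\mathfrak{r}(\boldsymbol{h}_j)$.) The affine field is $a(\boldsymbol{x},\boldsymbol{y})=\psi_0(\boldsymbol{x})+\sum_{j=1}^s(y_j-\tfrac12)\psi_j(\boldsymbol{x})$; the Chebyshev field is $a(\boldsymbol{x},\boldsymbol{y})=\psi_0(\boldsymbol{x})+\sum_{j=1}^s\sin(2\pi y_j)\psi_j(\boldsymbol{x})$. $\mathrm{supp}(\boldsymbol{h})=\{j:h_j\ne0\}$. **FNO.** Let $d_1,\dots,d_{L+1},d_u$ be positive integers. The parameters $\theta$ are $P\in\mathbb{R}^{d_1\times1}$, $Q\in\mathbb{R}^{d_u\times d_{L+1}}$ and, for $\ell=1,\dots,L$, $W_\ell\in\mathbb{R}^{d_{\ell+1}\times d_\ell}$, $b_\ell\in\mathbb{R}^{d_{\ell+1}}$, $\widehat{\kappa_\ell}(\boldsymbol{h})\in\mathbb{C}^{d_{\ell+1}\times d_\ell}$ ($\boldsymbol{h}\in\mathcal{A}$). The activation $\sigma$ is a smooth scalar function, applied componentwise to vectors, and to complex numbers by $\sigma(z)=\sigma(\mathrm{Re}\,z)+\mathrm{i}\,\sigma(\mathrm{Im}\,z)$; $\sigma^{(n)}$ is the $n$th derivative of the univariate function. Put $$(K_\ell v)(\boldsymbol{x})=\sum_{\boldsymbol{h}\in\mathcal{A}}\widehat{\kappa_\ell}(\boldsymbol{h})\,\widehat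 v(\boldsymbol{h})\,e^{2\pi\mathrm{i}\boldsymbol{h}\cdot\boldsymbol{x}},\qquad\boldsymbol{x}\in D,$$ where $\widehat v(\boldsymbol{h})$ stands for the Fourier coefficient $\int_Dv(\boldsymbol{x})e^{-2\pi\mathrm{i}\boldsymbol{h}\cdot\boldsymbol{x}}\,\mathrm{d}\boldsymbol{x}$ (componentwise), implicitly approximated in the FNO by the quadrature $\widehat v^{\rm app}(\boldsymbol{h})=\frac1m\sum_{k=1}^mv(\boldsymbol{x}_k)e^{-2\pi\mathrm{i}\boldsymbol{h}\cdot\boldsymbol{x}_k}$ over the spatial points, without this being shown in the notation. The FNO is $G_\theta(\boldsymbol{x},\boldsymbol{y}):=Q\,\sigma(g^{[L]}(\boldsymbol{x},\boldsymbol{y}))$, where $g^{[1]}(\boldsymbol{x},\boldsymbol{y}):=W_1P\,a(\boldsymbol{x},\boldsymbol{y})+(K_1P\,a(\cdot,\boldsymbol{y}))(\boldsymbol{x})+b_1$ and $g^{[\ell]}(\boldsymbol{x},\boldsymbol{y}):=W_\ell\,\sigma(g^{[\ell-1]}(\boldsymbol{x},\boldsymbol{y}))+(K_\ell\,\sigma(g^{[\ell-1]}(\cdot,\boldsymbol{y})))(\boldsymbol{x})+b_\ell$ for $2\le\ell\le L$. **Notation.** $\|\cdot\|_\infty$ is the matrix $\infty$-norm (maximum absolute row sum) for matrices, the sup-norm for scalar functions, the max-norm for multiindices, and for $G_\theta$ the vector $\infty$-norm followed by the sup over $D\times Y$. $|\boldsymbol{\nu}|=\sum_j\nu_j$; $\boldsymbol{m}\le\boldsymbol{\nu}$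 componentwise (nonnegative integer entries); $(T\boldsymbol{\beta})^{\boldsymbol{\nu}}=\prod_j(T\beta_j)^{\nu_j}$; $\partial^{\boldsymbol{\nu}}$ is the mixed partial derivative. $\mathcal{S}(n,k)$ is the Stirling number of the second kind ($\mathcal{S}(n,0)=\delta_{n,0}$, $\mathcal{S}(n,k)=0$ for $k>n$), $\mathcal{S}(\boldsymbol{\nu},\boldsymbol{m})=\prod_j\mathcal{S}(\nu_j,m_j)$. For $\mathfrak{u}\subseteq\{1:s\}=\{1,\dots,s\}$, $\boldsymbol{m}_{\mathfrak{u}}=(m_j)_{j\in\mathfrak{u}}$, $\boldsymbol{\alpha}_{\mathfrak{u}}=(\alpha)_{j\in\mathfrak{u}}$. $\zeta$ is the Riemann zeta function. **Function spaces.** For integer $\alpha\ge1$ and positive weights $(\gamma_{\mathfrak{u}})_{\mathfrak{u}\subseteq\{1:s\}}$, $$\|v\|_{\mathcal{H}^\alpha_Y}^2:=\sum_{\mathfrak{u}\subseteq\{1:s\}}\frac1{\gamma_{\mathfrak{u}}}\int_{Y_{\mathfrak{u}}}\Big|\int_{Y_{-\mathfrak{u}}}\prod_{j\in\mathfrak{u}}\Big(\frac{\partial}{\partial y_j}\Big)^\alpha v(\boldsymbol{y})\,\mathrm{d}\boldsymbol{y}_{-\mathfrak{u}}\Big|^2\mathrm{d}\boldsymbol{y}_{\mathfrak{u}},$$ where $\boldsymbol{y}_{\mathfrak{u}}=(y_j)_{j\in\mathfrak{u}}\in Y_{\mathfrak{u}}$ and $\boldsymbol{y}_{-\mathfrak{u}}=(y_j)_{j\notin\mathfrak{u}}\in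 Y_{-\mathfrak{u}}$. In (a) $\mathcal{H}^1_Y$ is the non-periodic weighted Sobolev space with this norm ($\alpha=1$); in (b) $\mathcal{H}^\alpha_Y$ is the weighted Korobov space of 1-periodic functions with this norm. $\mathcal{H}^\omega_D$ is the weighted Korobov space of 1-periodic functions on $D$ with the analogous norm, with $(D,d,\omega,\rho_{\mathfrak{u}})$ in place of $(Y,s,\alpha,\gamma_{\mathfrak{u}})$. **Lattices.** The spatial lattice with generating vector $\boldsymbol{z}\in\mathbb{Z}^d$ is $\boldsymbol{x}_k=(k\boldsymbol{z}\bmod m)/m$, $k=1,\dots,m$. The parametric lattice with generating vector $\boldsymbol{w}\in\mathbb{Z}^s$ is $\boldsymbol{y}_i=(i\boldsymbol{w}/n+\boldsymbol{\Delta})\bmod1$, $i=1,\dots,n$, with $\boldsymbol{\Delta}\in[0,1]^s$ a (uniform) random shift in (a) and $\boldsymbol{\Delta}=\boldsymbol{0}$ in (b). The worst case error $e^{\rm wor}$ of an equal-weight quadrature rule is the supremum of its integration error over the unit ball of the space; r.m.s. is the root mean square over $\boldsymbol{\Delta}$. Generating vectors are *good* (obtainable by a known component-by-component construction) if $$\mathrm{r.m.s.}\;e^{\rm wor}_n(\boldsymbol{w};\mathcal{H}^1_Y)\le\Big(\tfrac2n\sum_{\emptyset\ne\mathfrak{u}\subseteq\{1:s\}}\gamma_{\mathfrak{u}}^\lambda\Big[\tfrac{2\zeta(2\lambda)2^\lambda}{(2\pi)^{2\lambda}}\Big]^{|\mathfrak{u}|}\Big)^{\frac1{2\lambda}}\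 \forall\lambda\in(\tfrac12,1]\quad\text{(in (a))},$$ $$e^{\rm wor}_n(\boldsymbol{w};\mathcal{H}^\alpha_Y)\le\Big(\tfrac2n\sum_{\emptyset\ne\mathfrak{u}\subseteq\{1:s\}}\gamma_{\mathfrak{u}}^\lambda\Big[\tfrac{2\zeta(2\alpha\lambda)}{(2\pi)^{2\alpha\lambda}}\Big]^{|\mathfrak{u}|}\Big)^{\frac1{2\lambda}}\ \forall\lambda\in(\tfrac1{2\alpha},1]\quad\text{(in (b))},$$ $$e^{\rm wor}_m(\boldsymbol{z};\mathcal{H}^\omega_D)\le\Big(\tfrac2m\sum_{\emptyset\ne\mathfrak{u}\subseteq\{1:d\}}\rho_{\mathfrak{u}}^\lambda\Big[\tfrac{2\zeta(2\omega\lambda)}{(2\pi)^{2\omega\lambda}}\Big]^{|\mathfrak{u}|}\Big)^{\frac1{2\lambda}}\ \forall\lambda\in(\tfrac1{2\omega},1].$$ *)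

theory Defs
  imports "HOL-Analysis.Analysis" "HOL-Combinatorics.Stirling"
begin

text \<open>
  The dimension \<open>s = 2 |A|\<close> depends on a set of frequencies, so dimensions are not types here.
  Points and multiindices are functions on \<^typ>\<open>nat\<close> that are extensional on their index
  set \<open>I\<close> (mostly \<open>{1..d}\<close> or \<open>{1..s}\<close>); matrices are functions of a row and a column index, both
  counted from 1 and used only up to the stated numbers of rows and columns.
\<close>

type_synonym point = "nat \<Rightarrow> real"

definition unit_cube :: "nat set \<Rightarrow> point set" where
  "unit_cube I = (\<Pi>\<^sub>E j\<in>I. {0..1})"

definition cube_measure :: "nat set \<Rightarrow> point measure" where
  "cube_measure I = Pi\<^sub>M I (\<lambda>_. restrict_space lborel {0..1})"

definition Lq :: "nat \<Rightarrow> 'a measure \<Rightarrow> ('a \<Rightarrow> complex) set" where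
  "Lq q M = {f \<in> borel_measurable M. integrable M (\<lambda>x. cmod (f x) ^ q)}"

definition Lq_norm :: "nat \<Rightarrow> 'a measure \<Rightarrow> ('a \<Rightarrow> complex) \<Rightarrow> real" where
  "Lq_norm q M f = (LINT x|M. cmod (f x) ^ q) powr (1 / real q)"

definition zeta :: "real \<Rightarrow> real" where
  "zeta t = (\<Sum>k. 1 / real (Suc k) powr t)"


subsection \<open>Spaces of dominating mixed smoothness\<close>

definition smooth :: "(real \<Rightarrow> real) \<Rightarrow> bool" where
  "smooth f \<longleftrightarrow> (\<forall>k t. (deriv ^^ k) f field_differentiable (at t))"

text \<open>
  The flag \<open>per\<close> selects between functions on the torus and functions on the cube. Derivatives are
  weak ones, tested against products of univariate test functions, whose span is dense in all
  test functions. For \<open>per = True\<close> the test functions do not vanish at the faces of the cube, so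
  that the derivatives are those on the torus (for \<open>\<alpha> \<ge> 2\<close> this forces the
  lower-order derivatives to be periodic as well).
\<close>

definition test_fun :: "bool \<Rightarrow> (real \<Rightarrow> real) \<Rightarrow> bool" where
  "test_fun per \<phi> \<longleftrightarrow> smooth \<phi> \<and>
     (if per then \<forall>t. \<phi> (t + 1) = \<phi> t
      else \<exists>a b. 0 < a \<and> b < 1 \<and> (\<forall>t. t \<notin> {a..b} \<longrightarrow> \<phi> t = 0))"

definition has_weak_deriv ::
  "bool \<Rightarrow> nat set \<Rightarrow> (nat \<Rightarrow> nat) \<Rightarrow> (point \<Rightarrow> complex) \<Rightarrow> (point \<Rightarrow> complex) \<Rightarrow> bool" where
  "has_weak_deriv per I \<nu> v g \<longleftrightarrow>
     integrable (cube_measure I) v \<and> integrable (cube_measure I) g \<and>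
     (\<forall>\<phi>. (\<forall>j\<in>I. test_fun per (\<phi> j)) \<longrightarrow>
        (LINT x|cube_measure I. v x * of_real (\<Prod>j\<in>I. (deriv ^^ \<nu> j) (\<phi> j) (x j))) =
        (-1) ^ (\<Sum>j\<in>I. \<nu> j) * (LINT x|cube_measure I. g x * of_real (\<Prod>j\<in>I. \<phi> j (x j))))"

text \<open>Weak derivatives are unique almost everywhere, so integrals do not depend on the choice.\<close>

definition weak_deriv ::
  "bool \<Rightarrow> nat set \<Rightarrow> (nat \<Rightarrow> nat) \<Rightarrow> (point \<Rightarrow> complex) \<Rightarrow> point \<Rightarrow> complex" where
  "weak_deriv per I \<nu> v = (SOME g. has_weak_deriv per I \<nu> v g)"

abbreviation (input) deriv_order :: "nat set \<Rightarrow> nat \<Rightarrow> nat \<Rightarrow> nat" where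
  "deriv_order u \<alpha> \<equiv> \<lambda>j. if j \<in> u then \<alpha> else 0"

text \<open>
  Elements are functions, represented by their continuous version, since they are
  evaluated at quadrature points. As a set the space does not depend on the positive weights.
\<close>

definition mixed_space :: "bool \<Rightarrow> nat set \<Rightarrow> nat \<Rightarrow> (point \<Rightarrow> complex) set" where
  "mixed_space per I \<alpha> = {v.
     continuous_on (unit_cube I) v \<and>
     (per \<longrightarrow> (\<forall>y\<in>unit_cube I. \<forall>j\<in>I. v (y(j := 0)) = v (y(j := 1)))) \<and>
     (\<forall>u\<subseteq>I. \<exists>g\<in>Lq 2 (cube_measure I). has_weak_deriv per I (deriv_order u \<alpha>) v g)}"

definition mixed_norm ::
  "bool \<Rightarrow> nat set \<Rightarrow> nat \<Rightarrow> (nat set \<Rightarrow> real) \<Rightarrow> (point \<Rightarrow> complex) \<Rightarrow> real" where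
  "mixed_norm per I \<alpha> \<gamma> v = sqrt (\<Sum>u\<in>Pow I. 1 / \<gamma> u *
     (LINT y|cube_measure u. (cmod (LINT z|cube_measure (I - u).
        weak_deriv per I (deriv_order u \<alpha>) v (merge u (I - u) (y, z))))\<^sup>2))"

abbreviation (input) "korobov_space \<equiv> mixed_space True"


subsection \<open>Lattice rules\<close>

definition lattice_point ::
  "nat set \<Rightarrow> nat \<Rightarrow> (nat \<Rightarrow> int) \<Rightarrow> point \<Rightarrow> nat \<Rightarrow> point" where
  "lattice_point I N z \<Delta> k = (\<lambda>j\<in>I. frac (real k * of_int (z j) / real N + \<Delta> j))"

definition worst_case_error ::
  "bool \<Rightarrow> nat set \<Rightarrow> nat \<Rightarrow> (nat set \<Rightarrow> real) \<Rightarrow> nat \<Rightarrow> (nat \<Rightarrow> point) \<Rightarrow> ennreal" where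
  "worst_case_error per I \<alpha> \<gamma> N pts =
     (SUP v\<in>{v \<in> mixed_space per I \<alpha>. mixed_norm per I \<alpha> \<gamma> v \<le> 1}.
        ennreal (cmod ((LINT y|cube_measure I. v y) - (\<Sum>k=1..N. v (pts k)) / of_nat N)))"

definition lattice_bound :: "nat set \<Rightarrow> nat \<Rightarrow> (nat set \<Rightarrow> real) \<Rightarrow> real \<Rightarrow> real \<Rightarrow> real" where
  "lattice_bound I N \<gamma> lam c =
     (2 / real N * (\<Sum>u\<in>Pow I - {{}}. \<gamma> u powr lam * c ^ card u)) powr (1 / (2 * lam))"

definition good_lattice ::
  "nat set \<Rightarrow> nat \<Rightarrow> (nat set \<Rightarrow> real) \<Rightarrow> nat \<Rightarrow> (nat \<Rightarrow> int) \<Rightarrow> bool" where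
  "good_lattice I \<alpha> \<gamma> N z \<longleftrightarrow> (\<forall>lam. 1 / (2 * real \<alpha>) < lam \<and> lam \<le> 1 \<longrightarrow>
     worst_case_error True I \<alpha> \<gamma> N (lattice_point I N z (\<lambda>_. 0))
       \<le> ennreal (lattice_bound I N \<gamma> lam (2 * zeta (2 * \<alpha> * lam) / (2 * pi) powr (2 * \<alpha> * lam))))"

text \<open>The bound on the root mean square over the shift \<open>\<Delta>\<close>, with both sides squared.\<close>

definition good_shifted_lattice ::
  "nat set \<Rightarrow> (nat set \<Rightarrow> real) \<Rightarrow> nat \<Rightarrow> (nat \<Rightarrow> int) \<Rightarrow> bool" where
  "good_shifted_lattice I \<gamma> N w \<longleftrightarrow> (\<forall>lam. 1 / 2 < lam \<and> lam \<le> 1 \<longrightarrow>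
     (\<integral>\<^sup>+\<Delta>. (worst_case_error False I 1 \<gamma> N (lattice_point I N w \<Delta>))\<^sup>2 \<partial>cube_measure I)
       \<le> (ennreal (lattice_bound I N \<gamma> lam
             (2 * zeta (2 * lam) * 2 powr lam / (2 * pi) powr (2 * lam))))\<^sup>2)"


subsection \<open>Input fields\<close>

definition fourier_char :: "nat \<Rightarrow> (nat \<Rightarrow> int) \<Rightarrow> point \<Rightarrow> complex" where
  "fourier_char d h x = cis (2 * pi * (\<Sum>p=1..d. of_int (h p) * x p))"

definition basis_fun ::
  "nat \<Rightarrow> real \<Rightarrow> ((nat \<Rightarrow> int) \<Rightarrow> real) \<Rightarrow> (nat \<Rightarrow> nat \<Rightarrow> int) \<Rightarrow> nat \<Rightarrow> point \<Rightarrow> complex" where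
  "basis_fun d \<eta> r h j x =
     (if j = 0 then 1
      else let k = (j + 1) div 2; e = of_real \<eta> * fourier_char d (h k) x / of_real (r (h k))
           in if odd j then e else \<i> * e)"

definition affine_field :: "nat \<Rightarrow> (nat \<Rightarrow> point \<Rightarrow> complex) \<Rightarrow> point \<Rightarrow> point \<Rightarrow> complex" where
  "affine_field s \<psi> x y = \<psi> 0 x + (\<Sum>j=1..s. of_real (y j - 1 / 2) * \<psi> j x)"

definition chebyshev_field :: "nat \<Rightarrow> (nat \<Rightarrow> point \<Rightarrow> complex) \<Rightarrow> point \<Rightarrow> point \<Rightarrow> complex" where
  "chebyshev_field s \<psi> x y = \<psi> 0 x + (\<Sum>j=1..s. of_real (sin (2 * pi * y j)) * \<psi> j x)"


subsection \<open>Fourier neural operators\<close>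

record fno_params =
  lift_mat :: "nat \<Rightarrow> nat \<Rightarrow> real"
  proj_mat :: "nat \<Rightarrow> nat \<Rightarrow> real"
  weight :: "nat \<Rightarrow> nat \<Rightarrow> nat \<Rightarrow> real"
  bias :: "nat \<Rightarrow> nat \<Rightarrow> real"
  kernel_coeff :: "nat \<Rightarrow> (nat \<Rightarrow> int) \<Rightarrow> nat \<Rightarrow> nat \<Rightarrow> complex"

definition mat_norm_inf :: "nat \<Rightarrow> nat \<Rightarrow> (nat \<Rightarrow> nat \<Rightarrow> 'a::real_normed_vector) \<Rightarrow> real" where
  "mat_norm_inf nr nc B = Max ((\<lambda>i. \<Sum>j=1..nc. norm (B i j)) ` {1..nr})"

definition fourier_coeff :: "nat \<Rightarrow> (point \<Rightarrow> complex) \<Rightarrow> (nat \<Rightarrow> int) \<Rightarrow> complex" where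
  "fourier_coeff d v h = (LINT x|cube_measure {1..d}. v x * fourier_char d (\<lambda>p. - h p) x)"

definition fourier_coeff_app ::
  "nat \<Rightarrow> nat \<Rightarrow> (nat \<Rightarrow> point) \<Rightarrow> (point \<Rightarrow> complex) \<Rightarrow> (nat \<Rightarrow> int) \<Rightarrow> complex" where
  "fourier_coeff_app d m xs v h = (\<Sum>k=1..m. v (xs k) * fourier_char d (\<lambda>p. - h p) (xs k)) / of_nat m"

definition act :: "(real \<Rightarrow> real) \<Rightarrow> complex \<Rightarrow> complex" where
  "act \<sigma> z = Complex (\<sigma> (Re z)) (\<sigma> (Im z))"

text \<open>
  The argument \<open>FC\<close> is the functional that yields the Fourier coefficients, either
  \<^const>\<open>fourier_coeff\<close> or \<^const>\<open>fourier_coeff_app\<close>. The following maps the values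
  \<open>v\<close> entering layer \<open>l\<close> to \<open>W\<^sub>l v + K\<^sub>l v + b\<^sub>l\<close>.
\<close>

definition fno_layer ::
  "nat \<Rightarrow> (nat \<Rightarrow> int) set \<Rightarrow> (nat \<Rightarrow> nat) \<Rightarrow> ((point \<Rightarrow> complex) \<Rightarrow> (nat \<Rightarrow> int) \<Rightarrow> complex) \<Rightarrow>
   fno_params \<Rightarrow> nat \<Rightarrow> (point \<Rightarrow> nat \<Rightarrow> complex) \<Rightarrow> point \<Rightarrow> nat \<Rightarrow> complex" where
  "fno_layer d A dims FC \<theta> l v x i =
     (\<Sum>j=1..dims l. of_real (weight \<theta> l i j) * v x j) +
     (\<Sum>h\<in>A. (\<Sum>j=1..dims l. kernel_coeff \<theta> l h i j * FC (\<lambda>x'. v x' j) h) * fourier_char d h x) +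
     of_real (bias \<theta> l i)"

text \<open>
  \<open>fno_hidden \<dots> \<theta> 0 a\<close> is \<open>P a\<close>, and \<open>fno_hidden \<dots> \<theta> l a\<close> is
  \<open>\<sigma>(g\<^sup>[\<^sup>l\<^sup>])\<close> for \<open>l \<ge> 1\<close>, where \<open>a\<close> is the input field at a fixed parameter.
\<close>

primrec fno_hidden ::
  "nat \<Rightarrow> (nat \<Rightarrow> int) set \<Rightarrow> (nat \<Rightarrow> nat) \<Rightarrow> ((point \<Rightarrow> complex) \<Rightarrow> (nat \<Rightarrow> int) \<Rightarrow> complex) \<Rightarrow>
   (real \<Rightarrow> real) \<Rightarrow> fno_params \<Rightarrow> nat \<Rightarrow> (point \<Rightarrow> complex) \<Rightarrow> point \<Rightarrow> nat \<Rightarrow> complex" where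
  "fno_hidden d A dims FC \<sigma> \<theta> 0 a = (\<lambda>x i. of_real (lift_mat \<theta> i 1) * a x)"
| "fno_hidden d A dims FC \<sigma> \<theta> (Suc l) a =
     (\<lambda>x i. act \<sigma> (fno_layer d A dims FC \<theta> (Suc l) (fno_hidden d A dims FC \<sigma> \<theta> l a) x i))"

definition fno ::
  "nat \<Rightarrow> (nat \<Rightarrow> int) set \<Rightarrow> nat \<Rightarrow> (nat \<Rightarrow> nat) \<Rightarrow> ((point \<Rightarrow> complex) \<Rightarrow> (nat \<Rightarrow> int) \<Rightarrow> complex) \<Rightarrow>
   (real \<Rightarrow> real) \<Rightarrow> (point \<Rightarrow> point \<Rightarrow> complex) \<Rightarrow> fno_params \<Rightarrow>
   nat \<Rightarrow> point \<Rightarrow> point \<Rightarrow> complex" where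
  "fno d A L dims FC \<sigma> a \<theta> p x y =
     (\<Sum>j=1..dims (L + 1). of_real (proj_mat \<theta> p j) *
        fno_hidden d A dims FC \<sigma> \<theta> L (\<lambda>x'. a x' y) x j)"

text \<open>Vector-valued functions on \<open>D \<times> Y\<close> have the component index as their first argument.\<close>

definition sup_norm :: "nat \<Rightarrow> nat \<Rightarrow> nat \<Rightarrow> (nat \<Rightarrow> point \<Rightarrow> point \<Rightarrow> complex) \<Rightarrow> real" where
  "sup_norm d s du H =
     (SUP (x, y)\<in>unit_cube {1..d} \<times> unit_cube {1..s}. Max ((\<lambda>p. cmod (H p x y)) ` {1..du}))"

definition gen_error ::
  "nat \<Rightarrow> nat \<Rightarrow> nat \<Rightarrow> (nat \<Rightarrow> point \<Rightarrow> point \<Rightarrow> complex) \<Rightarrow>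
   (nat \<Rightarrow> point \<Rightarrow> point \<Rightarrow> complex) \<Rightarrow> real" where
  "gen_error d s du G H = sqrt (LINT y|cube_measure {1..s}. LINT x|cube_measure {1..d}.
     (\<Sum>p=1..du. (cmod (G p x y - H p x y))\<^sup>2))"

definition train_error ::
  "nat \<Rightarrow> nat \<Rightarrow> nat \<Rightarrow> (nat \<Rightarrow> point) \<Rightarrow> (nat \<Rightarrow> point) \<Rightarrow>
   (nat \<Rightarrow> point \<Rightarrow> point \<Rightarrow> complex) \<Rightarrow> (nat \<Rightarrow> point \<Rightarrow> point \<Rightarrow> complex) \<Rightarrow> real" where
  "train_error du n m ys xs G H = sqrt (1 / real n * (\<Sum>i=1..n. 1 / real m * (\<Sum>k=1..m.
     (\<Sum>p=1..du. (cmod (G p (xs k) (ys i) - H p (xs k) (ys i)))\<^sup>2))))"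


subsection \<open>Constants controlling the network\<close>

definition Pi_R :: "real \<Rightarrow> real \<Rightarrow> (nat \<Rightarrow> real) \<Rightarrow> nat \<Rightarrow> real" where
  "Pi_R \<xi> \<tau> R k = (\<Prod>t=1..k. \<xi> * \<tau> * R t)"

definition S_const :: "real \<Rightarrow> real \<Rightarrow> (nat \<Rightarrow> real) \<Rightarrow> nat \<Rightarrow> real" where
  "S_const \<xi> \<tau> R L = 1 / \<xi> * (\<Sum>k=1..L. Pi_R \<xi> \<tau> R k)"

definition C_const :: "real \<Rightarrow> real \<Rightarrow> (nat \<Rightarrow> real) \<Rightarrow> nat \<Rightarrow> real \<Rightarrow> real \<Rightarrow> real" where
  "C_const \<xi> \<tau> R L normG normQ = max normG (normQ * (Pi_R \<xi> \<tau> R L / S_const \<xi> \<tau> R L))"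

definition J_const ::
  "nat \<Rightarrow> real \<Rightarrow> ((nat \<Rightarrow> int) \<Rightarrow> real) \<Rightarrow> (nat \<Rightarrow> int) set \<Rightarrow> nat \<Rightarrow> real" where
  "J_const d \<eta> r A \<omega> =
     2 * \<eta> * (\<Sum>h\<in>A. (\<Prod>p\<in>{p\<in>{1..d}. h p \<noteq> 0}. \<bar>of_int (h p)\<bar> ^ \<omega>) / r h)"

definition St_const :: "real \<Rightarrow> real \<Rightarrow> (nat \<Rightarrow> real) \<Rightarrow> nat \<Rightarrow> real \<Rightarrow> real \<Rightarrow> real" where
  "St_const \<xi> \<tau> R L normP J = 1 + normP * J / \<xi> * (\<Sum>k=1..L. Pi_R \<xi> \<tau> R k)"

definition Ct_const :: "real \<Rightarrow> real \<Rightarrow> (nat \<Rightarrow> real) \<Rightarrow> nat \<Rightarrow> real \<Rightarrow> real \<Rightarrow> real" where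
  "Ct_const \<xi> \<tau> R L normG normQ =
     max normG (normQ * (\<xi> * Pi_R \<xi> \<tau> R L / (\<Sum>k=1..L. Pi_R \<xi> \<tau> R k)))"


subsection \<open>Weights\<close>

definition rho_weight :: "nat \<Rightarrow> real \<Rightarrow> real \<Rightarrow> nat set \<Rightarrow> real" where
  "rho_weight \<omega> \<epsilon> Tt u = (let lam = 1 / (2 * (real \<omega> - \<epsilon>)) in
     (2 * pi) ^ (2 * \<omega> * card u) *
     (fact (\<omega> * card u + 1) * (Tt ^ \<omega> / sqrt (2 * zeta (2 * \<omega> * lam))) ^ card u)
       powr (2 / (1 + lam)))"

definition gamma_affine :: "real \<Rightarrow> (nat \<Rightarrow> real) \<Rightarrow> real \<Rightarrow> real \<Rightarrow> nat set \<Rightarrow> real" where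
  "gamma_affine T \<beta> pstar \<delta> u =
     (let lam = (if pstar \<le> 2 / 3 then 1 / (2 - 2 * \<delta>) else pstar / (2 - pstar)) in
     (fact (card u + 1) *
        (\<Prod>j\<in>u. sqrt ((2 * pi) powr (2 * lam) / (2 * zeta (2 * lam) * 2 powr lam)) * (T * \<beta> j)))
       powr (2 / (1 + lam)))"

definition alpha_chebyshev :: "real \<Rightarrow> nat" where
  "alpha_chebyshev pstar = nat \<lfloor>1 / pstar + 1 / 2\<rfloor>"

definition gamma_chebyshev :: "real \<Rightarrow> (nat \<Rightarrow> real) \<Rightarrow> real \<Rightarrow> nat set \<Rightarrow> real" where
  "gamma_chebyshev T \<beta> pstar u = (let \<alpha> = alpha_chebyshev pstar; lam = pstar / (2 - pstar) in
     (2 * pi) ^ (2 * \<alpha> * card u) *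
     (\<Sum>k\<in>(\<Pi>\<^sub>E j\<in>u. {0..\<alpha>}).
        (fact ((\<Sum>j\<in>u. k j) + 1) *
           (\<Prod>j\<in>u. (T * \<beta> j) ^ k j * real (Stirling \<alpha> (k j)) / sqrt (2 * zeta (2 * \<alpha> * lam))))
          powr (2 / (1 + lam))))"


subsection \<open>Regularity of the target\<close>

definition regular_in_x :: "nat \<Rightarrow> nat \<Rightarrow> (point \<Rightarrow> complex) \<Rightarrow> real \<Rightarrow> real \<Rightarrow> bool" where
  "regular_in_x d \<omega> v Ct Tt \<longleftrightarrow> v \<in> korobov_space {1..d} \<omega> \<and>
     (\<forall>\<nu>\<in>(\<Pi>\<^sub>E j\<in>{1..d}. {0..\<omega>}). let k = (\<Sum>j=1..d. \<nu> j) in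
        \<exists>g\<in>Lq 4 (cube_measure {1..d}). has_weak_deriv True {1..d} \<nu> v g \<and>
           Lq_norm 4 (cube_measure {1..d}) g \<le> Ct * (2 * pi) ^ k * fact k * Tt ^ k)"

text \<open>
  Partial derivatives of \<open>y \<mapsto> V(\<cdot>, y)\<close>, seen as a function on \<open>U\<^sup>s\<close> with values in \<open>L\<^sub>2(D)\<close>:
  \<open>g \<nu>\<close> is \<open>\<partial>\<^sup>\<nu>\<^sub>y V\<close>, and all difference quotients converge in
  \<open>L\<^sub>2(D)\<close>. If the classical derivatives exist for every \<open>x\<close> and satisfy bounds that are locally
  uniform in \<open>y\<close>, they meet this condition. With \<open>U = {0..1}\<close> derivatives at the boundary are
  one-sided. The bounds are imposed on \<open>Y = [0,1]\<^sup>s\<close>.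
\<close>

definition regular_in_y ::
  "nat \<Rightarrow> nat \<Rightarrow> real set \<Rightarrow> (point \<Rightarrow> point \<Rightarrow> complex) \<Rightarrow> ((nat \<Rightarrow> nat) \<Rightarrow> real) \<Rightarrow> bool" where
  "regular_in_y d s U V bnd \<longleftrightarrow> (\<exists>g :: (nat \<Rightarrow> nat) \<Rightarrow> point \<Rightarrow> point \<Rightarrow> complex.
     (\<forall>y\<in>(\<Pi>\<^sub>E j\<in>{1..s}. U). \<forall>x\<in>unit_cube {1..d}. g (\<lambda>j\<in>{1..s}. 0) x y = V x y) \<and>
     (\<forall>\<nu>\<in>(\<Pi>\<^sub>E j\<in>{1..s}. UNIV).
        (\<forall>y\<in>(\<Pi>\<^sub>E j\<in>{1..s}. U).
           (\<lambda>x. g \<nu> x y) \<in> Lq 2 (cube_measure {1..d}) \<and>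
           (\<forall>j\<in>{1..s}.
              ((\<lambda>t. Lq_norm 2 (cube_measure {1..d})
                  (\<lambda>x. (g \<nu> x (y(j := t)) - g \<nu> x y) / of_real (t - y j)
                        - g (\<nu>(j := Suc (\<nu> j))) x y))
               \<longlongrightarrow> 0) (at (y j) within U))) \<and>
        (\<forall>y\<in>unit_cube {1..s}. Lq_norm 2 (cube_measure {1..d}) (\<lambda>x. g \<nu> x y) \<le> bnd \<nu>)))"

definition bound_affine :: "nat \<Rightarrow> real \<Rightarrow> real \<Rightarrow> (nat \<Rightarrow> real) \<Rightarrow> (nat \<Rightarrow> nat) \<Rightarrow> real" where
  "bound_affine s C T \<beta> \<nu> = C * fact (\<Sum>j=1..s. \<nu> j) * (\<Prod>j=1..s. (T * \<beta> j) ^ \<nu> j)"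

definition bound_chebyshev :: "nat \<Rightarrow> real \<Rightarrow> real \<Rightarrow> (nat \<Rightarrow> real) \<Rightarrow> (nat \<Rightarrow> nat) \<Rightarrow> real" where
  "bound_chebyshev s C T \<beta> \<nu> = C * (2 * pi) ^ (\<Sum>j=1..s. \<nu> j) *
     (\<Sum>k\<in>(\<Pi>\<^sub>E j\<in>{1..s}. {0..\<nu> j}).
        fact (\<Sum>j=1..s. k j) * (\<Prod>j=1..s. (T * \<beta> j) ^ k j) *
        (\<Prod>j=1..s. real (Stirling (\<nu> j) (k j))))"

definition periodic_in_y :: "nat \<Rightarrow> nat \<Rightarrow> (point \<Rightarrow> point \<Rightarrow> complex) \<Rightarrow> bool" where
  "periodic_in_y d s V \<longleftrightarrow> (\<forall>x\<in>unit_cube {1..d}. \<forall>y\<in>(\<Pi>\<^sub>E j\<in>{1..s}. UNIV). \<forall>j\<in>{1..s}.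
     V x (y(j := y j + 1)) = V x y)"

end

theory Submission
  imports Defs
begin

text \<open>
  Up to two quadrature errors, the squared generalization error is the squared training error: one is that of
  the parametric rule for \<open>y \<mapsto> \<integral>\<^sub>D |G - G\<^sub>\<theta>|\<^sup>2\<close>, the other the average over \<open>i\<close> of the errors of the spatial rule
  for \<open>|G - G\<^sub>\<theta>|\<^sup>2(\<cdot>, y\<^sub>i)\<close>. Both integrands belong to the respective spaces of mixed smoothness, with norms
  bounded independently of \<open>n\<close>, \<open>m\<close>, the lattices and \<open>\<theta>\<close>, so each quadrature error is at most a constant times the
  worst case error, and a suitable choice of the exponent in the bounds for good generating vectors gives
  twice the stated rates. Taking square roots halves them.

  The biases of the network are arbitrary, so only its derivatives are controlled layer by layer; its size is
  controlled by the assumption on \<open>\<parallel>G\<^sub>\<theta>\<parallel>\<^sub>\<infinity>\<close>. A bias is harmless for the derivatives with respect to \<open>x\<close> only if the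
  Fourier coefficients of a constant vanish at nonzero frequencies. The lattice approximations of these coefficients may
  violate this by aliasing, but then a single Fourier character shows that the worst case error of
  the spatial lattice is bounded below, and the trivial bound on the generalization error suffices.
\<close>

text \<open>Constants may grow freely with the dimensions, the smoothness and the depth, so all
  bounds are crude; what matters is that each constant is chosen before \<theta> and the Fourier
  functional. The square of G - G_\<theta> is treated differently in the two variables. In y it
  becomes an inner product in L_2(D) of functions that are differentiable with values in L_2(D), and
  the Leibniz rule for that inner product suffices. In x the target has only weak derivatives; they
  are taken in L_4 because products then lie in L_2. The norms of the function spaces contain weak
  derivatives picked by a choice operator, so their uniqueness must be proved before any norm can be
  estimated. The network itself is differentiated classically. There, and for everything
  differentiated in y, one derivative more than the space asks for is carried along, because the
  bound on the next derivative makes the previous one continuous. Periodic functions live on the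
  whole space, where opposite faces of the cube cancel under partial integration; the others live on
  the closed cube with one-sided derivatives.\<close>

abbreviation (input) "unit_meas \<equiv> restrict_space lborel {0..1::real}"

section \<open>Integration over the cube\<close>

lemma space_unit_meas [simp]: "space unit_meas = {0..1}"
  by (simp add: space_restrict_space)

lemma finite_measure_unit: "finite_measure unit_meas"
  by standard (simp add: emeasure_restrict_space)

interpretation unit_meas: finite_measure unit_meas
  by (rule finite_measure_unit)

interpretation cube: product_sigma_finite "\<lambda>_::nat. unit_meas"
  by standard

lemma space_cube [simp]: "space (cube_measure I) = unit_cube I"
  by (simp add: cube_measure_def unit_cube_def space_PiM)

lemma unit_cubeD: "x \<in> unit_cube I \<Longrightarrow> j \<in> I \<Longrightarrow> 0 \<le> x j \<and> x j \<le> 1"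
  by (auto simp: unit_cube_def PiE_def)

lemma emeasure_cube: "finite I \<Longrightarrow> emeasure (cube_measure I) (unit_cube I) = 1"
  using cube.emeasure_PiM[of I "\<lambda>_. {0..1}"]
  by (simp add: cube_measure_def unit_cube_def emeasure_restrict_space sets_restrict_space_iff)

lemma finite_measure_cube: "finite I \<Longrightarrow> finite_measure (cube_measure I)"
  by standard (simp add: emeasure_cube)

lemma measure_cube [simp]: "finite I \<Longrightarrow> measure (cube_measure I) (unit_cube I) = 1"
  by (simp add: measure_def emeasure_cube)

text \<open>Holds for \<open>i\<close> outside \<open>I\<close> as well: points of the cube are
  extensional, so that coordinate is the constant \<open>undefined\<close>. Having every coordinate
  makes the inclusion into the full function space Borel measurable, and with it all functions that
  are continuous on the cube.\<close>

lemma measurable_cube_component: "(\<lambda>x. x i) \<in> borel_measurable (cube_measure I)"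
proof (cases "i \<in> I")
  case True
  have "(\<lambda>x. x i) \<in> measurable (cube_measure I) unit_meas"
    using True unfolding cube_measure_def by measurable
  then show ?thesis
    by (rule measurable_compose) (simp add: measurable_restrict_space1)
next
  case False
  have "(\<lambda>x::point. x i) \<in> borel_measurable (cube_measure I) \<longleftrightarrow>
      (\<lambda>x::point. undefined::real) \<in> borel_measurable (cube_measure I)"
    using False by (intro measurable_cong) (auto simp: unit_cube_def PiE_def extensional_def)
  then show ?thesis by simp
qed

lemma measurable_cube_ident: "(\<lambda>x. x) \<in> borel_measurable (cube_measure I)"
  by (intro measurable_coordinatewise_then_product measurable_cube_component)

lemma borel_measurable_cube:
  fixes f :: "point \<Rightarrow> 'b::topological_space"
  assumes "continuous_on (unit_cube I) f"
  shows "f \<in> borel_measurable (cube_measure I)"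
proof -
  have "(\<lambda>x. x) \<in> measurable (cube_measure I) (restrict_space borel (unit_cube I))"
    by (intro measurable_restrict_space2 measurable_cube_ident) auto
  from measurable_compose[OF this borel_measurable_continuous_on_restrict[OF assms]]
  show ?thesis .
qed

text \<open>Inside the space of all functions on the naturals the cube is a product of copies of
  [0,1] over \<open>I\<close> and of singletons \<open>{undefined}\<close> elsewhere, so Tychonoff's
  theorem applies.\<close>

lemma compact_unit_cube: "compact (unit_cube I)"
proof -
  have eq: "unit_cube I = (\<Pi>\<^sub>E j\<in>UNIV. if j \<in> I then {0..1} else {undefined})"
    by (auto simp: unit_cube_def PiE_def extensional_def Pi_def split: if_splits)
  have "compactin (product_topology (\<lambda>_. euclidean) UNIV)
      (\<Pi>\<^sub>E j\<in>(UNIV::nat set). if j \<in> I then {0..1::real} else {undefined})"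
    by (subst compactin_PiE) auto
  then show ?thesis
    unfolding eq by (simp add: euclidean_product_topology)
qed

lemma closed_unit_cube: "closed (unit_cube I)"
  by (simp add: compact_unit_cube compact_imp_closed)

lemma integrable_cube_bounded:
  fixes f :: "point \<Rightarrow> 'b::{banach, second_countable_topology}"
  assumes "finite I" "f \<in> borel_measurable (cube_measure I)" "\<And>x. x \<in> unit_cube I \<Longrightarrow> norm (f x) \<le> B"
  shows "integrable (cube_measure I) f"
  by (intro finite_measure.integrable_const_bound[OF finite_measure_cube[OF assms(1)], of _ B] AE_I2 assms(2))
     (simp add: assms(3))

lemma bounded_on_cube:
  fixes f :: "point \<Rightarrow> 'b::real_normed_vector"
  assumes "continuous_on (unit_cube I) f"
  obtains B where "B \<ge> 0" "\<And>x. x \<in> unit_cube I \<Longrightarrow> norm (f x) \<le> B"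
proof -
  have "bounded (f ` unit_cube I)"
    by (intro compact_imp_bounded compact_continuous_image assms compact_unit_cube)
  then obtain B where "B > 0" "\<forall>x\<in>unit_cube I. norm (f x) \<le> B"
    by (auto simp: bounded_pos)
  then show ?thesis using that[of B] by auto
qed

lemma integrable_cube_continuous:
  fixes f :: "point \<Rightarrow> 'b::{banach, second_countable_topology}"
  assumes "finite I" "continuous_on (unit_cube I) f"
  shows "integrable (cube_measure I) f"
proof -
  obtain B where "\<And>x. x \<in> unit_cube I \<Longrightarrow> norm (f x) \<le> B"
    using bounded_on_cube[OF assms(2)] by blast
  then show ?thesis
    by (rule integrable_cube_bounded[OF assms(1) borel_measurable_cube[OF assms(2)]])
qed

text \<open>The cube has measure 1. A function that is not integrable has integral 0 by convention,
  which is why \<open>0 \<le> B\<close> can stand in for integrability.\<close>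

lemma norm_integral_cube_le:
  fixes f :: "point \<Rightarrow> 'b::{banach, second_countable_topology}"
  assumes "finite I" "\<And>x. x \<in> unit_cube I \<Longrightarrow> norm (f x) \<le> B"  "B \<ge> 0"
  shows "norm (LINT x|cube_measure I. f x) \<le> B"
proof (cases "integrable (cube_measure I) f")
  case True
  interpret finite_measure "cube_measure I" by (rule finite_measure_cube[OF assms(1)])
  have "norm (LINT x|cube_measure I. f x) \<le> (LINT x|cube_measure I. norm (f x))"
    by simp
  also have "\<dots> \<le> (LINT x|cube_measure I. B)"
    using True assms(2) by (intro integral_mono) auto
  finally show ?thesis using assms(1) by simp
next
  case False then show ?thesis using assms by (simp add: not_integrable_integral_eq)
qed

text \<open>Jensen's inequality for a probability measure, from expanding the nonnegative integral
  of (|f| - c)^2 with c the modulus of the integral of f. Integrability of f comes from t \<le> 1 +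
  t^2.\<close>

lemma cmod_integral_square_le:
  fixes f :: "'a \<Rightarrow> complex"
  assumes "finite_measure M" "measure M (space M) = 1"
    and int2: "integrable M (\<lambda>x. (cmod (f x))\<^sup>2)" and [measurable]: "f \<in> borel_measurable M"
  shows "(cmod (LINT x|M. f x))\<^sup>2 \<le> (LINT x|M. (cmod (f x))\<^sup>2)"
proof -
  interpret finite_measure M by fact
  have bd: "cmod (f x) \<le> 1 + (cmod (f x))\<^sup>2" for x
    using zero_le_power2[of "cmod (f x) - 1"] norm_ge_zero[of "f x"]
    unfolding power2_diff one_power2 by linarith
  have int: "integrable M f"
    by (rule Bochner_Integration.integrable_bound[of M "\<lambda>x. 1 + (cmod (f x))\<^sup>2"])
       (use int2 bd in \<open>auto simp: abs_of_nonneg\<close>)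
  define c where "c = cmod (LINT x|M. f x)"
  have int1: "integrable M (\<lambda>x. cmod (f x))" using int by simp
  have c: "c \<le> (LINT x|M. cmod (f x))" unfolding c_def by simp
  have "0 \<le> (LINT x|M. (cmod (f x) - c)\<^sup>2)" by simp
  also have "(LINT x|M. (cmod (f x) - c)\<^sup>2) = (LINT x|M. (cmod (f x))\<^sup>2 - 2 * c * cmod (f x) + c\<^sup>2)"
    by (simp add: power2_eq_square algebra_simps)
  also have "\<dots> = (LINT x|M. (cmod (f x))\<^sup>2) - 2 * c * (LINT x|M. cmod (f x)) + c\<^sup>2"
    using int1 int2 assms(2) by simp
  finally have "0 \<le> (LINT x|M. (cmod (f x))\<^sup>2) - 2 * c * (LINT x|M. cmod (f x)) + c\<^sup>2" .
  moreover have "c * c \<le> c * (LINT x|M. cmod (f x))"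
    using c by (intro mult_left_mono) (auto simp: c_def)
  ultimately show ?thesis unfolding c_def[symmetric] by (simp add: power2_eq_square)
qed

section \<open>Smooth functions of one real variable\<close>

definition smooth_upto :: "nat \<Rightarrow> (real \<Rightarrow> real) \<Rightarrow> bool" where
  "smooth_upto n f \<longleftrightarrow> (\<forall>k\<le>n. \<forall>t. (deriv ^^ k) f field_differentiable (at t))"

lemma smooth_iff_upto: "smooth f \<longleftrightarrow> (\<forall>n. smooth_upto n f)"
  unfolding smooth_def smooth_upto_def by blast

lemma smooth_upto_0: "smooth_upto 0 f \<longleftrightarrow> (\<forall>t. f field_differentiable (at t))"
  by (auto simp: smooth_upto_def)

text \<open>Truncating smoothness at a finite order gives this recursion, in which the first
  derivative is split off. Closure under sums, products and composition then follows by induction on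
  the order, each time with the derivative given explicitly through
  \<open>smooth_upto_deriv_eq\<close>.\<close>

lemma smooth_upto_Suc:
  "smooth_upto (Suc n) f \<longleftrightarrow> (\<forall>t. f field_differentiable (at t)) \<and> smooth_upto n (deriv f)"
proof -
  have "(\<forall>k\<le>Suc n. P k) \<longleftrightarrow> P 0 \<and> (\<forall>k\<le>n. P (Suc k))" for P
    using All_less_Suc2[of "Suc n" P] unfolding less_Suc_eq_le .
  from this[of "\<lambda>k. \<forall>t. (deriv ^^ k) f field_differentiable (at t)"] show ?thesis
    unfolding smooth_upto_def funpow_Suc_right o_def by simp
qed

lemma smooth_upto_deriv_eq:
  assumes "\<And>t. (f has_field_derivative f' t) (at t)"
  shows "smooth_upto (Suc n) f \<longleftrightarrow> smooth_upto n f'"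
proof -
  have "deriv f = f'" using assms by (auto intro!: ext DERIV_imp_deriv)
  then show ?thesis using assms by (auto simp: smooth_upto_Suc field_differentiable_def)
qed

lemma smooth_upto_mono: "smooth_upto n f \<Longrightarrow> k \<le> n \<Longrightarrow> smooth_upto k f"
  by (auto simp: smooth_upto_def)

lemma smooth_upto_diff: "smooth_upto n f \<Longrightarrow> (f has_field_derivative deriv f t) (at t)"
  unfolding smooth_upto_def by (drule spec[of _ 0]) (auto intro: field_differentiable_derivI)

lemma smooth_upto_const: "smooth_upto n (\<lambda>_. c)"
  by (induction n arbitrary: c)
     (auto simp: smooth_upto_0 smooth_upto_Suc)

lemma smooth_upto_add: "smooth_upto n f \<Longrightarrow> smooth_upto n g \<Longrightarrow> smooth_upto n (\<lambda>t. f t + g t)"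
proof (induction n arbitrary: f g)
  case 0 then show ?case by (simp add: smooth_upto_0 field_differentiable_add)
next
  case (Suc n)
  have d: "((\<lambda>t. f t + g t) has_field_derivative deriv f t + deriv g t) (at t)" for t
    by (rule DERIV_add[OF smooth_upto_diff[OF Suc.prems(1)] smooth_upto_diff[OF Suc.prems(2)]])
  show ?case using Suc unfolding smooth_upto_deriv_eq[OF d] by (simp add: smooth_upto_Suc)
qed

lemma smooth_upto_mult: "smooth_upto n f \<Longrightarrow> smooth_upto n g \<Longrightarrow> smooth_upto n (\<lambda>t. f t * g t)"
proof (induction n arbitrary: f g)
  case 0 then show ?case by (simp add: smooth_upto_0 field_differentiable_mult)
next
  case (Suc n)
  have d: "((\<lambda>t. f t * g t) has_field_derivative deriv f t * g t + deriv g t * f t) (at t)" for t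
    by (rule DERIV_mult[OF smooth_upto_diff[OF Suc.prems(1)] smooth_upto_diff[OF Suc.prems(2)]])
  have "smooth_upto n f" "smooth_upto n g" using Suc.prems by (auto elim: smooth_upto_mono)
  then show ?case using Suc.IH[of "deriv f" g] Suc.IH[of "deriv g" f] Suc.prems
    unfolding smooth_upto_deriv_eq[OF d] by (intro smooth_upto_add) (simp_all add: smooth_upto_Suc)
qed

lemma smooth_upto_compose: "smooth_upto n f \<Longrightarrow> smooth_upto n g \<Longrightarrow> smooth_upto n (\<lambda>t. f (g t))"
proof (induction n arbitrary: f)
  case 0 then show ?case using field_differentiable_compose[of g _ f]
    by (auto simp: smooth_upto_0 o_def)
next
  case (Suc n)
  have d: "((\<lambda>t. f (g t)) has_field_derivative deriv f (g t) * deriv g t) (at t)" for t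
    by (rule DERIV_chain2[OF smooth_upto_diff[OF Suc.prems(1)] smooth_upto_diff[OF Suc.prems(2)]])
  have "smooth_upto n f" "smooth_upto n g" using Suc.prems by (auto elim: smooth_upto_mono)
  then show ?case using Suc.IH[of "deriv f"] Suc.prems
    unfolding smooth_upto_deriv_eq[OF d] by (intro smooth_upto_mult) (simp_all add: smooth_upto_Suc)
qed

lemma smooth_mult: "smooth f \<Longrightarrow> smooth g \<Longrightarrow> smooth (\<lambda>t. f t * g t)"
  by (simp add: smooth_iff_upto smooth_upto_mult)

lemma smooth_compose: "smooth f \<Longrightarrow> smooth g \<Longrightarrow> smooth (\<lambda>t. f (g t))"
  by (simp add: smooth_iff_upto smooth_upto_compose)

lemma smooth_const: "smooth (\<lambda>_. c)"
  by (simp add: smooth_iff_upto smooth_upto_const)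

lemma smooth_power: "smooth f \<Longrightarrow> smooth (\<lambda>t. f t ^ n)"
  by (induction n) (auto intro: smooth_const smooth_mult)

lemma smooth_affine: "smooth (\<lambda>t. a * t + b)"
proof -
  have d: "((\<lambda>t. a * t + b) has_field_derivative a) (at t)" for t
    by (auto intro!: derivative_eq_intros)
  have "smooth_upto n (\<lambda>t. a * t + b)" for n
    by (rule smooth_upto_mono[of "Suc n"]) (simp_all add: smooth_upto_deriv_eq[OF d] smooth_upto_const)
  then show ?thesis by (simp add: smooth_iff_upto)
qed

text \<open>The family c cos(t + b) is closed under differentiation, which only shifts the phase by
  pi/2; hence the induction over all \<open>b\<close>.\<close>

lemma smooth_cos_add: "smooth (\<lambda>t. c * cos (t + b))"
proof -
  have d: "((\<lambda>t. c * cos (t + b)) has_field_derivative (c * cos (t + (b + pi/2)))) (at t)" for t b c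
  proof -
    have "cos (t + (b + pi/2)) = - sin (t + b)"
      by (simp add: minus_sin_cos_eq add.assoc)
    then show ?thesis by (auto intro!: derivative_eq_intros)
  qed
  have "smooth_upto n (\<lambda>t. c * cos (t + b))" for n b
  proof (induction n arbitrary: b)
    case 0 then show ?case using d by (auto simp: smooth_upto_0 field_differentiable_def)
  next
    case (Suc n) then show ?case by (simp add: smooth_upto_deriv_eq[OF d])
  qed
  then show ?thesis by (simp add: smooth_iff_upto)
qed

lemma smooth_cos_affine: "smooth (\<lambda>t. cos (a * t + b))"
  using smooth_compose[OF smooth_cos_add[of 1 b] smooth_affine[of a 0]] by simp

lemma smooth_sin_affine: "smooth (\<lambda>t. sin (a * t + b))"
proof -
  have "sin (a * t + b) = cos (a * t + (b - pi/2))" for t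
    using cos_diff[of "a * t + b" "pi/2"] by (simp add: add_diff_eq)
  then show ?thesis using smooth_cos_affine[of a "b - pi/2"] by simp
qed

lemma smooth_deriv_funpow:
  assumes "smooth f"
  shows "((deriv ^^ k) f has_field_derivative (deriv ^^ Suc k) f t) (at t)"
  using assms by (auto simp: smooth_def intro: field_differentiable_derivI)

lemma smooth_funpow_continuous: "smooth f \<Longrightarrow> continuous_on S ((deriv ^^ k) f)"
  using smooth_deriv_funpow[of f k]
  by (auto intro!: continuous_at_imp_continuous_on dest: DERIV_isCont)

lemma deriv_funpow_periodic:
  assumes "smooth f" "\<And>t. f (t + 1) = f t"
  shows "(deriv ^^ k) f (t + 1) = (deriv ^^ k) f t"
proof (induction k arbitrary: t)
  case 0 then show ?case using assms by simp
next
  case (Suc k)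
  have "((\<lambda>t. (deriv ^^ k) f (t + 1)) has_field_derivative (deriv ^^ Suc k) f (t + 1)) (at t)"
    using smooth_deriv_funpow[OF assms(1), of k "t + 1"] DERIV_shift by blast
  then have "((deriv ^^ k) f has_field_derivative (deriv ^^ Suc k) f (t + 1)) (at t)"
    by (simp add: Suc)
  then show ?case using smooth_deriv_funpow[OF assms(1), of k t] DERIV_unique by blast
qed

lemma periodic_frac:
  fixes f :: "real \<Rightarrow> 'a"
  assumes "\<And>t. f (t + 1) = f t"
  shows "f (frac t) = f t"
proof -
  interpret periodic_fun_simple' f by standard (rule assms)
  show ?thesis using minus_of_int[of t "\<lfloor>t\<rfloor>"] by (simp add: frac_def)
qed

lemma periodic_smooth_bounded:
  assumes "smooth f" "\<And>t. f (t + 1) = f t"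
  obtains B where "B \<ge> 0" "\<And>t. \<bar>(deriv ^^ k) f t\<bar> \<le> B"
proof -
  have "bounded ((deriv ^^ k) f ` {0..1})"
    by (intro compact_imp_bounded compact_continuous_image smooth_funpow_continuous assms) auto
  then obtain B where B: "B > 0" "\<And>t. t \<in> {0..1} \<Longrightarrow> \<bar>(deriv ^^ k) f t\<bar> \<le> B"
    by (auto simp: bounded_pos)
  have "\<bar>(deriv ^^ k) f t\<bar> \<le> B" for t
    using B(2)[of "frac t"] periodic_frac[of "(deriv ^^ k) f" t] deriv_funpow_periodic[OF assms]
    by (auto simp: less_imp_le[OF frac_lt_1])
  then show ?thesis using that[of B] B(1) by simp
qed

lemma deriv_funpow_zero_on_open:
  assumes "open S" "\<And>t. t \<in> S \<Longrightarrow> f t = 0" "t \<in> S"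
  shows "(deriv ^^ k) f t = (0::real)"
  using assms(3)
proof (induction k arbitrary: t)
  case (Suc k)
  have "((deriv ^^ k) f has_field_derivative 0) (at t)"
    by (rule has_field_derivative_transform_within_open[OF _ assms(1), of "\<lambda>_. 0"])
       (use Suc in auto)
  then show ?case by (simp add: DERIV_imp_deriv)
qed (use assms in auto)

text \<open>The sign produced by reflecting the argument is the one that cancels the sign in the
  definition of weak derivatives when a reflected kernel serves as test function.\<close>

lemma deriv_funpow_shift:
  assumes "smooth f"
  shows "(deriv ^^ k) (\<lambda>t. f (x - t)) t = (-1) ^ k * (deriv ^^ k) f (x - t)"
proof (induction k arbitrary: t)
  case (Suc k)
  have "((\<lambda>t. (-1) ^ k * (deriv ^^ k) f (x - t)) has_field_derivative
      (-1) ^ k * ((deriv ^^ Suc k) f (x - t) * (-1))) (at t)"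
    by (intro DERIV_cmult DERIV_chain2[OF smooth_deriv_funpow[OF assms]]) (auto intro!: derivative_eq_intros)
  moreover have "(deriv ^^ k) (\<lambda>t. f (x - t)) = (\<lambda>t. (-1) ^ k * (deriv ^^ k) f (x - t))"
    using Suc by auto
  ultimately show ?case using DERIV_imp_deriv by fastforce
qed auto

text \<open>The classical function exp(-1/x), extended by 0, from which bump functions are built.
  The polynomial in 1/x makes the family closed under differentiation.\<close>

definition flat :: "real poly \<Rightarrow> real \<Rightarrow> real" where
  "flat p x = (if x > 0 then poly p (1 / x) * exp (- (1 / x)) else 0)"

lemma poly_exp_tendsto_0: "((\<lambda>x. poly p x * exp (- x)) \<longlongrightarrow> (0::real)) at_top"
proof -
  have "((\<lambda>x. \<Sum>i\<le>degree p. coeff p i * (x ^ i / exp x)) \<longlongrightarrow> (\<Sum>i\<le>degree p. coeff p i * 0)) at_top"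
    by (intro tendsto_intros tendsto_power_div_exp_0)
  then show ?thesis
    by (simp add: poly_altdef sum_distrib_right exp_minus divide_inverse mult.assoc)
qed

text \<open>Differentiating p(1/x) exp(-1/x) gives (1/x)^2 (p - p')(1/x) exp(-1/x), whence the
  polynomial X^2 (p - p'). Only the point 0 needs a limit argument.\<close>

lemma flat_has_derivative:
  "(flat p has_field_derivative flat ([:0, 0, 1:] * (p - pderiv p)) x) (at x)"
proof -
  consider "x < 0" | "x = 0" | "x > 0" by linarith
  then show ?thesis
  proof cases
    case 1
    have "(flat p has_field_derivative 0) (at x)"
      by (rule has_field_derivative_transform_within_open[of "\<lambda>_. 0" _ _ "{..<0}"])
         (use 1 in \<open>auto simp: flat_def\<close>)
    then show ?thesis using 1 by (simp add: flat_def)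
  next
    case 3
    have "((\<lambda>x. poly p (1 / x) * exp (- (1 / x))) has_field_derivative
        flat ([:0, 0, 1:] * (p - pderiv p)) x) (at x)"
      using 3
      by (auto intro!: derivative_eq_intros simp: flat_def power2_eq_square divide_simps algebra_simps)
    then show ?thesis
      by (rule has_field_derivative_transform_within_open[of _ _ _ "{0<..}"])
         (use 3 in \<open>auto simp: flat_def\<close>)
  next
    case 2
    \<comment> \<open>Dividing by y multiplies the polynomial by X, so the quotient still decays
      because the exponential beats every polynomial in 1/y.\<close>
    have "((\<lambda>y. (flat p y - flat p 0) / (y - 0)) \<longlongrightarrow> 0) (at_right 0)"
    proof -
      have "((\<lambda>y. poly ([:0,1:] * p) (inverse y) * exp (- inverse y)) \<longlongrightarrow> 0) (at_right 0)"
        by (rule filterlim_compose[OF poly_exp_tendsto_0 filterlim_inverse_at_top_right])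
      then show ?thesis
        by (rule Lim_transform_eventually)
           (auto simp: eventually_at_filter flat_def divide_simps)
    qed
    moreover have "((\<lambda>y. (flat p y - flat p 0) / (y - 0)) \<longlongrightarrow> 0) (at_left 0)"
      by (rule Lim_transform_eventually[OF tendsto_const]) (auto simp: eventually_at_filter flat_def)
    ultimately have "((\<lambda>y. (flat p y - flat p 0) / (y - 0)) \<longlongrightarrow> 0) (at 0)"
      using filterlim_split_at by blast
    then show ?thesis using 2 by (simp add: has_field_derivative_iff flat_def)
  qed
qed

lemma smooth_flat: "smooth (flat p)"
proof -
  have "smooth_upto n (flat p)" for n
  proof (induction n arbitrary: p)
    case 0 then show ?case using flat_has_derivative by (auto simp: smooth_upto_0 field_differentiable_def)
  next
    case (Suc n) then show ?case by (simp add: smooth_upto_deriv_eq[OF flat_has_derivative])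
  qed
  then show ?thesis by (simp add: smooth_iff_upto)
qed

section \<open>Difference quotients and increments\<close>

lemma has_vector_derivative_iff_quotient:
  fixes f :: "real \<Rightarrow> complex"
  shows "(f has_vector_derivative D) (at x within S) \<longleftrightarrow>
    ((\<lambda>t. (f t - f x) / of_real (t - x)) \<longlongrightarrow> D) (at x within S)"
proof -
  have "(f has_vector_derivative D) (at x within S) \<longleftrightarrow>
      ((\<lambda>t. norm ((f t - f x - (t - x) *\<^sub>R D) /\<^sub>R norm (t - x))) \<longlongrightarrow> 0) (at x within S)"
    unfolding has_vector_derivative_def has_derivative_within tendsto_norm_zero_iff
    by (simp add: bounded_linear_scaleR_left diff_diff_eq divide_inverse)
  also have "\<dots> \<longleftrightarrow> ((\<lambda>t. norm ((f t - f x) / of_real (t - x) - D)) \<longlongrightarrow> 0) (at x within S)"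
  proof (rule filterlim_cong[OF refl refl], unfold eventually_at_filter, rule always_eventually, intro allI impI)
    fix t assume "t \<noteq> x"
    then have "(f t - f x) / of_real (t - x) - D = (f t - f x - (t - x) *\<^sub>R D) / of_real (t - x)"
      by (simp add: field_simps scaleR_conv_of_real)
    also have "norm \<dots> = norm (f t - f x - (t - x) *\<^sub>R D) / norm (t - x)"
      by (simp only: norm_divide norm_of_real real_norm_def)
    finally show "norm ((f t - f x - (t - x) *\<^sub>R D) /\<^sub>R norm (t - x)) = norm ((f t - f x) / of_real (t - x) - D)"
      by (simp only: norm_scaleR real_norm_def abs_inverse abs_idempotent divide_inverse mult.commute)
  qed
  also have "\<dots> \<longleftrightarrow> ((\<lambda>t. (f t - f x) / of_real (t - x)) \<longlongrightarrow> D) (at x within S)"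
    by (simp only: tendsto_norm_zero_iff LIM_zero_iff)
  finally show ?thesis .
qed

text \<open>Mean value inequality relative to a convex set, valid at end points with one-sided
  derivatives. It supplies the majorants whenever a derivative is pulled through an integral or
  another limit functional.\<close>

lemma norm_increment_le:
  fixes f :: "real \<Rightarrow> complex"
  assumes "convex U" "\<And>t. t \<in> U \<Longrightarrow> (f has_vector_derivative f' t) (at t within U)"
    "\<And>t. t \<in> U \<Longrightarrow> cmod (f' t) \<le> B" "s \<in> U" "t \<in> U"
  shows "cmod (f t - f s) \<le> B * \<bar>t - s\<bar>"
proof -
  have "norm (f t - f s) \<le> B * norm (t - s)"
  proof (rule differentiable_bound[OF assms(1), where f' = "\<lambda>t h. h *\<^sub>R f' t"])
    fix u assume "u \<in> U"
    then show "(f has_derivative (\<lambda>h. h *\<^sub>R f' u)) (at u within U)"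
      using assms(2) by (simp add: has_vector_derivative_def)
    show "onorm (\<lambda>h. h *\<^sub>R f' u) \<le> B"
      using assms(3)[OF \<open>u \<in> U\<close>] by (intro onorm_le) (auto simp: mult.commute[of B] intro: mult_left_mono)
  qed (use assms in auto)
  then show ?thesis by simp
qed

subsection \<open>Iterated partial derivatives\<close>

text \<open>
  The meaning of a partial derivative and of a bound is left abstract: the predicate is used with
  pointwise derivatives and bounds, with \<open>L\<^sub>q\<close>-bounds, and for functions with values in \<open>L\<^sub>2(D)\<close>.
\<close>

inductive diff_class ::
  "(real \<Rightarrow> 'f \<Rightarrow> bool) \<Rightarrow> (nat \<Rightarrow> 'f \<Rightarrow> 'f \<Rightarrow> bool) \<Rightarrow> nat set \<Rightarrow> real \<Rightarrow> (nat \<Rightarrow> nat) \<Rightarrow> 'f \<Rightarrow> bool"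
  for P der I B where
  diff_classI: "P B f \<Longrightarrow>
     (\<forall>j\<in>I. \<mu> j > 0 \<longrightarrow> (\<exists>f'. der j f f' \<and> diff_class P der I B (\<mu>(j := \<mu> j - 1)) f')) \<Longrightarrow>
     diff_class P der I B \<mu> f"

lemma diff_class_bound: "diff_class P der I B \<mu> f \<Longrightarrow> P B f"
  by (auto elim: diff_class.cases)

lemma diff_class_deriv:
  assumes "diff_class P der I B \<mu> f" "j \<in> I" "\<mu> j > 0"
  obtains f' where "der j f f'" "diff_class P der I B (\<mu>(j := \<mu> j - 1)) f'"
proof -
  have "\<exists>f'. der j f f' \<and> diff_class P der I B (\<mu>(j := \<mu> j - 1)) f'"
    using assms(1) by (cases rule: diff_class.cases) (use assms in blast)
  then show thesis using that by blast
qed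

lemma sum_upd_less:
  fixes \<mu> :: "nat \<Rightarrow> nat"
  assumes "finite I" "j \<in> I" "\<mu> j > 0"
  shows "sum \<mu> I = Suc (sum (\<mu>(j := \<mu> j - 1)) I)"
  using assms by (simp add: sum.remove[of I j])

text \<open>The class is inductive, but membership can be shown coinductively from an invariant
  \<open>X\<close>, because every derivative lowers the total order \<open>sum \<mu> I\<close> and
  the descent stops.\<close>

lemma diff_class_coinduct:
  assumes "finite I" "X \<mu> f"
    and step: "\<And>\<mu> f. X \<mu> f \<Longrightarrow> P B f \<and>
      (\<forall>j\<in>I. \<mu> j > 0 \<longrightarrow> (\<exists>f'. der j f f' \<and> X (\<mu>(j := \<mu> j - 1)) f'))"
  shows "diff_class P der I B \<mu> f"
  using assms(2)
proof (induction "sum \<mu> I" arbitrary: \<mu> f rule: less_induct)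
  case less
  show ?case
  proof (rule diff_classI; (intro ballI impI)?)
    show "P B f" using step[OF less.prems] by blast
    fix j assume "j \<in> I" "\<mu> j > 0"
    then show "\<exists>f'. der j f f' \<and> diff_class P der I B (\<mu>(j := \<mu> j - 1)) f'"
      using step[OF less.prems] less.hyps sum_upd_less[OF assms(1)] by (metis lessI)
  qed
qed

lemma diff_class_le:
  assumes "finite I" "diff_class P der I B \<mu> f" "\<And>j. j \<in> I \<Longrightarrow> \<nu> j \<le> \<mu> j"
  shows "diff_class P der I B \<nu> f"
proof (rule diff_class_coinduct[OF assms(1),
    where X = "\<lambda>\<nu> f. \<exists>\<mu>. diff_class P der I B \<mu> f \<and> (\<forall>j\<in>I. \<nu> j \<le> \<mu> j)"])
  fix \<nu> f assume "\<exists>\<mu>. diff_class P der I B \<mu> f \<and> (\<forall>j\<in>I. \<nu> j \<le> \<mu> j)"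
  then obtain \<mu> where \<mu>: "diff_class P der I B \<mu> f" "\<forall>j\<in>I. \<nu> j \<le> \<mu> j" by blast
  show "P B f \<and> (\<forall>j\<in>I. 0 < \<nu> j \<longrightarrow> (\<exists>f'. der j f f' \<and>
      (\<exists>\<mu>. diff_class P der I B \<mu> f' \<and> (\<forall>i\<in>I. (\<nu>(j := \<nu> j - 1)) i \<le> \<mu> i))))"
  proof (intro conjI ballI impI)
    fix j assume j: "j \<in> I" "0 < \<nu> j"
    with \<mu> have "\<mu> j > 0" using order_less_le_trans by blast
    then obtain f' where f': "der j f f'" "diff_class P der I B (\<mu>(j := \<mu> j - 1)) f'"
      using \<mu>(1) j(1) by (metis diff_class_deriv)
    have "\<forall>i\<in>I. (\<nu>(j := \<nu> j - 1)) i \<le> (\<mu>(j := \<mu> j - 1)) i"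
      using \<mu>(2) j by (auto intro: diff_le_mono)
    with f' show "\<exists>f'. der j f f' \<and>
      (\<exists>\<mu>. diff_class P der I B \<mu> f' \<and> (\<forall>i\<in>I. (\<nu>(j := \<nu> j - 1)) i \<le> \<mu> i))" by blast
  qed (rule diff_class_bound[OF \<mu>(1)])
qed (use assms in blast)

text \<open>With \<open>T\<close> the identity this exchanges the notions of bound and derivative,
  for example enlarging a bound or passing from pointwise to L_2-valued derivatives; otherwise
  \<open>T\<close> is an operation that commutes with differentiation.\<close>

lemma diff_class_map:
  assumes "finite I" "diff_class P der I B \<mu> f"
    and P: "\<And>f. P B f \<Longrightarrow> P' B' (T f)"
    and der: "\<And>j f f'. j \<in> I \<Longrightarrow> P B f \<Longrightarrow> P B f' \<Longrightarrow> der j f f' \<Longrightarrow> der' j (T f) (T f')"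
  shows "diff_class P' der' I B' \<mu> (T f)"
proof (rule diff_class_coinduct[OF assms(1), where X = "\<lambda>\<mu> g. \<exists>f. diff_class P der I B \<mu> f \<and> g = T f"])
  fix \<mu> g assume "\<exists>f. diff_class P der I B \<mu> f \<and> g = T f"
  then obtain f where f: "diff_class P der I B \<mu> f" "g = T f" by blast
  show "P' B' g \<and> (\<forall>j\<in>I. 0 < \<mu> j \<longrightarrow> (\<exists>f'. der' j g f' \<and>
      (\<exists>f. diff_class P der I B (\<mu>(j := \<mu> j - 1)) f \<and> f' = T f)))"
  proof (intro conjI ballI impI)
    show "P' B' g" using f P diff_class_bound by metis
    fix j assume j: "j \<in> I" "0 < \<mu> j"
    then obtain f' where f': "der j f f'" "diff_class P der I B (\<mu>(j := \<mu> j - 1)) f'"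
      using f(1) by (metis diff_class_deriv)
    then have "der' j g (T f')" using f j der diff_class_bound by metis
    with f' show "\<exists>f'. der' j g f' \<and> (\<exists>f. diff_class P der I B (\<mu>(j := \<mu> j - 1)) f \<and> f' = T f)" by blast
  qed
qed (use assms in blast)

lemma diff_class_add:
  assumes "finite I" "diff_class P der I B \<mu> f" "diff_class P der I C \<mu> g"
    and P: "\<And>f g. P B f \<Longrightarrow> P C g \<Longrightarrow> P (B + C) (a f g)"
    and der: "\<And>j f f' g g'. j \<in> I \<Longrightarrow> der j f f' \<Longrightarrow> der j g g' \<Longrightarrow> der j (a f g) (a f' g')"
  shows "diff_class P der I (B + C) \<mu> (a f g)"
proof (rule diff_class_coinduct[OF assms(1), where X = "\<lambda>\<mu> h. \<exists>f g. diff_class P der I B \<mu> f \<and>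
    diff_class P der I C \<mu> g \<and> h = a f g"])
  fix \<mu> h assume "\<exists>f g. diff_class P der I B \<mu> f \<and> diff_class P der I C \<mu> g \<and> h = a f g"
  then obtain f g where f: "diff_class P der I B \<mu> f" and g: "diff_class P der I C \<mu> g" and h: "h = a f g"
    by blast
  show "P (B + C) h \<and> (\<forall>j\<in>I. 0 < \<mu> j \<longrightarrow> (\<exists>f'. der j h f' \<and> (\<exists>f g.
      diff_class P der I B (\<mu>(j := \<mu> j - 1)) f \<and> diff_class P der I C (\<mu>(j := \<mu> j - 1)) g \<and> f' = a f g)))"
  proof (intro conjI ballI impI)
    show "P (B + C) h" using f g h P diff_class_bound by metis
    fix j assume j: "j \<in> I" "0 < \<mu> j"
    obtain f' where "der j f f'" "diff_class P der I B (\<mu>(j := \<mu> j - 1)) f'"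
      using f j by (metis diff_class_deriv)
    moreover obtain g' where "der j g g'" "diff_class P der I C (\<mu>(j := \<mu> j - 1)) g'"
      using g j by (metis diff_class_deriv)
    ultimately show "\<exists>f'. der j h f' \<and> (\<exists>f g.
      diff_class P der I B (\<mu>(j := \<mu> j - 1)) f \<and> diff_class P der I C (\<mu>(j := \<mu> j - 1)) g \<and> f' = a f g)"
      using der[OF j(1)] h by blast
  qed
qed (use assms in blast)

text \<open>Leibniz rule for an abstract bilinear operation. Each derivative turns one term into
  two, so a derivative of total order k has 2^k terms, each bounded by B C. The factors and the
  product may use three different notions of bound: L_4 times L_4 into L_2, or two L_2(D)-valued
  functions into scalars.\<close>

lemma diff_class_mult:
  assumes "finite I" and fg: "diff_class P1 der1 I B \<mu> f" "diff_class P2 der2 I C \<mu> g" and "0 \<le> B" "0 \<le> C"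
    and mult: "\<And>f g. P1 B f \<Longrightarrow> P2 C g \<Longrightarrow> P3 (B * C) (m f g)"
    and dmult: "\<And>j f f' g g'. j \<in> I \<Longrightarrow> P1 B f \<Longrightarrow> P1 B f' \<Longrightarrow> P2 C g \<Longrightarrow> P2 C g' \<Longrightarrow>
      der1 j f f' \<Longrightarrow> der2 j g g' \<Longrightarrow> der3 j (m f g) (a (m f' g) (m f g'))"
    and add: "\<And>f g B C. P3 B f \<Longrightarrow> P3 C g \<Longrightarrow> P3 (B + C) (a f g)"
    and dadd: "\<And>j f f' g g'. j \<in> I \<Longrightarrow> der3 j f f' \<Longrightarrow> der3 j g g' \<Longrightarrow> der3 j (a f g) (a f' g')"
    and mono: "\<And>f B C. P3 B f \<Longrightarrow> B \<le> C \<Longrightarrow> P3 C f"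
  shows "diff_class P3 der3 I (2 ^ sum \<mu> I * (B * C)) \<mu> (m f g)"
  using fg
proof (induction "sum \<mu> I" arbitrary: \<mu> f g rule: less_induct)
  case less
  let ?K = "2 ^ sum \<mu> I * (B * C)"
  show ?case
  proof (rule diff_classI; (intro ballI impI)?)
    have "1 * (B * C) \<le> ?K" using assms by (intro mult_right_mono) auto
    then show "P3 ?K (m f g)"
      using mono[OF mult[OF diff_class_bound[OF less.prems(1)] diff_class_bound[OF less.prems(2)]]] by simp
    fix j assume j: "j \<in> I" "\<mu> j > 0"
    let ?\<mu> = "\<mu>(j := \<mu> j - 1)"
    let ?K' = "2 ^ sum ?\<mu> I * (B * C)"
    obtain f' where f': "der1 j f f'" "diff_class P1 der1 I B ?\<mu> f'"
      using less.prems(1) j by (metis diff_class_deriv)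
    obtain g' where g': "der2 j g g'" "diff_class P2 der2 I C ?\<mu> g'"
      using less.prems(2) j by (metis diff_class_deriv)
    have lt: "sum ?\<mu> I < sum \<mu> I" and K: "?K = ?K' + ?K'"
      using sum_upd_less[of I j \<mu>] assms(1) j by (auto simp: algebra_simps)
    \<comment> \<open>The undifferentiated factor of each new term is needed at the lowered order
      too.\<close>
    have "diff_class P1 der1 I B ?\<mu> f" "diff_class P2 der2 I C ?\<mu> g"
      using less.prems by (auto elim!: diff_class_le[OF assms(1)])
    then have "diff_class P3 der3 I ?K' ?\<mu> (m f' g)" "diff_class P3 der3 I ?K' ?\<mu> (m f g')"
      using less.hyps[OF lt] f' g' by blast+
    from diff_class_add[OF assms(1) this add dadd]
    have "diff_class P3 der3 I ?K ?\<mu> (a (m f' g) (m f g'))" by (simp add: K)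
    moreover have "der3 j (m f g) (a (m f' g) (m f g'))"
      using dmult[OF j(1)] f' g' less.prems diff_class_bound by metis
    ultimately show "\<exists>h. der3 j (m f g) h \<and> diff_class P3 der3 I ?K ?\<mu> h" by blast
  qed
qed

section \<open>Pointwise derivatives in y, depending on a parameter x\<close>

abbreviation (input) cube_on :: "nat set \<Rightarrow> real set \<Rightarrow> point set" where
  "cube_on I U \<equiv> \<Pi>\<^sub>E j\<in>I. U"

text \<open>Two sets are needed since periodic functions are differentiated on the whole line
  (\<open>U\<close>) while the bounds of the target are given on the unit cube only
  (\<open>V\<close>). The first argument of \<open>H\<close> is a parameter ranging over
  \<open>M\<close>; it is not differentiated.\<close>

definition pw_bounded ::
  "'a measure \<Rightarrow> nat set \<Rightarrow> real set \<Rightarrow> real set \<Rightarrow> real \<Rightarrow> ('a \<Rightarrow> point \<Rightarrow> complex) \<Rightarrow> bool" where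
  "pw_bounded M I U V B H \<longleftrightarrow> (\<forall>y\<in>cube_on I U. (\<lambda>x. H x y) \<in> borel_measurable M) \<and>
     (\<forall>x\<in>space M. \<forall>y\<in>cube_on I V. cmod (H x y) \<le> B)"

definition pw_deriv ::
  "'a measure \<Rightarrow> nat set \<Rightarrow> real set \<Rightarrow> nat \<Rightarrow> ('a \<Rightarrow> point \<Rightarrow> complex) \<Rightarrow> ('a \<Rightarrow> point \<Rightarrow> complex) \<Rightarrow> bool" where
  "pw_deriv M I U j H H' \<longleftrightarrow> (\<forall>x\<in>space M. \<forall>y\<in>cube_on I U.
     ((\<lambda>t. H x (y(j := t))) has_vector_derivative H' x y) (at (y j) within U))"

abbreviation pw_class where
  "pw_class M I U V \<equiv> diff_class (pw_bounded M I U V) (pw_deriv M I U) I"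

lemma cube_on_upd: "y \<in> cube_on I U \<Longrightarrow> j \<in> I \<Longrightarrow> t \<in> U \<Longrightarrow> y(j := t) \<in> cube_on I U"
  by (auto simp: PiE_def extensional_def)

lemma pw_derivD:
  assumes "pw_deriv M I U j H H'" "x \<in> space M" "y \<in> cube_on I U" "j \<in> I" "t \<in> U"
  shows "((\<lambda>t. H x (y(j := t))) has_vector_derivative H' x (y(j := t))) (at t within U)"
proof -
  have "((\<lambda>u. H x ((y(j := t))(j := u))) has_vector_derivative H' x (y(j := t))) (at ((y(j := t)) j) within U)"
    using assms(1,2) cube_on_upd[OF assms(3,4,5)] unfolding pw_deriv_def by blast
  then show ?thesis by simp
qed

lemma pw_derivI:
  "(\<And>x y. x \<in> space M \<Longrightarrow> y \<in> cube_on I U \<Longrightarrow>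
     ((\<lambda>t. H x (y(j := t))) has_vector_derivative H' x y) (at (y j) within U)) \<Longrightarrow> pw_deriv M I U j H H'"
  by (simp add: pw_deriv_def)

lemma pw_derivE:
  "pw_deriv M I U j H H' \<Longrightarrow> x \<in> space M \<Longrightarrow> y \<in> cube_on I U \<Longrightarrow>
     ((\<lambda>t. H x (y(j := t))) has_vector_derivative H' x y) (at (y j) within U)"
  by (simp add: pw_deriv_def)

lemma pw_deriv_add: "pw_deriv M I U j f f' \<Longrightarrow> pw_deriv M I U j g g' \<Longrightarrow>
    pw_deriv M I U j (\<lambda>x y. f x y + g x y) (\<lambda>x y. f' x y + g' x y)"
  by (rule pw_derivI, rule has_vector_derivative_add; erule (2) pw_derivE)

lemma pw_deriv_mult:
  assumes "pw_deriv M I U j f f'" "pw_deriv M I U j g g'"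
  shows "pw_deriv M I U j (\<lambda>x y. f x y * g x y) (\<lambda>x y. f' x y * g x y + f x y * g' x y)"
proof (rule pw_derivI)
  fix x y assume xy: "x \<in> space M" "y \<in> cube_on I U"
  show "((\<lambda>t. f x (y(j := t)) * g x (y(j := t))) has_vector_derivative f' x y * g x y + f x y * g' x y) (at (y j) within U)"
    using has_vector_derivative_mult[OF pw_derivE[OF assms(1) xy] pw_derivE[OF assms(2) xy]]
    by (simp add: add.commute)
qed

lemma pw_deriv_linear: "bounded_linear T \<Longrightarrow> pw_deriv M I U j f f' \<Longrightarrow>
    pw_deriv M I U j (\<lambda>x y. T (f x y)) (\<lambda>x y. T (f' x y))"
  by (rule pw_derivI, erule bounded_linear.has_vector_derivative, erule (2) pw_derivE)

lemma pw_bounded_measurable: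
  "pw_bounded M I U V B f \<Longrightarrow> y \<in> cube_on I U \<Longrightarrow> (\<lambda>x. f x y) \<in> borel_measurable M"
  by (simp add: pw_bounded_def)

lemma pw_bounded_le:
  "pw_bounded M I U V B f \<Longrightarrow> x \<in> space M \<Longrightarrow> y \<in> cube_on I V \<Longrightarrow> cmod (f x y) \<le> B"
  by (simp add: pw_bounded_def)

lemma pw_bounded_add:
  "pw_bounded M I U V B f \<Longrightarrow> pw_bounded M I U V C g \<Longrightarrow> pw_bounded M I U V (B + C) (\<lambda>x y. f x y + g x y)"
  by (subst pw_bounded_def) (auto intro!: borel_measurable_add norm_triangle_mono intro: pw_bounded_measurable pw_bounded_le)

lemma pw_bounded_mult:
  "pw_bounded M I U V B f \<Longrightarrow> pw_bounded M I U V C g \<Longrightarrow> 0 \<le> B \<Longrightarrow>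
   pw_bounded M I U V (B * C) (\<lambda>x y. f x y * g x y)"
  by (subst pw_bounded_def)
     (auto simp: norm_mult intro!: borel_measurable_times mult_mono intro: pw_bounded_measurable pw_bounded_le)

lemma pw_bounded_mono: "pw_bounded M I U V B f \<Longrightarrow> B \<le> C \<Longrightarrow> pw_bounded M I U V C f"
  unfolding pw_bounded_def by force

lemma pw_class_mono:
  assumes "finite I" "pw_class M I U V B \<mu> H" "B \<le> C"
  shows "pw_class M I U V C \<mu> H"
  by (rule diff_class_map[OF assms(1,2)]) (auto intro: pw_bounded_mono[OF _ assms(3)])

lemma pw_class_add:
  assumes "finite I" "pw_class M I U V B \<mu> f" "pw_class M I U V C \<mu> g"
  shows "pw_class M I U V (B + C) \<mu> (\<lambda>x y. f x y + g x y)"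
  by (rule diff_class_add[OF assms, of "\<lambda>f g x y. f x y + g x y"])
     (rule pw_bounded_add pw_deriv_add; assumption)+

lemma pw_class_mult:
  assumes "finite I" "pw_class M I U V B \<mu> f" "pw_class M I U V C \<mu> g" "0 \<le> B" "0 \<le> C"
  shows "pw_class M I U V (2 ^ sum \<mu> I * (B * C)) \<mu> (\<lambda>x y. f x y * g x y)"
  by (rule diff_class_mult[OF assms, where a = "\<lambda>f g x y. f x y + g x y"])
     (rule pw_bounded_mult[OF _ _ assms(4)] pw_deriv_mult pw_bounded_add pw_deriv_add pw_bounded_mono; assumption)+

lemma pw_class_linear:
  assumes "finite I" "pw_class M I U V B \<mu> f" "bounded_linear T" "\<And>z. cmod (T z) \<le> c * cmod z" "0 \<le> c"
  shows "pw_class M I U V (c * B) \<mu> (\<lambda>x y. T (f x y))"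
proof (rule diff_class_map[OF assms(1,2)])
  fix f assume f: "pw_bounded M I U V B f"
  have T: "T \<in> borel_measurable borel"
    by (intro borel_measurable_continuous_onI linear_continuous_on assms)
  have "cmod (T (f x y)) \<le> c * B" if "x \<in> space M" "y \<in> cube_on I V" for x y
  proof -
    have "cmod (f x y) \<le> B" using f that by (auto simp: pw_bounded_def)
    then show ?thesis using assms(4)[of "f x y"] mult_left_mono[OF _ assms(5)] by (meson order_trans)
  qed
  moreover have "(\<lambda>x. T (f x y)) \<in> borel_measurable M" if "y \<in> cube_on I U" for y
    by (rule measurable_compose[OF pw_bounded_measurable[OF f that] T])
  ultimately show "pw_bounded M I U V (c * B) (\<lambda>x y. T (f x y))"
    by (auto simp: pw_bounded_def)
qed (rule pw_deriv_linear[OF assms(3)])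

lemma pw_class_Re:
  "finite I \<Longrightarrow> pw_class M I U V B \<mu> f \<Longrightarrow> pw_class M I U V B \<mu> (\<lambda>x y. of_real (Re (f x y)))"
  using pw_class_linear[of I M U V B \<mu> f "\<lambda>z. of_real (Re z)" 1]
  by (simp add: abs_Re_le_cmod bounded_linear_compose[OF bounded_linear_of_real bounded_linear_Re])

lemma pw_class_const:
  assumes "finite I" "cmod c \<le> B" "0 \<le> B"
  shows "pw_class M I U V B \<mu> (\<lambda>_ _. c)"
proof (rule diff_class_coinduct[OF assms(1), where X = "\<lambda>\<mu> f. \<exists>c. cmod c \<le> B \<and> f = (\<lambda>_ _. c)"])
  fix \<mu> :: "nat \<Rightarrow> nat" and f :: "'a \<Rightarrow> point \<Rightarrow> complex" assume "\<exists>c. cmod c \<le> B \<and> f = (\<lambda>_ _. c)"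
  then obtain c where c: "cmod c \<le> B" "f = (\<lambda>_ _. c)" by blast
  have pb: "pw_bounded M I U V B f" using c by (simp add: pw_bounded_def)
  have "pw_deriv M I U j f (\<lambda>_ _. 0)" for j
    using c by (auto simp: pw_deriv_def)
  moreover have "\<exists>c'. cmod c' \<le> B \<and> (\<lambda>(_::'a) (_::point). 0::complex) = (\<lambda>_ _. c')"
    using assms(3) by (intro exI[of _ 0]) auto
  ultimately show "pw_bounded M I U V B f \<and> (\<forall>j\<in>I. 0 < \<mu> j \<longrightarrow>
      (\<exists>f'. pw_deriv M I U j f f' \<and> (\<exists>c. cmod c \<le> B \<and> f' = (\<lambda>_ _. c))))"
    using pb by blast
qed (use assms in blast)

lemma pw_class_sum:
  assumes "finite I" "finite J" "\<And>k. k \<in> J \<Longrightarrow> pw_class M I U V (B k) \<mu> (f k)"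
  shows "pw_class M I U V (\<Sum>k\<in>J. B k) \<mu> (\<lambda>x y. \<Sum>k\<in>J. f k x y)"
  using assms(2,3)
  by (induction J rule: finite_induct) (auto intro!: pw_class_const pw_class_add assms(1))

text \<open>No bound on the function itself: the biases of the network are not controlled.\<close>

definition slope_class ::
  "'a measure \<Rightarrow> nat set \<Rightarrow> real set \<Rightarrow> real \<Rightarrow> (nat \<Rightarrow> nat) \<Rightarrow> ('a \<Rightarrow> point \<Rightarrow> complex) \<Rightarrow> bool" where
  "slope_class M I U B \<mu> H \<longleftrightarrow>
     (\<forall>y\<in>cube_on I U. (\<lambda>x. H x y) \<in> borel_measurable M \<and> (\<exists>b. \<forall>x\<in>space M. cmod (H x y) \<le> b)) \<and>
     (\<forall>j\<in>I. \<mu> j > 0 \<longrightarrow> (\<exists>H'. pw_deriv M I U j H H' \<and> pw_class M I U U B (\<mu>(j := \<mu> j - 1)) H'))"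

text \<open>The point where a bound on the function itself re-enters: all derivatives are already
  controlled, and \<open>C\<close> comes from the assumption on the sup norm of the network.\<close>

lemma slope_class_pw:
  assumes "slope_class M I U B \<mu> H" "pw_bounded M I U U C H" "B \<le> C" "finite I"
  shows "pw_class M I U U C \<mu> H"
proof (rule diff_classI; (intro ballI impI)?)
  fix j assume "j \<in> I" "0 < \<mu> j"
  then obtain H' where "pw_deriv M I U j H H'" "pw_class M I U U B (\<mu>(j := \<mu> j - 1)) H'"
    using assms(1) unfolding slope_class_def by blast
  then show "\<exists>H'. pw_deriv M I U j H H' \<and> pw_class M I U U C (\<mu>(j := \<mu> j - 1)) H'"
    using pw_class_mono[OF assms(4) _ assms(3)] by blast
qed fact

lemma pw_class_slope:
  assumes "pw_class M I U U B \<mu> H"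
  shows "slope_class M I U B \<mu> H"
  unfolding slope_class_def
proof (intro conjI ballI impI)
  fix y assume "y \<in> cube_on I U"
  then show "(\<lambda>x. H x y) \<in> borel_measurable M" "\<exists>b. \<forall>x\<in>space M. cmod (H x y) \<le> b"
    using diff_class_bound[OF assms] unfolding pw_bounded_def by blast+
next
  fix j assume "j \<in> I" "0 < \<mu> j"
  then show "\<exists>H'. pw_deriv M I U j H H' \<and> pw_class M I U U B (\<mu>(j := \<mu> j - 1)) H'"
    using diff_class_deriv[OF assms] by metis
qed

lemma slope_class_mono:
  assumes "finite I" "slope_class M I U B \<mu> H" "B \<le> C"
  shows "slope_class M I U C \<mu> H"
  unfolding slope_class_def
proof (intro conjI ballI impI)
  fix y assume "y \<in> cube_on I U"
  then show "(\<lambda>x. H x y) \<in> borel_measurable M" "\<exists>b. \<forall>x\<in>space M. cmod (H x y) \<le> b"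
    using assms(2) unfolding slope_class_def by blast+
next
  fix j assume "j \<in> I" "0 < \<mu> j"
  then obtain H' where "pw_deriv M I U j H H'" "pw_class M I U U B (\<mu>(j := \<mu> j - 1)) H'"
    using assms(2) unfolding slope_class_def by blast
  then show "\<exists>H'. pw_deriv M I U j H H' \<and> pw_class M I U U C (\<mu>(j := \<mu> j - 1)) H'"
    using pw_class_mono[OF assms(1) _ assms(3)] by blast
qed

lemma slope_class_le:
  assumes "finite I" "slope_class M I U B \<mu> H" "\<And>j. j \<in> I \<Longrightarrow> \<nu> j \<le> \<mu> j"
  shows "slope_class M I U B \<nu> H"
proof -
  have "\<exists>H'. pw_deriv M I U j H H' \<and> pw_class M I U U B (\<nu>(j := \<nu> j - 1)) H'" if j: "j \<in> I" "0 < \<nu> j" for j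
  proof -
    have "0 < \<mu> j" using j assms(3) order_less_le_trans by blast
    then obtain H' where H': "pw_deriv M I U j H H'" "pw_class M I U U B (\<mu>(j := \<mu> j - 1)) H'"
      using assms(2) j unfolding slope_class_def by blast
    have "pw_class M I U U B (\<nu>(j := \<nu> j - 1)) H'"
      by (rule diff_class_le[OF assms(1) H'(2)]) (use assms(3) in \<open>auto intro: diff_le_mono\<close>)
    with H' show ?thesis by blast
  qed
  then show ?thesis using assms(2) unfolding slope_class_def by (intro conjI) auto
qed

lemma slope_class_add:
  assumes "finite I" "slope_class M I U B \<mu> f" "slope_class M I U C \<mu> g"
  shows "slope_class M I U (B + C) \<mu> (\<lambda>x y. f x y + g x y)"
  unfolding slope_class_def
proof (intro conjI ballI impI)
  fix y assume y: "y \<in> cube_on I U"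
  show "(\<lambda>x. f x y + g x y) \<in> borel_measurable M"
    using assms(2,3) y unfolding slope_class_def by (intro borel_measurable_add) blast+
  obtain b c where "\<forall>x\<in>space M. cmod (f x y) \<le> b" "\<forall>x\<in>space M. cmod (g x y) \<le> c"
    using assms(2,3) y unfolding slope_class_def by blast
  then show "\<exists>b. \<forall>x\<in>space M. cmod (f x y + g x y) \<le> b"
    by (intro exI[of _ "b + c"]) (auto intro!: norm_triangle_mono)
next
  fix j assume j: "j \<in> I" "0 < \<mu> j"
  obtain f' where "pw_deriv M I U j f f'" "pw_class M I U U B (\<mu>(j := \<mu> j - 1)) f'"
    using assms(2) j unfolding slope_class_def by blast
  moreover obtain g' where "pw_deriv M I U j g g'" "pw_class M I U U C (\<mu>(j := \<mu> j - 1)) g'"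
    using assms(3) j unfolding slope_class_def by blast
  ultimately show "\<exists>H'. pw_deriv M I U j (\<lambda>x y. f x y + g x y) H' \<and> pw_class M I U U (B + C) (\<mu>(j := \<mu> j - 1)) H'"
    using pw_deriv_add pw_class_add[OF assms(1)] by blast
qed

lemma slope_class_linear:
  assumes "finite I" "slope_class M I U B \<mu> f" "bounded_linear T" "\<And>z. cmod (T z) \<le> c * cmod z" "0 \<le> c"
  shows "slope_class M I U (c * B) \<mu> (\<lambda>x y. T (f x y))"
  unfolding slope_class_def
proof (intro conjI ballI impI)
  have T: "T \<in> borel_measurable borel"
    by (intro borel_measurable_continuous_onI linear_continuous_on assms)
  fix y assume y: "y \<in> cube_on I U"
  have f: "(\<lambda>x. f x y) \<in> borel_measurable M"
    using assms(2) y unfolding slope_class_def by blast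
  show "(\<lambda>x. T (f x y)) \<in> borel_measurable M" by (rule measurable_compose[OF f T])
  obtain b where b: "\<forall>x\<in>space M. cmod (f x y) \<le> b"
    using assms(2) y unfolding slope_class_def by blast
  have "cmod (T (f x y)) \<le> c * b" if "x \<in> space M" for x
    using assms(4)[of "f x y"] mult_left_mono[OF bspec[OF b that] assms(5)] by (rule order_trans)
  then show "\<exists>b. \<forall>x\<in>space M. cmod (T (f x y)) \<le> b" by blast
next
  fix j assume j: "j \<in> I" "0 < \<mu> j"
  obtain f' where "pw_deriv M I U j f f'" "pw_class M I U U B (\<mu>(j := \<mu> j - 1)) f'"
    using assms(2) j unfolding slope_class_def by blast
  then show "\<exists>H'. pw_deriv M I U j (\<lambda>x y. T (f x y)) H' \<and> pw_class M I U U (c * B) (\<mu>(j := \<mu> j - 1)) H'"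
    using pw_deriv_linear[OF assms(3)] pw_class_linear[OF assms(1) _ assms(3-5)] by blast
qed

lemma slope_class_cmult:
  "finite I \<Longrightarrow> slope_class M I U B \<mu> f \<Longrightarrow> slope_class M I U (cmod c * B) \<mu> (\<lambda>x y. c * f x y)"
  by (rule slope_class_linear) (auto simp: norm_mult bounded_linear_mult_right)

lemma slope_class_const: "finite I \<Longrightarrow> 0 \<le> B \<Longrightarrow> slope_class M I U B \<mu> (\<lambda>_ _. c)"
  unfolding slope_class_def
proof (intro conjI ballI impI)
  fix j assume "finite I" "0 \<le> B" "j \<in> I"
  then show "\<exists>H'. pw_deriv M I U j (\<lambda>_ _. c) H' \<and> pw_class M I U U B (\<mu>(j := \<mu> j - 1)) H'"
    by (intro exI[of _ "\<lambda>_ _. 0"] conjI pw_class_const) (auto simp: pw_deriv_def)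
qed auto

lemma slope_class_sum:
  assumes "finite I" "finite J" "\<And>k. k \<in> J \<Longrightarrow> slope_class M I U (B k) \<mu> (f k)"
  shows "slope_class M I U (\<Sum>k\<in>J. B k) \<mu> (\<lambda>x y. \<Sum>k\<in>J. f k x y)"
  using assms(2,3)
  by (induction J rule: finite_induct) (auto intro!: slope_class_const slope_class_add assms(1))

subsection \<open>Composition with a smooth function\<close>

text \<open>Bounds the derivatives up to total order \<open>n\<close> of the composite of the k-th
  derivative of \<sigma> with a function whose slopes are bounded by \<open>B\<close>. The first
  summand is for the composite itself; the second is the Leibniz bound for its derivative, the
  product of the (k+1)-st derivative composed and a slope.\<close>

fun comp_bound :: "(nat \<Rightarrow> real) \<Rightarrow> real \<Rightarrow> nat \<Rightarrow> nat \<Rightarrow> real" where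
  "comp_bound b B 0 k = b k"
| "comp_bound b B (Suc n) k = b k + 2 ^ n * (comp_bound b B n (Suc k) * B)"

lemma comp_bound_nonneg: "0 \<le> B \<Longrightarrow> \<forall>k\<ge>1. 0 \<le> b k \<Longrightarrow> k \<ge> 1 \<Longrightarrow> 0 \<le> comp_bound b B n k"
  by (induction n arbitrary: k) auto

lemma comp_bound_ge: "0 \<le> B \<Longrightarrow> \<forall>k\<ge>1. 0 \<le> b k \<Longrightarrow> k \<ge> 1 \<Longrightarrow> b k \<le> comp_bound b B n k"
  by (cases n) (auto intro!: mult_nonneg_nonneg comp_bound_nonneg)

lemma pw_deriv_compose:
  assumes "smooth \<sigma>" "pw_deriv M I U j H H'"
  shows "pw_deriv M I U j (\<lambda>x y. of_real ((deriv ^^ k) \<sigma> (Re (H x y))))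
           (\<lambda>x y. of_real ((deriv ^^ Suc k) \<sigma> (Re (H x y))) * of_real (Re (H' x y)))"
  unfolding pw_deriv_def
proof (intro ballI)
  fix x y assume "x \<in> space M" "y \<in> cube_on I U"
  then have "((\<lambda>t. H x (y(j := t))) has_vector_derivative H' x y) (at (y j) within U)"
    using assms(2) by (auto simp: pw_deriv_def)
  then have "((\<lambda>t. Re (H x (y(j := t)))) has_field_derivative Re (H' x y)) (at (y j) within U)"
    unfolding has_real_derivative_iff_has_vector_derivative
    by (rule bounded_linear.has_vector_derivative[OF bounded_linear_Re])
  from DERIV_chain'[OF this smooth_deriv_funpow[OF assms(1)]]
  have "((\<lambda>t. (deriv ^^ k) \<sigma> (Re (H x (y(j := t))))) has_field_derivative
      (deriv ^^ Suc k) \<sigma> (Re (H x y)) * Re (H' x y)) (at (y j) within U)"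
    by (simp only: fun_upd_triv)
  from has_vector_derivative_of_real[OF this]
  show "((\<lambda>t. of_real ((deriv ^^ k) \<sigma> (Re (H x (y(j := t)))))) has_vector_derivative
      (of_real ((deriv ^^ Suc k) \<sigma> (Re (H x y))) * of_real (Re (H' x y)) :: complex)) (at (y j) within U)"
    by (simp only: of_real_mult)
qed

lemma borel_measurable_smooth: "smooth \<sigma> \<Longrightarrow> (deriv ^^ k) \<sigma> \<in> borel_measurable borel"
  by (intro borel_measurable_continuous_onI smooth_funpow_continuous)

text \<open>Restricted to \<open>k \<ge> 1\<close> because \<sigma> itself need not be bounded, only
  its derivatives. The induction on the order runs over all \<open>k\<close> at once: the chain rule
  trades one order for one more derivative of \<sigma>.\<close>

lemma pw_class_compose:
  assumes "finite I" "smooth \<sigma>" "\<And>k t. k \<ge> 1 \<Longrightarrow> \<bar>(deriv ^^ k) \<sigma> t\<bar> \<le> b k" "0 \<le> B" "k \<ge> 1"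
    "slope_class M I U B \<mu> H"
  shows "pw_class M I U U (comp_bound b B (sum \<mu> I) k) \<mu> (\<lambda>x y. of_real ((deriv ^^ k) \<sigma> (Re (H x y))))"
  using assms(5,6)
proof (induction "sum \<mu> I" arbitrary: \<mu> k)
  case 0
  have "pw_bounded M I U U (b k) (\<lambda>x y. of_real ((deriv ^^ k) \<sigma> (Re (H x y))))"
    unfolding pw_bounded_def using 0 assms(3) borel_measurable_smooth[OF assms(2), of k]
    by (auto simp: slope_class_def)
  moreover have "\<mu> j = 0" if "j \<in> I" for j using 0(1) assms(1) that by simp
  ultimately show ?case unfolding 0(1)[symmetric] by (intro diff_classI) auto
next
  case (Suc n)
  have nn: "\<forall>k\<ge>1. 0 \<le> b k" using assms(3) abs_ge_zero order_trans by blast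
  let ?F = "\<lambda>k x y. of_real ((deriv ^^ k) \<sigma> (Re (H x y))) :: complex"
  show ?case unfolding Suc(2)[symmetric]
  proof (rule diff_classI; (intro ballI impI)?)
    have "pw_bounded M I U U (b k) (?F k)"
      unfolding pw_bounded_def using Suc.prems assms(3) borel_measurable_smooth[OF assms(2), of k]
      by (auto simp: slope_class_def)
    then show "pw_bounded M I U U (comp_bound b B (Suc n) k) (?F k)"
      using comp_bound_ge[OF assms(4) nn Suc.prems(1), of "Suc n"] unfolding pw_bounded_def by force
    fix j assume j: "j \<in> I" "0 < \<mu> j"
    let ?\<mu> = "\<mu>(j := \<mu> j - 1)"
    obtain H' where H': "pw_deriv M I U j H H'" "pw_class M I U U B ?\<mu> H'"
      using Suc.prems(2) j unfolding slope_class_def by blast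
    have n: "n = sum ?\<mu> I" using sum_upd_less[of I j \<mu>] assms(1) j Suc(2) by simp
    have "slope_class M I U B ?\<mu> H" by (rule slope_class_le[OF assms(1) Suc.prems(2)]) auto
    then have "pw_class M I U U (comp_bound b B (sum ?\<mu> I) (Suc k)) ?\<mu> (?F (Suc k))"
      by (intro Suc(1)[OF n]) simp_all
    then have "pw_class M I U U (comp_bound b B n (Suc k)) ?\<mu> (?F (Suc k))"
      by (simp only: n[symmetric])
    from pw_class_mult[OF assms(1) this pw_class_Re[OF assms(1) H'(2)] comp_bound_nonneg[OF assms(4) nn] assms(4)]
    have "pw_class M I U U (2 ^ n * (comp_bound b B n (Suc k) * B)) ?\<mu> (\<lambda>x y. ?F (Suc k) x y * of_real (Re (H' x y)))"
      unfolding n[symmetric] by simp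
    then have "pw_class M I U U (comp_bound b B (Suc n) k) ?\<mu> (\<lambda>x y. ?F (Suc k) x y * of_real (Re (H' x y)))"
      by (rule pw_class_mono[OF assms(1)]) (use nn Suc.prems(1) in auto)
    then show "\<exists>f'. pw_deriv M I U j (?F k) f' \<and> pw_class M I U U (comp_bound b B (Suc n) k) ?\<mu> f'"
      using pw_deriv_compose[OF assms(2) H'(1)] by blast
  qed
qed

text \<open>The case of \<sigma> itself. Only slopes are claimed, so after one application of the
  chain rule the composite involves just the first and higher derivatives of \<sigma>.\<close>

lemma slope_class_compose:
  assumes "finite I" "smooth \<sigma>" "\<And>k t. k \<ge> 1 \<Longrightarrow> \<bar>(deriv ^^ k) \<sigma> t\<bar> \<le> b k" "0 \<le> B"
    "slope_class M I U B \<mu> H"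
  shows "slope_class M I U (2 ^ sum \<mu> I * (comp_bound b B (sum \<mu> I) 1 * B)) \<mu> (\<lambda>x y. of_real (\<sigma> (Re (H x y))))"
  unfolding slope_class_def
proof (intro conjI ballI impI)
  fix y assume y: "y \<in> cube_on I U"
  then have [measurable]: "(\<lambda>x. H x y) \<in> borel_measurable M" using assms(5) by (auto simp: slope_class_def)
  have [measurable]: "\<sigma> \<in> borel_measurable borel" using borel_measurable_smooth[OF assms(2), of 0] by simp
  show "(\<lambda>x. complex_of_real (\<sigma> (Re (H x y)))) \<in> borel_measurable M" by measurable
  obtain c where c: "\<forall>x\<in>space M. cmod (H x y) \<le> c" using assms(5) y by (auto simp: slope_class_def)
  \<comment> \<open>For fixed \<open>y\<close> the argument of \<sigma> stays in a compact interval.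
    The resulting bound may depend on \<open>y\<close> and on the biases, which a slope class
    permits.\<close>
  have "bounded (\<sigma> ` {-c..c})"
    using smooth_funpow_continuous[OF assms(2), of _ 0]
    by (intro compact_imp_bounded compact_continuous_image) auto
  then obtain C where C: "\<forall>t\<in>{-c..c}. \<bar>\<sigma> t\<bar> \<le> C" by (auto simp: bounded_iff)
  have "Re (H x y) \<in> {-c..c}" if "x \<in> space M" for x
    using c that abs_Re_le_cmod[of "H x y"] by fastforce
  with C show "\<exists>b. \<forall>x\<in>space M. cmod (complex_of_real (\<sigma> (Re (H x y)))) \<le> b"
    by (intro exI[of _ C]) auto
next
  fix j assume j: "j \<in> I" "0 < \<mu> j"
  let ?\<mu> = "\<mu>(j := \<mu> j - 1)"
  have nn: "\<forall>k\<ge>1. 0 \<le> b k" using assms(3) abs_ge_zero order_trans by blast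
  obtain H' where H': "pw_deriv M I U j H H'" "pw_class M I U U B ?\<mu> H'"
    using assms(5) j unfolding slope_class_def by blast
  have "pw_class M I U U (comp_bound b B (sum \<mu> I) 1) ?\<mu> (\<lambda>x y. of_real ((deriv ^^ 1) \<sigma> (Re (H x y))))"
    by (rule diff_class_le[OF assms(1) pw_class_compose[OF assms(1-4) _ assms(5)]]) auto
  from pw_class_mult[OF assms(1) this pw_class_Re[OF assms(1) H'(2)] comp_bound_nonneg[OF assms(4) nn] assms(4)]
  have "pw_class M I U U (2 ^ sum ?\<mu> I * (comp_bound b B (sum \<mu> I) 1 * B)) ?\<mu>
      (\<lambda>x y. of_real ((deriv ^^ Suc 0) \<sigma> (Re (H x y))) * of_real (Re (H' x y)))"
    by simp
  then have "pw_class M I U U (2 ^ sum \<mu> I * (comp_bound b B (sum \<mu> I) 1 * B)) ?\<mu>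
      (\<lambda>x y. of_real ((deriv ^^ Suc 0) \<sigma> (Re (H x y))) * of_real (Re (H' x y)))"
    by (rule pw_class_mono[OF assms(1)])
       (intro mult_right_mono power_increasing mult_nonneg_nonneg comp_bound_nonneg assms(4) nn sum_mono; simp)
  then show "\<exists>f'. pw_deriv M I U j (\<lambda>x y. of_real (\<sigma> (Re (H x y)))) f' \<and>
      pw_class M I U U (2 ^ sum \<mu> I * (comp_bound b B (sum \<mu> I) 1 * B)) ?\<mu> f'"
    using pw_deriv_compose[OF assms(2) H'(1), of 0] unfolding funpow_0 by blast
qed

subsection \<open>Functionals applied to a parameter-dependent function\<close>

definition cube_bounded :: "nat set \<Rightarrow> real \<Rightarrow> (point \<Rightarrow> complex) \<Rightarrow> bool" where
  "cube_bounded D B v \<longleftrightarrow> v \<in> borel_measurable (cube_measure D) \<and> (\<forall>x\<in>unit_cube D. cmod (v x) \<le> B)"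

text \<open>The properties shared by exact Fourier coefficients and their lattice approximations.\<close>

definition averaging :: "nat set \<Rightarrow> ((point \<Rightarrow> complex) \<Rightarrow> complex) \<Rightarrow> bool" where
  "averaging D F \<longleftrightarrow>
     (\<forall>u v a b B C. cube_bounded D B u \<longrightarrow> cube_bounded D C v \<longrightarrow> F (\<lambda>x. a * u x + b * v x) = a * F u + b * F v) \<and>
     (\<forall>v B. cube_bounded D B v \<longrightarrow> cmod (F v) \<le> B) \<and>
     (\<forall>V v B. (\<forall>n. cube_bounded D B (V n)) \<longrightarrow> (\<forall>x\<in>unit_cube D. (\<lambda>n. V n x) \<longlonglongrightarrow> v x) \<longrightarrow>
        (\<lambda>n. F (V n)) \<longlonglongrightarrow> F v)"

lemma averaging_linear:
  "averaging D F \<Longrightarrow> cube_bounded D B u \<Longrightarrow> cube_bounded D C v \<Longrightarrow> F (\<lambda>x. a * u x + b * v x) = a * F u + b * F v"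
  unfolding averaging_def by blast

lemma averaging_le: "averaging D F \<Longrightarrow> cube_bounded D B v \<Longrightarrow> cmod (F v) \<le> B"
  unfolding averaging_def by blast

lemma averaging_LIMSEQ:
  "averaging D F \<Longrightarrow> (\<And>n. cube_bounded D B (V n)) \<Longrightarrow> (\<And>x. x \<in> unit_cube D \<Longrightarrow> (\<lambda>n. V n x) \<longlonglongrightarrow> v x) \<Longrightarrow>
   (\<lambda>n. F (V n)) \<longlonglongrightarrow> F v"
  unfolding averaging_def by (elim conjE) blast

lemma norm_quotient_le:
  assumes "pw_deriv M I U j H H'" "pw_bounded M I U U B H'" "convex U" "x \<in> space M" "y \<in> cube_on I U" "j \<in> I"
    "t \<in> U" "t \<noteq> y j"
  shows "cmod ((H x (y(j := t)) - H x y) / of_real (t - y j)) \<le> B"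
proof -
  have yj: "y j \<in> U" using assms(5,6) by auto
  have "cmod (H x (y(j := t)) - H x (y(j := y j))) \<le> B * \<bar>t - y j\<bar>"
    by (rule norm_increment_le[OF assms(3), where f = "\<lambda>t. H x (y(j := t))" and f' = "\<lambda>t. H' x (y(j := t))",
        OF pw_derivD[OF assms(1,4,5,6)] pw_bounded_le[OF assms(2,4) cube_on_upd[OF assms(5,6)]] yj assms(7)])
  then show ?thesis using assms(8) by (simp add: norm_divide divide_le_eq del: of_real_diff)
qed

text \<open>A linear functional that is continuous under bounded pointwise convergence commutes with
  d/dy: the difference quotients are bounded uniformly by the mean value inequality and converge
  pointwise.\<close>

lemma averaging_has_vector_derivative:
  assumes F: "averaging D F" and "convex U"
    and H: "pw_deriv (cube_measure D) I U j H H'" "pw_bounded (cube_measure D) I U U B H'"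
    and bd: "\<And>y. y \<in> cube_on I U \<Longrightarrow> \<exists>b. cube_bounded D b (\<lambda>x. H x y)"
    and y: "y \<in> cube_on I U" "j \<in> I"
  shows "((\<lambda>t. F (\<lambda>x. H x (y(j := t)))) has_vector_derivative F (\<lambda>x. H' x y)) (at (y j) within U)"
  unfolding has_vector_derivative_iff_quotient tendsto_at_iff_sequentially
proof (intro allI impI)
  fix T :: "nat \<Rightarrow> real" assume T: "\<forall>n. T n \<in> U - {y j}" "T \<longlonglongrightarrow> y j"
  let ?V = "\<lambda>n x. (H x (y(j := T n)) - H x y) / of_real (T n - y j)"
  have eq: "F (?V n) = (F (\<lambda>x. H x (y(j := T n))) - F (\<lambda>x. H x y)) / of_real (T n - y j)" for n
  proof -
    obtain b c where bc: "cube_bounded D b (\<lambda>x. H x (y(j := T n)))" "cube_bounded D c (\<lambda>x. H x y)"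
      using bd[OF cube_on_upd[OF y, of "T n"]] bd[OF y(1)] T(1) by blast
    have "?V n = (\<lambda>x. inverse (of_real (T n - y j)) * H x (y(j := T n)) + (- inverse (of_real (T n - y j))) * H x y)"
      by (auto simp: divide_inverse algebra_simps)
    then show ?thesis
      by (simp only: averaging_linear[OF F bc]) (simp add: divide_inverse algebra_simps)
  qed
  have "(\<lambda>n. F (?V n)) \<longlonglongrightarrow> F (\<lambda>x. H' x y)"
  proof (rule averaging_LIMSEQ[OF F])
    fix n
    obtain b c where bc: "cube_bounded D b (\<lambda>x. H x (y(j := T n)))" "cube_bounded D c (\<lambda>x. H x y)"
      using bd[OF cube_on_upd[OF y, of "T n"]] bd[OF y(1)] T(1) by blast
    then have "(\<lambda>x. H x (y(j := T n))) \<in> borel_measurable (cube_measure D)"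
      "(\<lambda>x. H x y) \<in> borel_measurable (cube_measure D)" by (auto simp: cube_bounded_def)
    then have "?V n \<in> borel_measurable (cube_measure D)" by measurable
    then show "cube_bounded D B (?V n)"
      using norm_quotient_le[OF H assms(2) _ y, of _ "T n"] T(1) by (auto simp: cube_bounded_def)
  next
    fix x assume "x \<in> unit_cube D"
    then have "((\<lambda>t. H x (y(j := t))) has_vector_derivative H' x y) (at (y j) within U)"
      using pw_derivE[OF H(1) _ y(1)] by simp
    then show "(\<lambda>n. ?V n x) \<longlonglongrightarrow> H' x y"
      using T unfolding has_vector_derivative_iff_quotient tendsto_at_iff_sequentially
      by (auto simp: o_def)
  qed
  then show "((\<lambda>t. (F (\<lambda>x. H x (y(j := t))) - F (\<lambda>x. H x (y(j := y j)))) / of_real (t - y j)) \<circ> T) \<longlonglongrightarrow> F (\<lambda>x. H' x y)"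
    unfolding eq by (simp add: o_def)
qed

lemma pw_bounded_cube_bounded:
  "pw_bounded (cube_measure D) I U U B H \<Longrightarrow> y \<in> cube_on I U \<Longrightarrow> cube_bounded D B (\<lambda>x. H x y)"
  by (auto simp: pw_bounded_def cube_bounded_def)

text \<open>The bound survives with the same constant because the functional is dominated by the sup
  of its argument. The result is constant in the parameter, so the new parameter space is
  arbitrary.\<close>

lemma pw_class_averaging:
  assumes "finite I" "averaging D F" "convex U" "pw_class (cube_measure D) I U U B \<mu> H"
  shows "pw_class M I U U B \<mu> (\<lambda>_ y. F (\<lambda>x. H x y))"
proof (rule diff_class_map[OF assms(1,4)])
  fix f assume "pw_bounded (cube_measure D) I U U B f"
  then show "pw_bounded M I U U B (\<lambda>_ y. F (\<lambda>x. f x y))"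
    using averaging_le[OF assms(2)] pw_bounded_cube_bounded unfolding pw_bounded_def[of M] by auto
next
  fix j f f'
  assume j: "j \<in> I" and f: "pw_bounded (cube_measure D) I U U B f" "pw_bounded (cube_measure D) I U U B f'"
    "pw_deriv (cube_measure D) I U j f f'"
  show "pw_deriv M I U j (\<lambda>_ y. F (\<lambda>x. f x y)) (\<lambda>_ y. F (\<lambda>x. f' x y))"
    by (rule pw_derivI, rule averaging_has_vector_derivative[OF assms(2,3) f(3,2) _ _ j])
       (use pw_bounded_cube_bounded[OF f(1)] in blast)+
qed

lemma slope_class_averaging:
  assumes "finite I" "averaging D F" "convex U" "slope_class (cube_measure D) I U B \<mu> H"
  shows "slope_class M I U B \<mu> (\<lambda>_ y. F (\<lambda>x. H x y))"
  unfolding slope_class_def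
proof (intro conjI ballI impI)
  fix j assume j: "j \<in> I" "0 < \<mu> j"
  obtain H' where H': "pw_deriv (cube_measure D) I U j H H'"
    "pw_class (cube_measure D) I U U B (\<mu>(j := \<mu> j - 1)) H'"
    using assms(4) j unfolding slope_class_def by blast
  have "\<exists>b. cube_bounded D b (\<lambda>x. H x y)" if "y \<in> cube_on I U" for y
    using assms(4) that unfolding slope_class_def cube_bounded_def by auto
  then have "pw_deriv M I U j (\<lambda>_ y. F (\<lambda>x. H x y)) (\<lambda>_ y. F (\<lambda>x. H' x y))"
    by (intro pw_derivI averaging_has_vector_derivative[OF assms(2,3) H'(1) diff_class_bound[OF H'(2)] _ _ j(1)])
  then show "\<exists>H'. pw_deriv M I U j (\<lambda>_ y. F (\<lambda>x. H x y)) H' \<and> pw_class M I U U B (\<mu>(j := \<mu> j - 1)) H'"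
    using pw_class_averaging[OF assms(1-3) H'(2)] by blast
qed auto

text \<open>The coordinates are exchanged one at a time: \<open>m J\<close> agrees with
  \<open>x'\<close> on \<open>J\<close> and with \<open>x\<close> elsewhere, and every single
  exchange is estimated along one coordinate line. No bound on \<open>H\<close> itself
  enters.\<close>

lemma slope_class_increment_le:
  assumes "finite I" "slope_class M I U B \<mu> H" "\<And>j. j \<in> I \<Longrightarrow> 0 < \<mu> j" "convex U"
    "u \<in> space M" "x \<in> cube_on I U" "x' \<in> cube_on I U"
  shows "cmod (H u x' - H u x) \<le> B * (\<Sum>j\<in>I. \<bar>x' j - x j\<bar>)"
proof -
  define m where "m J = (\<lambda>j. if j \<in> J then x' j else x j)" for J
  have m: "m J \<in> cube_on I U" if "J \<subseteq> I" for J
    using assms(6,7) that by (fastforce simp: m_def PiE_def extensional_def Pi_def)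
  have "cmod (H u (m J) - H u x) \<le> B * (\<Sum>j\<in>J. \<bar>x' j - x j\<bar>)" if "J \<subseteq> I" for J
    using finite_subset[OF that assms(1)] that
  proof (induction J rule: finite_induct)
    case empty then show ?case by (simp add: m_def)
  next
    case (insert k J)
    then have k: "k \<in> I" "J \<subseteq> I" by auto
    obtain H' where H': "pw_deriv M I U k H H'" "pw_class M I U U B (\<mu>(k := \<mu> k - 1)) H'"
      using assms(2,3) k(1) unfolding slope_class_def by blast
    have yk: "m J k \<in> U" "x' k \<in> U" using m[OF k(2)] k assms(7) by auto
    have "cmod (H u ((m J)(k := x' k)) - H u ((m J)(k := m J k))) \<le> B * \<bar>x' k - m J k\<bar>"
      by (rule norm_increment_le[OF assms(4), where f = "\<lambda>t. H u ((m J)(k := t))" and f' = "\<lambda>t. H' u ((m J)(k := t))",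
        OF pw_derivD[OF H'(1) assms(5) m[OF k(2)] k(1)]
           pw_bounded_le[OF diff_class_bound[OF H'(2)] assms(5) cube_on_upd[OF m[OF k(2)] k(1)]] yk])
    moreover have "(m J)(k := x' k) = m (insert k J)" "m J k = x k"
      using insert.hyps by (auto simp: m_def)
    ultimately have "cmod (H u (m (insert k J)) - H u (m J)) \<le> B * \<bar>x' k - x k\<bar>"
      unfolding fun_upd_triv by simp
    moreover have "cmod (H u (m J) - H u x) \<le> B * (\<Sum>j\<in>J. \<bar>x' j - x j\<bar>)"
      using insert.IH k(2) by simp
    ultimately show ?case
      using norm_triangle_ineq[of "H u (m (insert k J)) - H u (m J)" "H u (m J) - H u x"] insert.hyps
      by (simp add: distrib_left)
  qed
  moreover have "m I = x'"
    using assms(6,7) by (auto simp: m_def PiE_def extensional_def fun_eq_iff)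
  ultimately show ?thesis by blast
qed

text \<open>Bounded partial derivatives in every coordinate give a Lipschitz bound in the l_1
  distance and hence joint continuity. This is the reason for carrying one derivative in
  reserve.\<close>

lemma slope_class_continuous:
  assumes "finite I" "slope_class M I U B \<mu> H" "\<And>j. j \<in> I \<Longrightarrow> 0 < \<mu> j" "convex U" "u \<in> space M"
  shows "continuous_on (cube_on I U) (H u)"
  unfolding continuous_on_def
proof
  fix x assume x: "x \<in> cube_on I U"
  let ?g = "\<lambda>x'. B * (\<Sum>j\<in>I. \<bar>x' j - x j\<bar>)"
  have "continuous_on UNIV ?g" by (intro continuous_intros continuous_on_product_coordinates)
  then have "(?g \<longlongrightarrow> ?g x) (at x within cube_on I U)"
    using continuous_on_subset[OF _ subset_UNIV, of _ "cube_on I U"] x unfolding continuous_on_def by blast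
  then have "(?g \<longlongrightarrow> 0) (at x within cube_on I U)" by simp
  then have "((\<lambda>x'. H u x' - H u x) \<longlongrightarrow> 0) (at x within cube_on I U)"
  proof (rule Lim_null_comparison[rotated])
    show "\<forall>\<^sub>F x' in at x within cube_on I U. cmod (H u x' - H u x) \<le> ?g x'"
      using slope_class_increment_le[OF assms(1-3) assms(4,5) x]
      by (auto simp: eventually_at_filter)
  qed
  then show "(H u \<longlongrightarrow> H u x) (at x within cube_on I U)" by (simp add: LIM_zero_iff)
qed

text \<open>Meant for Fourier characters when the network is differentiated in y: they depend on the
  parameter x only and have modulus 1, so the slope bound is unchanged.\<close>

lemma slope_class_times_parameter:
  assumes "finite I" "slope_class M I U B \<mu> f" "g \<in> borel_measurable M" "\<And>x. cmod (g x) \<le> 1"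
  shows "slope_class M I U B \<mu> (\<lambda>x y. g x * f x y)"
proof -
  have le: "cmod (g x * z) \<le> c" if "cmod z \<le> c" for x z c
    using mult_mono[OF assms(4)[of x] that] by (simp add: norm_mult)
  have der: "pw_deriv M I U j (\<lambda>x y. g x * h x y) (\<lambda>x y. g x * h' x y)" if "pw_deriv M I U j h h'" for j h h'
    by (rule pw_derivI, rule bounded_linear.has_vector_derivative[OF bounded_linear_mult_right])
       (rule pw_derivE[OF that])
  show ?thesis
    unfolding slope_class_def
  proof (intro conjI ballI impI)
    fix y assume y: "y \<in> cube_on I U"
    show "(\<lambda>x. g x * f x y) \<in> borel_measurable M"
      using assms(2,3) y unfolding slope_class_def by (intro borel_measurable_times) blast+
    show "\<exists>b. \<forall>x\<in>space M. cmod (g x * f x y) \<le> b"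
      using assms(2) y le unfolding slope_class_def by meson
  next
    fix j assume j: "j \<in> I" "0 < \<mu> j"
    obtain f' where f': "pw_deriv M I U j f f'" "pw_class M I U U B (\<mu>(j := \<mu> j - 1)) f'"
      using assms(2) j unfolding slope_class_def by blast
    have "pw_class M I U U B (\<mu>(j := \<mu> j - 1)) (\<lambda>x y. g x * f' x y)"
    proof (rule diff_class_map[OF assms(1) f'(2)])
      fix h assume "pw_bounded M I U U B h"
      then show "pw_bounded M I U U B (\<lambda>x y. g x * h x y)"
        unfolding pw_bounded_def[of _ _ _ _ _ "\<lambda>x y. g x * h x y"]
        by (intro conjI ballI borel_measurable_times assms(3) le) (auto intro: pw_bounded_measurable pw_bounded_le)
    qed (rule der)
    then show "\<exists>H'. pw_deriv M I U j (\<lambda>x y. g x * f x y) H' \<and> pw_class M I U U B (\<mu>(j := \<mu> j - 1)) H'"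
      using der[OF f'(1)] by blast
  qed
qed

text \<open>Since Im z = Re(-i z), the imaginary part of the complexified activation is the real
  composition applied to -i H, and the two parts contribute equally.\<close>

lemma slope_class_act:
  assumes "finite I" "smooth \<sigma>" "\<And>k t. k \<ge> 1 \<Longrightarrow> \<bar>(deriv ^^ k) \<sigma> t\<bar> \<le> b k" "0 \<le> B" "slope_class M I U B \<mu> H"
  shows "slope_class M I U (2 * (2 ^ sum \<mu> I * (comp_bound b B (sum \<mu> I) 1 * B))) \<mu> (\<lambda>x y. act \<sigma> (H x y))"
proof -
  let ?K = "2 ^ sum \<mu> I * (comp_bound b B (sum \<mu> I) 1 * B)"
  have "slope_class M I U B \<mu> (\<lambda>x y. - \<i> * H x y)"
    using slope_class_cmult[OF assms(1,5), of "- \<i>"] by simp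
  from slope_class_cmult[OF assms(1) slope_class_compose[OF assms(1-4) this], of \<i>]
  have "slope_class M I U ?K \<mu> (\<lambda>x y. \<i> * of_real (\<sigma> (Im (H x y))))" by simp
  from slope_class_add[OF assms(1) slope_class_compose[OF assms(1-5)] this]
  have "slope_class M I U (2 * ?K) \<mu> (\<lambda>x y. of_real (\<sigma> (Re (H x y))) + \<i> * of_real (\<sigma> (Im (H x y))))"
    unfolding mult_2 .
  then show ?thesis unfolding act_def Complex_eq .
qed

text \<open>One affine layer with its Fourier part left abstract. The constant \<open>c\<close> is
  the loss in passing from slopes of v_j to slopes of coefficient times character: 1 in the variable
  y, an oscillation constant in the variable x.\<close>

lemma slope_class_layer:
  fixes n :: nat and R B c :: real
  assumes "finite I" "finite A" "0 \<le> B" "0 \<le> c"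
    and v: "\<And>j. j \<in> {1..n} \<Longrightarrow> slope_class M I U B \<mu> (v j)"
    and q: "\<And>j h. j \<in> {1..n} \<Longrightarrow> h \<in> A \<Longrightarrow> slope_class M I U (c * B) \<mu> (\<lambda>x y. q h j x y * e h x y)"
    and W: "\<And>j. j \<in> {1..n} \<Longrightarrow> \<bar>W j\<bar> \<le> R" and \<kappa>: "\<And>j h. j \<in> {1..n} \<Longrightarrow> h \<in> A \<Longrightarrow> cmod (\<kappa> h j) \<le> R"
  shows "slope_class M I U (n * (R * B) + card A * (n * (R * (c * B)))) \<mu>
    (\<lambda>x y. (\<Sum>j=1..n. of_real (W j) * v j x y) + (\<Sum>h\<in>A. (\<Sum>j=1..n. \<kappa> h j * q h j x y) * e h x y) + of_real b)"
proof -
  have 1: "slope_class M I U (R * B) \<mu> (\<lambda>x y. of_real (W j) * v j x y)" if "j \<in> {1..n}" for j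
    by (rule slope_class_mono[OF assms(1) slope_class_cmult[OF assms(1) v[OF that]]])
       (use W[OF that] assms(3) in \<open>auto intro: mult_right_mono\<close>)
  have 2: "slope_class M I U (R * (c * B)) \<mu> (\<lambda>x y. \<kappa> h j * (q h j x y * e h x y))" if "j \<in> {1..n}" "h \<in> A" for j h
    by (rule slope_class_mono[OF assms(1) slope_class_cmult[OF assms(1) q[OF that]]])
       (use \<kappa>[OF that] assms(3,4) in \<open>auto intro: mult_right_mono\<close>)
  have "slope_class M I U (\<Sum>j=1..n. R * (c * B)) \<mu> (\<lambda>x y. \<Sum>j=1..n. \<kappa> h j * (q h j x y * e h x y))" if "h \<in> A" for h
    by (rule slope_class_sum[OF assms(1)]) (use 2 that in auto)
  then have "slope_class M I U (\<Sum>h\<in>A. \<Sum>j=1..n. R * (c * B)) \<mu> (\<lambda>x y. \<Sum>h\<in>A. \<Sum>j=1..n. \<kappa> h j * (q h j x y * e h x y))"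
    by (intro slope_class_sum[OF assms(1,2)])
  moreover have "slope_class M I U (\<Sum>j=1..n. R * B) \<mu> (\<lambda>x y. \<Sum>j=1..n. of_real (W j) * v j x y)"
    by (rule slope_class_sum[OF assms(1)]) (use 1 in auto)
  ultimately have "slope_class M I U ((\<Sum>j=1..n. R * B) + (\<Sum>h\<in>A. \<Sum>j=1..n. R * (c * B)) + 0) \<mu>
    (\<lambda>x y. (\<Sum>j=1..n. of_real (W j) * v j x y) + (\<Sum>h\<in>A. \<Sum>j=1..n. \<kappa> h j * (q h j x y * e h x y)) + of_real b)"
    by (intro slope_class_add[OF assms(1)] slope_class_const[OF assms(1)]) auto
  then show ?thesis by (simp add: sum_distrib_right mult.assoc)
qed

subsection \<open>Regularity of the network\<close>

text \<open>Entrywise consequences of the norm bounds, with thresholds that do not involve \<theta>,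
  so that regularity constants can be fixed before \<theta>.\<close>

definition params_bounded ::
  "(nat \<Rightarrow> int) set \<Rightarrow> nat \<Rightarrow> nat \<Rightarrow> (nat \<Rightarrow> nat) \<Rightarrow> (nat \<Rightarrow> real) \<Rightarrow> real \<Rightarrow> real \<Rightarrow> fno_params \<Rightarrow> bool" where
  "params_bounded A L du dims R P Q \<theta> \<longleftrightarrow>
     (\<forall>l\<in>{1..L}. \<forall>i\<in>{1..dims (l + 1)}. \<forall>j\<in>{1..dims l}.
        \<bar>weight \<theta> l i j\<bar> \<le> R l \<and> (\<forall>h\<in>A. cmod (kernel_coeff \<theta> l h i j) \<le> R l)) \<and>
     (\<forall>i\<in>{1..dims 1}. \<bar>lift_mat \<theta> i 1\<bar> \<le> P) \<and>
     (\<forall>p\<in>{1..du}. \<forall>j\<in>{1..dims (L + 1)}. \<bar>proj_mat \<theta> p j\<bar> \<le> Q)"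

lemma fourier_char_measurable: "fourier_char d h \<in> borel_measurable (cube_measure {1..d})"
proof -
  have "continuous_on UNIV (fourier_char d h)"
    unfolding fourier_char_def
    by (intro continuous_intros continuous_on_product_coordinates)
  then show ?thesis by (rule borel_measurable_cube[OF continuous_on_subset[OF _ subset_UNIV]])
qed

lemma cmod_fourier_char [simp]: "cmod (fourier_char d h x) = 1"
  by (simp add: fourier_char_def)

text \<open>Induction over the layers with a constant that precedes both \<theta> and the Fourier
  functional, since exact and approximated coefficients must be covered by the same bound.\<close>

lemma hidden_slope_y:
  assumes I: "finite I" and A: "finite A" and U: "convex U"
    and \<sigma>: "smooth \<sigma>" "\<And>k t. k \<ge> 1 \<Longrightarrow> \<bar>(deriv ^^ k) \<sigma> t\<bar> \<le> b k"
    and R: "\<And>l. l \<ge> 1 \<Longrightarrow> 0 \<le> R l" and P: "0 \<le> P" and Ba: "0 \<le> Ba"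
    and a: "slope_class (cube_measure {1..d}) I U Ba \<mu> a"
    and "l \<le> L"
  shows "\<exists>K\<ge>0. \<forall>\<theta> FC. params_bounded A L du dims R P Q \<theta> \<longrightarrow> (\<forall>h\<in>A. averaging {1..d} (\<lambda>v. FC v h)) \<longrightarrow>
     (\<forall>i\<in>{1..dims (Suc l)}. slope_class (cube_measure {1..d}) I U K \<mu>
        (\<lambda>x y. fno_hidden d A dims FC \<sigma> \<theta> l (\<lambda>x'. a x' y) x i))"
  using \<open>l \<le> L\<close>
proof (induction l)
  case 0
  have "slope_class (cube_measure {1..d}) I U (P * Ba) \<mu> (\<lambda>x y. of_real (lift_mat \<theta> i 1) * a x y)"
    if "params_bounded A L du dims R P Q \<theta>" "i \<in> {1..dims (Suc 0)}" for \<theta> i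
    by (rule slope_class_mono[OF I slope_class_cmult[OF I a]])
       (use that Ba in \<open>auto simp: params_bounded_def intro!: mult_right_mono\<close>)
  then show ?case using P Ba by (intro exI[of _ "P * Ba"]) auto
next
  case (Suc l)
  then obtain K where K: "K \<ge> 0" and IH: "\<And>\<theta> FC i. params_bounded A L du dims R P Q \<theta> \<Longrightarrow>
     (\<forall>h\<in>A. averaging {1..d} (\<lambda>v. FC v h)) \<Longrightarrow> i \<in> {1..dims (Suc l)} \<Longrightarrow>
     slope_class (cube_measure {1..d}) I U K \<mu> (\<lambda>x y. fno_hidden d A dims FC \<sigma> \<theta> l (\<lambda>x'. a x' y) x i)"
    by auto
  let ?n = "dims (Suc l)" and ?R = "R (Suc l)"
  \<comment> \<open>\<open>K1\<close> is the slope bound after the affine layer, with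
    \<open>c = 1\<close>; \<open>K2\<close> is the one after the activation.\<close>
  define K1 where "K1 = ?n * (?R * K) + card A * (?n * (?R * (1 * K)))"
  have K1: "0 \<le> K1" using K R[of "Suc l"] by (auto simp: K1_def)
  define K2 where "K2 = 2 * (2 ^ sum \<mu> I * (comp_bound b K1 (sum \<mu> I) 1 * K1))"
  have "\<forall>k\<ge>1. 0 \<le> b k" using \<sigma>(2) abs_ge_zero order_trans by blast
  then have "0 \<le> K2" using K1 by (auto simp: K2_def intro!: mult_nonneg_nonneg comp_bound_nonneg)
  moreover have "slope_class (cube_measure {1..d}) I U K2 \<mu>
        (\<lambda>x y. fno_hidden d A dims FC \<sigma> \<theta> (Suc l) (\<lambda>x'. a x' y) x i)"
    if \<theta>: "params_bounded A L du dims R P Q \<theta>" and FC: "\<forall>h\<in>A. averaging {1..d} (\<lambda>v. FC v h)"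
      and i: "i \<in> {1..dims (Suc (Suc l))}" for \<theta> FC i
  proof -
    define v where "v j = (\<lambda>x y. fno_hidden d A dims FC \<sigma> \<theta> l (\<lambda>x'. a x' y) x j)" for j
    have v: "slope_class (cube_measure {1..d}) I U K \<mu> (v j)" if "j \<in> {1..?n}" for j
      unfolding v_def by (rule IH[OF \<theta> FC that])
    \<comment> \<open>The coefficient depends on y alone and inherits the slope bound of its
      argument; the character depends on x alone.\<close>
    have q: "slope_class (cube_measure {1..d}) I U (1 * K) \<mu> (\<lambda>x y. FC (\<lambda>x'. v j x' y) h * fourier_char d h x)"
      if "j \<in> {1..?n}" "h \<in> A" for j h
    proof -
      have "averaging {1..d} (\<lambda>v. FC v h)" using FC that by blast
      from slope_class_times_parameter[OF I slope_class_averaging[OF I this U v[OF that(1)]] fourier_char_measurable]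
      show ?thesis by (simp add: mult.commute)
    qed
    have "\<bar>weight \<theta> (Suc l) i j\<bar> \<le> ?R" "\<And>h. h \<in> A \<Longrightarrow> cmod (kernel_coeff \<theta> (Suc l) h i j) \<le> ?R"
      if "j \<in> {1..?n}" for j
      using \<theta> i that Suc.prems unfolding params_bounded_def by force+
    note Wk = this
    have "slope_class (cube_measure {1..d}) I U K1 \<mu> (\<lambda>x y. (\<Sum>j=1..?n. of_real (weight \<theta> (Suc l) i j) * v j x y) +
        (\<Sum>h\<in>A. (\<Sum>j=1..?n. kernel_coeff \<theta> (Suc l) h i j * FC (\<lambda>x'. v j x' y) h) * fourier_char d h x) +
        of_real (bias \<theta> (Suc l) i))"
      unfolding K1_def by (rule slope_class_layer[OF I A K zero_le_one]) (rule v q Wk; assumption)+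
    then have "slope_class (cube_measure {1..d}) I U K1 \<mu>
      (\<lambda>x y. fno_layer d A dims FC \<theta> (Suc l) (fno_hidden d A dims FC \<sigma> \<theta> l (\<lambda>x'. a x' y)) x i)"
      unfolding fno_layer_def v_def .
    from slope_class_act[OF I \<sigma> K1 this]
    show ?thesis unfolding K2_def fno_hidden.simps .
  qed
  ultimately show ?case by (intro exI[of _ K2] conjI allI impI ballI)
qed

lemma fno_slope_y:
  assumes I: "finite I" and A: "finite A" and U: "convex U"
    and \<sigma>: "smooth \<sigma>" "\<And>k t. k \<ge> 1 \<Longrightarrow> \<bar>(deriv ^^ k) \<sigma> t\<bar> \<le> b k"
    and R: "\<And>l. l \<ge> 1 \<Longrightarrow> 0 \<le> R l" and P: "0 \<le> P" and Ba: "0 \<le> Ba" and Q: "0 \<le> Q"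
    and a: "slope_class (cube_measure {1..d}) I U Ba \<mu> a"
  shows "\<exists>K\<ge>0. \<forall>\<theta> FC. params_bounded A L du dims R P Q \<theta> \<longrightarrow> (\<forall>h\<in>A. averaging {1..d} (\<lambda>v. FC v h)) \<longrightarrow>
     (\<forall>p\<in>{1..du}. slope_class (cube_measure {1..d}) I U K \<mu> (fno d A L dims FC \<sigma> a \<theta> p))"
proof -
  have "\<exists>K\<ge>0. \<forall>\<theta> FC. params_bounded A L du dims R P Q \<theta> \<longrightarrow>
     (\<forall>h\<in>A. averaging {1..d} (\<lambda>v. FC v h)) \<longrightarrow> (\<forall>i\<in>{1..dims (Suc L)}.
     slope_class (cube_measure {1..d}) I U K \<mu> (\<lambda>x y. fno_hidden d A dims FC \<sigma> \<theta> L (\<lambda>x'. a x' y) x i))"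
    by (rule hidden_slope_y[OF I A U \<sigma>(1) _ _ P Ba a order_refl]) (rule \<sigma>(2) R; assumption)+
  then obtain K where K: "K \<ge> 0" and H: "\<forall>\<theta> FC. params_bounded A L du dims R P Q \<theta> \<longrightarrow>
     (\<forall>h\<in>A. averaging {1..d} (\<lambda>v. FC v h)) \<longrightarrow> (\<forall>i\<in>{1..dims (Suc L)}.
     slope_class (cube_measure {1..d}) I U K \<mu> (\<lambda>x y. fno_hidden d A dims FC \<sigma> \<theta> L (\<lambda>x'. a x' y) x i))"
    by (elim exE conjE) (rule that)
  note * = H[THEN spec, THEN spec, THEN mp, THEN mp, THEN bspec]
  have "slope_class (cube_measure {1..d}) I U (\<Sum>j=1..dims (L+1). Q * K) \<mu> (fno d A L dims FC \<sigma> a \<theta> p)"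
    if \<theta>: "params_bounded A L du dims R P Q \<theta>" and FC: "\<forall>h\<in>A. averaging {1..d} (\<lambda>v. FC v h)"
      and p: "p \<in> {1..du}" for \<theta> FC p
    unfolding fno_def
  proof (rule slope_class_sum[OF I])
    fix j assume j: "j \<in> {1..dims (L+1)}"
    then have "\<bar>proj_mat \<theta> p j\<bar> \<le> Q" using \<theta> p unfolding params_bounded_def by blast
    then show "slope_class (cube_measure {1..d}) I U (Q * K) \<mu>
       (\<lambda>x y. of_real (proj_mat \<theta> p j) * fno_hidden d A dims FC \<sigma> \<theta> L (\<lambda>x'. a x' y) x j)"
      using j K by (intro slope_class_mono[OF I slope_class_cmult[OF I *[OF \<theta> FC]]])
        (auto intro!: mult_right_mono)
  qed auto
  then show ?thesis using K Q by (intro exI[of _ "\<Sum>j=1..dims (L+1). Q * K"]) auto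
qed

section \<open>Regularity of the network in the spatial variable\<close>

abbreviation (input) "one_point \<equiv> count_space (UNIV :: unit set)"

text \<open>Every derivative multiplies the character by a factor 2 pi i h_j of modulus at most
  \<open>k\<close>, so the character stays a multiple of itself.\<close>

lemma fourier_char_pw_class:
  fixes d :: nat
  shows "\<exists>K\<ge>0. pw_class one_point {1..d} UNIV UNIV K \<mu> (\<lambda>_. fourier_char d h)"
proof -
  define k where "k = 1 + (\<Sum>p=1..d. 2 * pi * \<bar>of_int (h p)\<bar> :: real)"
  have k1: "k \<ge> 1" unfolding k_def by (simp add: sum_nonneg)
  have kp: "2 * pi * \<bar>of_int (h p)\<bar> \<le> k" if "p \<in> {1..d}" for p
  proof -
    have "2 * pi * \<bar>of_int (h p)\<bar> \<le> (\<Sum>p=1..d. 2 * pi * \<bar>of_int (h p)\<bar> :: real)"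
      using that by (intro member_le_sum) auto
    then show ?thesis by (simp add: k_def)
  qed
  \<comment> \<open>The invariant trades spent order against size: the coefficient times
    \<open>k\<close> to the remaining order never exceeds \<open>k\<close> to the full order. The
    summand 1 in \<open>k\<close> ensures \<open>k \<ge> 1\<close>, so the coefficient alone obeys
    the bound.\<close>
  let ?X = "\<lambda>\<nu> g. \<exists>c. g = (\<lambda>(_::unit) x. c * fourier_char d h x) \<and> cmod c * k ^ sum \<nu> {1..d} \<le> k ^ sum \<mu> {1..d}"
  have "pw_class one_point {1..d} UNIV UNIV (k ^ sum \<mu> {1..d}) \<mu> (\<lambda>_. fourier_char d h)"
  proof (rule diff_class_coinduct[where X = ?X])
    show "?X \<mu> (\<lambda>_. fourier_char d h)" by (intro exI[of _ 1]) auto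
    fix \<nu> g assume "?X \<nu> g"
    then obtain c where g: "g = (\<lambda>_ x. c * fourier_char d h x)" and c: "cmod c * k ^ sum \<nu> {1..d} \<le> k ^ sum \<mu> {1..d}"
      by blast
    have "cmod c * 1 \<le> cmod c * k ^ sum \<nu> {1..d}" using k1 by (intro mult_left_mono) auto
    then have "pw_bounded one_point {1..d} UNIV UNIV (k ^ sum \<mu> {1..d}) g"
      using c by (auto simp: pw_bounded_def g norm_mult)
    moreover have "\<exists>f'. pw_deriv one_point {1..d} UNIV j g f' \<and> ?X (\<nu>(j := \<nu> j - 1)) f'"
      if j: "j \<in> {1..d}" "0 < \<nu> j" for j
    proof (intro exI conjI)
      let ?c = "c * (\<i> * of_real (2 * pi * of_int (h j)))"
      show "pw_deriv one_point {1..d} UNIV j g (\<lambda>_ x. ?c * fourier_char d h x)"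
      proof (rule pw_derivI)
        fix x :: point
        define w where "w = (\<Sum>p\<in>{1..d} - {j}. of_int (h p) * x p :: real)"
        have eq: "fourier_char d h (x(j := t)) = cis (2 * pi * (of_int (h j) * t + w))" for t
        proof -
          have "(\<Sum>p=1..d. of_int (h p) * (x(j := t)) p) = of_int (h j) * t + w"
            unfolding w_def by (subst sum.remove[of _ j]) (use j in \<open>auto intro!: sum.cong\<close>)
          then show ?thesis unfolding fourier_char_def by (simp only:)
        qed
        have "((\<lambda>t. cis (2 * pi * (of_int (h j) * t + w))) has_vector_derivative
            (2 * pi * of_int (h j)) *\<^sub>R (\<i> * cis (2 * pi * (of_int (h j) * x j + w)))) (at (x j))"
        proof -
          have "((\<lambda>t. 2 * pi * (of_int (h j) * t + w)) has_derivative (\<lambda>t. t * (2 * pi * of_int (h j)))) (at (x j))"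
            by (auto intro!: derivative_eq_intros simp: algebra_simps)
          from has_derivative_cis[OF this] show ?thesis
            unfolding has_vector_derivative_def scaleR_scaleR .
        qed
        then have "((\<lambda>t. fourier_char d h (x(j := t))) has_vector_derivative
            (2 * pi * of_int (h j)) *\<^sub>R (\<i> * fourier_char d h (x(j := x j)))) (at (x j))"
          unfolding eq .
        from bounded_linear.has_vector_derivative[OF bounded_linear_mult_right[of c] this]
        show "((\<lambda>t. g u (x(j := t))) has_vector_derivative ?c * fourier_char d h x) (at (x j))" for u
          by (simp add: g scaleR_conv_of_real mult_ac)
      qed
      have "cmod ?c * k ^ sum (\<nu>(j := \<nu> j - 1)) {1..d} =
          cmod c * ((2 * pi * \<bar>of_int (h j)\<bar>) * k ^ sum (\<nu>(j := \<nu> j - 1)) {1..d})"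
        by (simp add: norm_mult)
      also have "\<dots> \<le> cmod c * (k * k ^ sum (\<nu>(j := \<nu> j - 1)) {1..d})"
        using k1 kp[OF j(1)] by (intro mult_left_mono mult_right_mono) auto
      also have "\<dots> = cmod c * k ^ sum \<nu> {1..d}"
        using sum_upd_less[of "{1..d}" j \<nu>] j by simp
      finally show "cmod ?c * k ^ sum (\<nu>(j := \<nu> j - 1)) {1..d} \<le> k ^ sum \<mu> {1..d}" using c by simp
    qed (rule refl)
    ultimately show "pw_bounded one_point {1..d} UNIV UNIV (k ^ sum \<mu> {1..d}) g \<and>
      (\<forall>j\<in>{1..d}. 0 < \<nu> j \<longrightarrow> (\<exists>f'. pw_deriv one_point {1..d} UNIV j g f' \<and> ?X (\<nu>(j := \<nu> j - 1)) f'))"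
      by blast
  qed auto
  then show ?thesis using k1 by (intro exI[of _ "k ^ sum \<mu> {1..d}"]) auto
qed

text \<open>A functional that annihilates constants sees only the oscillation: F v = F (v - v(x0)),
  and on the unit cube the slopes bound v - v(x0) by d B. Thus a coefficient is controlled although
  the size of v is not.\<close>

lemma averaging_oscillation:
  assumes F: "averaging {1..d} F" "F (\<lambda>_. 1) = 0"
    and v: "slope_class one_point {1..d} UNIV B \<mu> (\<lambda>_. v)" "\<And>j. j \<in> {1..d} \<Longrightarrow> 0 < \<mu> j" "0 \<le> B"
  shows "cmod (F v) \<le> d * B"
proof -
  have sub: "unit_cube {1..d} \<subseteq> cube_on {1..d} UNIV" by (auto simp: unit_cube_def PiE_def)
  have cont: "continuous_on (unit_cube {1..d}) v"
    using slope_class_continuous[OF _ v(1,2), of "()"] continuous_on_subset[OF _ sub] by simp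
  obtain b where b: "\<And>x. x \<in> unit_cube {1..d} \<Longrightarrow> cmod (v x) \<le> b"
    using bounded_on_cube[OF cont] by blast
  define x0 :: point where "x0 = (\<lambda>j\<in>{1..d}. 0)"
  have x0: "x0 \<in> unit_cube {1..d}" by (auto simp: x0_def unit_cube_def)
  have bv: "cube_bounded {1..d} b v" "cube_bounded {1..d} 1 (\<lambda>_. 1)"
    using borel_measurable_cube[OF cont] b by (auto simp: cube_bounded_def)
  have "F v = F (\<lambda>x. 1 * v x + (- v x0) * 1)"
    using averaging_linear[OF F(1) bv, of 1 "- v x0"] F(2) by simp
  also have "cmod \<dots> \<le> d * B"
  proof (rule averaging_le[OF F(1)], unfold cube_bounded_def, intro conjI ballI)
    show "(\<lambda>x. 1 * v x + - v x0 * 1) \<in> borel_measurable (cube_measure {1..d})"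
      using bv(1) unfolding cube_bounded_def by (intro borel_measurable_add borel_measurable_times borel_measurable_const) blast
  next
    fix x assume x: "x \<in> unit_cube {1..d}"
    have "cmod (v x - v x0) \<le> B * (\<Sum>j\<in>{1..d}. \<bar>x j - x0 j\<bar>)"
      by (rule slope_class_increment_le[OF finite_atLeastAtMost v(1,2) convex_UNIV _ subsetD[OF sub x0] subsetD[OF sub x]]) simp_all
    also have "\<dots> \<le> B * (\<Sum>j\<in>{1..d}. 1)"
      using unit_cubeD[OF x] by (intro mult_left_mono sum_mono v(3)) (auto simp: x0_def)
    finally show "cmod (1 * v x + - v x0 * 1) \<le> d * B" by (simp add: mult.commute)
  qed
  finally show ?thesis .
qed

text \<open>Unlike in the variable y, the derivative now falls on the characters and leaves the
  coefficients in front, so the size of the coefficients matters and slopes alone no longer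
  suffice.\<close>

lemma hidden_slope_x:
  assumes A: "finite A"
    and \<sigma>: "smooth \<sigma>" "\<And>k t. k \<ge> 1 \<Longrightarrow> \<bar>(deriv ^^ k) \<sigma> t\<bar> \<le> b k"
    and R: "\<And>l. l \<ge> 1 \<Longrightarrow> 0 \<le> R l" and P: "0 \<le> P" and Ba: "0 \<le> Ba"
    and \<mu>: "\<And>j. j \<in> {1..d} \<Longrightarrow> 0 < \<mu> j"
    and "l \<le> L"
  shows "\<exists>K\<ge>0. \<forall>\<theta> FC a. params_bounded A L du dims R P Q \<theta> \<longrightarrow> (\<forall>h\<in>A. averaging {1..d} (\<lambda>v. FC v h)) \<longrightarrow>
     (\<forall>h\<in>A. (\<exists>p\<in>{1..d}. h p \<noteq> 0) \<longrightarrow> FC (\<lambda>_. 1) h = 0) \<longrightarrow>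
     slope_class one_point {1..d} UNIV Ba \<mu> (\<lambda>_. a) \<longrightarrow>
     (\<forall>i\<in>{1..dims (Suc l)}. slope_class one_point {1..d} UNIV K \<mu>
        (\<lambda>_ x. fno_hidden d A dims FC \<sigma> \<theta> l a x i))"
  using \<open>l \<le> L\<close>
proof (induction l)
  case 0
  have I: "finite {1..d}" by simp
  have "slope_class one_point {1..d} UNIV (P * Ba) \<mu> (\<lambda>_ x. of_real (lift_mat \<theta> i 1) * a x)"
    if "params_bounded A L du dims R P Q \<theta>" "i \<in> {1..dims (Suc 0)}"
      "slope_class one_point {1..d} UNIV Ba \<mu> (\<lambda>_. a)" for \<theta> i a
    by (rule slope_class_mono[OF I slope_class_cmult[OF I that(3)]])
       (use that(1,2) Ba in \<open>auto simp: params_bounded_def intro!: mult_right_mono\<close>)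
  then show ?case using P Ba unfolding fno_hidden.simps
    by (intro exI[of _ "P * Ba"] conjI allI impI ballI mult_nonneg_nonneg)
next
  case (Suc l)
  have I: "finite {1..d}" by simp
  from Suc have "\<exists>K\<ge>0. \<forall>\<theta> FC a. params_bounded A L du dims R P Q \<theta> \<longrightarrow> (\<forall>h\<in>A. averaging {1..d} (\<lambda>v. FC v h)) \<longrightarrow>
     (\<forall>h\<in>A. (\<exists>p\<in>{1..d}. h p \<noteq> 0) \<longrightarrow> FC (\<lambda>_. 1) h = 0) \<longrightarrow>
     slope_class one_point {1..d} UNIV Ba \<mu> (\<lambda>_. a) \<longrightarrow>
     (\<forall>i\<in>{1..dims (Suc l)}. slope_class one_point {1..d} UNIV K \<mu>
        (\<lambda>_ x. fno_hidden d A dims FC \<sigma> \<theta> l a x i))" by simp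
  then obtain K where K: "K \<ge> 0" and IH: "\<forall>\<theta> FC a. params_bounded A L du dims R P Q \<theta> \<longrightarrow>
     (\<forall>h\<in>A. averaging {1..d} (\<lambda>v. FC v h)) \<longrightarrow>
     (\<forall>h\<in>A. (\<exists>p\<in>{1..d}. h p \<noteq> 0) \<longrightarrow> FC (\<lambda>_. 1) h = 0) \<longrightarrow>
     slope_class one_point {1..d} UNIV Ba \<mu> (\<lambda>_. a) \<longrightarrow>
     (\<forall>i\<in>{1..dims (Suc l)}. slope_class one_point {1..d} UNIV K \<mu>
        (\<lambda>_ x. fno_hidden d A dims FC \<sigma> \<theta> l a x i))"
    by (elim exE conjE) (rule that)
  have "\<forall>h. \<exists>K. 0 \<le> K \<and> pw_class one_point {1..d} UNIV UNIV K \<mu> (\<lambda>_. fourier_char d h)"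
    using fourier_char_pw_class by simp
  then obtain E where "\<forall>h. 0 \<le> E h \<and> pw_class one_point {1..d} UNIV UNIV (E h) \<mu> (\<lambda>_. fourier_char d h)"
    by (rule choice[THEN exE])
  then have E: "0 \<le> E h" "pw_class one_point {1..d} UNIV UNIV (E h) \<mu> (\<lambda>_. fourier_char d h)" for h
    by simp_all
  \<comment> \<open>A coefficient at a nonzero frequency is at most \<open>d * K\<close> by the
    oscillation bound, and the derivatives of its character are at most \<open>E h\<close>.\<close>
  define c where "c = (\<Sum>h\<in>A. d * E h)"
  have c: "0 \<le> c" unfolding c_def by (intro sum_nonneg mult_nonneg_nonneg E) simp
  have ch: "d * E h \<le> c" if "h \<in> A" for h
    unfolding c_def by (rule member_le_sum) (use that A E in auto)
  let ?n = "dims (Suc l)" and ?R = "R (Suc l)"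
  define K1 where "K1 = ?n * (?R * K) + card A * (?n * (?R * (c * K)))"
  have K1: "0 \<le> K1" using K R[of "Suc l"] c by (auto simp: K1_def)
  define K2 where "K2 = 2 * (2 ^ sum \<mu> {1..d} * (comp_bound b K1 (sum \<mu> {1..d}) 1 * K1))"
  have "\<forall>k\<ge>1. 0 \<le> b k" using \<sigma>(2) abs_ge_zero order_trans by blast
  then have "0 \<le> K2" using K1 by (auto simp: K2_def intro!: mult_nonneg_nonneg comp_bound_nonneg)
  moreover have "slope_class one_point {1..d} UNIV K2 \<mu> (\<lambda>_ x. fno_hidden d A dims FC \<sigma> \<theta> (Suc l) a x i)"
    if \<theta>: "params_bounded A L du dims R P Q \<theta>" and FC: "\<forall>h\<in>A. averaging {1..d} (\<lambda>v. FC v h)"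
      and FC1: "\<forall>h\<in>A. (\<exists>p\<in>{1..d}. h p \<noteq> 0) \<longrightarrow> FC (\<lambda>_. 1) h = 0"
      and a: "slope_class one_point {1..d} UNIV Ba \<mu> (\<lambda>_. a)"
      and i: "i \<in> {1..dims (Suc (Suc l))}" for \<theta> FC a i
  proof -
    define v where "v j = (\<lambda>x. fno_hidden d A dims FC \<sigma> \<theta> l a x j)" for j
    have v: "slope_class one_point {1..d} UNIV K \<mu> (\<lambda>_. v j)" if "j \<in> {1..?n}" for j
      unfolding v_def
      by (rule IH[THEN spec, THEN spec, THEN spec, THEN mp, THEN mp, THEN mp, THEN mp, THEN bspec, OF \<theta> FC FC1 a that])
    have q: "slope_class one_point {1..d} UNIV (c * K) \<mu> (\<lambda>_ x. FC (v j) h * fourier_char d h x)"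
      if j: "j \<in> {1..?n}" and h: "h \<in> A" for j h
    proof (cases "\<exists>p\<in>{1..d}. h p \<noteq> 0")
      case True
      have "cmod (FC (v j) h) \<le> d * K"
        by (rule averaging_oscillation[OF _ _ v[OF j] \<mu> K]) (use FC FC1 h True in blast)+
      then have "cmod (FC (v j) h) * E h \<le> (d * K) * E h" by (rule mult_right_mono[OF _ E(1)])
      also have "\<dots> = (d * E h) * K" by (simp only: mult_ac)
      also have "\<dots> \<le> c * K" by (rule mult_right_mono[OF ch[OF h] K])
      finally show ?thesis
        by (rule slope_class_mono[OF I slope_class_cmult[OF I pw_class_slope[OF E(2)]]])
    next
      case False
      \<comment> \<open>At frequency zero the character is constant, so this term has no slope
        however large its coefficient is.\<close>
      then have "fourier_char d h = (\<lambda>x. 1)" unfolding fourier_char_def by (intro ext) simp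
      then show ?thesis using slope_class_const[OF I mult_nonneg_nonneg[OF c K]] by simp
    qed
    have Wk: "\<bar>weight \<theta> (Suc l) i j\<bar> \<le> ?R" "\<And>h. h \<in> A \<Longrightarrow> cmod (kernel_coeff \<theta> (Suc l) h i j) \<le> ?R"
      if "j \<in> {1..?n}" for j
      using \<theta> i that Suc.prems unfolding params_bounded_def by force+
    have "slope_class one_point {1..d} UNIV K1 \<mu> (\<lambda>_ x. (\<Sum>j=1..?n. of_real (weight \<theta> (Suc l) i j) * v j x) +
        (\<Sum>h\<in>A. (\<Sum>j=1..?n. kernel_coeff \<theta> (Suc l) h i j * FC (v j) h) * fourier_char d h x) +
        of_real (bias \<theta> (Suc l) i))"
      unfolding K1_def by (rule slope_class_layer[OF I A K c]) (rule v q Wk; assumption)+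
    then have "slope_class one_point {1..d} UNIV K1 \<mu>
      (\<lambda>_ x. fno_layer d A dims FC \<theta> (Suc l) (fno_hidden d A dims FC \<sigma> \<theta> l a) x i)"
      unfolding fno_layer_def v_def .
    from slope_class_act[OF I \<sigma> K1 this]
    show ?thesis unfolding K2_def fno_hidden.simps .
  qed
  ultimately show ?case by (intro exI[of _ K2] conjI allI impI ballI)
qed

lemma fno_slope_x:
  assumes A: "finite A"
    and \<sigma>: "smooth \<sigma>" "\<And>k t. k \<ge> 1 \<Longrightarrow> \<bar>(deriv ^^ k) \<sigma> t\<bar> \<le> b k"
    and R: "\<And>l. l \<ge> 1 \<Longrightarrow> 0 \<le> R l" and P: "0 \<le> P" and Ba: "0 \<le> Ba" and Q: "0 \<le> Q"
    and \<mu>: "\<And>j. j \<in> {1..d} \<Longrightarrow> 0 < \<mu> j"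
  shows "\<exists>K\<ge>0. \<forall>\<theta> FC a y. params_bounded A L du dims R P Q \<theta> \<longrightarrow> (\<forall>h\<in>A. averaging {1..d} (\<lambda>v. FC v h)) \<longrightarrow>
     (\<forall>h\<in>A. (\<exists>p\<in>{1..d}. h p \<noteq> 0) \<longrightarrow> FC (\<lambda>_. 1) h = 0) \<longrightarrow>
     slope_class one_point {1..d} UNIV Ba \<mu> (\<lambda>_ x. a x y) \<longrightarrow>
     (\<forall>p\<in>{1..du}. slope_class one_point {1..d} UNIV K \<mu> (\<lambda>_ x. fno d A L dims FC \<sigma> a \<theta> p x y))"
proof -
  have I: "finite {1..d}" by simp
  have "\<exists>K\<ge>0. \<forall>\<theta> FC a. params_bounded A L du dims R P Q \<theta> \<longrightarrow> (\<forall>h\<in>A. averaging {1..d} (\<lambda>v. FC v h)) \<longrightarrow>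
     (\<forall>h\<in>A. (\<exists>p\<in>{1..d}. h p \<noteq> 0) \<longrightarrow> FC (\<lambda>_. 1) h = 0) \<longrightarrow>
     slope_class one_point {1..d} UNIV Ba \<mu> (\<lambda>_. a) \<longrightarrow>
     (\<forall>i\<in>{1..dims (Suc L)}. slope_class one_point {1..d} UNIV K \<mu>
        (\<lambda>_ x. fno_hidden d A dims FC \<sigma> \<theta> L a x i))"
    by (rule hidden_slope_x[OF A \<sigma>(1) _ _ P Ba _ order_refl]) (rule \<sigma>(2) R \<mu>; assumption)+
  then obtain K where K: "K \<ge> 0" and H: "\<forall>\<theta> FC a. params_bounded A L du dims R P Q \<theta> \<longrightarrow>
     (\<forall>h\<in>A. averaging {1..d} (\<lambda>v. FC v h)) \<longrightarrow>
     (\<forall>h\<in>A. (\<exists>p\<in>{1..d}. h p \<noteq> 0) \<longrightarrow> FC (\<lambda>_. 1) h = 0) \<longrightarrow>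
     slope_class one_point {1..d} UNIV Ba \<mu> (\<lambda>_. a) \<longrightarrow>
     (\<forall>i\<in>{1..dims (Suc L)}. slope_class one_point {1..d} UNIV K \<mu>
        (\<lambda>_ x. fno_hidden d A dims FC \<sigma> \<theta> L a x i))"
    by (elim exE conjE) (rule that)
  note * = H[THEN spec, THEN spec, THEN spec, THEN mp, THEN mp, THEN mp, THEN mp, THEN bspec]
  have "slope_class one_point {1..d} UNIV (\<Sum>j=1..dims (L+1). Q * K) \<mu> (\<lambda>_ x. fno d A L dims FC \<sigma> a \<theta> p x y)"
    if \<theta>: "params_bounded A L du dims R P Q \<theta>" and FC: "\<forall>h\<in>A. averaging {1..d} (\<lambda>v. FC v h)"
      and FC1: "\<forall>h\<in>A. (\<exists>p\<in>{1..d}. h p \<noteq> 0) \<longrightarrow> FC (\<lambda>_. 1) h = 0"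
      and a: "slope_class one_point {1..d} UNIV Ba \<mu> (\<lambda>_ x. a x y)"
      and p: "p \<in> {1..du}" for \<theta> FC a y p
    unfolding fno_def
  proof (rule slope_class_sum[OF I])
    fix j assume j: "j \<in> {1..dims (L+1)}"
    then have "\<bar>proj_mat \<theta> p j\<bar> \<le> Q" using \<theta> p unfolding params_bounded_def by blast
    then show "slope_class one_point {1..d} UNIV (Q * K) \<mu>
       (\<lambda>_ x. of_real (proj_mat \<theta> p j) * fno_hidden d A dims FC \<sigma> \<theta> L (\<lambda>x'. a x' y) x j)"
      using j K by (intro slope_class_mono[OF I slope_class_cmult[OF I *[OF \<theta> FC FC1 a]]])
        (auto intro!: mult_right_mono)
  qed auto
  then show ?thesis using K Q
    by (intro exI[of _ "\<Sum>j=1..dims (L+1). Q * K"] conjI allI impI ballI sum_nonneg mult_nonneg_nonneg)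
qed

declare One_nat_def [simp del]

subsection \<open>Fourier coefficients\<close>

lemma cube_bounded_nonneg: "cube_bounded D B v \<Longrightarrow> 0 \<le> B"
proof -
  assume *: "cube_bounded D B v"
  have "(\<lambda>j\<in>D. 0) \<in> unit_cube D" by (auto simp: unit_cube_def)
  then have "cmod (v (\<lambda>j\<in>D. 0)) \<le> B" using * by (auto simp: cube_bounded_def)
  then show ?thesis using norm_ge_zero order_trans by blast
qed

text \<open>Everything rests on the character having modulus 1 and the cube measure 1: the
  functional is dominated by the sup of v, and bounded convergence passes to the integral.\<close>

lemma averaging_fourier_coeff: "averaging {1..d} (\<lambda>v. fourier_coeff d v h)"
  unfolding averaging_def fourier_coeff_def
proof (intro conjI allI impI)
  let ?M = "cube_measure {1..d}" and ?e = "fourier_char d (\<lambda>p. - h p)"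
  have int: "integrable ?M (\<lambda>x. v x * ?e x)" if "cube_bounded {1..d} B v" for v B
    by (rule integrable_cube_bounded[of _ _ B])
       (use that in \<open>auto simp: cube_bounded_def norm_mult intro!: borel_measurable_times fourier_char_measurable\<close>)
  fix u v a b B C assume "cube_bounded {1..d} B u" "cube_bounded {1..d} C v"
  then have "integrable ?M (\<lambda>x. u x * ?e x)" "integrable ?M (\<lambda>x. v x * ?e x)" using int by blast+
  moreover have "(a * u x + b * v x) * ?e x = a * (u x * ?e x) + b * (v x * ?e x)" for x
    by (simp add: algebra_simps)
  ultimately show "(LINT x|?M. (a * u x + b * v x) * ?e x) = a * (LINT x|?M. u x * ?e x) + b * (LINT x|?M. v x * ?e x)"
    by simp
next
  fix v B assume v: "cube_bounded {1..d} B v"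
  then show "cmod (LINT x|cube_measure {1..d}. v x * fourier_char d (\<lambda>p. - h p) x) \<le> B"
    by (intro norm_integral_cube_le cube_bounded_nonneg[OF v]) (auto simp: cube_bounded_def norm_mult)
next
  let ?M = "cube_measure {1..d}" and ?e = "fourier_char d (\<lambda>p. - h p)"
  fix V :: "nat \<Rightarrow> point \<Rightarrow> complex" and v B
  assume V: "\<forall>n. cube_bounded {1..d} B (V n)" "\<forall>x\<in>unit_cube {1..d}. (\<lambda>n. V n x) \<longlonglongrightarrow> v x"
  have vm: "v \<in> borel_measurable ?M"
    by (rule borel_measurable_LIMSEQ_metric[of V]) (use V in \<open>auto simp: cube_bounded_def\<close>)
  show "(\<lambda>n. LINT x|?M. V n x * ?e x) \<longlonglongrightarrow> (LINT x|?M. v x * ?e x)"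
  proof (rule integral_dominated_convergence[where w = "\<lambda>_. B"])
    show "integrable ?M (\<lambda>_. B)" by (rule integrable_cube_bounded[of _ _ "\<bar>B\<bar>"]) auto
    show "AE x in ?M. (\<lambda>n. V n x * ?e x) \<longlonglongrightarrow> v x * ?e x"
      using V(2) by (intro AE_I2 tendsto_mult tendsto_const) simp
    show "AE x in ?M. norm (V n x * ?e x) \<le> B" for n
      using V(1) by (intro AE_I2) (simp add: norm_mult cube_bounded_def)
    show "(\<lambda>x. v x * ?e x) \<in> borel_measurable ?M"
      by (intro borel_measurable_times vm fourier_char_measurable)
    show "(\<lambda>x. V n x * ?e x) \<in> borel_measurable ?M" for n
      using V(1) by (intro borel_measurable_times fourier_char_measurable) (simp add: cube_bounded_def)
  qed
qed

lemma averaging_fourier_coeff_app: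
  assumes "m \<ge> 1" "\<And>k. k \<in> {1..m} \<Longrightarrow> xs k \<in> unit_cube {1..d}"
  shows "averaging {1..d} (\<lambda>v. fourier_coeff_app d m xs v h)"
  unfolding averaging_def fourier_coeff_app_def
proof (intro conjI allI impI)
  fix u v :: "point \<Rightarrow> complex" and a b :: complex
  let ?e = "fourier_char d (\<lambda>p. - h p)"
  have "(\<Sum>k=1..m. (a * u (xs k) + b * v (xs k)) * ?e (xs k)) =
      a * (\<Sum>k=1..m. u (xs k) * ?e (xs k)) + b * (\<Sum>k=1..m. v (xs k) * ?e (xs k))"
    by (simp add: sum_distrib_left sum.distrib[symmetric] algebra_simps)
  then show "(\<Sum>k=1..m. (a * u (xs k) + b * v (xs k)) * ?e (xs k)) / of_nat m =
      a * ((\<Sum>k=1..m. u (xs k) * ?e (xs k)) / of_nat m) + b * ((\<Sum>k=1..m. v (xs k) * ?e (xs k)) / of_nat m)"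
    by (simp add: add_divide_distrib)
next
  fix v B assume v: "cube_bounded {1..d} B v"
  have "cmod (\<Sum>k=1..m. v (xs k) * fourier_char d (\<lambda>p. - h p) (xs k)) \<le> (\<Sum>k=1..m. B)"
    by (rule sum_norm_le) (use v assms(2) in \<open>auto simp: cube_bounded_def norm_mult\<close>)
  then show "cmod ((\<Sum>k=1..m. v (xs k) * fourier_char d (\<lambda>p. - h p) (xs k)) / of_nat m) \<le> B"
    using assms(1) by (simp add: norm_divide divide_le_eq mult.commute)
next
  fix V :: "nat \<Rightarrow> point \<Rightarrow> complex" and v B
  assume V: "\<forall>n. cube_bounded {1..d} B (V n)" "\<forall>x\<in>unit_cube {1..d}. (\<lambda>n. V n x) \<longlonglongrightarrow> v x"
  show "(\<lambda>n. (\<Sum>k=1..m. V n (xs k) * fourier_char d (\<lambda>p. - h p) (xs k)) / of_nat m)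
      \<longlonglongrightarrow> (\<Sum>k=1..m. v (xs k) * fourier_char d (\<lambda>p. - h p) (xs k)) / of_nat m"
    by (intro tendsto_divide tendsto_sum tendsto_mult tendsto_const bspec[OF V(2)] assms(2)) (use assms(1) in auto)
qed

lemma integral_unit_FTC:
  fixes f :: "real \<Rightarrow> 'a::euclidean_space"
  assumes "\<And>t. 0 \<le> t \<Longrightarrow> t \<le> 1 \<Longrightarrow> (F has_vector_derivative f t) (at t within {0..1})" "continuous_on {0..1} f"
  shows "(LINT t|unit_meas. f t) = F 1 - F 0"
  using integral_FTC_atLeastAtMost[of 0 1 F f] assms
  by (subst integral_restrict_space) auto

lemma integral_cis_zero:
  assumes "k \<noteq> 0"
  shows "(LINT t|unit_meas. cis (2 * pi * (of_int k * t))) = 0"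
proof -
  define c where "c = 2 * pi * real_of_int k"
  have c: "c \<noteq> 0" using assms by (simp add: c_def)
  define a where "a = \<i> * complex_of_real c"
  have a: "a \<noteq> 0" using c by (simp add: a_def)
  have "((\<lambda>t. inverse a * cis (c * t)) has_vector_derivative cis (c * t)) (at t within {0..1})" for t
  proof -
    have "((\<lambda>t. c * t) has_derivative (\<lambda>t. t * c)) (at t within {0..1})"
      by (auto intro!: derivative_eq_intros)
    from has_derivative_cis[OF this]
    have "((\<lambda>t. cis (c * t)) has_vector_derivative c *\<^sub>R (\<i> * cis (c * t))) (at t within {0..1})"
      by (simp only: has_vector_derivative_def scaleR_scaleR)
    from bounded_linear.has_vector_derivative[OF bounded_linear_mult_right[of "inverse a"] this]
    have "((\<lambda>t. inverse a * cis (c * t)) has_vector_derivative inverse a * (c *\<^sub>R (\<i> * cis (c * t)))) (at t within {0..1})" .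
    also have "c *\<^sub>R (\<i> * cis (c * t)) = a * cis (c * t)"
      by (simp add: a_def scaleR_conv_of_real mult_ac)
    also have "inverse a * (a * cis (c * t)) = cis (c * t)"
      using a by (simp only: mult.assoc[symmetric] left_inverse mult_1_left not_False_eq_True)
    finally show ?thesis .
  qed
  moreover have "continuous_on {0..1} (\<lambda>t. cis (c * t))" by (intro continuous_intros)
  ultimately have "(LINT t|unit_meas. cis (c * t)) = inverse a * cis (c * 1) - inverse a * cis (c * 0)"
    by (intro integral_unit_FTC)
  also have "cis (c * 1) = 1" unfolding c_def mult_1_right by (rule cis_multiple_2pi) simp
  finally show ?thesis by (simp add: c_def mult.assoc)
qed

lemma cis_sum: "finite S \<Longrightarrow> cis (\<Sum>p\<in>S. f p) = (\<Prod>p\<in>S. cis (f p))"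
  by (induction S rule: finite_induct) (auto simp: cis_mult[symmetric])

lemma fourier_char_prod: "fourier_char d h x = (\<Prod>p=1..d. cis (2 * pi * (of_int (h p) * x p)))"
  by (simp add: fourier_char_def sum_distrib_left cis_sum)

lemma integral_fourier_char_zero:
  assumes "p \<in> {1..d}" "h p \<noteq> 0"
  shows "(LINT x|cube_measure {1..d}. fourier_char d h x) = 0"
proof -
  have m: "integrable unit_meas (\<lambda>t. cis (2 * pi * (of_int (h p) * t)))" for p
    by (rule unit_meas.integrable_const_bound[of _ 1])
       (auto intro!: measurable_restrict_space1 borel_measurable_continuous_onI continuous_intros)
  have "(LINT x|cube_measure {1..d}. fourier_char d h x) =
      (\<Prod>p=1..d. LINT t|unit_meas. cis (2 * pi * (of_int (h p) * t)))"
    unfolding fourier_char_prod cube_measure_def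
    by (rule cube.product_integral_prod) (use m in auto)
  also have "\<dots> = 0" using assms integral_cis_zero by (intro prod_zero bexI[of _ p]) auto
  finally show ?thesis .
qed

lemma fourier_coeff_one: "p \<in> {1..d} \<Longrightarrow> h p \<noteq> 0 \<Longrightarrow> fourier_coeff d (\<lambda>_. 1) h = 0"
  using integral_fourier_char_zero[of p d "\<lambda>p. - h p"] by (simp add: fourier_coeff_def)

lemma lattice_point_in_cube: "lattice_point I N z \<Delta> k \<in> unit_cube I"
  by (auto simp: lattice_point_def unit_cube_def less_imp_le[OF frac_lt_1])

text \<open>The character sum over a lattice is that of the powers of an \<open>m\<close>-th root of unity.\<close>

lemma fourier_char_lattice_sum:
  assumes "m \<ge> 1"
  shows "(\<Sum>k=1..m. fourier_char d h (lattice_point {1..d} m z (\<lambda>_. 0) k)) / of_nat m \<in> {0, 1}"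
proof -
  define w where "w = (\<Sum>p=1..d. of_int (h p) * of_int (z p) :: real) / m"
  define \<zeta> where "\<zeta> = cis (2 * pi * w)"
  have e: "fourier_char d h (lattice_point {1..d} m z (\<lambda>_. 0) k) = \<zeta> ^ k" for k
  proof -
    \<comment> \<open>The integer parts removed by \<open>frac\<close> change the phase only by an
      integer multiple of 2 pi.\<close>
    define N where "N = (\<Sum>p=1..d. of_int (h p) * of_int \<lfloor>real k * of_int (z p) / m\<rfloor> :: real)"
    have N: "N \<in> \<int>" unfolding N_def by auto
    have "(\<Sum>p=1..d. of_int (h p) * lattice_point {1..d} m z (\<lambda>_. 0) k p) =
        (\<Sum>p=1..d. of_int (h p) * (real k * of_int (z p) / m)) - N"
      unfolding N_def sum_subtractf[symmetric]
      by (intro sum.cong refl) (simp add: lattice_point_def frac_def right_diff_distrib)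
    also have "(\<Sum>p=1..d. of_int (h p) * (real k * of_int (z p) / m)) = k * w"
      by (simp add: w_def sum_distrib_left sum_divide_distrib mult_ac)
    finally have "fourier_char d h (lattice_point {1..d} m z (\<lambda>_. 0) k) = cis (2 * pi * (k * w) - 2 * pi * N)"
      by (simp add: fourier_char_def right_diff_distrib)
    also have "\<dots> = cis (k * (2 * pi * w)) / cis (2 * pi * N)"
      by (simp add: cis_divide mult_ac)
    also have "\<dots> = cis (k * (2 * pi * w))" using cis_multiple_2pi[OF N] by simp
    also have "\<dots> = \<zeta> ^ k" unfolding \<zeta>_def by (rule Complex.DeMoivre[symmetric])
    finally show ?thesis .
  qed
  have "\<zeta> ^ m = cis (2 * pi * (\<Sum>p=1..d. of_int (h p) * of_int (z p)))"
    using assms by (simp add: \<zeta>_def Complex.DeMoivre w_def)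
  also have "\<dots> = 1" by (rule cis_multiple_2pi) auto
  finally have \<zeta>m: "\<zeta> ^ m = 1" .
  show ?thesis
  proof (cases "\<zeta> = 1")
    case True
    then show ?thesis using assms unfolding e by simp
  next
    case False
    \<comment> \<open>The geometric sum runs from 1 to m and telescopes to \<zeta> - \<zeta>^(m+1),
      which vanishes for an m-th root of unity.\<close>
    have "(1 - \<zeta>) * (\<Sum>k=1..m. \<zeta> ^ k) = \<zeta> ^ 1 - \<zeta> ^ Suc m" by (rule sum_gp_multiplied[OF assms])
    also have "\<dots> = 0" using \<zeta>m by simp
    finally show ?thesis using False unfolding e by simp
  qed
qed

subsection \<open>Input fields\<close>

lemma slope_class_coordinate:
  assumes "finite I" "j \<in> I"
  shows "slope_class M I U 1 \<mu> (\<lambda>x y. of_real (y j))"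
  unfolding slope_class_def
proof (intro conjI ballI impI)
  fix i assume i: "i \<in> I" "0 < \<mu> i"
  have "pw_deriv M I U i (\<lambda>x y. of_real (y j)) (\<lambda>_ _. if i = j then 1 else 0)"
  proof (rule pw_derivI)
    fix y :: point
    show "((\<lambda>t. of_real ((y(i := t)) j)) has_vector_derivative (if i = j then 1 else 0 :: complex)) (at (y i) within U)"
    proof (cases "i = j")
      case True
      have "((\<lambda>t. t) has_field_derivative 1) (at (y i) within U)" by (rule DERIV_ident)
      from has_vector_derivative_of_real[OF this] show ?thesis using True by simp
    qed auto
  qed
  then show "\<exists>H'. pw_deriv M I U i (\<lambda>x y. of_real (y j)) H' \<and> pw_class M I U U 1 (\<mu>(i := \<mu> i - 1)) H'"
    using pw_class_const[OF assms(1), of "if i = j then 1 else 0" 1 M U U "\<mu>(i := \<mu> i - 1)"] by auto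
qed auto

lemma basis_fun_eq:
  assumes "j \<noteq> 0"
  shows "basis_fun d \<eta> r h j = (\<lambda>x. (if odd j then 1 else \<i>) * of_real \<eta> / of_real (r (h ((j + 1) div 2))) *
           fourier_char d (h ((j + 1) div 2)) x)"
  using assms by (auto simp: basis_fun_def Let_def)

lemma smooth_sin_2pi: "smooth (\<lambda>t. sin (2 * pi * t))"
  using smooth_sin_affine[of "2 * pi" 0] by simp

text \<open>Both fields have this form, with \<phi>(t) = t - 1/2 and \<phi>(t) = sin(2 pi t). The
  coordinate function is smooth with slope 1, so the composition lemma applies to it.\<close>

lemma field_slope_y:
  fixes \<phi> :: "real \<Rightarrow> real"
  assumes "smooth \<phi>" "\<And>k t. k \<ge> 1 \<Longrightarrow> \<bar>(deriv ^^ k) \<phi> t\<bar> \<le> b k"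
  shows "\<exists>B\<ge>0. slope_class (cube_measure {1..d}) {1..s} U B \<mu>
    (\<lambda>x y. basis_fun d \<eta> r h 0 x + (\<Sum>j=1..s. of_real (\<phi> (y j)) * basis_fun d \<eta> r h j x))"
proof -
  have I: "finite {1..s}" by simp
  let ?M = "cube_measure {1..d}"
  let ?c = "\<lambda>j. (if odd j then 1 else \<i>) * of_real \<eta> / of_real (r (h ((j + 1) div 2))) :: complex"
  define B where "B = 2 ^ sum \<mu> {1..s} * (comp_bound b 1 (sum \<mu> {1..s}) 1 * 1)"
  have nn: "\<forall>k\<ge>1. 0 \<le> b k" using assms(2) abs_ge_zero order_trans by blast
  have B: "0 \<le> B" unfolding B_def
    by (intro mult_nonneg_nonneg comp_bound_nonneg nn) auto
  have "slope_class ?M {1..s} U (cmod (?c j) * B) \<mu> (\<lambda>x y. of_real (\<phi> (y j)) * basis_fun d \<eta> r h j x)"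
    if j: "j \<in> {1..s}" for j
  proof -
    have "slope_class ?M {1..s} U B \<mu> (\<lambda>x y. of_real (\<phi> (Re (of_real (y j)))))"
      unfolding B_def by (rule slope_class_compose[OF I assms _ slope_class_coordinate[OF I j]]) auto
    then have "slope_class ?M {1..s} U B \<mu> (\<lambda>x y. of_real (\<phi> (y j)))" by simp
    from slope_class_cmult[OF I slope_class_times_parameter[OF I this fourier_char_measurable[of d "h ((j + 1) div 2)"]], of "?c j"]
    show ?thesis using j by (simp add: basis_fun_eq mult_ac)
  qed
  from slope_class_sum[OF I I this]
  have 1: "slope_class ?M {1..s} U (\<Sum>j=1..s. cmod (?c j) * B) \<mu> (\<lambda>x y. \<Sum>j=1..s. of_real (\<phi> (y j)) * basis_fun d \<eta> r h j x)" .
  have "slope_class ?M {1..s} U 0 \<mu> (\<lambda>x y. basis_fun d \<eta> r h 0 x)"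
    using slope_class_const[OF I order_refl, of ?M U \<mu> 1] by (simp add: basis_fun_def)
  from slope_class_add[OF I this 1]
  show ?thesis by (intro exI conjI) (auto intro!: sum_nonneg mult_nonneg_nonneg B)
qed

text \<open>For fixed y only the size of the coefficients of the basis functions matters; both
  fields have coefficients of modulus at most 1 on the parameter cube, which makes the bound uniform
  in y.\<close>

lemma field_slope_x:
  fixes d :: nat
  shows "\<exists>B\<ge>0. \<forall>c :: nat \<Rightarrow> real. (\<forall>j\<in>{1..s}. \<bar>c j\<bar> \<le> 1) \<longrightarrow>
    slope_class one_point {1..d} UNIV B \<mu>
      (\<lambda>_ x. basis_fun d \<eta> r h 0 x + (\<Sum>j=1..s. of_real (c j) * basis_fun d \<eta> r h j x))"
proof -
  have I: "finite {1..d}" by simp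
  let ?k = "\<lambda>j. (if odd j then 1 else \<i>) * of_real \<eta> / of_real (r (h ((j + 1) div 2))) :: complex"
  have "\<forall>h. \<exists>K. 0 \<le> K \<and> pw_class one_point {1..d} UNIV UNIV K \<mu> (\<lambda>_. fourier_char d h)"
    using fourier_char_pw_class by simp
  then obtain E where "\<forall>h. 0 \<le> E h \<and> pw_class one_point {1..d} UNIV UNIV (E h) \<mu> (\<lambda>_. fourier_char d h)"
    by (rule choice[THEN exE])
  then have E: "0 \<le> E h" "pw_class one_point {1..d} UNIV UNIV (E h) \<mu> (\<lambda>_. fourier_char d h)" for h
    by simp_all
  let ?B = "\<lambda>j. cmod (?k j) * E (h ((j + 1) div 2))"
  have "slope_class one_point {1..d} UNIV (0 + (\<Sum>j=1..s. ?B j)) \<mu>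
      (\<lambda>_ x. basis_fun d \<eta> r h 0 x + (\<Sum>j=1..s. of_real (c j) * basis_fun d \<eta> r h j x))"
    if c: "\<forall>j\<in>{1..s}. \<bar>c j\<bar> \<le> 1" for c
  proof (rule slope_class_add[OF I])
    show "slope_class one_point {1..d} UNIV 0 \<mu> (\<lambda>_ x. basis_fun d \<eta> r h 0 x)"
      using slope_class_const[OF I order_refl, of one_point UNIV \<mu> 1] by (simp add: basis_fun_def)
    show "slope_class one_point {1..d} UNIV (\<Sum>j=1..s. ?B j) \<mu> (\<lambda>_ x. \<Sum>j=1..s. of_real (c j) * basis_fun d \<eta> r h j x)"
    proof (rule slope_class_sum[OF I])
      fix j assume j: "j \<in> {1..s}"
      have "slope_class one_point {1..d} UNIV (?B j) \<mu> (\<lambda>_ x. basis_fun d \<eta> r h j x)"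
        using slope_class_cmult[OF I pw_class_slope[OF E(2)], of "?k j" "h ((j + 1) div 2)"] j
        by (simp add: basis_fun_eq)
      from slope_class_cmult[OF I this, of "of_real (c j)"]
      show "slope_class one_point {1..d} UNIV (?B j) \<mu> (\<lambda>_ x. of_real (c j) * basis_fun d \<eta> r h j x)"
        by (rule slope_class_mono[OF I]) (use c j E(1) in \<open>auto intro!: mult_left_le_one_le\<close>)
    qed simp
  qed
  then show ?thesis
    by (intro exI[of _ "0 + (\<Sum>j=1..s. ?B j)"] conjI allI impI add_nonneg_nonneg sum_nonneg
          mult_nonneg_nonneg E norm_ge_zero order_refl)
qed

subsection \<open>Uniqueness of weak derivatives\<close>

text \<open>Within [0,1] positive exactly on the interval (a, b). The product of two sines does the
  same on the torus: each factor changes sign under a shift by 1, the product does not.\<close>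

definition bump_arg :: "bool \<Rightarrow> real \<Rightarrow> real \<Rightarrow> real \<Rightarrow> real" where
  "bump_arg per a b t = (if per then sin (pi * (t - a)) * sin (pi * (b - t)) else (t - a) * (b - t))"

text \<open>The scaling by k + 1 drives exp(-1/x) to 1 wherever the argument is positive, so these
  functions approach an indicator from below.\<close>

definition bump :: "bool \<Rightarrow> real \<Rightarrow> real \<Rightarrow> nat \<Rightarrow> real \<Rightarrow> real" where
  "bump per a b k t = flat 1 (real (Suc k) * bump_arg per a b t)"

lemma bump_arg_pos_iff:
  assumes "0 < a" "a < b" "b < 1" "0 \<le> t" "t \<le> 1"
  shows "bump_arg per a b t > 0 \<longleftrightarrow> a < t \<and> t < b"
proof -
  have sin_pos: "sin (pi * x) > 0 \<longleftrightarrow> x > 0" and sin_neg: "sin (pi * x) < 0 \<longleftrightarrow> x < 0"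
    if "-1 < x" "x < 1" for x
  proof -
    have p: "sin (pi * x) > 0" if "0 < x" "x < 1" for x
      using that by (intro sin_gt_zero) auto
    have n: "sin (pi * x) < 0" if "x < 0" "-1 < x" for x
      using p[of "-x"] that by simp
    show "sin (pi * x) > 0 \<longleftrightarrow> x > 0" "sin (pi * x) < 0 \<longleftrightarrow> x < 0"
      using p[of x] n[of x] that by (cases "x = 0"; force)+
  qed
  show ?thesis
  proof (cases per)
    case True
    have "bump_arg per a b t > 0 \<longleftrightarrow> (t - a > 0 \<and> b - t > 0) \<or> (t - a < 0 \<and> b - t < 0)"
      using True assms sin_pos[of "t - a"] sin_neg[of "t - a"] sin_pos[of "b - t"] sin_neg[of "b - t"]
      by (simp add: bump_arg_def zero_less_mult_iff)
    then show ?thesis using assms by auto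
  next
    case False
    then show ?thesis using assms by (auto simp: bump_arg_def zero_less_mult_iff)
  qed
qed

lemma smooth_bump: "smooth (bump per a b k)"
proof -
  have "smooth (bump_arg per a b)"
  proof (cases per)
    case True
    have "bump_arg per a b = (\<lambda>t. sin (pi * t + (- (pi * a))) * sin ((- pi) * t + pi * b))"
      using True by (auto simp: bump_arg_def algebra_simps)
    then show ?thesis by (simp only: smooth_mult smooth_sin_affine)
  next
    case False
    have "bump_arg per a b = (\<lambda>t. (1 * t + (- a)) * ((- 1) * t + b))"
      using False by (auto simp: bump_arg_def algebra_simps)
    then show ?thesis by (simp only: smooth_mult smooth_affine)
  qed
  then have "smooth (\<lambda>t. real (Suc k) * bump_arg per a b t)"
    by (intro smooth_mult smooth_const)
  from smooth_compose[OF smooth_flat this] show ?thesis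
    unfolding bump_def by simp
qed

lemma test_fun_bump:
  assumes "0 < a" "a < b" "b < 1"
  shows "test_fun per (bump per a b k)"
proof (cases per)
  case True
  have "sin (pi * (t + 1 - a)) = - sin (pi * (t - a))" "sin (pi * (b - (t + 1))) = - sin (pi * (b - t))" for t
    using sin_periodic_pi[of "pi * (t - a)"] sin_periodic_pi[of "pi * (b - (t + 1))"]
    by (simp_all add: algebra_simps)
  then have "bump per a b k (t + 1) = bump per a b k t" for t
    using True by (simp add: bump_def bump_arg_def)
  then show ?thesis using True smooth_bump by (auto simp: test_fun_def)
next
  case False
  have "bump per a b k t = 0" if "t \<notin> {a..b}" for t
  proof -
    have "(t - a) * (b - t) \<le> 0" using that assms by (auto simp: mult_le_0_iff)
    then have "real (Suc k) * bump_arg per a b t \<le> 0"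
      using False by (intro mult_nonneg_nonpos) (auto simp: bump_arg_def)
    then show ?thesis by (simp add: bump_def flat_def)
  qed
  then show ?thesis using False assms smooth_bump unfolding test_fun_def by auto
qed

lemma bump_bounds: "0 \<le> bump per a b k t" "bump per a b k t \<le> 1"
  by (auto simp: bump_def flat_def)

lemma test_fun_zero: "test_fun per (\<lambda>_. 0)"
  unfolding test_fun_def using smooth_const[of 0]
  by (auto intro!: exI[of _ "1/4"] exI[of _ "1/2"])

text \<open>Enough test functions to reach indicators of intervals as bounded pointwise limits, for
  both kinds of test functions at once.\<close>

lemma ex_test_fun_indicator:
  shows "\<exists>\<phi>. (\<forall>k. test_fun per (\<phi> k) \<and> (\<forall>t. 0 \<le> \<phi> k t \<and> \<phi> k t \<le> 1)) \<and>
    (\<forall>t\<in>{0..1}. (\<lambda>k. \<phi> k t) \<longlonglongrightarrow> indicator ({a<..<b} \<inter> {0<..<1}) t)"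
proof -
  \<comment> \<open>Moving the end points inwards by 1/(k+1) keeps them strictly inside (0,1) even
    when \<open>a < 0\<close> or \<open>b > 1\<close>, as nonperiodic test functions require. If the
    interval becomes empty, the zero function is used.\<close>
  define lo where "lo k = max 0 a + inverse (real (Suc k))" for k
  define hi where "hi k = min 1 b - inverse (real (Suc k))" for k
  define \<phi> where "\<phi> k = (if lo k < hi k then bump per (lo k) (hi k) k else (\<lambda>_. 0))" for k
  have inv: "0 < inverse (real (Suc k))" for k by simp
  have lo: "0 < lo k" "hi k < 1" for k using inv[of k] unfolding lo_def hi_def by linarith+
  have lim: "lo \<longlonglongrightarrow> max 0 a" "hi \<longlonglongrightarrow> min 1 b"
    unfolding lo_def hi_def
    using tendsto_add[OF tendsto_const[of "max 0 a"] LIMSEQ_inverse_real_of_nat]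
      tendsto_diff[OF tendsto_const[of "min 1 b"] LIMSEQ_inverse_real_of_nat] by simp_all
  have "(\<lambda>k. \<phi> k t) \<longlonglongrightarrow> indicator ({a<..<b} \<inter> {0<..<1}) t" if t: "t \<in> {0..1}" for t
  proof (cases "max 0 a < t \<and> t < min 1 b")
    case True
    have ev: "eventually (\<lambda>k. lo k < t \<and> t < hi k) sequentially"
      using order_tendstoD(2)[OF lim(1), of t] order_tendstoD(1)[OF lim(2), of t] True
      by (auto elim: eventually_elim2)
    have q: "(\<lambda>k. bump_arg per (lo k) (hi k) t) \<longlonglongrightarrow> bump_arg per (max 0 a) (min 1 b) t"
      unfolding bump_arg_def by (cases per) (auto intro!: tendsto_intros lim)
    have pos: "bump_arg per (max 0 a) (min 1 b) t > 0"
    proof (cases per)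
      case True
      then show ?thesis using \<open>max 0 a < t \<and> t < min 1 b\<close> t unfolding bump_arg_def
        by (auto intro!: mult_pos_pos sin_gt_zero simp del: max_less_iff_conj min_less_iff_conj) 
    next
      case False
      then show ?thesis using \<open>max 0 a < t \<and> t < min 1 b\<close> unfolding bump_arg_def
        by (auto intro!: mult_pos_pos)
    qed
    \<comment> \<open>At a point inside the limiting interval the unscaled argument tends to a
      positive number, so the scaled one tends to infinity and exp(-1/x) to 1.\<close>
    have "filterlim (\<lambda>k. bump_arg per (lo k) (hi k) t * real (Suc k)) at_top sequentially"
      by (rule filterlim_tendsto_pos_mult_at_top[OF q pos])
         (rule filterlim_compose[OF filterlim_real_sequentially filterlim_Suc])
    then have "(\<lambda>k. exp (- inverse (bump_arg per (lo k) (hi k) t * real (Suc k)))) \<longlonglongrightarrow> exp (- 0)"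
      by (intro tendsto_intros) (rule filterlim_compose[OF tendsto_inverse_0_at_top filterlim_ident])
    moreover have "eventually (\<lambda>k. exp (- inverse (bump_arg per (lo k) (hi k) t * real (Suc k))) = \<phi> k t) sequentially"
      using ev
    proof eventually_elim
      case (elim k)
      then have "bump_arg per (lo k) (hi k) t > 0" using lo[of k] t by (subst bump_arg_pos_iff) auto
      then show ?case using elim by (simp add: \<phi>_def bump_def flat_def divide_inverse mult.commute)
    qed
    ultimately have "(\<lambda>k. \<phi> k t) \<longlonglongrightarrow> exp (- 0)" by (rule Lim_transform_eventually)
    then show ?thesis using True by (simp add: indicator_def)
  next
    case False
    have "\<phi> k t = 0" for k
    proof (cases "lo k < hi k")
      case True
      have "\<not> (lo k < t \<and> t < hi k)" using False inv[of k] unfolding lo_def hi_def by linarith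
      then have "\<not> bump_arg per (lo k) (hi k) t > 0" using lo[of k] t True by (subst bump_arg_pos_iff) auto
      then show ?thesis by (auto simp: \<phi>_def bump_def flat_def zero_less_mult_iff)
    qed (simp add: \<phi>_def)
    then show ?thesis using False by (auto simp: indicator_def)
  qed
  moreover have "test_fun per (\<phi> k) \<and> (\<forall>t. 0 \<le> \<phi> k t \<and> \<phi> k t \<le> 1)" for k
    using test_fun_bump[of "lo k" "hi k" per k] lo[of k] test_fun_zero bump_bounds by (auto simp: \<phi>_def)
  ultimately show ?thesis by (intro exI[of _ \<phi>]) blast
qed

lemma smooth_measurable: "smooth f \<Longrightarrow> f \<in> borel_measurable borel"
  using borel_measurable_smooth[of f 0] by simp

lemma test_fun_smooth: "test_fun per \<phi> \<Longrightarrow> smooth \<phi>"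
  by (simp add: test_fun_def)

text \<open>The faces form a null set. This removes the restriction to the open unit interval that
  test functions vanishing near the faces leave behind.\<close>

lemma AE_cube_interior:
  assumes "finite I"
  shows "AE x in cube_measure I. \<forall>j\<in>I. x j \<noteq> 0 \<and> x j \<noteq> 1"
proof -
  have "AE x in cube_measure I. x j \<noteq> c" if j: "j \<in> I" and c: "0 \<le> c" "c \<le> 1" for j c
  proof (rule AE_I)
    let ?A = "\<lambda>i. if i = j then {c} else {0..1::real}"
    have A: "?A i \<in> sets unit_meas" for i using c by (simp add: sets_restrict_space_iff)
    show "{x \<in> space (cube_measure I). \<not> x j \<noteq> c} \<subseteq> Pi\<^sub>E I ?A"
      by (auto simp: unit_cube_def PiE_def Pi_def)
    show "Pi\<^sub>E I ?A \<in> sets (cube_measure I)"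
      unfolding cube_measure_def by (rule sets_PiM_I_finite[OF assms A])
    have "emeasure (cube_measure I) (Pi\<^sub>E I ?A) = (\<Prod>i\<in>I. emeasure unit_meas (?A i))"
      unfolding cube_measure_def by (rule cube.emeasure_PiM[OF assms A])
    also have "\<dots> = 0"
      by (rule prod_zero[OF assms bexI[OF _ j]]) (use c in \<open>simp add: emeasure_restrict_space\<close>)
    finally show "emeasure (cube_measure I) (Pi\<^sub>E I ?A) = 0" .
  qed
  then show ?thesis using assms by (intro AE_finite_allI[OF assms] AE_conjI) auto
qed

text \<open>Orthogonality to products of test functions passes to indicators of boxes by dominated
  convergence, with |g| as majorant.\<close>

lemma integral_box_zero:
  assumes I: "finite I" and g: "integrable (cube_measure I) g"
    and z: "\<And>\<phi>. (\<forall>j\<in>I. test_fun per (\<phi> j)) \<Longrightarrow>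
      (LINT x|cube_measure I. g x * of_real (\<Prod>j\<in>I. \<phi> j (x j))) = (0::complex)"
  shows "(LINT x|cube_measure I. g x * of_real (\<Prod>j\<in>I. indicator {a j<..<b j} (x j))) = 0"
proof -
  let ?M = "cube_measure I"
  have "\<forall>j. \<exists>\<phi>. (\<forall>k. test_fun per (\<phi> k) \<and> (\<forall>t. 0 \<le> \<phi> k t \<and> \<phi> k t \<le> 1)) \<and>
    (\<forall>t\<in>{0..1}. (\<lambda>k. \<phi> k t) \<longlonglongrightarrow> indicator ({a j<..<b j} \<inter> {0<..<1}) t)"
    using ex_test_fun_indicator by simp
  then obtain \<phi> where "\<forall>j. (\<forall>k. test_fun per (\<phi> j k) \<and> (\<forall>t. 0 \<le> \<phi> j k t \<and> \<phi> j k t \<le> 1)) \<and>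
    (\<forall>t\<in>{0..1}. (\<lambda>k. \<phi> j k t) \<longlonglongrightarrow> indicator ({a j<..<b j} \<inter> {0<..<1}) t)"
    by (rule choice[THEN exE])
  then have \<phi>: "test_fun per (\<phi> j k)" "0 \<le> \<phi> j k t" "\<phi> j k t \<le> 1"
    "t \<in> {0..1} \<Longrightarrow> (\<lambda>k. \<phi> j k t) \<longlonglongrightarrow> indicator ({a j<..<b j} \<inter> {0<..<1}) t" for j k t
    by blast+
  have m1: "(\<lambda>x. \<Prod>j\<in>I. \<phi> j k (x j)) \<in> borel_measurable ?M" for k
    by (intro borel_measurable_prod measurable_compose[OF measurable_cube_component]
          smooth_measurable test_fun_smooth[OF \<phi>(1)])
  have m2: "(\<lambda>x. \<Prod>j\<in>I. indicator ({a j<..<b j} \<inter> {0<..<1}) (x j) :: real) \<in> borel_measurable ?M"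
    by (intro borel_measurable_prod measurable_compose[OF measurable_cube_component]) simp
  have "(\<lambda>k. LINT x|?M. g x * of_real (\<Prod>j\<in>I. \<phi> j k (x j))) \<longlonglongrightarrow>
     (LINT x|?M. g x * of_real (\<Prod>j\<in>I. indicator ({a j<..<b j} \<inter> {0<..<1}) (x j)))"
  proof (rule integral_dominated_convergence[where w = "\<lambda>x. norm (g x)"])
    show "(\<lambda>x. g x * of_real (\<Prod>j\<in>I. indicator ({a j<..<b j} \<inter> {0<..<1}) (x j))) \<in> borel_measurable ?M"
      using g m2 by (intro borel_measurable_times measurable_compose[OF m2]) auto
    show "(\<lambda>x. g x * of_real (\<Prod>j\<in>I. \<phi> j k (x j))) \<in> borel_measurable ?M" for k
      using g by (intro borel_measurable_times measurable_compose[OF m1]) auto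
    show "integrable ?M (\<lambda>x. norm (g x))" using g by simp
    show "AE x in ?M. (\<lambda>k. g x * of_real (\<Prod>j\<in>I. \<phi> j k (x j))) \<longlonglongrightarrow>
        g x * of_real (\<Prod>j\<in>I. indicator ({a j<..<b j} \<inter> {0<..<1}) (x j))"
      by (intro AE_I2 tendsto_mult tendsto_const tendsto_of_real tendsto_prod \<phi>(4))
         (auto dest: unit_cubeD)
    show "AE x in ?M. norm (g x * of_real (\<Prod>j\<in>I. \<phi> j k (x j))) \<le> norm (g x)" for k
    proof (rule AE_I2)
      fix x
      have "0 \<le> (\<Prod>j\<in>I. \<phi> j k (x j))" "(\<Prod>j\<in>I. \<phi> j k (x j)) \<le> 1"
        by (intro prod_nonneg prod_le_1 ballI conjI \<phi>)+
      then show "norm (g x * of_real (\<Prod>j\<in>I. \<phi> j k (x j))) \<le> norm (g x)"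
        by (simp only: norm_mult norm_of_real abs_of_nonneg mult_left_le norm_ge_zero)
    qed
  qed
  moreover have "(LINT x|?M. g x * of_real (\<Prod>j\<in>I. \<phi> j k (x j))) = 0" for k
    by (rule z) (simp add: \<phi>(1))
  ultimately have "(LINT x|?M. g x * of_real (\<Prod>j\<in>I. indicator ({a j<..<b j} \<inter> {0<..<1}) (x j))) = 0"
    using LIMSEQ_unique[OF _ tendsto_const] by simp
  moreover have "(LINT x|?M. g x * of_real (\<Prod>j\<in>I. indicator ({a j<..<b j} \<inter> {0<..<1}) (x j))) =
      (LINT x|?M. g x * of_real (\<Prod>j\<in>I. indicator {a j<..<b j} (x j)))"
  proof (rule integral_cong_AE)
    show "(\<lambda>x. g x * of_real (\<Prod>j\<in>I. indicator ({a j<..<b j} \<inter> {0<..<1}) (x j))) \<in> borel_measurable ?M"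
      using g by (intro borel_measurable_times measurable_compose[OF m2]) auto
    have m3: "(\<lambda>x. \<Prod>j\<in>I. indicator {a j<..<b j} (x j) :: real) \<in> borel_measurable ?M"
      by (intro borel_measurable_prod measurable_compose[OF measurable_cube_component]) simp
    show "(\<lambda>x. g x * of_real (\<Prod>j\<in>I. indicator {a j<..<b j} (x j))) \<in> borel_measurable ?M"
      using g by (intro borel_measurable_times measurable_compose[OF m3]) auto
    show "AE x in ?M. g x * of_real (\<Prod>j\<in>I. indicator ({a j<..<b j} \<inter> {0<..<1}) (x j)) =
        g x * of_real (\<Prod>j\<in>I. indicator {a j<..<b j} (x j))"
      using AE_cube_interior[OF I] AE_space
    proof eventually_elim
      case (elim x)
      have "indicator ({a j<..<b j} \<inter> {0<..<1}) (x j) = (indicator {a j<..<b j} (x j) :: real)" if "j \<in> I" for j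
        using elim that unit_cubeD[of x I j] by (auto simp: indicator_def less_le)
      then show ?case by (simp cong: prod.cong)
    qed
  qed
  ultimately show ?thesis by simp
qed

text \<open>A generator of the sigma-algebra that is closed under intersection and contains the cube
  itself; only open intervals occur because these are what test functions approximate.\<close>

definition open_boxes :: "nat set \<Rightarrow> point set set" where
  "open_boxes I = {\<Pi>\<^sub>E j\<in>I. {a j<..<b j} \<inter> {0..1} |a b. True}"

lemma open_boxesI: "X = (\<Pi>\<^sub>E j\<in>I. {a j<..<b j} \<inter> {0..1}) \<Longrightarrow> X \<in> open_boxes I"
  unfolding open_boxes_def by blast

lemma sets_cube_boxes:
  assumes "finite I"
  shows "sets (cube_measure I) = sigma_sets (unit_cube I) (open_boxes I)"
proof
  let ?N = "sigma (unit_cube I) (open_boxes I)"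
  have sub: "open_boxes I \<subseteq> Pow (unit_cube I)"
    by (auto simp: open_boxes_def unit_cube_def PiE_def Pi_def)
  have sp: "space ?N = unit_cube I" "sets ?N = sigma_sets (unit_cube I) (open_boxes I)"
    using sub by simp_all
  have comp: "(\<lambda>x. x i) \<in> borel_measurable ?N" if i: "i \<in> I" for i
  proof (rule borel_measurableI_less)
    fix c :: real
    \<comment> \<open>The bounds -1 and 2 lie outside [0,1] and so impose nothing on the other
      coordinates.\<close>
    have "{x \<in> space ?N. x i < c} = (\<Pi>\<^sub>E j\<in>I. {-1 <..< (if j = i then min c 2 else 2)} \<inter> {0..1})"
    proof (intro set_eqI iffI)
      fix x assume x: "x \<in> {x \<in> space ?N. x i < c}"
      then have xc: "x \<in> unit_cube I" and xi: "x i < c" unfolding sp by simp_all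
      show "x \<in> (\<Pi>\<^sub>E j\<in>I. {-1 <..< (if j = i then min c 2 else 2)} \<inter> {0..1})"
      proof (rule PiE_I)
        fix j assume "j \<in> I"
        then show "x j \<in> {-1 <..< (if j = i then min c 2 else 2)} \<inter> {0..1}"
          using unit_cubeD[OF xc, of j] xi by auto
      next
        fix j assume "j \<notin> I" then show "x j = undefined"
          using PiE_arb[OF xc[unfolded unit_cube_def]] by blast
      qed
    next
      fix x assume x: "x \<in> (\<Pi>\<^sub>E j\<in>I. {-1 <..< (if j = i then min c 2 else 2)} \<inter> {0..1})"
      have "x \<in> unit_cube I" unfolding unit_cube_def
      proof (rule PiE_I)
        fix j assume "j \<in> I" then show "x j \<in> {0..1}" using PiE_mem[OF x] by blast
      next
        fix j assume "j \<notin> I" then show "x j = undefined" using PiE_arb[OF x] by blast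
      qed
      moreover have "x i \<in> {-1 <..< (if i = i then min c 2 else 2)} \<inter> {0..1}" using PiE_mem[OF x i] .
      ultimately show "x \<in> {x \<in> space ?N. x i < c}" unfolding sp by simp
    qed
    also have "\<dots> \<in> open_boxes I" by (rule open_boxesI) (rule refl)
    finally show "{x \<in> space ?N. x i < c} \<in> sets ?N" unfolding sp by (rule sigma_sets.Basic)
  qed
  have "sets (cube_measure I) \<subseteq> sets ?N"
    unfolding cube_measure_def
  proof (rule sets_PiM_in_sets)
    show "space ?N = (\<Pi>\<^sub>E i\<in>I. space unit_meas)" unfolding sp by (simp add: unit_cube_def)
    fix i A assume iA: "i \<in> I" "A \<in> sets unit_meas"
    then have "A \<in> sets borel" by (auto simp: sets_restrict_space)
    from measurable_sets[OF comp[OF iA(1)] this] show "{x \<in> space ?N. x i \<in> A} \<in> sets ?N"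
      by (simp add: vimage_def Int_def conj_commute)
  qed
  then show "sets (cube_measure I) \<subseteq> sigma_sets (unit_cube I) (open_boxes I)" unfolding sp .
  have "open_boxes I \<subseteq> sets (cube_measure I)"
    unfolding open_boxes_def cube_measure_def
    by (auto intro!: sets_PiM_I_finite[OF assms] simp: sets_restrict_space_iff)
  then show "sigma_sets (unit_cube I) (open_boxes I) \<subseteq> sets (cube_measure I)"
    using sets.sigma_sets_subset[of "open_boxes I" "cube_measure I"] by simp
qed

lemma Int_stable_open_boxes: "Int_stable (open_boxes I)"
proof (rule Int_stableI)
  fix A B assume "A \<in> open_boxes I" "B \<in> open_boxes I"
  then obtain a b a' b' where AB: "A = (\<Pi>\<^sub>E j\<in>I. {a j<..<b j} \<inter> {0..1})" "B = (\<Pi>\<^sub>E j\<in>I. {a' j<..<b' j} \<inter> {0..1})"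
    unfolding open_boxes_def by blast
  have "A \<inter> B = (\<Pi>\<^sub>E j\<in>I. {max (a j) (a' j)<..<min (b j) (b' j)} \<inter> {0..1})"
    unfolding AB PiE_Int by (intro PiE_cong) auto
  then show "A \<inter> B \<in> open_boxes I" by (rule open_boxesI)
qed

text \<open>The positive and the negative part of \<open>h\<close> are densities of two finite
  measures. They agree on boxes, hence everywhere, so the two densities agree almost everywhere; as
  one of them always vanishes, \<open>h\<close> is zero.\<close>

lemma AE_zero_of_boxes:
  fixes h :: "point \<Rightarrow> real"
  assumes I: "finite I" and h: "integrable (cube_measure I) h"
    and z: "\<And>a b. (LINT x|cube_measure I. h x * (\<Prod>j\<in>I. indicator {a j<..<b j} (x j))) = 0"
  shows "AE x in cube_measure I. h x = 0"
proof -
  let ?M = "cube_measure I"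
  have hm[measurable]: "h \<in> borel_measurable ?M" using h by simp
  have ip: "integrable ?M (\<lambda>x. max 0 (h x))" "integrable ?M (\<lambda>x. max 0 (- h x))"
    using h by auto
  let ?P = "density ?M (\<lambda>x. ennreal (max 0 (h x)))" and ?N = "density ?M (\<lambda>x. ennreal (max 0 (- h x)))"
  have em: "emeasure (density ?M (\<lambda>x. ennreal (max 0 (f x)))) X = ennreal (LINT x|?M. max 0 (f x) * indicator X x)"
    if "X \<in> sets ?M" "integrable ?M f" for X f
  proof -
    have [measurable]: "f \<in> borel_measurable ?M" "X \<in> sets ?M" using that by auto
    have i: "integrable ?M (\<lambda>x. max 0 (f x) * indicator X x)"
      using that by (intro integrable_real_mult_indicator integrable_max) auto
    have "emeasure (density ?M (\<lambda>x. ennreal (max 0 (f x)))) X = (\<integral>\<^sup>+x. ennreal (max 0 (f x)) * indicator X x \<partial>?M)"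
      by (rule emeasure_density) auto
    also have "\<dots> = (\<integral>\<^sup>+x. ennreal (max 0 (f x) * indicator X x) \<partial>?M)"
      by (intro nn_integral_cong) (auto simp: indicator_def)
    also have "\<dots> = ennreal (LINT x|?M. max 0 (f x) * indicator X x)"
      by (rule nn_integral_eq_integral[OF i]) (auto simp: indicator_def)
    finally show ?thesis .
  qed
  have "?P = ?N"
  proof (rule measure_eqI_generator_eq[OF Int_stable_open_boxes])
    show "open_boxes I \<subseteq> Pow (unit_cube I)" by (auto simp: open_boxes_def unit_cube_def PiE_def Pi_def)
    show "sets ?P = sigma_sets (unit_cube I) (open_boxes I)" "sets ?N = sigma_sets (unit_cube I) (open_boxes I)"
      using sets_cube_boxes[OF I] by simp_all
    have "unit_cube I = (\<Pi>\<^sub>E j\<in>I. {(\<lambda>_::nat. -1) j<..<(\<lambda>_::nat. 2) j} \<inter> {0..1})"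
      unfolding unit_cube_def by (intro PiE_cong) auto
    then have "unit_cube I \<in> open_boxes I" by (rule open_boxesI)
    then show "range (\<lambda>_::nat. unit_cube I) \<subseteq> open_boxes I" by auto
    show "(\<Union>i::nat. unit_cube I) = unit_cube I" by simp
    show "emeasure ?P (unit_cube I) \<noteq> \<infinity>"
      using em[of "unit_cube I" h] h sets.top[of ?M] by simp
    fix X assume X: "X \<in> open_boxes I"
    then obtain a b where ab: "X = (\<Pi>\<^sub>E j\<in>I. {a j<..<b j} \<inter> {0..1})" unfolding open_boxes_def by blast
    have Xs: "X \<in> sets ?M" using X sets_cube_boxes[OF I] by (auto intro: sigma_sets.Basic)
    have ind: "indicator X x = (\<Prod>j\<in>I. indicator {a j<..<b j} (x j) :: real)" if x: "x \<in> unit_cube I" for x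
    proof (cases "x \<in> X")
      case True
      then have "(\<Prod>j\<in>I. indicator {a j<..<b j} (x j) :: real) = 1"
        by (intro prod.neutral) (auto simp: ab PiE_def Pi_def)
      then show ?thesis using True by simp
    next
      case False
      then obtain j where "j \<in> I" "x j \<notin> {a j<..<b j}"
        using x by (auto simp: ab unit_cube_def PiE_def Pi_def)
      then have "(\<Prod>j\<in>I. indicator {a j<..<b j} (x j) :: real) = 0"
        by (intro prod_zero[OF I]) (auto simp: indicator_def intro!: bexI[of _ j])
      then show ?thesis using False by simp
    qed
    have "(LINT x|?M. h x * indicator X x) = (LINT x|?M. h x * (\<Prod>j\<in>I. indicator {a j<..<b j} (x j)))"
      by (intro Bochner_Integration.integral_cong refl) (simp add: ind)
    then have "(LINT x|?M. h x * indicator X x) = 0" using z by simp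
    moreover have "(LINT x|?M. h x * indicator X x) =
      (LINT x|?M. max 0 (h x) * indicator X x - max 0 (- h x) * indicator X x)"
      by (intro Bochner_Integration.integral_cong refl) (auto simp: max_def left_diff_distrib[symmetric])
    moreover have "\<dots> = (LINT x|?M. max 0 (h x) * indicator X x) - (LINT x|?M. max 0 (- h x) * indicator X x)"
      using ip Xs by (intro Bochner_Integration.integral_diff integrable_real_mult_indicator) auto
    ultimately show "emeasure ?P X = emeasure ?N X"
      using em[OF Xs h] em[OF Xs, of "\<lambda>x. - h x"] h by simp
  qed
  moreover have "sigma_finite_measure ?P"
  proof -
    have "finite_measure ?P" using em[of "unit_cube I" h] h sets.top[of ?M] by (intro finite_measureI) simp
    then show ?thesis by (rule finite_measure.axioms)
  qed
  ultimately have "AE x in ?M. ennreal (max 0 (h x)) = ennreal (max 0 (- h x))"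
    by (subst (asm) sigma_finite_density_unique) auto
  then show ?thesis by eventually_elim (auto simp: max_def split: if_splits)
qed

lemma has_weak_derivD:
  "has_weak_deriv per I \<nu> v g \<Longrightarrow> \<forall>j\<in>I. test_fun per (\<phi> j) \<Longrightarrow>
    (LINT x|cube_measure I. v x * of_real (\<Prod>j\<in>I. (deriv ^^ \<nu> j) (\<phi> j) (x j))) =
    (-1) ^ (\<Sum>j\<in>I. \<nu> j) * (LINT x|cube_measure I. g x * of_real (\<Prod>j\<in>I. \<phi> j (x j)))"
  by (simp add: has_weak_deriv_def)

text \<open>The difference of two weak derivatives is orthogonal to all products of test functions,
  hence to all boxes. Norms refer to an arbitrarily chosen weak derivative, and this lemma lets a
  classical derivative take its place.\<close>

lemma weak_deriv_unique:
  assumes I: "finite I" and w: "has_weak_deriv per I \<nu> v g" "has_weak_deriv per I \<nu> v g'"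
  shows "AE x in cube_measure I. g x = g' x"
proof -
  let ?M = "cube_measure I"
  have int: "integrable ?M g" "integrable ?M g'" using w by (auto simp: has_weak_deriv_def)
  let ?h = "\<lambda>x. g x - g' x"
  have ih: "integrable ?M ?h" using int by simp
  have hz: "(LINT x|?M. ?h x * of_real (\<Prod>j\<in>I. \<phi> j (x j))) = 0" if \<phi>: "\<forall>j\<in>I. test_fun per (\<phi> j)" for \<phi>
  proof -
    have cont: "continuous_on (unit_cube I) (\<lambda>x. complex_of_real (\<Prod>j\<in>I. \<phi> j (x j)))"
    proof (intro continuous_on_of_real continuous_on_prod)
      fix j assume "j \<in> I"
      then have "continuous_on UNIV (\<phi> j)" using smooth_funpow_continuous[of "\<phi> j" UNIV 0] \<phi> test_fun_smooth by auto
      then show "continuous_on (unit_cube I) (\<lambda>x. \<phi> j (x j))"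
        by (rule continuous_on_compose2) (auto intro!: continuous_on_product_coordinates continuous_on_subset[OF _ subset_UNIV])
    qed
    obtain B where B: "\<And>x. x \<in> unit_cube I \<Longrightarrow> cmod (complex_of_real (\<Prod>j\<in>I. \<phi> j (x j))) \<le> B"
      using bounded_on_cube[OF cont] by blast
    have i: "integrable ?M (\<lambda>x. f x * of_real (\<Prod>j\<in>I. \<phi> j (x j)))" if "integrable ?M f" for f :: "point \<Rightarrow> complex"
    proof (rule Bochner_Integration.integrable_bound[of _ "\<lambda>x. B * cmod (f x)"])
      show "integrable ?M (\<lambda>x. B * cmod (f x))" using that by simp
      show "(\<lambda>x. f x * of_real (\<Prod>j\<in>I. \<phi> j (x j))) \<in> borel_measurable ?M"
        using that by (intro borel_measurable_times borel_measurable_cube[OF cont]) auto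
      show "AE x in ?M. cmod (f x * of_real (\<Prod>j\<in>I. \<phi> j (x j))) \<le> norm (B * cmod (f x))"
      proof (rule AE_I2)
        fix x assume "x \<in> space ?M"
        then have "cmod (complex_of_real (\<Prod>j\<in>I. \<phi> j (x j))) * cmod (f x) \<le> B * cmod (f x)"
          using B by (intro mult_right_mono) auto
        also have "\<dots> \<le> norm (B * cmod (f x))" by simp
        finally show "cmod (f x * of_real (\<Prod>j\<in>I. \<phi> j (x j))) \<le> norm (B * cmod (f x))"
          by (simp only: norm_mult mult.commute)
      qed
    qed
    have "(-1) ^ (\<Sum>j\<in>I. \<nu> j) * (LINT x|?M. g x * of_real (\<Prod>j\<in>I. \<phi> j (x j))) =
        (-1) ^ (\<Sum>j\<in>I. \<nu> j) * (LINT x|?M. g' x * of_real (\<Prod>j\<in>I. \<phi> j (x j)))"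
      by (rule trans[OF sym[OF has_weak_derivD[OF w(1) \<phi>]] has_weak_derivD[OF w(2) \<phi>]])
    then have "(LINT x|?M. g x * of_real (\<Prod>j\<in>I. \<phi> j (x j))) = (LINT x|?M. g' x * of_real (\<Prod>j\<in>I. \<phi> j (x j)))"
      by simp
    then show ?thesis using i[OF int(1)] i[OF int(2)] by (simp add: left_diff_distrib)
  qed
  have box: "(LINT x|?M. ?h x * of_real (\<Prod>j\<in>I. indicator {a j<..<b j} (x j))) = 0" for a b
    by (rule integral_box_zero[where per = per, OF I ih]) (rule hz)
  have ibox: "integrable ?M (\<lambda>x. ?h x * of_real (\<Prod>j\<in>I. indicator {a j<..<b j} (x j)))" for a b
  proof (rule Bochner_Integration.integrable_bound[OF ih])
    have m3: "(\<lambda>x. \<Prod>j\<in>I. indicator {a j<..<b j} (x j) :: real) \<in> borel_measurable ?M"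
      by (intro borel_measurable_prod measurable_compose[OF measurable_cube_component]) simp
    show "(\<lambda>x. ?h x * of_real (\<Prod>j\<in>I. indicator {a j<..<b j} (x j))) \<in> borel_measurable ?M"
      using ih by (intro borel_measurable_times measurable_compose[OF m3]) auto
    show "AE x in ?M. norm (?h x * of_real (\<Prod>j\<in>I. indicator {a j<..<b j} (x j))) \<le> norm (?h x)"
    proof (rule AE_I2)
      fix x :: point
      have "0 \<le> (\<Prod>j\<in>I. indicator {a j<..<b j} (x j) :: real)" "(\<Prod>j\<in>I. indicator {a j<..<b j} (x j) :: real) \<le> 1"
        by (intro prod_nonneg prod_le_1 ballI conjI indicator_pos_le indicator_le_1)+
      then show "norm (?h x * of_real (\<Prod>j\<in>I. indicator {a j<..<b j} (x j))) \<le> norm (?h x)"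
        by (simp only: norm_mult norm_of_real abs_of_nonneg mult_left_le norm_ge_zero)
    qed
  qed
  have "AE x in ?M. Re (?h x) = 0"
  proof (rule AE_zero_of_boxes[OF I])
    show "integrable ?M (\<lambda>x. Re (?h x))" by (rule integrable_Re[OF ih])
    show "(LINT x|?M. Re (?h x) * (\<Prod>j\<in>I. indicator {a j<..<b j} (x j))) = 0" for a b
    proof -
      have "(LINT x|?M. Re (?h x) * (\<Prod>j\<in>I. indicator {a j<..<b j} (x j))) =
          (LINT x|?M. Re (?h x * of_real (\<Prod>j\<in>I. indicator {a j<..<b j} (x j))))"
        by (simp only: times_complex.sel Re_complex_of_real Im_complex_of_real mult_zero_right diff_zero add_0)
      also have "\<dots> = Re (LINT x|?M. ?h x * of_real (\<Prod>j\<in>I. indicator {a j<..<b j} (x j)))"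
        by (rule integral_Re[OF ibox])
      also have "\<dots> = 0" unfolding box by simp
      finally show ?thesis .
    qed
  qed
  moreover have "AE x in ?M. Im (?h x) = 0"
  proof (rule AE_zero_of_boxes[OF I])
    show "integrable ?M (\<lambda>x. Im (?h x))" by (rule integrable_Im[OF ih])
    show "(LINT x|?M. Im (?h x) * (\<Prod>j\<in>I. indicator {a j<..<b j} (x j))) = 0" for a b
    proof -
      have "(LINT x|?M. Im (?h x) * (\<Prod>j\<in>I. indicator {a j<..<b j} (x j))) =
          (LINT x|?M. Im (?h x * of_real (\<Prod>j\<in>I. indicator {a j<..<b j} (x j))))"
        by (simp only: times_complex.sel Re_complex_of_real Im_complex_of_real mult_zero_right diff_zero add_0)
      also have "\<dots> = Im (LINT x|?M. ?h x * of_real (\<Prod>j\<in>I. indicator {a j<..<b j} (x j)))"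
        by (rule integral_Im[OF ibox])
      also have "\<dots> = 0" unfolding box by simp
      finally show ?thesis .
    qed
  qed
  ultimately show ?thesis by eventually_elim (simp add: complex_eq_iff)
qed

subsection \<open>Classical derivatives are weak derivatives\<close>

text \<open>Continuity is included so that all integrability questions disappear. The q-th power of
  the bound avoids roots.\<close>

definition Lq_bounded :: "nat \<Rightarrow> nat set \<Rightarrow> real \<Rightarrow> (point \<Rightarrow> complex) \<Rightarrow> bool" where
  "Lq_bounded q I B f \<longleftrightarrow> continuous_on (unit_cube I) f \<and> (LINT y|cube_measure I. cmod (f y) ^ q) \<le> B ^ q"

abbreviation pderiv_rel :: "nat set \<Rightarrow> real set \<Rightarrow> nat \<Rightarrow> (point \<Rightarrow> complex) \<Rightarrow> (point \<Rightarrow> complex) \<Rightarrow> bool" where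
  "pderiv_rel I U j f f' \<equiv> pw_deriv one_point I U j (\<lambda>_. f) (\<lambda>_. f')"

abbreviation Lq_class where
  "Lq_class q I U \<equiv> diff_class (Lq_bounded q I) (pderiv_rel I U) I"

text \<open>Periodicity on the whole space. Unlike the mere equality of values on opposite faces, it
  is inherited by partial derivatives.\<close>

definition torus_periodic :: "nat set \<Rightarrow> (point \<Rightarrow> complex) \<Rightarrow> bool" where
  "torus_periodic I f \<longleftrightarrow> (\<forall>j\<in>I. \<forall>y\<in>cube_on I UNIV. f (y(j := y j + 1)) = f y)"

lemma torus_periodicD: "torus_periodic I f \<Longrightarrow> j \<in> I \<Longrightarrow> y \<in> cube_on I UNIV \<Longrightarrow> f (y(j := y j + 1)) = f y"
  by (simp add: torus_periodic_def)

lemma torus_periodic_deriv: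
  assumes "torus_periodic I f" "pderiv_rel I UNIV j f f'" "j \<in> I"
  shows "torus_periodic I f'"
  unfolding torus_periodic_def
proof (intro ballI)
  fix i y assume i: "i \<in> I" and y: "y \<in> cube_on I UNIV"
  let ?y = "y(i := y i + 1)"
  have y': "?y \<in> cube_on I UNIV" by (rule cube_on_upd[OF y i UNIV_I])
  have d: "((\<lambda>t. f (y(j := t))) has_vector_derivative f' y) (at (y j))"
    using pw_derivE[OF assms(2) _ y, of "()"] by simp
  have d': "((\<lambda>t. f (?y(j := t))) has_vector_derivative f' ?y) (at (?y j))"
    using pw_derivE[OF assms(2) _ y', of "()"] by simp
  show "f' ?y = f' y"
  proof (cases "i = j")
    case True
    have eq: "f (y(j := t + 1)) = f (y(j := t))" for t
      using torus_periodicD[OF assms(1,3) cube_on_upd[OF y assms(3) UNIV_I, of t]] by simp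
    have "((\<lambda>t. f (y(j := t))) has_vector_derivative f' ?y) (at (y j + 1))"
      using d' True by simp
    moreover have "((\<lambda>t. t + 1) has_vector_derivative 1) (at (y j))"
      by (auto intro!: derivative_eq_intros)
    ultimately have "((\<lambda>t. f (y(j := t + 1))) has_vector_derivative f' ?y) (at (y j))"
      using vector_diff_chain_at[of "\<lambda>t. t + 1" 1 "y j" "\<lambda>t. f (y(j := t))" "f' ?y"] by (simp add: o_def)
    then have "((\<lambda>t. f (y(j := t))) has_vector_derivative f' ?y) (at (y j))" unfolding eq .
    then show ?thesis using d vector_derivative_unique_at by blast
  next
    case False
    have eq: "f (?y(j := t)) = f (y(j := t))" for t
    proof -
      have "?y(j := t) = (y(j := t))(i := (y(j := t)) i + 1)" using False by (auto simp: fun_eq_iff)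
      then show ?thesis using torus_periodicD[OF assms(1) i cube_on_upd[OF y assms(3) UNIV_I, of t]] by simp
    qed
    have "((\<lambda>t. f (y(j := t))) has_vector_derivative f' ?y) (at (y j))"
      using d' False unfolding eq by simp
    then show ?thesis using d vector_derivative_unique_at by blast
  qed
qed

lemma integrable_unit_continuous:
  fixes f :: "real \<Rightarrow> 'a::{banach, second_countable_topology}"
  assumes "continuous_on {0..1} f"
  shows "integrable unit_meas f"
proof -
  have "f \<in> borel_measurable (restrict_space borel {0..1})"
    by (rule borel_measurable_continuous_on_restrict[OF assms])
  then have m: "f \<in> borel_measurable unit_meas"
    by (simp cong: measurable_cong_sets add: sets_restrict_space)
  have "bounded (f ` {0..1})" by (intro compact_imp_bounded compact_continuous_image assms compact_Icc)
  then obtain B where "\<forall>t\<in>{0..1}. norm (f t) \<le> B" by (auto simp: bounded_iff)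
  then show ?thesis by (intro unit_meas.integrable_const_bound[OF _ m, of B] AE_I2) simp
qed

lemma ibp_unit:
  fixes F f :: "real \<Rightarrow> complex" and \<psi> \<psi>' :: "real \<Rightarrow> real"
  assumes F: "\<And>t. 0 \<le> t \<Longrightarrow> t \<le> 1 \<Longrightarrow> (F has_vector_derivative f t) (at t within {0..1})"
    and cont: "continuous_on {0..1} F" "continuous_on {0..1} f" "continuous_on {0..1} \<psi>'"
    and \<psi>: "\<And>t. (\<psi> has_field_derivative \<psi>' t) (at t)"
    and bd: "F 1 * of_real (\<psi> 1) = F 0 * of_real (\<psi> 0)"
  shows "(LINT t|unit_meas. F t * of_real (\<psi>' t)) = - (LINT t|unit_meas. f t * of_real (\<psi> t))"
proof -
  have c\<psi>: "continuous_on {0..1} \<psi>"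
    by (intro continuous_at_imp_continuous_on ballI DERIV_isCont[OF \<psi>])
  have i: "integrable unit_meas (\<lambda>t. F t * of_real (\<psi>' t))" "integrable unit_meas (\<lambda>t. f t * of_real (\<psi> t))"
    by (intro integrable_unit_continuous continuous_on_mult continuous_on_of_real cont c\<psi>)+
  have "(LINT t|unit_meas. F t * of_real (\<psi>' t) + f t * of_real (\<psi> t)) = F 1 * of_real (\<psi> 1) - F 0 * of_real (\<psi> 0)"
  proof (rule integral_unit_FTC)
    fix t :: real assume t: "0 \<le> t" "t \<le> 1"
    have "(\<psi> has_field_derivative \<psi>' t) (at t within {0..1})" by (rule DERIV_subset[OF \<psi> subset_UNIV])
    from has_vector_derivative_mult[OF F[OF t] has_vector_derivative_of_real[OF this]]
    show "((\<lambda>t. F t * of_real (\<psi> t)) has_vector_derivative F t * of_real (\<psi>' t) + f t * of_real (\<psi> t)) (at t within {0..1})" .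
  next
    show "continuous_on {0..1} (\<lambda>t. F t * of_real (\<psi>' t) + f t * of_real (\<psi> t))"
      by (intro continuous_on_add continuous_on_mult continuous_on_of_real cont c\<psi>)
  qed
  then have "(LINT t|unit_meas. F t * of_real (\<psi>' t)) + (LINT t|unit_meas. f t * of_real (\<psi> t)) = 0"
    using i bd by simp
  then show ?thesis by (simp add: eq_neg_iff_add_eq_0)
qed

lemma continuous_on_coordinate_line:
  assumes "continuous_on (unit_cube I) f" "j \<in> I" "y \<in> unit_cube (I - {j})"
  shows "continuous_on {0..1} (\<lambda>t. f (y(j := t)))"
proof (rule continuous_on_compose2[OF assms(1)])
  have "continuous_on {0..1} (\<lambda>t. (y(j := t)) i)" for i by (cases "i = j") auto
  then show "continuous_on {0..1} (\<lambda>t. y(j := t))" by (rule continuous_on_coordinatewise_then_product)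
  show "(\<lambda>t. y(j := t)) ` {0..1} \<subseteq> unit_cube I"
    using assms(2,3) by (auto simp: unit_cube_def PiE_def Pi_def extensional_def)
qed

lemma unit_cube_sub_cube_on: "{0..1} \<subseteq> U \<Longrightarrow> unit_cube I \<subseteq> cube_on I U"
  unfolding unit_cube_def by (rule PiE_mono) 

lemma continuous_on_test_prod:
  assumes "\<And>j. j \<in> I \<Longrightarrow> test_fun per (\<phi> j)"
  shows "continuous_on (unit_cube I) (\<lambda>x. complex_of_real (\<Prod>j\<in>I. (deriv ^^ \<nu> j) (\<phi> j) (x j)))"
proof (intro continuous_on_of_real continuous_on_prod)
  fix j assume "j \<in> I"
  then have "continuous_on UNIV ((deriv ^^ \<nu> j) (\<phi> j))"
    by (intro smooth_funpow_continuous test_fun_smooth[OF assms])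
  then show "continuous_on (unit_cube I) (\<lambda>x. (deriv ^^ \<nu> j) (\<phi> j) (x j))"
    by (rule continuous_on_compose2)
       (rule continuous_on_subset[OF continuous_on_product_coordinates subset_UNIV], rule subset_UNIV)
qed

text \<open>Fubini isolates coordinate \<open>j\<close>, in which one-dimensional partial
  integration moves a single derivative from the test function to \<open>f\<close>; the remaining
  factors of the test function are the constant \<open>c x\<close>.\<close>

lemma ibp_cube:
  assumes I: "finite I" and j: "j \<in> I" and U: "{0..1} \<subseteq> U"
    and f: "continuous_on (unit_cube I) f" "continuous_on (unit_cube I) f'" "pderiv_rel I U j f f'"
    and per: "per \<Longrightarrow> U = UNIV \<and> torus_periodic I f"
    and \<phi>: "\<And>i. i \<in> I \<Longrightarrow> test_fun per (\<phi> i)" and \<nu>: "\<nu> j > 0"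
  shows "(LINT x|cube_measure I. f x * of_real (\<Prod>i\<in>I. (deriv ^^ \<nu> i) (\<phi> i) (x i))) =
    - (LINT x|cube_measure I. f' x * of_real (\<Prod>i\<in>I. (deriv ^^ (\<nu>(j := \<nu> j - 1)) i) (\<phi> i) (x i)))"
proof -
  let ?J = "I - {j}"
  define n where "n = \<nu> j - 1"
  have n: "\<nu> j = Suc n" using \<nu> by (simp add: n_def)
  have IJ: "insert j ?J = I" "finite ?J" "j \<notin> ?J" using I j by auto
  define c where "c x = complex_of_real (\<Prod>i\<in>?J. (deriv ^^ \<nu> i) (\<phi> i) (x i))" for x :: point
  have e1: "(\<Prod>i\<in>?J. (deriv ^^ \<nu> i) (\<phi> i) ((x(j := t)) i)) = (\<Prod>i\<in>?J. (deriv ^^ \<nu> i) (\<phi> i) (x i))" for x t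
    by (intro prod.cong refl) auto
  have e2: "(\<Prod>i\<in>?J. (deriv ^^ (\<nu>(j := \<nu> j - 1)) i) (\<phi> i) ((x(j := t)) i)) = (\<Prod>i\<in>?J. (deriv ^^ \<nu> i) (\<phi> i) (x i))" for x t
    by (intro prod.cong refl) auto
  have p1: "of_real (\<Prod>i\<in>I. (deriv ^^ \<nu> i) (\<phi> i) ((x(j := t)) i)) = c x * of_real ((deriv ^^ Suc n) (\<phi> j) t)" for x t
    unfolding c_def prod.remove[OF I j] e1 by (simp only: fun_upd_same n of_real_mult mult.commute)
  have p2: "of_real (\<Prod>i\<in>I. (deriv ^^ (\<nu>(j := \<nu> j - 1)) i) (\<phi> i) ((x(j := t)) i)) = c x * of_real ((deriv ^^ n) (\<phi> j) t)" for x t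
    unfolding c_def prod.remove[OF I j] e2 by (simp only: fun_upd_same n_def of_real_mult mult.commute)
  have expand: "(LINT x|cube_measure I. F x) = (LINT x|cube_measure ?J. LINT t|unit_meas. F (x(j := t)))"
    if "continuous_on (unit_cube I) F" for F :: "point \<Rightarrow> complex"
    using cube.product_integral_insert[OF IJ(2,3), of F] integrable_cube_continuous[OF I that]
    unfolding IJ(1) cube_measure_def by blast
  note tp = continuous_on_test_prod[OF \<phi>]
  have sm: "smooth (\<phi> j)" using test_fun_smooth[OF \<phi>[OF j]] .
  have inner: "(LINT t|unit_meas. f (x(j := t)) * (c x * of_real ((deriv ^^ Suc n) (\<phi> j) t))) =
      - (LINT t|unit_meas. f' (x(j := t)) * (c x * of_real ((deriv ^^ n) (\<phi> j) t)))"
    if x: "x \<in> unit_cube ?J" for x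
  proof -
    have xt: "x(j := t) \<in> unit_cube I" if "0 \<le> t" "t \<le> 1" for t
      using x that j by (auto simp: unit_cube_def PiE_def Pi_def extensional_def)
    have "(LINT t|unit_meas. f (x(j := t)) * of_real ((deriv ^^ Suc n) (\<phi> j) t)) =
        - (LINT t|unit_meas. f' (x(j := t)) * of_real ((deriv ^^ n) (\<phi> j) t))"
    proof (rule ibp_unit)
      fix t :: real assume t: "0 \<le> t" "t \<le> 1"
      have "((\<lambda>u. f ((x(j := t))(j := u))) has_vector_derivative f' (x(j := t))) (at ((x(j := t)) j) within U)"
        using pw_derivE[OF f(3) _ subsetD[OF unit_cube_sub_cube_on[OF U] xt[OF t]], of "()"] by simp
      then have "((\<lambda>u. f (x(j := u))) has_vector_derivative f' (x(j := t))) (at t within U)"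
        by simp
      then show "((\<lambda>u. f (x(j := u))) has_vector_derivative f' (x(j := t))) (at t within {0..1})"
        by (rule has_vector_derivative_within_subset[OF _ U])
    next
      show "continuous_on {0..1} (\<lambda>t. f (x(j := t)))" "continuous_on {0..1} (\<lambda>t. f' (x(j := t)))"
        by (rule continuous_on_coordinate_line[OF f(1) j x] continuous_on_coordinate_line[OF f(2) j x])+
      show "continuous_on {0..1} ((deriv ^^ Suc n) (\<phi> j))" by (rule smooth_funpow_continuous[OF sm])
      show "((deriv ^^ n) (\<phi> j) has_field_derivative (deriv ^^ Suc n) (\<phi> j) t) (at t)" for t
        by (rule smooth_deriv_funpow[OF sm])
      \<comment> \<open>The boundary terms cancel: by periodicity of both factors on the torus, and
        otherwise because the test function vanishes in neighbourhoods of 0 and 1, so that its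
        derivatives vanish there as well.\<close>
      show "f (x(j := 1)) * of_real ((deriv ^^ n) (\<phi> j) 1) = f (x(j := 0)) * of_real ((deriv ^^ n) (\<phi> j) 0)"
      proof (cases per)
        case True
        have "x(j := 0) \<in> cube_on I UNIV" using subsetD[OF unit_cube_sub_cube_on[OF subset_UNIV] xt[of 0]] by simp
        from torus_periodicD[OF _ j this] per[OF True] have "f (x(j := 1)) = f (x(j := 0))" by simp
        moreover have "(deriv ^^ n) (\<phi> j) 1 = (deriv ^^ n) (\<phi> j) 0"
          using deriv_funpow_periodic[OF sm, of n 0] \<phi>[OF j] True by (simp add: test_fun_def)
        ultimately show ?thesis by simp
      next
        case False
        then obtain a b where ab: "0 < a" "b < 1" "\<And>t. t \<notin> {a..b} \<Longrightarrow> \<phi> j t = 0"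
          using \<phi>[OF j] unfolding test_fun_def by auto
        have "(deriv ^^ n) (\<phi> j) 0 = 0"
          by (rule deriv_funpow_zero_on_open[of "{..<a}"]) (use ab in auto)
        moreover have "(deriv ^^ n) (\<phi> j) 1 = 0"
          by (rule deriv_funpow_zero_on_open[of "{b<..}"]) (use ab in auto)
        ultimately show ?thesis by simp
      qed
    qed
    then have "c x * (LINT t|unit_meas. f (x(j := t)) * of_real ((deriv ^^ Suc n) (\<phi> j) t)) =
        c x * (- (LINT t|unit_meas. f' (x(j := t)) * of_real ((deriv ^^ n) (\<phi> j) t)))" by (rule arg_cong)
    then show ?thesis
      unfolding mult_minus_right integral_mult_right_zero[symmetric] by (simp only: mult.left_commute)
  qed
  have "(LINT x|cube_measure I. f x * of_real (\<Prod>i\<in>I. (deriv ^^ \<nu> i) (\<phi> i) (x i))) =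
      (LINT x|cube_measure ?J. LINT t|unit_meas. f (x(j := t)) * (c x * of_real ((deriv ^^ Suc n) (\<phi> j) t)))"
    by (subst expand) (intro continuous_on_mult f tp, assumption, simp only: p1)
  also have "\<dots> = (LINT x|cube_measure ?J. - (LINT t|unit_meas. f' (x(j := t)) * (c x * of_real ((deriv ^^ n) (\<phi> j) t))))"
    by (intro Bochner_Integration.integral_cong refl inner) simp
  also have "\<dots> = - (LINT x|cube_measure ?J. LINT t|unit_meas. f' (x(j := t)) * (c x * of_real ((deriv ^^ n) (\<phi> j) t)))"
    by (rule integral_minus)
  also have "(LINT x|cube_measure ?J. LINT t|unit_meas. f' (x(j := t)) * (c x * of_real ((deriv ^^ n) (\<phi> j) t))) =
     (LINT x|cube_measure I. f' x * of_real (\<Prod>i\<in>I. (deriv ^^ (\<nu>(j := \<nu> j - 1)) i) (\<phi> i) (x i)))"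
    by (subst expand) (intro continuous_on_mult f tp, assumption, simp only: p2)
  finally show ?thesis .
qed

text \<open>Induction on the order of the derivative, one partial integration per step. Periodicity
  has to be passed on to the derivative for the next step.\<close>

lemma Lq_class_weak_deriv:
  assumes I: "finite I" and U: "{0..1} \<subseteq> U"
    and "Lq_class q I U B \<mu> f" "\<And>j. j \<in> I \<Longrightarrow> \<nu> j \<le> \<mu> j"
    and "per \<Longrightarrow> U = UNIV \<and> torus_periodic I f"
  shows "\<exists>g. Lq_bounded q I B g \<and> has_weak_deriv per I \<nu> f g"
  using assms(3-5)
proof (induction "sum \<nu> I" arbitrary: \<nu> \<mu> f rule: less_induct)
  case less
  have f: "Lq_bounded q I B f" using diff_class_bound[OF less.prems(1)] .
  then have cf: "continuous_on (unit_cube I) f" by (simp add: Lq_bounded_def)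
  show ?case
  proof (cases "\<forall>j\<in>I. \<nu> j = 0")
    case True
    have "has_weak_deriv per I \<nu> f f"
      unfolding has_weak_deriv_def using integrable_cube_continuous[OF I cf] True by (simp cong: prod.cong)
    then show ?thesis using f by blast
  next
    case False
    then obtain j where j: "j \<in> I" "\<nu> j > 0" by auto
    then have "\<mu> j > 0" using less.prems(2)[OF j(1)] by simp
    then obtain f' where f': "pderiv_rel I U j f f'" "Lq_class q I U B (\<mu>(j := \<mu> j - 1)) f'"
      using diff_class_deriv[OF less.prems(1) j(1)] by blast
    let ?\<nu> = "\<nu>(j := \<nu> j - 1)"
    have sum\<nu>: "sum \<nu> I = Suc (sum ?\<nu> I)" using sum_upd_less[of I j \<nu>] I j by simp
    have "\<exists>g. Lq_bounded q I B g \<and> has_weak_deriv per I ?\<nu> f' g"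
    proof (rule less.hyps[OF _ f'(2)])
      show "sum ?\<nu> I < sum \<nu> I" using sum\<nu> by simp
      show "?\<nu> i \<le> (\<mu>(j := \<mu> j - 1)) i" if "i \<in> I" for i
        using less.prems(2)[OF that] by (auto intro: diff_le_mono)
      show "U = UNIV \<and> torus_periodic I f'" if per
        using less.prems(3)[OF that] torus_periodic_deriv[OF _ _ j(1)] f'(1) by blast
    qed
    then obtain g where g: "Lq_bounded q I B g" "has_weak_deriv per I ?\<nu> f' g" by blast
    have cf': "continuous_on (unit_cube I) f'"
      using diff_class_bound[OF f'(2)] by (simp add: Lq_bounded_def)
    have "has_weak_deriv per I \<nu> f g"
      unfolding has_weak_deriv_def
    proof (intro conjI allI impI)
      show "integrable (cube_measure I) f" by (rule integrable_cube_continuous[OF I cf])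
      show "integrable (cube_measure I) g" using g(2) by (simp add: has_weak_deriv_def)
      fix \<phi> assume \<phi>: "\<forall>j\<in>I. test_fun per (\<phi> j)"
      have "(LINT x|cube_measure I. f x * of_real (\<Prod>j\<in>I. (deriv ^^ \<nu> j) (\<phi> j) (x j))) =
        - (LINT x|cube_measure I. f' x * of_real (\<Prod>i\<in>I. (deriv ^^ ?\<nu> i) (\<phi> i) (x i)))"
      proof (rule ibp_cube[where per = per, OF I j(1) U cf cf' f'(1)])
        show "U = UNIV \<and> torus_periodic I f" if per using less.prems(3)[OF that] .
        show "test_fun per (\<phi> i)" if "i \<in> I" for i using \<phi> that by blast
        show "\<nu> j > 0" by (rule j(2))
      qed
      also have "(LINT x|cube_measure I. f' x * of_real (\<Prod>i\<in>I. (deriv ^^ ?\<nu> i) (\<phi> i) (x i))) =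
        (-1) ^ (\<Sum>j\<in>I. ?\<nu> j) * (LINT x|cube_measure I. g x * of_real (\<Prod>j\<in>I. \<phi> j (x j)))"
        by (rule has_weak_derivD[OF g(2) \<phi>])
      also have "- ((-1) ^ (\<Sum>j\<in>I. ?\<nu> j) * (LINT x|cube_measure I. g x * of_real (\<Prod>j\<in>I. \<phi> j (x j)))) =
        (-1) ^ (\<Sum>j\<in>I. \<nu> j) * (LINT x|cube_measure I. g x * of_real (\<Prod>j\<in>I. \<phi> j (x j)))"
        unfolding sum\<nu> power_Suc by simp
      finally show "(LINT x|cube_measure I. f x * of_real (\<Prod>j\<in>I. (deriv ^^ \<nu> j) (\<phi> j) (x j))) =
        (-1) ^ (\<Sum>j\<in>I. \<nu> j) * (LINT x|cube_measure I. g x * of_real (\<Prod>j\<in>I. \<phi> j (x j)))" .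
    qed
    with g(1) show ?thesis by blast
  qed
qed

subsection \<open>Norms and quadrature errors\<close>

text \<open>The chosen weak derivative is replaced by the continuous \<open>g\<close>, equal almost
  everywhere; then Jensen's inequality for the inner integral and Fubini reduce the term to the L_2
  norm over the whole cube.\<close>

lemma mixed_norm_term_le:
  assumes I: "finite I" and u: "u \<subseteq> I" and g: "Lq_bounded 2 I B g" "has_weak_deriv per I \<nu> v g"
  shows "(LINT y|cube_measure u. (cmod (LINT z|cube_measure (I - u).
        weak_deriv per I \<nu> v (merge u (I - u) (y, z))))\<^sup>2) \<le> B\<^sup>2"
proof -
  let ?J = "I - u"
  let ?Mu = "cube_measure u" and ?MJ = "cube_measure ?J" and ?M = "cube_measure I"
  have fin: "finite u" "finite ?J" "u \<inter> ?J = {}" "u \<union> ?J = I" using I u finite_subset by auto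
  interpret Mu: finite_measure ?Mu by (rule finite_measure_cube[OF fin(1)])
  interpret MJ: finite_measure ?MJ by (rule finite_measure_cube[OF fin(2)])
  interpret P: pair_sigma_finite ?Mu ?MJ ..
  define w where "w = weak_deriv per I \<nu> v"
  have w: "has_weak_deriv per I \<nu> v w"
    unfolding w_def weak_deriv_def by (rule someI[of _ g]) (rule g(2))
  have "integrable ?M w" using w unfolding has_weak_deriv_def by blast
  then have wm: "w \<in> borel_measurable ?M" by simp
  have gc: "continuous_on (unit_cube I) g" and gB: "(LINT y|?M. (cmod (g y))\<^sup>2) \<le> B\<^sup>2"
    using g(1) by (auto simp: Lq_bounded_def)
  have gm: "g \<in> borel_measurable ?M" by (rule borel_measurable_cube[OF gc])
  have AE: "AE x in ?M. w x = g x" by (rule weak_deriv_unique[OF I w g(2)])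
  have mm: "merge u ?J \<in> measurable (?Mu \<Otimes>\<^sub>M ?MJ) ?M"
    using measurable_merge[of u ?J "\<lambda>_. unit_meas"] unfolding cube_measure_def fin(4) .
  \<comment> \<open>Gluing points of two complementary cubes preserves the measure. Hence an
    identity almost everywhere on the large cube holds almost everywhere on almost every
    slice.\<close>
  have eq: "distr (?Mu \<Otimes>\<^sub>M ?MJ) ?M (merge u ?J) = ?M"
    using cube.distr_merge[OF fin(3,1,2)] unfolding cube_measure_def fin(4) .
  have "AE x in distr (?Mu \<Otimes>\<^sub>M ?MJ) ?M (merge u ?J). w x = g x" unfolding eq by (rule AE)
  then have "AE p in ?Mu \<Otimes>\<^sub>M ?MJ. w (merge u ?J p) = g (merge u ?J p)"
    by (rule AE_distrD[OF mm])
  then have AE2: "AE y in ?Mu. AE z in ?MJ. w (merge u ?J (y, z)) = g (merge u ?J (y, z))"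
    by (rule P.AE_pair)
  have m: "(\<lambda>p. f (merge u ?J p)) \<in> borel_measurable (?Mu \<Otimes>\<^sub>M ?MJ)" if "f \<in> borel_measurable ?M" for f :: "point \<Rightarrow> complex"
    by (rule measurable_compose[OF mm that])
  have mz: "(\<lambda>z. f (merge u ?J (y, z))) \<in> borel_measurable ?MJ"
    if "f \<in> borel_measurable ?M" "y \<in> unit_cube u" for f :: "point \<Rightarrow> complex" and y
    by (rule measurable_compose[OF measurable_Pair1' m[OF that(1)]]) (use that in simp)
  have mI: "(\<lambda>y. LINT z|?MJ. f (merge u ?J (y, z))) \<in> borel_measurable ?Mu"
    if "f \<in> borel_measurable ?M" for f :: "point \<Rightarrow> complex"
    using MJ.borel_measurable_lebesgue_integral[of "\<lambda>y z. f (merge u ?J (y, z))" ?Mu] m[OF that]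
    by (simp add: case_prod_unfold)
  have "(LINT y|?Mu. (cmod (LINT z|?MJ. w (merge u ?J (y, z))))\<^sup>2) =
      (LINT y|?Mu. (cmod (LINT z|?MJ. g (merge u ?J (y, z))))\<^sup>2)"
  proof (rule integral_cong_AE)
    show "(\<lambda>y. (cmod (LINT z|?MJ. w (merge u ?J (y, z))))\<^sup>2) \<in> borel_measurable ?Mu"
      "(\<lambda>y. (cmod (LINT z|?MJ. g (merge u ?J (y, z))))\<^sup>2) \<in> borel_measurable ?Mu"
      using mI[OF wm] mI[OF gm] by (auto intro!: borel_measurable_power borel_measurable_norm)
    show "AE y in ?Mu. (cmod (LINT z|?MJ. w (merge u ?J (y, z))))\<^sup>2 = (cmod (LINT z|?MJ. g (merge u ?J (y, z))))\<^sup>2"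
      using AE2 AE_space
    proof eventually_elim
      case (elim y)
      then have "(LINT z|?MJ. w (merge u ?J (y, z))) = (LINT z|?MJ. g (merge u ?J (y, z)))"
        by (intro integral_cong_AE mz wm gm) auto
      then show ?case by simp
    qed
  qed
  also have "\<dots> \<le> (LINT y|?Mu. LINT z|?MJ. (cmod (g (merge u ?J (y, z))))\<^sup>2)"
  proof (rule integral_mono_AE)
    obtain b where b: "b \<ge> 0" "\<And>x. x \<in> unit_cube I \<Longrightarrow> norm (g x) \<le> b" using bounded_on_cube[OF gc] by blast
    have mem: "merge u ?J (y, z) \<in> unit_cube I" if "y \<in> unit_cube u" "z \<in> unit_cube ?J" for y z
      using measurable_space[OF mm, of "(y, z)"] that by (simp add: space_pair_measure)
    have "norm (LINT z|?MJ. g (merge u ?J (y, z))) \<le> b" if "y \<in> unit_cube u" for y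
      by (rule norm_integral_cube_le[OF fin(2) _ b(1)]) (use mem[OF that] b in blast)
    then show "integrable ?Mu (\<lambda>y. (cmod (LINT z|?MJ. g (merge u ?J (y, z))))\<^sup>2)"
      using mI[OF gm] by (intro integrable_cube_bounded[OF fin(1), of _ "b\<^sup>2"] borel_measurable_power borel_measurable_norm)
        (auto intro!: power_mono)
    have "norm (LINT z|?MJ. (cmod (g (merge u ?J (y, z))))\<^sup>2) \<le> b\<^sup>2" if "y \<in> unit_cube u" for y
      by (rule norm_integral_cube_le[OF fin(2)]) (use mem[OF that] b in \<open>auto intro!: power_mono\<close>)
    moreover have "(\<lambda>y. LINT z|?MJ. (cmod (g (merge u ?J (y, z))))\<^sup>2) \<in> borel_measurable ?Mu"
      using MJ.borel_measurable_lebesgue_integral[of "\<lambda>y z. (cmod (g (merge u ?J (y, z))))\<^sup>2" ?Mu] m[OF gm]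
      by (simp add: case_prod_unfold)
    ultimately show "integrable ?Mu (\<lambda>y. LINT z|?MJ. (cmod (g (merge u ?J (y, z))))\<^sup>2)"
      by (intro integrable_cube_bounded[OF fin(1), of _ "b\<^sup>2"]) auto
    show "AE y in ?Mu. (cmod (LINT z|?MJ. g (merge u ?J (y, z))))\<^sup>2 \<le> (LINT z|?MJ. (cmod (g (merge u ?J (y, z))))\<^sup>2)"
    proof (rule AE_I2)
      fix y assume "y \<in> space ?Mu"
      then have y: "y \<in> unit_cube u" by simp
      have "integrable ?MJ (\<lambda>z. (cmod (g (merge u ?J (y, z))))\<^sup>2)"
        by (rule integrable_cube_bounded[OF fin(2), of _ "b\<^sup>2"])
           (use mem[OF y] b mz[OF gm y] in \<open>auto intro!: power_mono borel_measurable_power borel_measurable_norm\<close>)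
      then show "(cmod (LINT z|?MJ. g (merge u ?J (y, z))))\<^sup>2 \<le> (LINT z|?MJ. (cmod (g (merge u ?J (y, z))))\<^sup>2)"
        by (intro cmod_integral_square_le MJ.finite_measure_axioms mz[OF gm y]) (simp_all add: fin(2))
    qed
  qed
  also have "\<dots> = (LINT x|?M. (cmod (g x))\<^sup>2)"
  proof -
    have "integrable ?M (\<lambda>x. (cmod (g x))\<^sup>2)"
      by (intro integrable_cube_continuous[OF I] continuous_on_power continuous_on_norm gc)
    then show ?thesis
      using cube.product_integral_fold[OF fin(3,1,2), of "\<lambda>x. (cmod (g x))\<^sup>2"]
      unfolding cube_measure_def fin(4) by simp
  qed
  also have "\<dots> \<le> B\<^sup>2" by (rule gB)
  finally show ?thesis unfolding w_def .
qed

lemma mixed_norm_le: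
  assumes I: "finite I" and \<gamma>: "\<And>u. u \<subseteq> I \<Longrightarrow> 0 < \<gamma> u" and "0 \<le> B"
    and g: "\<And>u. u \<subseteq> I \<Longrightarrow> \<exists>g. Lq_bounded 2 I B g \<and> has_weak_deriv per I (deriv_order u \<alpha>) v g"
  shows "mixed_norm per I \<alpha> \<gamma> v \<le> B * sqrt (\<Sum>u\<in>Pow I. 1 / \<gamma> u)"
proof -
  have "mixed_norm per I \<alpha> \<gamma> v \<le> sqrt (\<Sum>u\<in>Pow I. 1 / \<gamma> u * B\<^sup>2)"
    unfolding mixed_norm_def
  proof (intro real_sqrt_le_mono sum_mono mult_left_mono)
    fix u assume "u \<in> Pow I"
    then have u: "u \<subseteq> I" by simp
    then obtain h where "Lq_bounded 2 I B h" "has_weak_deriv per I (deriv_order u \<alpha>) v h" using g by blast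
    from mixed_norm_term_le[OF I u this]
    show "(LINT y|cube_measure u. (cmod (LINT z|cube_measure (I - u).
        weak_deriv per I (deriv_order u \<alpha>) v (merge u (I - u) (y, z))))\<^sup>2) \<le> B\<^sup>2" .
    show "0 \<le> 1 / \<gamma> u" using \<gamma>[OF u] by simp
  qed
  also have "\<dots> = B * sqrt (\<Sum>u\<in>Pow I. 1 / \<gamma> u)"
    using \<open>0 \<le> B\<close> unfolding sum_distrib_right[symmetric] real_sqrt_mult by simp
  finally show ?thesis .
qed

lemma Lq_class_mixed_space:
  assumes I: "finite I" and U: "{0..1} \<subseteq> U" and v: "Lq_class 2 I U B (\<lambda>_. \<alpha>) v"
    and per: "per \<Longrightarrow> U = UNIV \<and> torus_periodic I v"
  shows "v \<in> mixed_space per I \<alpha>"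
    and "u \<subseteq> I \<Longrightarrow> \<exists>g. Lq_bounded 2 I B g \<and> has_weak_deriv per I (deriv_order u \<alpha>) v g"
proof -
  show w: "\<exists>g. Lq_bounded 2 I B g \<and> has_weak_deriv per I (deriv_order u \<alpha>) v g" for u
    by (rule Lq_class_weak_deriv[OF I U v _ per]) simp_all
  have cont: "continuous_on (unit_cube I) v" using diff_class_bound[OF v] by (simp add: Lq_bounded_def)
  show "v \<in> mixed_space per I \<alpha>"
    unfolding mixed_space_def
  proof (intro CollectI conjI impI ballI allI)
    show "continuous_on (unit_cube I) v" by (rule cont)
  next
    fix y j assume "per" and y: "y \<in> unit_cube I" and j: "j \<in> I"
    have "y(j := 0) \<in> cube_on I UNIV"
      using cube_on_upd[OF subsetD[OF unit_cube_sub_cube_on[OF subset_UNIV] y] j UNIV_I] .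
    from torus_periodicD[OF conjunct2[OF per[OF \<open>per\<close>]] j this] show "v (y(j := 0)) = v (y(j := 1))" by simp
  next
    fix u
    obtain g where g: "Lq_bounded 2 I B g" "has_weak_deriv per I (deriv_order u \<alpha>) v g" using w by blast
    then have gc: "continuous_on (unit_cube I) g" by (simp add: Lq_bounded_def)
    have "g \<in> Lq 2 (cube_measure I)"
      unfolding Lq_def using borel_measurable_cube[OF gc]
        integrable_cube_continuous[OF I continuous_on_power[OF continuous_on_norm[OF gc]]] by simp
    with g(2) show "\<exists>g\<in>Lq 2 (cube_measure I). has_weak_deriv per I (deriv_order u \<alpha>) v g" by blast
  qed
qed

lemma Lq_class_scale:
  assumes "finite I" "Lq_class q I U B \<mu> f"
  shows "Lq_class q I U (\<bar>c\<bar> * B) \<mu> (\<lambda>x. of_real c * f x)"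
proof (rule diff_class_map[OF assms])
  fix f assume f: "Lq_bounded q I B f"
  have "(LINT y|cube_measure I. cmod (of_real c * f y) ^ q) = \<bar>c\<bar> ^ q * (LINT y|cube_measure I. cmod (f y) ^ q)"
    by (simp add: norm_mult power_mult_distrib)
  also have "\<dots> \<le> \<bar>c\<bar> ^ q * B ^ q" using f by (intro mult_left_mono) (auto simp: Lq_bounded_def)
  finally show "Lq_bounded q I (\<bar>c\<bar> * B) (\<lambda>x. of_real c * f x)"
    using f by (auto simp: Lq_bounded_def power_mult_distrib intro!: continuous_intros)
next
  fix j f f' assume "pderiv_rel I U j f f'"
  then show "pderiv_rel I U j (\<lambda>x. of_real c * f x) (\<lambda>x. of_real c * f' x)"
    by (rule pw_deriv_linear[OF bounded_linear_mult_right])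
qed

definition quad_error :: "nat set \<Rightarrow> nat \<Rightarrow> (nat \<Rightarrow> point) \<Rightarrow> (point \<Rightarrow> complex) \<Rightarrow> complex" where
  "quad_error I N pts v = (LINT y|cube_measure I. v y) - (\<Sum>k=1..N. v (pts k)) / of_nat N"

lemma quad_error_scale: "quad_error I N pts (\<lambda>x. c * v x) = c * quad_error I N pts v"
  by (simp add: quad_error_def right_diff_distrib sum_distrib_left)

text \<open>Stated in extended reals because the worst case error is a supremum that might be
  infinite.\<close>

lemma quad_error_le_wce:
  assumes I: "finite I" and U: "{0..1} \<subseteq> U" and v: "Lq_class 2 I U B (\<lambda>_. \<alpha>) v"
    and per: "per \<Longrightarrow> U = UNIV \<and> torus_periodic I v"
    and \<gamma>: "\<And>u. u \<subseteq> I \<Longrightarrow> 0 < \<gamma> u" and B: "0 < B"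
  shows "ennreal (cmod (quad_error I N pts v)) \<le>
    ennreal (B * sqrt (\<Sum>u\<in>Pow I. 1 / \<gamma> u)) * worst_case_error per I \<alpha> \<gamma> N pts"
proof -
  define K where "K = sqrt (\<Sum>u\<in>Pow I. 1 / \<gamma> u)"
  have "0 < (\<Sum>u\<in>Pow I. 1 / \<gamma> u)" by (rule sum_pos) (use I \<gamma> in auto)
  then have K: "0 < K" by (simp add: K_def)
  \<comment> \<open>\<open>B * K\<close> bounds the norm of \<open>v\<close>; the scaled function
    lies in the unit ball, and the error is homogeneous. Here \<open>B > 0\<close> and
    \<open>K > 0\<close> are needed.\<close>
  define c where "c = 1 / (B * K)"
  have c: "0 < c" using B K by (simp add: c_def)
  let ?v = "\<lambda>x. of_real c * v x"
  have vc: "Lq_class 2 I U (c * B) (\<lambda>_. \<alpha>) ?v" using Lq_class_scale[OF I v, of c] c by simp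
  have perc: "per \<Longrightarrow> U = UNIV \<and> torus_periodic I ?v"
    using per unfolding torus_periodic_def by simp
  have "mixed_norm per I \<alpha> \<gamma> ?v \<le> (c * B) * K"
    unfolding K_def by (rule mixed_norm_le[OF I \<gamma> _ Lq_class_mixed_space(2)[OF I U vc perc]]) (use c B in simp_all)
  also have "\<dots> = 1" using B K by (simp add: c_def)
  finally have "?v \<in> {v \<in> mixed_space per I \<alpha>. mixed_norm per I \<alpha> \<gamma> v \<le> 1}"
    using Lq_class_mixed_space(1)[OF I U vc perc] by blast
  then have le: "ennreal (cmod (quad_error I N pts ?v)) \<le> worst_case_error per I \<alpha> \<gamma> N pts"
    unfolding worst_case_error_def quad_error_def by (rule SUP_upper2) (rule order_refl)
  have "cmod (quad_error I N pts v) = B * K * cmod (quad_error I N pts ?v)"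
    unfolding quad_error_scale norm_mult norm_of_real using B K by (simp add: c_def)
  then have "ennreal (cmod (quad_error I N pts v)) = ennreal (B * K) * ennreal (cmod (quad_error I N pts ?v))"
    using B K by (simp add: ennreal_mult)
  also have "\<dots> \<le> ennreal (B * K) * worst_case_error per I \<alpha> \<gamma> N pts" by (rule mult_left_mono[OF le]) simp
  finally show ?thesis unfolding K_def .
qed

subsection \<open>Mollification on the torus\<close>

text \<open>The mean of cos^(2n) over a period, given by its Wallis recursion.\<close>

primrec kern_mass :: "nat \<Rightarrow> real" where
  "kern_mass 0 = 1"
| "kern_mass (Suc n) = (2 * n + 1) / (2 * n + 2) * kern_mass n"

text \<open>The de la Vallee Poussin kernel: smooth, nonnegative, even, 1-periodic and of mass 1.
  Its concentration can be computed exactly.\<close>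

definition kern :: "nat \<Rightarrow> real \<Rightarrow> real" where
  "kern n t = cos (pi * t) ^ (2 * n) / kern_mass n"

lemma kern_mass_pos: "0 < kern_mass n"
  by (induction n) auto

lemma smooth_kern: "smooth (kern n)"
proof -
  have "smooth (\<lambda>t. cos (pi * t + 0) ^ (2 * n) * (1 / kern_mass n))"
    by (intro smooth_mult smooth_const smooth_power smooth_cos_affine)
  then show ?thesis unfolding kern_def by simp
qed

lemma kern_periodic: "kern n (t + 1) = kern n t"
proof -
  have "cos (pi * (t + 1)) = - cos (pi * t)" by (simp add: distrib_left)
  then show ?thesis by (simp add: kern_def power_mult)
qed

lemma kern_nonneg: "0 \<le> kern n t"
  using kern_mass_pos[of n] by (simp add: kern_def power_mult)

lemma kern_even: "kern n (- t) = kern n t"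
  by (simp add: kern_def)

text \<open>The recursion comes from differentiating sin times cos^(2n+1); this function has period
  1 in t, so its boundary values cancel.\<close>

lemma integral_cos_power: "(LINT t|unit_meas. cos (pi * (x - t)) ^ (2 * n)) = kern_mass n"
proof (induction n)
  case 0
  then show ?case using unit_meas.finite_measure_axioms by (simp add: measure_restrict_space)
next
  case (Suc n)
  let ?s = "\<lambda>t. sin (pi * (x - t))" and ?c = "\<lambda>t. cos (pi * (x - t))"
  have i: "integrable unit_meas (\<lambda>t. ?c t ^ k)" for k
    by (intro integrable_unit_continuous continuous_intros)
  have "(LINT t|unit_meas. (2 * n + 2) * ?c t ^ (2 * Suc n) - (2 * n + 1) * ?c t ^ (2 * n)) =
      (- (1 / pi) * (?s 1 * ?c 1 ^ (2 * n + 1))) - (- (1 / pi) * (?s 0 * ?c 0 ^ (2 * n + 1)))"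
  proof (rule integral_unit_FTC)
    fix t :: real
    have ds: "(?s has_field_derivative ?c t * (- pi)) (at t within {0..1})"
      by (auto intro!: derivative_eq_intros)
    have dc: "(?c has_field_derivative - ?s t * (- pi)) (at t within {0..1})"
      by (auto intro!: derivative_eq_intros)
    have dp: "((\<lambda>t. ?c t ^ (2 * n + 1)) has_field_derivative real (2 * n + 1) * ((- ?s t * (- pi)) * ?c t ^ (2 * n))) (at t within {0..1})"
      using DERIV_power[OF dc, of "2 * n + 1"] by simp
    have "((\<lambda>t. - (1 / pi) * (?s t * ?c t ^ (2 * n + 1))) has_field_derivative
        - (1 / pi) * ((?c t * (- pi)) * ?c t ^ (2 * n + 1) +
           (real (2 * n + 1) * ((- ?s t * (- pi)) * ?c t ^ (2 * n))) * ?s t)) (at t within {0..1})"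
      by (rule DERIV_cmult[OF DERIV_mult[OF ds dp]])
    also have "- (1 / pi) * ((?c t * (- pi)) * ?c t ^ (2 * n + 1) +
           (real (2 * n + 1) * ((- ?s t * (- pi)) * ?c t ^ (2 * n))) * ?s t) =
        ?c t ^ (2 * Suc n) - (2 * n + 1) * (?c t ^ (2 * n) * (?s t)\<^sup>2)"
    proof -
      have "- (1 / pi) * ((a * (- pi)) * p + (k * ((- b * (- pi)) * q)) * b) = a * p - k * (q * b\<^sup>2)"
        for a b p q k :: real by (simp add: field_simps power2_eq_square)
      note alg = this[of "?c t" "?c t ^ (2 * n + 1)" "real (2 * n + 1)" "?s t" "?c t ^ (2 * n)"]
      have "2 * Suc n = Suc (2 * n + 1)" by simp
      then have e1: "?c t ^ (2 * Suc n) = ?c t * ?c t ^ (2 * n + 1)" by (simp only: power_Suc)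
      show ?thesis unfolding e1 using alg by simp
    qed
    also have "\<dots> = (2 * n + 2) * ?c t ^ (2 * Suc n) - (2 * n + 1) * ?c t ^ (2 * n)"
      unfolding sin_squared_eq by (simp add: algebra_simps power2_eq_square)
    finally show "((\<lambda>t. - (1 / pi) * (?s t * ?c t ^ (2 * n + 1))) has_vector_derivative
        (2 * n + 2) * ?c t ^ (2 * Suc n) - (2 * n + 1) * ?c t ^ (2 * n)) (at t within {0..1})"
      by (simp add: has_real_derivative_iff_has_vector_derivative)
  qed (intro continuous_intros)
  also have "\<dots> = 0"
    by (simp add: right_diff_distrib sin_diff cos_diff power_mult_distrib)
  finally have "(LINT t|unit_meas. (2 * n + 2) * ?c t ^ (2 * Suc n) - (2 * n + 1) * ?c t ^ (2 * n)) = 0" .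
  moreover have "(LINT t|unit_meas. (2 * n + 2) * ?c t ^ (2 * Suc n) - (2 * n + 1) * ?c t ^ (2 * n)) =
      (LINT t|unit_meas. (2 * n + 2) * ?c t ^ (2 * Suc n)) - (LINT t|unit_meas. (2 * n + 1) * ?c t ^ (2 * n))"
    by (rule Bochner_Integration.integral_diff; rule integrable_mult_right; rule i)
  ultimately have "(2 * n + 2) * (LINT t|unit_meas. ?c t ^ (2 * Suc n)) - (2 * n + 1) * (LINT t|unit_meas. ?c t ^ (2 * n)) = 0"
    unfolding integral_mult_right_zero by simp
  then show ?case unfolding Suc kern_mass.simps by (simp add: field_simps)
qed

lemma continuous_kern_line: "continuous_on S (\<lambda>t. kern n (x - t))"
  unfolding kern_def using kern_mass_pos[of n] by (intro continuous_intros) simp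

lemma integral_kern: "(LINT t|unit_meas. kern n (x - t)) = 1"
  using integral_cos_power[of x n] kern_mass_pos[of n] by (simp add: kern_def)

text \<open>Since sin^2 = 1 - cos^2, this moment is 1 minus a quotient of consecutive masses. Its
  decay in \<open>n\<close> expresses the concentration of the kernel.\<close>

lemma integral_kern_sin: "(LINT t|unit_meas. kern n (x - t) * (sin (pi * (x - t)))\<^sup>2) = 1 / (2 * n + 2)"
proof -
  have i: "integrable unit_meas (\<lambda>t. cos (pi * (x - t)) ^ k)" for k
    by (intro integrable_unit_continuous continuous_intros)
  have "kern n (x - t) * (sin (pi * (x - t)))\<^sup>2 =
     (cos (pi * (x - t)) ^ (2 * n) - cos (pi * (x - t)) ^ (2 * Suc n)) / kern_mass n" for t
    unfolding kern_def sin_squared_eq by (simp add: field_simps power2_eq_square)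
  then have "(LINT t|unit_meas. kern n (x - t) * (sin (pi * (x - t)))\<^sup>2) =
      (LINT t|unit_meas. (cos (pi * (x - t)) ^ (2 * n) - cos (pi * (x - t)) ^ (2 * Suc n)) / kern_mass n)"
    by simp
  also have "\<dots> = (kern_mass n - kern_mass (Suc n)) / kern_mass n"
    using i[of "2 * n"] i[of "2 * Suc n"] integral_cos_power[of x n] integral_cos_power[of x "Suc n"]
    by (simp del: mult_Suc_right kern_mass.simps)
  also have "\<dots> = 1 - (2 * n + 1) / (2 * n + 2)" using kern_mass_pos[of n] by (simp add: diff_divide_distrib)
  also have "\<dots> = 1 / (2 * n + 2)"
  proof -
    have "2 * real n + 2 \<noteq> 0" by linarith
    then show ?thesis by (simp add: divide_simps)
  qed
  finally show ?thesis by simp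
qed

text \<open>Convolution on the torus with the product kernel, differentiated \<nu>_j times in x_j.
  For \<open>\<nu> = 0\<close> it is the smoothed function, and increasing \<nu> yields its partial
  derivatives.\<close>

definition mollify :: "nat set \<Rightarrow> nat \<Rightarrow> (nat \<Rightarrow> nat) \<Rightarrow> (point \<Rightarrow> complex) \<Rightarrow> point \<Rightarrow> complex" where
  "mollify I n \<nu> f x = (LINT y|cube_measure I. f y * of_real (\<Prod>j\<in>I. (deriv ^^ \<nu> j) (kern n) (x j - y j)))"

lemma kern_bound:
  obtains B where "1 \<le> B" "\<And>k t. k \<le> N \<Longrightarrow> \<bar>(deriv ^^ k) (kern n) t\<bar> \<le> B"
proof -
  have "\<forall>k. \<exists>B. 0 \<le> B \<and> (\<forall>t. \<bar>(deriv ^^ k) (kern n) t\<bar> \<le> B)"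
    using periodic_smooth_bounded[OF smooth_kern kern_periodic] by metis
  then obtain b where "\<forall>k. 0 \<le> b k \<and> (\<forall>t. \<bar>(deriv ^^ k) (kern n) t\<bar> \<le> b k)" by (rule choice[THEN exE])
  then have b: "0 \<le> b k" "\<bar>(deriv ^^ k) (kern n) t\<bar> \<le> b k" for k t by simp_all
  have "b k \<le> 1 + (\<Sum>k\<le>N. b k)" if "k \<le> N" for k
    using member_le_sum[of k "{..N}" b] b(1) that by force
  then have "\<bar>(deriv ^^ k) (kern n) t\<bar> \<le> 1 + (\<Sum>k\<le>N. b k)" if "k \<le> N" for k t
    using b(2)[of k t] that by force
  then show ?thesis using that[of "1 + (\<Sum>k\<le>N. b k)"] sum_nonneg[of "{..N}" b] b(1) by simp
qed

lemma kern_prod_bound: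
  assumes "finite I"
  obtains B where "0 \<le> B" "\<And>x y :: point. \<bar>\<Prod>j\<in>I. (deriv ^^ \<nu> j) (kern n) (x j - y j)\<bar> \<le> B"
proof -
  obtain B where B: "1 \<le> B" "\<And>k t. k \<le> sum \<nu> I \<Longrightarrow> \<bar>(deriv ^^ k) (kern n) t\<bar> \<le> B"
    using kern_bound[of "sum \<nu> I" n] by blast
  have "\<bar>\<Prod>j\<in>I. (deriv ^^ \<nu> j) (kern n) (x j - y j)\<bar> \<le> (\<Prod>j\<in>I. B)" for x y :: point
    unfolding abs_prod by (intro prod_mono conjI abs_ge_zero B(2) member_le_sum assms) auto
  then show ?thesis using that[of "\<Prod>j\<in>I. B"] B(1) by (simp add: prod_nonneg)
qed

lemma continuous_kern_prod:
  "continuous_on S (\<lambda>y. complex_of_real (\<Prod>j\<in>I. (deriv ^^ \<nu> j) (kern n) (x j - y j)))"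
proof (intro continuous_on_of_real continuous_on_prod)
  fix j
  have "continuous_on UNIV ((deriv ^^ \<nu> j) (kern n))" by (rule smooth_funpow_continuous[OF smooth_kern])
  then show "continuous_on S (\<lambda>y. (deriv ^^ \<nu> j) (kern n) (x j - y j))"
    by (rule continuous_on_compose2)
       (intro continuous_on_diff continuous_on_const continuous_on_subset[OF continuous_on_product_coordinates], simp_all)
qed

lemma integrable_mollify:
  fixes f :: "point \<Rightarrow> complex"
  assumes "finite I" "integrable (cube_measure I) f"
  shows "integrable (cube_measure I) (\<lambda>y. f y * of_real (\<Prod>j\<in>I. (deriv ^^ \<nu> j) (kern n) (x j - y j)))"
proof -
  obtain B where B: "0 \<le> B" "\<And>x y. \<bar>\<Prod>j\<in>I. (deriv ^^ \<nu> j) (kern n) (x j - y j)\<bar> \<le> B"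
    using kern_prod_bound[OF assms(1), of \<nu> n] by blast
  show ?thesis
  proof (rule Bochner_Integration.integrable_bound[of _ "\<lambda>y. cmod (f y) * B"])
    show "integrable (cube_measure I) (\<lambda>y. cmod (f y) * B)" using assms(2) by simp
    show "(\<lambda>y. f y * of_real (\<Prod>j\<in>I. (deriv ^^ \<nu> j) (kern n) (x j - y j))) \<in> borel_measurable (cube_measure I)"
      by (intro borel_measurable_times borel_measurable_cube[OF continuous_kern_prod] borel_measurable_integrable assms)
    show "AE y in cube_measure I. norm (f y * of_real (\<Prod>j\<in>I. (deriv ^^ \<nu> j) (kern n) (x j - y j))) \<le> norm (cmod (f y) * B)"
    proof (rule AE_I2)
      fix y
      have "cmod (f y) * \<bar>\<Prod>j\<in>I. (deriv ^^ \<nu> j) (kern n) (x j - y j)\<bar> \<le> cmod (f y) * B"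
        by (intro mult_left_mono B norm_ge_zero)
      then show "norm (f y * of_real (\<Prod>j\<in>I. (deriv ^^ \<nu> j) (kern n) (x j - y j))) \<le> norm (cmod (f y) * B)"
        using B(1) by (simp only: norm_mult norm_of_real real_norm_def abs_mult abs_norm_cancel abs_of_nonneg)
    qed
  qed
qed

text \<open>Differentiation under the integral sign: the majorant \<open>w\<close> of the derivative
  also dominates the difference quotients, by the mean value inequality.\<close>

lemma has_vector_derivative_integral:
  fixes h h' :: "real \<Rightarrow> 'a \<Rightarrow> complex"
  assumes i: "\<And>t. integrable M (h t)"
    and d: "\<And>t y. y \<in> space M \<Longrightarrow> ((\<lambda>t. h t y) has_vector_derivative h' t y) (at t)"
    and w: "integrable M w" "\<And>t y. y \<in> space M \<Longrightarrow> cmod (h' t y) \<le> w y"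
    and m: "h' t0 \<in> borel_measurable M"
  shows "((\<lambda>t. LINT y|M. h t y) has_vector_derivative (LINT y|M. h' t0 y)) (at t0)"
  unfolding has_vector_derivative_iff_quotient tendsto_at_iff_sequentially
proof (intro allI impI)
  fix T :: "nat \<Rightarrow> real" assume T: "\<forall>n. T n \<in> UNIV - {t0}" "T \<longlonglongrightarrow> t0"
  have "(\<lambda>n. LINT y|M. (h (T n) y - h t0 y) / of_real (T n - t0)) \<longlonglongrightarrow> (LINT y|M. h' t0 y)"
  proof (rule integral_dominated_convergence[OF m _ w(1)])
    show "(\<lambda>y. (h (T n) y - h t0 y) / of_real (T n - t0)) \<in> borel_measurable M" for n
      using i by (intro borel_measurable_divide borel_measurable_diff borel_measurable_const) auto
    show "AE y in M. (\<lambda>n. (h (T n) y - h t0 y) / of_real (T n - t0)) \<longlonglongrightarrow> h' t0 y"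
    proof (rule AE_I2)
      fix y assume "y \<in> space M"
      then have "((\<lambda>t. h t y) has_vector_derivative h' t0 y) (at t0)" by (rule d)
      then show "(\<lambda>n. (h (T n) y - h t0 y) / of_real (T n - t0)) \<longlonglongrightarrow> h' t0 y"
        using T unfolding has_vector_derivative_iff_quotient tendsto_at_iff_sequentially by (auto simp: o_def)
    qed
    show "AE y in M. norm ((h (T n) y - h t0 y) / of_real (T n - t0)) \<le> w y" for n
    proof (rule AE_I2)
      fix y assume y: "y \<in> space M"
      have "cmod (h (T n) y - h t0 y) \<le> w y * \<bar>T n - t0\<bar>"
        by (rule norm_increment_le[of UNIV "\<lambda>t. h t y" "\<lambda>t. h' t y"]) (use d[OF y] w(2)[OF y] in auto)
      then show "norm ((h (T n) y - h t0 y) / of_real (T n - t0)) \<le> w y"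
        using T(1) by (simp add: norm_divide divide_le_eq del: of_real_diff)
    qed
  qed
  moreover have "(LINT y|M. (h (T n) y - h t0 y) / of_real (T n - t0)) =
      ((LINT y|M. h (T n) y) - (LINT y|M. h t0 y)) / of_real (T n - t0)" for n
    using i by simp
  ultimately show "((\<lambda>t. ((LINT y|M. h t y) - (LINT y|M. h t0 y)) / of_real (t - t0)) \<circ> T) \<longlonglongrightarrow> (LINT y|M. h' t0 y)"
    by (simp only: o_def)
qed

lemma mollify_deriv:
  assumes I: "finite I" and j: "j \<in> I" and f: "integrable (cube_measure I) f"
  shows "pderiv_rel I UNIV j (mollify I n \<nu> f) (mollify I n (\<nu>(j := Suc (\<nu> j))) f)"
proof (rule pw_derivI)
  fix x :: point and u :: unit
  let ?J = "I - {j}" and ?k = "\<lambda>i. (deriv ^^ \<nu> i) (kern n)" and ?\<nu> = "\<nu>(j := Suc (\<nu> j))"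
  define c where "c y = f y * of_real (\<Prod>i\<in>?J. ?k i (x i - y i))" for y
  have p1: "f y * of_real (\<Prod>i\<in>I. ?k i ((x(j := t)) i - y i)) = c y * of_real (?k j (t - y j))" for t y
  proof -
    have "(\<Prod>i\<in>?J. ?k i ((x(j := t)) i - y i)) = (\<Prod>i\<in>?J. ?k i (x i - y i))" by (intro prod.cong refl) auto
    then show ?thesis unfolding c_def prod.remove[OF I j] by (simp only: fun_upd_same of_real_mult mult_ac)
  qed
  have p2: "f y * of_real (\<Prod>i\<in>I. (deriv ^^ ?\<nu> i) (kern n) ((x(j := t)) i - y i)) =
     c y * of_real ((deriv ^^ Suc (\<nu> j)) (kern n) (t - y j))" for t y
  proof -
    have "(\<Prod>i\<in>?J. (deriv ^^ ?\<nu> i) (kern n) ((x(j := t)) i - y i)) = (\<Prod>i\<in>?J. ?k i (x i - y i))"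
      by (intro prod.cong refl) auto
    then show ?thesis unfolding c_def prod.remove[OF I j] by (simp only: fun_upd_same of_real_mult mult_ac)
  qed
  obtain B where B: "0 \<le> B" "\<And>x y. \<bar>\<Prod>i\<in>I. (deriv ^^ ?\<nu> i) (kern n) (x i - y i)\<bar> \<le> B"
    using kern_prod_bound[OF I, of ?\<nu> n] by blast
  have "((\<lambda>t. LINT y|cube_measure I. f y * of_real (\<Prod>i\<in>I. ?k i ((x(j := t)) i - y i))) has_vector_derivative
     (LINT y|cube_measure I. f y * of_real (\<Prod>i\<in>I. (deriv ^^ ?\<nu> i) (kern n) ((x(j := x j)) i - y i)))) (at (x j))"
  proof (rule has_vector_derivative_integral[where w = "\<lambda>y. cmod (f y) * B"
        and h' = "\<lambda>t y. f y * of_real (\<Prod>i\<in>I. (deriv ^^ ?\<nu> i) (kern n) ((x(j := t)) i - y i))"])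
    show "integrable (cube_measure I) (\<lambda>y. f y * of_real (\<Prod>i\<in>I. ?k i ((x(j := t)) i - y i)))" for t
      by (rule integrable_mollify[OF I f])
    show "integrable (cube_measure I) (\<lambda>y. cmod (f y) * B)" using f by simp
    show "(\<lambda>y. f y * of_real (\<Prod>i\<in>I. (deriv ^^ ?\<nu> i) (kern n) ((x(j := x j)) i - y i))) \<in> borel_measurable (cube_measure I)"
      by (rule borel_measurable_integrable[OF integrable_mollify[OF I f]])
    show "cmod (f y * of_real (\<Prod>i\<in>I. (deriv ^^ ?\<nu> i) (kern n) ((x(j := t)) i - y i))) \<le> cmod (f y) * B" for t y
      unfolding norm_mult norm_of_real by (intro mult_left_mono B norm_ge_zero)
    show "((\<lambda>t. f y * of_real (\<Prod>i\<in>I. ?k i ((x(j := t)) i - y i))) has_vector_derivative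
       f y * of_real (\<Prod>i\<in>I. (deriv ^^ ?\<nu> i) (kern n) ((x(j := t)) i - y i))) (at t)" for t y
    proof -
      have "((\<lambda>t. ?k j (t - y j)) has_field_derivative (deriv ^^ Suc (\<nu> j)) (kern n) (t - y j) * 1) (at t)"
        by (rule DERIV_chain2[OF smooth_deriv_funpow[OF smooth_kern]]) (auto intro!: derivative_eq_intros)
      then have "((\<lambda>t. ?k j (t - y j)) has_field_derivative (deriv ^^ Suc (\<nu> j)) (kern n) (t - y j)) (at t)"
        by (simp only: mult_1_right)
      from bounded_linear.has_vector_derivative[OF bounded_linear_mult_right[of "c y"] has_vector_derivative_of_real[OF this]]
      show ?thesis unfolding p1 p2 .
    qed
  qed
  then show "((\<lambda>t. mollify I n \<nu> f (x(j := t))) has_vector_derivative mollify I n ?\<nu> f x) (at (x j))"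
    unfolding mollify_def fun_upd_triv .
qed

text \<open>For fixed x the reflected kernel is a periodic test function of y, so the derivative can
  be moved from the kernel onto \<open>f\<close>. The sign of the weak derivative cancels that of
  the reflection.\<close>

lemma mollify_weak_deriv:
  assumes "has_weak_deriv True I \<nu> f g"
  shows "mollify I n \<nu> f = mollify I n (\<lambda>_. 0) g"
proof
  fix x :: point
  let ?\<phi> = "\<lambda>j t. kern n (x j - t)"
  have "test_fun True (?\<phi> j)" for j
  proof -
    have "smooth (\<lambda>t. kern n ((-1) * t + x j))" by (rule smooth_compose[OF smooth_kern smooth_affine])
    moreover have "kern n (x j - (t + 1)) = kern n (x j - t)" for t
      using kern_periodic[of n "x j - (t + 1)"] by (simp add: algebra_simps)
    ultimately show ?thesis by (simp add: test_fun_def)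
  qed
  then have "(LINT y|cube_measure I. f y * of_real (\<Prod>j\<in>I. (deriv ^^ \<nu> j) (?\<phi> j) (y j))) =
    (-1) ^ (\<Sum>j\<in>I. \<nu> j) * (LINT y|cube_measure I. g y * of_real (\<Prod>j\<in>I. ?\<phi> j (y j)))"
    by (intro has_weak_derivD[OF assms]) simp
  moreover have "(\<Prod>j\<in>I. (deriv ^^ \<nu> j) (?\<phi> j) (y j)) =
      (-1) ^ (\<Sum>j\<in>I. \<nu> j) * (\<Prod>j\<in>I. (deriv ^^ \<nu> j) (kern n) (x j - y j))" for y :: point
    unfolding deriv_funpow_shift[OF smooth_kern] prod.distrib power_sum ..
  moreover have "(LINT y|cube_measure I. f y * of_real ((-1) ^ (\<Sum>j\<in>I. \<nu> j) * (\<Prod>j\<in>I. (deriv ^^ \<nu> j) (kern n) (x j - y j)))) =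
      (-1) ^ (\<Sum>j\<in>I. \<nu> j) * mollify I n \<nu> f x"
    unfolding mollify_def integral_mult_right_zero[symmetric]
    by (simp only: of_real_mult of_real_power of_real_minus of_real_1 mult.left_commute)
  ultimately have "(-1) ^ (\<Sum>j\<in>I. \<nu> j) * mollify I n \<nu> f x =
      (-1) ^ (\<Sum>j\<in>I. \<nu> j) * (LINT y|cube_measure I. g y * of_real (\<Prod>j\<in>I. ?\<phi> j (y j)))"
    by (simp only:)
  then show "mollify I n \<nu> f x = mollify I n (\<lambda>_. 0) g x"
    unfolding mollify_def by simp
qed

definition kprod :: "nat set \<Rightarrow> nat \<Rightarrow> point \<Rightarrow> point \<Rightarrow> real" where
  "kprod I n x y = (\<Prod>j\<in>I. kern n (x j - y j))"

lemma mollify_0: "mollify I n (\<lambda>_. 0) f x = (LINT y|cube_measure I. f y * of_real (kprod I n x y))"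
  by (simp add: mollify_def kprod_def)

lemma kprod_nonneg: "0 \<le> kprod I n x y"
  unfolding kprod_def by (intro prod_nonneg kern_nonneg)

lemma kprod_commute: "kprod I n x y = kprod I n y x"
proof -
  have "kern n (x j - y j) = kern n (y j - x j)" for j using kern_even[of n "y j - x j"] by simp
  then show ?thesis by (simp add: kprod_def)
qed

lemma integrable_kern_line: "integrable unit_meas (\<lambda>t. kern n (x - t))"
  by (rule integrable_unit_continuous[OF continuous_kern_line])

lemma integral_kprod: "finite I \<Longrightarrow> (LINT y|cube_measure I. kprod I n x y) = 1"
  unfolding kprod_def cube_measure_def
  using cube.product_integral_prod[of I "\<lambda>j t. kern n (x j - t)"] integrable_kern_line by (simp add: integral_kern)

lemma continuous_kprod: "continuous_on S (\<lambda>y. kprod I n x y)"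
  unfolding kprod_def
  by (intro continuous_on_prod continuous_on_compose2[OF continuous_kern_line[of UNIV]]
        continuous_on_subset[OF continuous_on_product_coordinates]) simp_all

lemma kprod_bound:
  assumes "finite I"
  obtains B where "0 \<le> B" "\<And>x y. kprod I n x y \<le> B"
proof -
  obtain B where B: "0 \<le> B" "\<And>x y. \<bar>\<Prod>j\<in>I. (deriv ^^ 0) (kern n) (x j - y j)\<bar> \<le> B"
    using kern_prod_bound[OF assms, of "\<lambda>_. 0" n] by blast
  have "kprod I n x y \<le> B" for x y using B(2)[of x y] unfolding kprod_def by simp
  then show ?thesis using that B(1) by blast
qed

lemma mollify_continuous:
  assumes I: "finite I" and f: "integrable (cube_measure I) f"
  shows "continuous_on S (mollify I n \<nu> f)"
  unfolding continuous_on_sequentially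
proof (intro allI ballI impI)
  fix X :: "nat \<Rightarrow> point" and a assume "(\<forall>k. X k \<in> S) \<and> X \<longlonglongrightarrow> a"
  then have X: "(\<lambda>k. X k j) \<longlonglongrightarrow> a j" for j
    using continuous_on_tendsto_compose[OF continuous_on_product_coordinates, of X a sequentially j] by simp
  obtain B where B: "0 \<le> B" "\<And>x y. \<bar>\<Prod>i\<in>I. (deriv ^^ \<nu> i) (kern n) (x i - y i)\<bar> \<le> B"
    using kern_prod_bound[OF I, of \<nu> n] by blast
  have "(\<lambda>k. mollify I n \<nu> f (X k)) \<longlonglongrightarrow> mollify I n \<nu> f a"
    unfolding mollify_def
  proof (rule integral_dominated_convergence[where w = "\<lambda>y. cmod (f y) * B"])
    show "integrable (cube_measure I) (\<lambda>y. cmod (f y) * B)" using f by simp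
    show "(\<lambda>y. f y * of_real (\<Prod>j\<in>I. (deriv ^^ \<nu> j) (kern n) (x j - y j))) \<in> borel_measurable (cube_measure I)" for x
      by (rule borel_measurable_integrable[OF integrable_mollify[OF I f]])
    then show "(\<lambda>y. f y * of_real (\<Prod>j\<in>I. (deriv ^^ \<nu> j) (kern n) (X k j - y j))) \<in> borel_measurable (cube_measure I)" for k .
    show "AE y in cube_measure I. norm (f y * of_real (\<Prod>j\<in>I. (deriv ^^ \<nu> j) (kern n) (X k j - y j))) \<le> cmod (f y) * B" for k
      unfolding norm_mult norm_of_real by (intro AE_I2 mult_left_mono B norm_ge_zero)
    have "isCont ((deriv ^^ \<nu> j) (kern n)) t" for j t
      by (rule DERIV_isCont[OF smooth_deriv_funpow[OF smooth_kern]])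
    then show "AE y in cube_measure I. (\<lambda>k. f y * of_real (\<Prod>j\<in>I. (deriv ^^ \<nu> j) (kern n) (X k j - y j)))
        \<longlonglongrightarrow> f y * of_real (\<Prod>j\<in>I. (deriv ^^ \<nu> j) (kern n) (a j - y j))"
      by (intro AE_I2 tendsto_mult tendsto_const tendsto_of_real tendsto_prod isCont_tendsto_compose[OF _ tendsto_diff[OF X tendsto_const]])
  qed
  then show "((mollify I n \<nu> f) \<circ> X) \<longlonglongrightarrow> mollify I n \<nu> f a" by (simp add: o_def)
qed

lemma mollify_periodic:
  assumes "finite I"
  shows "torus_periodic I (mollify I n (\<lambda>_. 0) f)"
  unfolding torus_periodic_def
proof (intro ballI)
  fix j and x :: point assume "j \<in> I"
  have "kern n ((x(j := x j + 1)) i - y i) = kern n (x i - y i)" for i y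
    using kern_periodic[of n "x i - y i"] by (cases "i = j") (simp_all add: algebra_simps)
  then show "mollify I n (\<lambda>_. 0) f (x(j := x j + 1)) = mollify I n (\<lambda>_. 0) f x"
    unfolding mollify_0 kprod_def by simp
qed

text \<open>For fixed x the kernel is a probability density in y. Jensen's inequality applied twice,
  to g and to |g|^2, bounds the fourth power by the kernel average of |g|^4; Fubini and the symmetry
  of the kernel then integrate out x.\<close>

lemma mollify_L4_bound:
  assumes I: "finite I" and g: "g \<in> Lq 4 (cube_measure I)"
  shows "(LINT x|cube_measure I. cmod (mollify I n (\<lambda>_. 0) g x) ^ 4) \<le> (LINT y|cube_measure I. cmod (g y) ^ 4)"
proof -
  let ?M = "cube_measure I"
  have gm: "g \<in> borel_measurable ?M" and g4: "integrable ?M (\<lambda>y. cmod (g y) ^ 4)"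
    using g by (auto simp: Lq_def)
  interpret F: finite_measure ?M by (rule finite_measure_cube[OF I])
  interpret P: pair_sigma_finite ?M ?M ..
  obtain B where B: "0 \<le> B" "\<And>x y. kprod I n x y \<le> B" using kprod_bound[OF I, of n] by blast
  have km: "kprod I n x \<in> borel_measurable ?M" for x by (rule borel_measurable_cube[OF continuous_kprod])
  have pm: "(\<lambda>p. kprod I n (fst p) (snd p)) \<in> borel_measurable (?M \<Otimes>\<^sub>M ?M)"
    unfolding kprod_def kern_def
    by (intro borel_measurable_prod borel_measurable_divide borel_measurable_power borel_measurable_const
          measurable_compose[OF _ borel_measurable_continuous_onI[of cos]] borel_measurable_times borel_measurable_diff
          measurable_compose[OF measurable_fst measurable_cube_component]
          measurable_compose[OF measurable_snd measurable_cube_component] continuous_intros)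
  have ik: "integrable ?M (kprod I n x)" for x
    by (rule integrable_cube_continuous[OF I continuous_kprod])
  have dens: "finite_measure (density ?M (\<lambda>y. ennreal (kprod I n x y)))"
    "measure (density ?M (\<lambda>y. ennreal (kprod I n x y))) (space (density ?M (\<lambda>y. ennreal (kprod I n x y)))) = 1" for x
  proof -
    have "emeasure (density ?M (\<lambda>y. ennreal (kprod I n x y))) (unit_cube I) = (\<integral>\<^sup>+y. ennreal (kprod I n x y) \<partial>?M)"
      using km sets.top[of ?M] by (subst emeasure_density) (auto intro!: nn_integral_cong simp: indicator_def)
    also have "\<dots> = ennreal (LINT y|?M. kprod I n x y)"
      by (rule nn_integral_eq_integral[OF ik]) (simp add: kprod_nonneg)
    finally have e: "emeasure (density ?M (\<lambda>y. ennreal (kprod I n x y))) (unit_cube I) = 1"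
      by (simp add: integral_kprod[OF I])
    then show "finite_measure (density ?M (\<lambda>y. ennreal (kprod I n x y)))" by (intro finite_measureI) simp
    show "measure (density ?M (\<lambda>y. ennreal (kprod I n x y))) (space (density ?M (\<lambda>y. ennreal (kprod I n x y)))) = 1"
      using e by (simp add: measure_def)
  qed
  note id1 = integral_density[OF _ km AE_I2[OF kprod_nonneg]] and id2 = integrable_density[OF _ km AE_I2[OF kprod_nonneg]]
  have i4: "integrable ?M (\<lambda>y. kprod I n x y *\<^sub>R cmod (g y) ^ 4)" for x
  proof (rule Bochner_Integration.integrable_bound[of _ "\<lambda>y. B * cmod (g y) ^ 4"])
    show "integrable ?M (\<lambda>y. B * cmod (g y) ^ 4)" using g4 by simp
    show "(\<lambda>y. kprod I n x y *\<^sub>R cmod (g y) ^ 4) \<in> borel_measurable ?M"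
      by (rule borel_measurable_scaleR[OF km borel_measurable_integrable[OF g4]])
    show "AE y in ?M. norm (kprod I n x y *\<^sub>R cmod (g y) ^ 4) \<le> norm (B * cmod (g y) ^ 4)"
      using B kprod_nonneg by (intro AE_I2) (auto simp: abs_mult intro!: mult_right_mono)
  qed
  have gm2: "(\<lambda>y. cmod (g y) ^ k) \<in> borel_measurable ?M" for k
    using gm by measurable
  have pt: "cmod (mollify I n (\<lambda>_. 0) g x) ^ 4 \<le> (LINT y|?M. kprod I n x y * cmod (g y) ^ 4)" for x
  proof -
    let ?N = "density ?M (\<lambda>y. ennreal (kprod I n x y))"
    interpret N: finite_measure ?N by (rule dens(1))
    have c4: "(cmod (complex_of_real (a\<^sup>2)))\<^sup>2 = a ^ 4" for a :: real
    proof -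
      have "(cmod (complex_of_real (a\<^sup>2)))\<^sup>2 = (a\<^sup>2)\<^sup>2" by (simp only: norm_of_real abs_power2)
      then show ?thesis by (simp add: power_mult[symmetric])
    qed
    have gN: "g \<in> borel_measurable ?N" using gm by simp
    have N4: "integrable ?N (\<lambda>y. cmod (g y) ^ 4)" unfolding id2[OF gm2] by (rule i4)
    have "integrable ?N (\<lambda>y. 1 + cmod (g y) ^ 4)" using N4 by simp
    then have N2: "integrable ?N (\<lambda>y. (cmod (g y))\<^sup>2)"
    proof (rule Bochner_Integration.integrable_bound)
      show "(\<lambda>y. (cmod (g y))\<^sup>2) \<in> borel_measurable ?N" using gm2[of 2] by simp
      have "(cmod z)\<^sup>2 \<le> 1 + cmod z ^ 4" for z
      proof -
        have "0 \<le> ((cmod z)\<^sup>2 - 1)\<^sup>2" "0 \<le> (cmod z)\<^sup>2" by simp_all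
        moreover have "((cmod z)\<^sup>2 - 1)\<^sup>2 = cmod z ^ 4 - 2 * (cmod z)\<^sup>2 + 1"
          by (simp add: power2_diff power_mult[symmetric])
        ultimately show ?thesis by linarith
      qed
      then show "AE y in ?N. norm ((cmod (g y))\<^sup>2) \<le> norm (1 + cmod (g y) ^ 4)"
        by (intro AE_I2) (simp add: abs_of_nonneg)
    qed
    have "(\<lambda>y. complex_of_real ((cmod (g y))\<^sup>2)) \<in> borel_measurable ?M"
      by (rule measurable_compose[OF gm2]) (rule borel_measurable_continuous_onI, intro continuous_intros)
    then have c2: "(\<lambda>y. complex_of_real ((cmod (g y))\<^sup>2)) \<in> borel_measurable ?N" by simp
    have "mollify I n (\<lambda>_. 0) g x = (LINT y|?N. g y)"
      unfolding mollify_0 id1[OF gm] by (simp add: scaleR_conv_of_real mult.commute)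
    then have "cmod (mollify I n (\<lambda>_. 0) g x) ^ 4 = ((cmod (LINT y|?N. g y))\<^sup>2)\<^sup>2" by (simp add: power_mult[symmetric])
    also have "\<dots> \<le> (LINT y|?N. (cmod (g y))\<^sup>2)\<^sup>2"
      by (intro power_mono cmod_integral_square_le N.finite_measure_axioms dens(2) N2 gN) simp
    also have "\<dots> = (cmod (LINT y|?N. complex_of_real ((cmod (g y))\<^sup>2)))\<^sup>2"
      unfolding integral_complex_of_real by simp
    also have "\<dots> \<le> (LINT y|?N. (cmod (complex_of_real ((cmod (g y))\<^sup>2)))\<^sup>2)"
      by (intro cmod_integral_square_le N.finite_measure_axioms dens(2) c2) (simp only: c4 N4)
    also have "\<dots> = (LINT y|?N. cmod (g y) ^ 4)" by (simp only: c4)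
    also have "\<dots> = (LINT y|?M. kprod I n x y * cmod (g y) ^ 4)" unfolding id1[OF gm2] by simp
    finally show ?thesis .
  qed
  let ?F = "\<lambda>x y. kprod I n x y * cmod (g y) ^ 4"
  have Fm: "(\<lambda>p. ?F (fst p) (snd p)) \<in> borel_measurable (?M \<Otimes>\<^sub>M ?M)"
    by (intro borel_measurable_times pm measurable_compose[OF measurable_snd gm2])
  have Fnn: "0 \<le> ?F x y" for x y using kprod_nonneg by simp
  have i5: "integrable ?M (?F x)" for x using i4[of x] by simp
  have Fle: "(LINT y|?M. ?F x y) \<le> B * (LINT y|?M. cmod (g y) ^ 4)" for x
    unfolding integral_mult_right_zero[symmetric]
    by (rule integral_mono[OF i5]) (use g4 B in \<open>auto intro!: mult_right_mono\<close>)
  have mF: "(\<lambda>x. LINT y|?M. ?F x y) \<in> borel_measurable ?M"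
    using F.borel_measurable_lebesgue_integral[of ?F ?M] Fm by (simp add: case_prod_unfold)
  have iF: "integrable ?M (\<lambda>x. LINT y|?M. ?F x y)"
    by (rule F.integrable_const_bound[OF _ mF, of "B * (LINT y|?M. cmod (g y) ^ 4)"])
       (use Fle Fnn in \<open>auto simp: abs_of_nonneg integral_nonneg\<close>)
  have "integrable (?M \<Otimes>\<^sub>M ?M) (\<lambda>p. ?F (fst p) (snd p))"
    by (rule P.Fubini_integrable[OF Fm]) (use iF i5 Fnn in \<open>simp_all add: abs_of_nonneg\<close>)
  then have fub: "(LINT x|?M. LINT y|?M. ?F x y) = (LINT y|?M. LINT x|?M. ?F x y)"
    using P.Fubini_integral[of ?F] by (simp add: case_prod_unfold)
  have "(LINT x|?M. cmod (mollify I n (\<lambda>_. 0) g x) ^ 4) \<le> (LINT x|?M. LINT y|?M. ?F x y)"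
  proof (rule integral_mono)
    have "integrable ?M g"
    proof (rule Bochner_Integration.integrable_bound[of _ "\<lambda>y. 1 + cmod (g y) ^ 4"])
      show "integrable ?M (\<lambda>y. 1 + cmod (g y) ^ 4)" using g4 by simp
      have "cmod z \<le> 1 + cmod z ^ 4" for z
      proof (cases "cmod z \<le> 1")
        case True then show ?thesis by (simp add: add_increasing2)
      next
        case False then have "cmod z ^ 1 \<le> cmod z ^ 4" by (intro power_increasing) auto
        then show ?thesis by simp
      qed
      then show "AE y in ?M. norm (g y) \<le> norm (1 + cmod (g y) ^ 4)" by (intro AE_I2) (simp add: abs_of_nonneg)
    qed (rule gm)
    then show "integrable ?M (\<lambda>x. cmod (mollify I n (\<lambda>_. 0) g x) ^ 4)"
      by (rule integrable_cube_continuous[OF I continuous_on_power[OF continuous_on_norm[OF mollify_continuous[OF I]]]])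
  qed (rule iF, rule pt)
  also have "\<dots> = (LINT y|?M. (LINT x|?M. kprod I n x y) * cmod (g y) ^ 4)"
    unfolding fub integral_mult_left_zero ..
  also have "\<dots> = (LINT y|?M. cmod (g y) ^ 4)"
  proof -
    have "(LINT x|?M. kprod I n x y) = (LINT x|?M. kprod I n y x)" for y
      by (rule Bochner_Integration.integral_cong[OF refl]) (rule kprod_commute)
    then show ?thesis unfolding integral_kprod[OF I] by simp
  qed
  finally show ?thesis .
qed

text \<open>With both coordinates in [0,1], sin(pi (x_j - y_j)) vanishes only if the coordinates are
  equal or are the two opposite end points. So x and y are the same point of the torus, and the
  coordinates can be exchanged one by one using the face condition.\<close>

lemma torus_zero_eq:
  assumes faces: "\<And>y j. y \<in> unit_cube I \<Longrightarrow> j \<in> I \<Longrightarrow> f (y(j := 0)) = f (y(j := 1))"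
    and I: "finite I" and x: "x \<in> unit_cube I" and y: "y \<in> unit_cube I"
    and z: "\<And>j. j \<in> I \<Longrightarrow> sin (pi * (x j - y j)) = 0"
  shows "f y = f x"
proof -
  define m where "m J = (\<lambda>j. if j \<in> J then y j else x j)" for J
  have m: "m J \<in> unit_cube I" if "J \<subseteq> I" for J
    using x y that by (fastforce simp: m_def unit_cube_def PiE_def extensional_def Pi_def)
  have "f (m J) = f x" if "J \<subseteq> I" for J
    using finite_subset[OF that I] that
  proof (induction J rule: finite_induct)
    case empty then show ?case by (simp add: m_def)
  next
    case (insert k J)
    then have k: "k \<in> I" "J \<subseteq> I" by auto
    have eq: "m (insert k J) = (m J)(k := y k)" "m J = (m J)(k := x k)"
      using insert.hyps by (auto simp: m_def fun_eq_iff)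
    have r: "0 \<le> x k" "x k \<le> 1" "0 \<le> y k" "y k \<le> 1" using unit_cubeD[OF x k(1)] unit_cubeD[OF y k(1)] by auto
    have np: "\<not> (0 < t \<and> t < 1)" if "sin (pi * t) = 0" for t
      using that sin_gt_zero[of "pi * t"] by auto
    have z': "sin (pi * (y k - x k)) = 0"
      using z[OF k(1)] sin_minus[of "pi * (x k - y k)"] by (simp add: algebra_simps)
    have "\<not> (0 < x k - y k \<and> x k - y k < 1)" "\<not> (0 < y k - x k \<and> y k - x k < 1)"
      using np[OF z[OF k(1)]] np[OF z'] by blast+
    then consider "y k = x k" | "y k = 0" "x k = 1" | "y k = 1" "x k = 0" using r by linarith
    then have "f ((m J)(k := y k)) = f ((m J)(k := x k))"
      using faces[OF m[OF k(2)] k(1)] by cases auto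
    moreover have "f (m J) = f x" by (rule insert.IH[OF k(2)])
    ultimately show ?case by (simp only: eq(1) eq(2)[symmetric])
  qed
  moreover have "m I = y"
    using x y by (auto simp: m_def unit_cube_def PiE_def extensional_def fun_eq_iff)
  ultimately show ?thesis by blast
qed

text \<open>The integrand is a product over the coordinates in which all factors but the one for
  \<open>j\<close> have integral 1.\<close>

lemma integral_kprod_sin:
  assumes I: "finite I" and j: "j \<in> I"
  shows "integrable (cube_measure I) (\<lambda>y. (sin (pi * (x j - y j)))\<^sup>2 * kprod I n x y)"
    and "(LINT y|cube_measure I. (sin (pi * (x j - y j)))\<^sup>2 * kprod I n x y) = 1 / (2 * real n + 2)"
proof -
  let ?f = "\<lambda>i t. kern n (x i - t) * (if i = j then (sin (pi * (x j - t)))\<^sup>2 else 1)"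
  have cs: "continuous_on {0..1} (\<lambda>t. (sin (pi * (x j - t)))\<^sup>2)" by (intro continuous_intros)
  have i: "integrable unit_meas (?f i)" for i
    by (rule integrable_unit_continuous, cases "i = j") (simp_all add: continuous_kern_line continuous_on_mult cs)
  have eq: "(sin (pi * (x j - y j)))\<^sup>2 * kprod I n x y = (\<Prod>i\<in>I. ?f i (y i))" for y
  proof -
    have "(\<Prod>i\<in>I. ?f i (y i)) = kprod I n x y * (\<Prod>i\<in>I. if i = j then (sin (pi * (x j - y i)))\<^sup>2 else 1)"
      unfolding kprod_def by (rule prod.distrib)
    also have "(\<Prod>i\<in>I. if i = j then (sin (pi * (x j - y i)))\<^sup>2 else 1) = (sin (pi * (x j - y j)))\<^sup>2"
      using j I by (simp add: prod.delta)
    finally show ?thesis by (simp only: mult.commute)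
  qed
  show "integrable (cube_measure I) (\<lambda>y. (sin (pi * (x j - y j)))\<^sup>2 * kprod I n x y)"
    unfolding eq cube_measure_def by (rule cube.product_integrable_prod[OF I i])
  have "(LINT y|cube_measure I. (sin (pi * (x j - y j)))\<^sup>2 * kprod I n x y) = (\<Prod>i\<in>I. LINT t|unit_meas. ?f i t)"
    unfolding eq cube_measure_def by (rule cube.product_integral_prod[OF I i])
  also have "\<dots> = (\<Prod>i\<in>I. if i = j then 1 / (2 * real n + 2) else 1)"
    by (rule prod.cong[OF refl]) (simp add: integral_kern integral_kern_sin)
  also have "\<dots> = 1 / (2 * real n + 2)" using j I by (simp add: prod.delta)
  finally show "(LINT y|cube_measure I. (sin (pi * (x j - y j)))\<^sup>2 * kprod I n x y) = 1 / (2 * real n + 2)" .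
qed

text \<open>As in Korovkin's theorem, the modulus of continuity of \<open>f\<close> at \<open>x\<close> is measured by the
  function \<open>\<Sum>\<^sub>j sin\<^sup>2(\<pi>(x\<^sub>j - y\<^sub>j))\<close>, on which the kernels are computed explicitly.\<close>

lemma torus_modulus:
  fixes f :: "point \<Rightarrow> complex"
  assumes faces: "\<And>y j. y \<in> unit_cube I \<Longrightarrow> j \<in> I \<Longrightarrow> f (y(j := 0)) = f (y(j := 1))"
    and I: "finite I" and x: "x \<in> unit_cube I" and f: "continuous_on (unit_cube I) f" and "0 < \<eta>"
  obtains K where "0 \<le> K" "\<And>y. y \<in> unit_cube I \<Longrightarrow> cmod (f y - f x) \<le> \<eta> + K * (\<Sum>j\<in>I. (sin (pi * (x j - y j)))\<^sup>2)"
proof -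
  let ?g = "\<lambda>y. cmod (f y - f x)" and ?q = "\<lambda>y. \<Sum>j\<in>I. (sin (pi * (x j - y j)))\<^sup>2"
  have cg: "continuous_on (unit_cube I) ?g" by (intro continuous_intros f)
  have cq: "continuous_on S ?q" for S
    by (intro continuous_on_sum continuous_on_power continuous_on_sin continuous_on_mult continuous_on_diff
        continuous_on_const continuous_on_subset[OF continuous_on_product_coordinates]) simp
  have q0: "0 \<le> ?q y" for y by (intro sum_nonneg) simp
  \<comment> \<open>Outside \<open>S\<close> the increment is already below \<eta>. On this compact
    set the sine sum cannot vanish, so it has a positive minimum there.\<close>
  define S where "S = {y \<in> unit_cube I. \<eta> \<le> ?g y}"
  have "closed S" unfolding S_def
    using continuous_closed_preimage[OF cg closed_unit_cube closed_atLeast[of \<eta>]]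
    by (simp add: vimage_def Int_def)
  then have "compact (unit_cube I \<inter> S)" by (rule compact_Int_closed[OF compact_unit_cube])
  moreover have "unit_cube I \<inter> S = S" by (auto simp: S_def)
  ultimately have cS: "compact S" by simp
  have qpos: "0 < ?q y" if "y \<in> S" for y
  proof (rule ccontr)
    assume "\<not> 0 < ?q y"
    then have "?q y = 0" using q0[of y] by linarith
    then have "\<forall>j\<in>I. (sin (pi * (x j - y j)))\<^sup>2 = 0" by (subst (asm) sum_nonneg_eq_0_iff[OF I]) auto
    then have "sin (pi * (x j - y j)) = 0" if "j \<in> I" for j using that by simp
    moreover have y: "y \<in> unit_cube I" "\<eta> \<le> ?g y" using \<open>y \<in> S\<close> by (simp_all add: S_def)
    ultimately have "f y = f x" by (intro torus_zero_eq[OF faces I x])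
    then show False using y(2) \<open>0 < \<eta>\<close> by simp
  qed
  have "continuous_on (unit_cube I) (\<lambda>y. f y - f x)" by (intro continuous_on_diff f continuous_on_const)
  from bounded_on_cube[OF this] obtain b where b: "0 \<le> b" "\<And>y. y \<in> unit_cube I \<Longrightarrow> norm (f y - f x) \<le> b"
    by blast
  show ?thesis
  proof (cases "S = {}")
    case True
    show ?thesis
    proof (rule that[of 0])
      fix y assume "y \<in> unit_cube I"
      then show "?g y \<le> \<eta> + 0 * ?q y" using True unfolding S_def by force
    qed simp
  next
    case False
    \<comment> \<open>With \<open>b\<close> a bound on all increments, the constant b divided by the
      minimum of the sine sum makes the second term at least \<open>b\<close> on
      \<open>S\<close>.\<close>
    obtain y0 where y0: "y0 \<in> S" "\<forall>y\<in>S. ?q y0 \<le> ?q y"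
      using continuous_attains_inf[OF cS False cq] by blast
    have d: "0 < ?q y0" by (rule qpos[OF y0(1)])
    show ?thesis
    proof (rule that[of "b / ?q y0"])
      show "0 \<le> b / ?q y0" using b(1) d by simp
      fix y assume y: "y \<in> unit_cube I"
      show "?g y \<le> \<eta> + b / ?q y0 * ?q y"
      proof (cases "y \<in> S")
        case True
        then have "?q y0 \<le> ?q y" using y0(2) by blast
        then have "b / ?q y0 * ?q y0 \<le> b / ?q y0 * ?q y" using b(1) d by (intro mult_left_mono) auto
        then have "b \<le> b / ?q y0 * ?q y" using d by simp
        then show ?thesis using b(2)[OF y] \<open>0 < \<eta>\<close> by linarith
      next
        case False
        then have "?g y < \<eta>" using y by (auto simp: S_def)
        moreover have "0 \<le> b / ?q y0 * ?q y" using b(1) d q0[of y] by (intro mult_nonneg_nonneg) auto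
        ultimately show ?thesis by linarith
      qed
    qed
  qed
qed

lemma integrable_times_kprod:
  assumes I: "finite I" and f: "continuous_on (unit_cube I) f"
  shows "integrable (cube_measure I) (\<lambda>y. f y * kprod I n x y)"
  by (intro integrable_cube_continuous[OF I] continuous_on_mult f continuous_kprod)

text \<open>The kernel has mass 1, so the error is at most the kernel average of the modulus of
  continuity, that is r/2 plus K times the sum of the sine moments 1/(2n+2).\<close>

lemma mollify_tendsto:
  fixes f :: "point \<Rightarrow> complex"
  assumes faces: "\<And>y j. y \<in> unit_cube I \<Longrightarrow> j \<in> I \<Longrightarrow> f (y(j := 0)) = f (y(j := 1))"
    and I: "finite I" and x: "x \<in> unit_cube I" and f: "continuous_on (unit_cube I) f"
  shows "(\<lambda>n. mollify I n (\<lambda>_. 0) f x) \<longlonglongrightarrow> f x"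
proof (rule LIMSEQ_I)
  fix r :: real assume r: "0 < r"
  obtain K where K: "0 \<le> K" "\<And>y. y \<in> unit_cube I \<Longrightarrow> cmod (f y - f x) \<le> r / 2 + K * (\<Sum>j\<in>I. (sin (pi * (x j - y j)))\<^sup>2)"
    using torus_modulus[OF faces I x f, of "r / 2"] r by auto
  let ?M = "cube_measure I"
  have main: "cmod (mollify I n (\<lambda>_. 0) f x - f x) \<le> r / 2 + K * (card I * (1 / (2 * real n + 2)))" for n
  proof -
    have ik: "integrable ?M (\<lambda>y. kprod I n x y)" by (rule integrable_cube_continuous[OF I continuous_kprod])
    have i1: "integrable ?M (\<lambda>y. f y * of_real (kprod I n x y))"
      by (intro integrable_cube_continuous[OF I] continuous_on_mult f continuous_on_of_real continuous_kprod)
    have i2: "integrable ?M (\<lambda>y. f x * of_real (kprod I n x y))" using ik by simp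
    have "(LINT y|?M. (f y - f x) * of_real (kprod I n x y)) = (LINT y|?M. f y * of_real (kprod I n x y)) - (LINT y|?M. f x * of_real (kprod I n x y))"
      unfolding left_diff_distrib by (rule Bochner_Integration.integral_diff[OF i1 i2])
    also have "(LINT y|?M. f x * of_real (kprod I n x y)) = f x * of_real (LINT y|?M. kprod I n x y)"
      unfolding integral_mult_right_zero integral_complex_of_real ..
    finally have "mollify I n (\<lambda>_. 0) f x - f x = (LINT y|?M. (f y - f x) * of_real (kprod I n x y))"
      unfolding mollify_0 integral_kprod[OF I] by simp
    also have "cmod \<dots> \<le> (LINT y|?M. cmod ((f y - f x) * of_real (kprod I n x y)))" by (rule integral_norm_bound)
    also have "\<dots> = (LINT y|?M. cmod (f y - f x) * kprod I n x y)"
      by (simp only: norm_mult norm_of_real abs_of_nonneg[OF kprod_nonneg])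
    also have "\<dots> \<le> (LINT y|?M. r / 2 * kprod I n x y + K * (\<Sum>j\<in>I. (sin (pi * (x j - y j)))\<^sup>2 * kprod I n x y))"
    proof (rule integral_mono)
      show "integrable ?M (\<lambda>y. cmod (f y - f x) * kprod I n x y)"
        by (intro integrable_times_kprod[OF I] continuous_on_norm continuous_on_diff f continuous_on_const)
      show "integrable ?M (\<lambda>y. r / 2 * kprod I n x y + K * (\<Sum>j\<in>I. (sin (pi * (x j - y j)))\<^sup>2 * kprod I n x y))"
        by (intro Bochner_Integration.integrable_add integrable_mult_right ik Bochner_Integration.integrable_sum integral_kprod_sin(1)[OF I])
      fix y assume "y \<in> space ?M"
      then have "cmod (f y - f x) * kprod I n x y \<le> (r / 2 + K * (\<Sum>j\<in>I. (sin (pi * (x j - y j)))\<^sup>2)) * kprod I n x y"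
        using K(2) kprod_nonneg by (intro mult_right_mono) auto
      then show "cmod (f y - f x) * kprod I n x y \<le> r / 2 * kprod I n x y + K * (\<Sum>j\<in>I. (sin (pi * (x j - y j)))\<^sup>2 * kprod I n x y)"
        by (simp add: distrib_right sum_distrib_right mult.assoc)
    qed
    also have "\<dots> = r / 2 * (LINT y|?M. kprod I n x y) + K * (\<Sum>j\<in>I. LINT y|?M. (sin (pi * (x j - y j)))\<^sup>2 * kprod I n x y)"
      using ik integral_kprod_sin(1)[OF I] by (simp add: Bochner_Integration.integrable_sum)
    also have "\<dots> = r / 2 + K * (card I * (1 / (2 * real n + 2)))"
      by (simp add: integral_kprod[OF I] integral_kprod_sin(2)[OF I])
    finally show ?thesis .
  qed
  define B where "B = K * card I"
  have B: "0 \<le> B" using K(1) by (simp add: B_def)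
  obtain N where N: "B / (r / 2) < real N" using reals_Archimedean2 by blast
  show "\<exists>no. \<forall>n\<ge>no. norm (mollify I n (\<lambda>_. 0) f x - f x) < r"
  proof (intro exI[of _ N] allI impI)
    fix n assume "N \<le> n"
    then have "B / (r / 2) < (2 * real n + 2)" using N by linarith
    then have "B < (r / 2) * (2 * real n + 2)" using r by (simp add: divide_less_eq mult.commute)
    then have "B / (2 * real n + 2) < r / 2" by (simp add: divide_less_eq)
    moreover have "K * (card I * (1 / (2 * real n + 2))) = B / (2 * real n + 2)" by (simp add: B_def)
    ultimately show "norm (mollify I n (\<lambda>_. 0) f x - f x) < r" using main[of n] by linarith
  qed
qed

lemma mollify_le:
  assumes I: "finite I" and f: "continuous_on (unit_cube I) f" "\<And>y. y \<in> unit_cube I \<Longrightarrow> cmod (f y) \<le> b"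
  shows "cmod (mollify I n (\<lambda>_. 0) f x) \<le> b"
proof -
  let ?M = "cube_measure I"
  have "cmod (mollify I n (\<lambda>_. 0) f x) \<le> (LINT y|?M. cmod (f y * of_real (kprod I n x y)))"
    unfolding mollify_0 by (rule integral_norm_bound)
  also have "\<dots> = (LINT y|?M. cmod (f y) * kprod I n x y)"
    by (simp only: norm_mult norm_of_real abs_of_nonneg[OF kprod_nonneg])
  also have "\<dots> \<le> (LINT y|?M. b * kprod I n x y)"
  proof (rule integral_mono)
    show "integrable ?M (\<lambda>y. cmod (f y) * kprod I n x y)"
      by (intro integrable_times_kprod[OF I] continuous_on_norm f)
    show "integrable ?M (\<lambda>y. b * kprod I n x y)" by (intro integrable_times_kprod[OF I] continuous_on_const)
    show "cmod (f y) * kprod I n x y \<le> b * kprod I n x y" if "y \<in> space ?M" for y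
      using f(2) that kprod_nonneg by (intro mult_right_mono) auto
  qed
  also have "\<dots> = b" by (simp add: integral_kprod[OF I])
  finally show ?thesis .
qed

text \<open>The invariant keeps the derivative on the kernel, where differentiation is classical.
  For the bound the derivative is moved onto \<open>f\<close>, where the weak derivative is bounded
  in L_4 and mollification does not enlarge the norm.\<close>

lemma mollify_Lq_class:
  assumes I: "finite I" and f: "integrable (cube_measure I) f"
    and w: "\<And>\<nu>. \<nu> \<in> (\<Pi>\<^sub>E j\<in>I. {0..\<omega>}) \<Longrightarrow> \<exists>g\<in>Lq 4 (cube_measure I). has_weak_deriv True I \<nu> f g \<and>
      (LINT y|cube_measure I. cmod (g y) ^ 4) \<le> B ^ 4"
  shows "Lq_class 4 I UNIV B (\<lambda>_. \<omega>) (mollify I n (\<lambda>_. 0) f)"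
proof (rule diff_class_coinduct[OF I, where X = "\<lambda>\<mu> h. \<exists>\<nu>. h = mollify I n \<nu> f \<and> (\<forall>j\<in>I. \<nu> j + \<mu> j \<le> \<omega>)"])
  show "\<exists>\<nu>. mollify I n (\<lambda>_. 0) f = mollify I n \<nu> f \<and> (\<forall>j\<in>I. \<nu> j + \<omega> \<le> \<omega>)"
    by (intro exI[of _ "\<lambda>_. 0"]) simp
  fix \<mu> :: "nat \<Rightarrow> nat" and h assume "\<exists>\<nu>. h = mollify I n \<nu> f \<and> (\<forall>j\<in>I. \<nu> j + \<mu> j \<le> \<omega>)"
  then obtain \<nu> where h: "h = mollify I n \<nu> f" and \<nu>: "\<forall>j\<in>I. \<nu> j + \<mu> j \<le> \<omega>" by blast
  have "Lq_bounded 4 I B h"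
  proof -
    \<comment> \<open>The hypothesis speaks of extensional multiindices, and only the values on
      \<open>I\<close> enter the mollification.\<close>
    have mem: "restrict \<nu> I \<in> (\<Pi>\<^sub>E j\<in>I. {0..\<omega>})" using \<nu> by (auto dest: add_leD1)
    then obtain g where g: "g \<in> Lq 4 (cube_measure I)" "has_weak_deriv True I (restrict \<nu> I) f g"
      "(LINT y|cube_measure I. cmod (g y) ^ 4) \<le> B ^ 4" using w by blast
    have "h = mollify I n (restrict \<nu> I) f"
      unfolding h mollify_def by (simp cong: prod.cong)
    also have "\<dots> = mollify I n (\<lambda>_. 0) g" by (rule mollify_weak_deriv[OF g(2)])
    finally have hg: "h = mollify I n (\<lambda>_. 0) g" .
    have "(LINT y|cube_measure I. cmod (h y) ^ 4) \<le> B ^ 4"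
      unfolding hg by (rule order_trans[OF mollify_L4_bound[OF I g(1)] g(3)])
    then show ?thesis unfolding Lq_bounded_def using mollify_continuous[OF I f] h by blast
  qed
  moreover have "\<exists>h'. pderiv_rel I UNIV j h h' \<and> (\<exists>\<nu>. h' = mollify I n \<nu> f \<and> (\<forall>i\<in>I. \<nu> i + (\<mu>(j := \<mu> j - 1)) i \<le> \<omega>))"
    if j: "j \<in> I" "0 < \<mu> j" for j
  proof (intro exI conjI ballI)
    show "pderiv_rel I UNIV j h (mollify I n (\<nu>(j := Suc (\<nu> j))) f)"
      unfolding h by (rule mollify_deriv[OF I j(1) f])
    fix i assume "i \<in> I"
    then show "(\<nu>(j := Suc (\<nu> j))) i + (\<mu>(j := \<mu> j - 1)) i \<le> \<omega>" using \<nu> j by auto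
  qed (rule refl)
  ultimately show "Lq_bounded 4 I B h \<and> (\<forall>j\<in>I. 0 < \<mu> j \<longrightarrow> (\<exists>h'. pderiv_rel I UNIV j h h' \<and>
      (\<exists>\<nu>. h' = mollify I n \<nu> f \<and> (\<forall>i\<in>I. \<nu> i + (\<mu>(j := \<mu> j - 1)) i \<le> \<omega>))))" by blast
qed

subsection \<open>Algebra of the classes\<close>

lemma integrable_cube_cmod_power:
  fixes f :: "point \<Rightarrow> complex"
  shows "finite I \<Longrightarrow> continuous_on (unit_cube I) f \<Longrightarrow> integrable (cube_measure I) (\<lambda>y. cmod (f y) ^ q)"
  by (rule integrable_cube_continuous[OF _ continuous_on_power[OF continuous_on_norm]])

lemma weighted_am_gm:
  fixes a b s :: real
  assumes "0 < s"
  shows "2 * (a * b) \<le> s * a\<^sup>2 + 1 / s * b\<^sup>2"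
proof -
  have "0 \<le> (s * a - b)\<^sup>2 / s" using assms by simp
  also have "\<dots> = s * a\<^sup>2 + 1 / s * b\<^sup>2 - 2 * (a * b)"
    using assms by (simp add: field_simps power2_eq_square)
  finally show ?thesis by simp
qed

text \<open>The Cauchy-Schwarz inequality in the form of a weighted arithmetic-geometric mean. The
  weight \<open>s\<close>, the quotient of the squared bounds, balances both terms and gives exactly
  (B C)^2.\<close>

lemma L4_mult:
  assumes I: "finite I" and f: "Lq_bounded 4 I B f" and g: "Lq_bounded 4 I C g" and "0 < B" "0 < C"
  shows "Lq_bounded 2 I (B * C) (\<lambda>y. f y * g y)"
proof -
  let ?M = "cube_measure I"
  have c: "continuous_on (unit_cube I) f" "continuous_on (unit_cube I) g" using f g by (auto simp: Lq_bounded_def)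
  define s where "s = C\<^sup>2 / B\<^sup>2"
  have s: "0 < s" using assms by (simp add: s_def)
  have am: "(a * b)\<^sup>2 \<le> s / 2 * a ^ 4 + 1 / (2 * s) * b ^ 4" for a b :: real
  proof -
    have e: "x ^ 4 = (x\<^sup>2)\<^sup>2" for x :: real by (simp add: power_mult[symmetric])
    have "2 * (a\<^sup>2 * b\<^sup>2) \<le> s * (a\<^sup>2)\<^sup>2 + 1 / s * (b\<^sup>2)\<^sup>2" by (rule weighted_am_gm[OF s])
    then show ?thesis unfolding e power_mult_distrib by simp
  qed
  have "(LINT y|?M. cmod (f y * g y) ^ 2) \<le> (LINT y|?M. s / 2 * cmod (f y) ^ 4 + 1 / (2 * s) * cmod (g y) ^ 4)"
  proof (rule integral_mono)
    show "integrable ?M (\<lambda>y. cmod (f y * g y) ^ 2)"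
      by (intro integrable_cube_cmod_power[OF I] continuous_on_mult c)
    show "integrable ?M (\<lambda>y. s / 2 * cmod (f y) ^ 4 + 1 / (2 * s) * cmod (g y) ^ 4)"
      by (intro Bochner_Integration.integrable_add integrable_mult_right integrable_cube_cmod_power[OF I] c)
    show "cmod (f y * g y) ^ 2 \<le> s / 2 * cmod (f y) ^ 4 + 1 / (2 * s) * cmod (g y) ^ 4" for y
      unfolding norm_mult by (rule am)
  qed
  also have "\<dots> = s / 2 * (LINT y|?M. cmod (f y) ^ 4) + 1 / (2 * s) * (LINT y|?M. cmod (g y) ^ 4)"
    using integrable_cube_cmod_power[OF I c(1), of 4] integrable_cube_cmod_power[OF I c(2), of 4] by simp
  also have "\<dots> \<le> s / 2 * B ^ 4 + 1 / (2 * s) * C ^ 4"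
    using f g s by (intro add_mono mult_left_mono) (auto simp: Lq_bounded_def)
  also have "\<dots> = (B * C)\<^sup>2"
  proof -
    have e: "x ^ 4 = x\<^sup>2 * x\<^sup>2" for x :: real by (simp add: power_add[symmetric])
    have "B\<^sup>2 \<noteq> 0" "C\<^sup>2 \<noteq> 0" using assms by auto
    then show ?thesis unfolding s_def e power_mult_distrib by (simp add: field_simps)
  qed
  finally show ?thesis using c by (auto simp: Lq_bounded_def intro: continuous_on_mult)
qed

text \<open>Minkowski's inequality by the same device: with the weight C/B the estimate sums to
  exactly (B + C)^2, which keeps the Leibniz constants additive.\<close>

lemma L2_add:
  assumes I: "finite I" and f: "Lq_bounded 2 I B f" and g: "Lq_bounded 2 I C g" and "0 < B" "0 < C"
  shows "Lq_bounded 2 I (B + C) (\<lambda>y. f y + g y)"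
proof -
  let ?M = "cube_measure I"
  have c: "continuous_on (unit_cube I) f" "continuous_on (unit_cube I) g" using f g by (auto simp: Lq_bounded_def)
  define s where "s = C / B"
  have s: "0 < s" using assms by (simp add: s_def)
  have am: "(cmod (u + v))\<^sup>2 \<le> (1 + s) * (cmod u)\<^sup>2 + (1 + 1 / s) * (cmod v)\<^sup>2" for u v
  proof -
    let ?a = "cmod u" and ?b = "cmod v"
    have "2 * (?a * ?b) \<le> s * ?a\<^sup>2 + 1 / s * ?b\<^sup>2" by (rule weighted_am_gm[OF s])
    moreover have "(cmod (u + v))\<^sup>2 \<le> (?a + ?b)\<^sup>2" by (intro power_mono norm_triangle_ineq) simp
    moreover have "(?a + ?b)\<^sup>2 = ?a\<^sup>2 + ?b\<^sup>2 + 2 * (?a * ?b)" by (simp add: power2_sum)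
    ultimately show ?thesis by (simp only: distrib_right mult_1_left)
  qed
  have "(LINT y|?M. cmod (f y + g y) ^ 2) \<le> (LINT y|?M. (1 + s) * cmod (f y) ^ 2 + (1 + 1 / s) * cmod (g y) ^ 2)"
  proof (rule integral_mono)
    show "integrable ?M (\<lambda>y. cmod (f y + g y) ^ 2)"
      by (intro integrable_cube_cmod_power[OF I] continuous_on_add c)
    show "integrable ?M (\<lambda>y. (1 + s) * cmod (f y) ^ 2 + (1 + 1 / s) * cmod (g y) ^ 2)"
      by (intro Bochner_Integration.integrable_add integrable_mult_right integrable_cube_cmod_power[OF I] c)
  qed (rule am)
  also have "\<dots> = (1 + s) * (LINT y|?M. cmod (f y) ^ 2) + (1 + 1 / s) * (LINT y|?M. cmod (g y) ^ 2)"
    using integrable_cube_cmod_power[OF I c(1), of 2] integrable_cube_cmod_power[OF I c(2), of 2] by simp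
  also have "\<dots> \<le> (1 + s) * B ^ 2 + (1 + 1 / s) * C ^ 2"
    using f g s by (intro add_mono mult_left_mono) (auto simp: Lq_bounded_def)
  also have "\<dots> = (B + C)\<^sup>2"
    using assms unfolding s_def by (simp add: field_simps power2_eq_square)
  finally show ?thesis using c by (auto simp: Lq_bounded_def intro: continuous_on_add)
qed

text \<open>A cheap substitute for Minkowski in L_4: (a + b)^4 \<le> 8 (a^4 + b^4), and 8 + 8 = 2^4
  explains the factor 2. It is applied once, outside the Leibniz rule, so the loss does not
  accumulate.\<close>

lemma L4_diff:
  assumes I: "finite I" and f: "Lq_bounded 4 I B f" and g: "Lq_bounded 4 I C g" and "0 \<le> B" "0 \<le> C"
  shows "Lq_bounded 4 I (2 * (B + C)) (\<lambda>y. f y - g y)"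
proof -
  let ?M = "cube_measure I"
  have c: "continuous_on (unit_cube I) f" "continuous_on (unit_cube I) g" using f g by (auto simp: Lq_bounded_def)
  have e: "x ^ 4 = (x\<^sup>2)\<^sup>2" for x :: real by (simp add: power_mult[symmetric])
  have sq: "(a + b)\<^sup>2 \<le> 2 * (a\<^sup>2 + b\<^sup>2)" for a b :: real
    using zero_le_power2[of "a - b"] by (simp add: power2_eq_square algebra_simps)
  have am: "cmod (u - v) ^ 4 \<le> 8 * cmod u ^ 4 + 8 * cmod v ^ 4" for u v
  proof -
    let ?a = "cmod u" and ?b = "cmod v"
    have "(cmod (u - v))\<^sup>2 \<le> (?a + ?b)\<^sup>2" by (intro power_mono norm_triangle_ineq4) simp
    also have "\<dots> \<le> 2 * (?a\<^sup>2 + ?b\<^sup>2)" by (rule sq)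
    finally have "((cmod (u - v))\<^sup>2)\<^sup>2 \<le> (2 * (?a\<^sup>2 + ?b\<^sup>2))\<^sup>2" by (rule power_mono) simp
    also have "\<dots> = 4 * (?a\<^sup>2 + ?b\<^sup>2)\<^sup>2" unfolding power_mult_distrib by simp
    also have "\<dots> \<le> 4 * (2 * ((?a\<^sup>2)\<^sup>2 + (?b\<^sup>2)\<^sup>2))" by (intro mult_left_mono sq) simp
    finally show ?thesis unfolding e by simp
  qed
  have "(LINT y|?M. cmod (f y - g y) ^ 4) \<le> (LINT y|?M. 8 * cmod (f y) ^ 4 + 8 * cmod (g y) ^ 4)"
  proof (rule integral_mono)
    show "integrable ?M (\<lambda>y. cmod (f y - g y) ^ 4)"
      by (intro integrable_cube_cmod_power[OF I] continuous_on_diff c)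
    show "integrable ?M (\<lambda>y. 8 * cmod (f y) ^ 4 + 8 * cmod (g y) ^ 4)"
      by (intro Bochner_Integration.integrable_add integrable_mult_right integrable_cube_cmod_power[OF I] c)
  qed (rule am)
  also have "\<dots> = 8 * (LINT y|?M. cmod (f y) ^ 4) + 8 * (LINT y|?M. cmod (g y) ^ 4)"
    using integrable_cube_cmod_power[OF I c(1), of 4] integrable_cube_cmod_power[OF I c(2), of 4] by simp
  also have "\<dots> \<le> 8 * B ^ 4 + 8 * C ^ 4"
    using f g by (intro add_mono mult_left_mono) (auto simp: Lq_bounded_def)
  also have "\<dots> \<le> 8 * (B + C) ^ 4 + 8 * (B + C) ^ 4"
    using assms by (intro add_mono mult_left_mono power_mono) auto
  also have "\<dots> = (2 * (B + C)) ^ 4" unfolding power_mult_distrib by simp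
  finally show ?thesis using c by (auto simp: Lq_bounded_def intro: continuous_on_diff)
qed

lemma pderiv_rel_add: "pderiv_rel I U j f f' \<Longrightarrow> pderiv_rel I U j g g' \<Longrightarrow> pderiv_rel I U j (\<lambda>y. f y + g y) (\<lambda>y. f' y + g' y)"
  by (rule pw_deriv_add)

lemma pderiv_rel_mult: "pderiv_rel I U j f f' \<Longrightarrow> pderiv_rel I U j g g' \<Longrightarrow>
    pderiv_rel I U j (\<lambda>y. f y * g y) (\<lambda>y. f' y * g y + f y * g' y)"
  by (rule pw_deriv_mult)

text \<open>Positivity of the bound is built into the auxiliary predicate because the weighted proof
  of additivity in L_2 divides by the bounds.\<close>

lemma Lq_class_mult:
  assumes I: "finite I" and fg: "Lq_class 4 I U B \<mu> f" "Lq_class 4 I U C \<mu> g" and pos: "0 < B" "0 < C"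
  shows "Lq_class 2 I U (2 ^ sum \<mu> I * (B * C)) \<mu> (\<lambda>y. f y * g y)"
proof -
  have "diff_class (\<lambda>B f. 0 < B \<and> Lq_bounded 2 I B f) (pderiv_rel I U) I (2 ^ sum \<mu> I * (B * C)) \<mu> (\<lambda>y. f y * g y)"
  proof (rule diff_class_mult[OF I fg, where a = "\<lambda>f g y. f y + g y"])
    show "0 \<le> B" "0 \<le> C" using pos by auto
    show "0 < B * C \<and> Lq_bounded 2 I (B * C) (\<lambda>y. f y * g y)" if "Lq_bounded 4 I B f" "Lq_bounded 4 I C g" for f g
      using L4_mult[OF I that pos] pos by simp
    show "pderiv_rel I U j (\<lambda>y. f y * g y) (\<lambda>y. f' y * g y + f y * g' y)"
      if "pderiv_rel I U j f f'" "pderiv_rel I U j g g'" for j f f' g g' by (rule pderiv_rel_mult[OF that])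
    show "0 < B + C \<and> Lq_bounded 2 I (B + C) (\<lambda>y. f y + g y)"
      if "0 < B \<and> Lq_bounded 2 I B f" "0 < C \<and> Lq_bounded 2 I C g" for f g B C
      using L2_add[OF I, of B f C g] that by simp
    show "pderiv_rel I U j (\<lambda>y. f y + g y) (\<lambda>y. f' y + g' y)"
      if "pderiv_rel I U j f f'" "pderiv_rel I U j g g'" for j f f' g g' by (rule pderiv_rel_add[OF that])
    show "0 < C \<and> Lq_bounded 2 I C f" if "0 < B \<and> Lq_bounded 2 I B f" "B \<le> C" for f B C
    proof -
      have "B\<^sup>2 \<le> C\<^sup>2" using that by (intro power_mono) auto
      then show ?thesis using that unfolding Lq_bounded_def by linarith
    qed
  qed
  from diff_class_map[OF I this, of "Lq_bounded 2 I" _ "\<lambda>f. f" "pderiv_rel I U"] show ?thesis by blast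
qed

lemma Lq_class_add:
  assumes I: "finite I" and "Lq_class 2 I U B \<mu> f" "Lq_class 2 I U C \<mu> g" and "0 < B" "0 < C"
  shows "Lq_class 2 I U (B + C) \<mu> (\<lambda>y. f y + g y)"
  by (rule diff_class_add[OF I assms(2,3), where a = "\<lambda>f g y. f y + g y"])
     (rule L2_add[OF I _ _ assms(4,5)] pderiv_rel_add; assumption)+

lemma Lq_class_sum:
  fixes B :: real
  assumes I: "finite I" and "finite S" "S \<noteq> {}" "\<And>p. p \<in> S \<Longrightarrow> Lq_class 2 I U B \<mu> (f p)" "0 < B"
  shows "Lq_class 2 I U (card S * B) \<mu> (\<lambda>y. \<Sum>p\<in>S. f p y)"
  using assms(2-4)
proof (induction S rule: finite_ne_induct)
  case (singleton p) then show ?case by simp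
next
  case (insert p S)
  have "Lq_class 2 I U (B + card S * B) \<mu> (\<lambda>y. f p y + (\<Sum>p\<in>S. f p y))"
    using insert assms(5) by (intro Lq_class_add[OF I]) (auto simp: card_gt_0_iff)
  moreover have "real (card (insert p S)) * B = B + card S * B" using insert.hyps by (simp add: distrib_right)
  ultimately show ?case using insert.hyps by simp
qed

lemma Lq_class_diff:
  assumes I: "finite I" and fg: "Lq_class 4 I U B \<mu> f" "Lq_class 4 I U C \<mu> g" and "0 \<le> B" "0 \<le> C"
  shows "Lq_class 4 I U (2 * (B + C)) \<mu> (\<lambda>y. f y - g y)"
proof (rule diff_class_coinduct[OF I, where X = "\<lambda>\<mu> h. \<exists>f g. Lq_class 4 I U B \<mu> f \<and> Lq_class 4 I U C \<mu> g \<and> h = (\<lambda>y. f y - g y)"])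
  fix \<mu> h assume "\<exists>f g. Lq_class 4 I U B \<mu> f \<and> Lq_class 4 I U C \<mu> g \<and> h = (\<lambda>y. f y - g y)"
  then obtain f g where f: "Lq_class 4 I U B \<mu> f" and g: "Lq_class 4 I U C \<mu> g" and h: "h = (\<lambda>y. f y - g y)" by blast
  have "Lq_bounded 4 I (2 * (B + C)) h"
    unfolding h by (rule L4_diff[OF I diff_class_bound[OF f] diff_class_bound[OF g] assms(4,5)])
  moreover have "\<exists>h'. pderiv_rel I U j h h' \<and> (\<exists>f g. Lq_class 4 I U B (\<mu>(j := \<mu> j - 1)) f \<and>
      Lq_class 4 I U C (\<mu>(j := \<mu> j - 1)) g \<and> h' = (\<lambda>y. f y - g y))" if j: "j \<in> I" "0 < \<mu> j" for j
  proof -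
    obtain f' where f': "pderiv_rel I U j f f'" "Lq_class 4 I U B (\<mu>(j := \<mu> j - 1)) f'"
      using diff_class_deriv[OF f j] by blast
    obtain g' where g': "pderiv_rel I U j g g'" "Lq_class 4 I U C (\<mu>(j := \<mu> j - 1)) g'"
      using diff_class_deriv[OF g j] by blast
    have "pderiv_rel I U j h (\<lambda>y. f' y - g' y)"
      using pderiv_rel_add[OF f'(1) pw_deriv_linear[OF bounded_linear_minus[OF bounded_linear_ident] g'(1)]]
      unfolding h by simp
    with f'(2) g'(2) show ?thesis by blast
  qed
  ultimately show "Lq_bounded 4 I (2 * (B + C)) h \<and> (\<forall>j\<in>I. 0 < \<mu> j \<longrightarrow> (\<exists>h'. pderiv_rel I U j h h' \<and>
     (\<exists>f g. Lq_class 4 I U B (\<mu>(j := \<mu> j - 1)) f \<and> Lq_class 4 I U C (\<mu>(j := \<mu> j - 1)) g \<and> h' = (\<lambda>y. f y - g y))))"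
    by blast
qed (use fg in blast)

lemma Lq_class_cnj:
  assumes "finite I" "Lq_class q I U B \<mu> f"
  shows "Lq_class q I U B \<mu> (\<lambda>y. cnj (f y))"
proof (rule diff_class_map[OF assms])
  fix f assume "Lq_bounded q I B f"
  then show "Lq_bounded q I B (\<lambda>y. cnj (f y))" by (auto simp: Lq_bounded_def intro!: continuous_intros)
next
  fix j f f' assume "pderiv_rel I U j f f'"
  then show "pderiv_rel I U j (\<lambda>y. cnj (f y)) (\<lambda>y. cnj (f' y))" by (rule pw_deriv_linear[OF bounded_linear_cnj])
qed

text \<open>Costs one order in every coordinate: the derivatives of order up to \<mu> are continuous
  because they still have bounded partial derivatives. Hence the \<open>Suc\<close> in all later
  classes of this kind.\<close>

lemma pw_class_Lq:
  assumes I: "finite I" and h: "pw_class one_point I U {0..1} K \<nu> (\<lambda>_. h)" and \<nu>: "\<And>j. j \<in> I \<Longrightarrow> \<mu> j < \<nu> j"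
    and U: "{0..1} \<subseteq> U" and K: "0 \<le> K"
  shows "Lq_class q I U K \<mu> h"
proof (rule diff_class_coinduct[OF I, where X = "\<lambda>\<mu> h. \<exists>\<nu>. pw_class one_point I U {0..1} K \<nu> (\<lambda>_. h) \<and> (\<forall>j\<in>I. \<mu> j < \<nu> j)"])
  show "\<exists>\<nu>. pw_class one_point I U {0..1} K \<nu> (\<lambda>_. h) \<and> (\<forall>j\<in>I. \<mu> j < \<nu> j)" using h \<nu> by blast
  fix \<mu> h assume "\<exists>\<nu>. pw_class one_point I U {0..1} K \<nu> (\<lambda>_. h) \<and> (\<forall>j\<in>I. \<mu> j < \<nu> j)"
  then obtain \<nu> where h: "pw_class one_point I U {0..1} K \<nu> (\<lambda>_. h)" and \<nu>: "\<forall>j\<in>I. \<mu> j < \<nu> j" by blast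
  have "pw_class one_point I {0..1} {0..1} K \<nu> (\<lambda>_. h)"
  proof (rule diff_class_map[OF I h, where T = "\<lambda>f. f"])
    fix j :: nat and f f' :: "unit \<Rightarrow> point \<Rightarrow> complex"
    assume d: "pw_deriv one_point I U j f f'"
    show "pw_deriv one_point I {0..1} j f f'"
    proof (rule pw_derivI)
      fix x y assume xy: "x \<in> space one_point" "y \<in> cube_on I {0..1::real}"
      have "y \<in> cube_on I U" by (rule subsetD[OF PiE_mono[of I "\<lambda>_. {0..1}" "\<lambda>_. U", OF U] xy(2)])
      from has_vector_derivative_within_subset[OF pw_derivE[OF d xy(1) this] U]
      show "((\<lambda>t. f x (y(j := t))) has_vector_derivative f' x y) (at (y j) within {0..1})" .
    qed
  qed (auto simp: pw_bounded_def)
  then have sl: "slope_class one_point I {0..1} K \<nu> (\<lambda>_. h)" by (rule pw_class_slope)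
  have nz: "0 < \<nu> j" if "j \<in> I" for j using bspec[OF \<nu> that] by linarith
  have cont: "continuous_on (unit_cube I) h"
    unfolding unit_cube_def by (rule slope_class_continuous[OF I sl nz, of "()"]) simp_all
  have le: "cmod (h y) \<le> K" if "y \<in> unit_cube I" for y
    using pw_bounded_le[OF diff_class_bound[OF h], of "()" y] that unfolding unit_cube_def by simp
  have "norm (LINT y|cube_measure I. cmod (h y) ^ q) \<le> K ^ q"
    by (rule norm_integral_cube_le[OF I]) (use le K in \<open>auto intro!: power_mono\<close>)
  then have "Lq_bounded q I K h" using cont by (simp add: Lq_bounded_def)
  moreover have "\<exists>h'. pderiv_rel I U j h h' \<and> (\<exists>\<nu>. pw_class one_point I U {0..1} K \<nu> (\<lambda>_. h') \<and> (\<forall>i\<in>I. (\<mu>(j := \<mu> j - 1)) i < \<nu> i))"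
    if j: "j \<in> I" "0 < \<mu> j" for j
  proof -
    obtain h' where h': "pw_deriv one_point I U j (\<lambda>_. h) h'" "pw_class one_point I U {0..1} K (\<nu>(j := \<nu> j - 1)) h'"
      using diff_class_deriv[OF h j(1) nz[OF j(1)]] by blast
    obtain k where k: "h' = (\<lambda>_. k)" by (rule that[of "h' ()"]) (auto simp: fun_eq_iff)
    have "\<forall>i\<in>I. (\<mu>(j := \<mu> j - 1)) i < (\<nu>(j := \<nu> j - 1)) i" using \<nu> j by (auto intro: diff_less_mono)
    then show ?thesis using h' unfolding k by blast
  qed
  ultimately show "Lq_bounded q I K h \<and> (\<forall>j\<in>I. 0 < \<mu> j \<longrightarrow> (\<exists>h'. pderiv_rel I U j h h' \<and>
     (\<exists>\<nu>. pw_class one_point I U {0..1} K \<nu> (\<lambda>_. h') \<and> (\<forall>i\<in>I. (\<mu>(j := \<mu> j - 1)) i < \<nu> i))))" by blast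
qed

lemma quad_error_tendsto:
  assumes I: "finite I" and pts: "\<And>k. k \<in> {1..N} \<Longrightarrow> pts k \<in> unit_cube I"
    and m: "\<And>n. V n \<in> borel_measurable (cube_measure I)" and b: "\<And>n x. x \<in> unit_cube I \<Longrightarrow> cmod (V n x) \<le> b"
    and lim: "\<And>x. x \<in> unit_cube I \<Longrightarrow> (\<lambda>n. V n x) \<longlonglongrightarrow> v x"
  shows "(\<lambda>n. quad_error I N pts (V n)) \<longlonglongrightarrow> quad_error I N pts v"
  unfolding quad_error_def
proof (intro tendsto_diff)
  show "(\<lambda>n. LINT y|cube_measure I. V n y) \<longlonglongrightarrow> (LINT y|cube_measure I. v y)"
  proof (rule integral_dominated_convergence[where w = "\<lambda>_. b"])
    show "v \<in> borel_measurable (cube_measure I)"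
      by (rule borel_measurable_LIMSEQ_metric[OF m]) (use lim in simp)
    show "integrable (cube_measure I) (\<lambda>_. b)" by (rule integrable_cube_continuous[OF I continuous_on_const])
    show "AE x in cube_measure I. (\<lambda>n. V n x) \<longlonglongrightarrow> v x" by (rule AE_I2) (use lim in simp)
    show "AE x in cube_measure I. norm (V n x) \<le> b" for n by (rule AE_I2) (use b in simp)
  qed (rule m)
  have "(\<lambda>n. \<Sum>k=1..N. V n (pts k)) \<longlonglongrightarrow> (\<Sum>k=1..N. v (pts k))"
    by (rule tendsto_sum) (rule lim[OF pts])
  then have "(\<lambda>n. (\<Sum>k=1..N. V n (pts k)) * inverse (of_nat N)) \<longlonglongrightarrow> (\<Sum>k=1..N. v (pts k)) * inverse (of_nat N)"
    by (intro tendsto_mult tendsto_const)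
  then show "(\<lambda>n. (\<Sum>k=1..N. V n (pts k)) / of_nat N) \<longlonglongrightarrow> (\<Sum>k=1..N. v (pts k)) / of_nat N"
    by (simp add: divide_inverse)
qed

text \<open>The square of a function with weak derivatives in \<open>L\<^sub>4\<close> is handled without a product rule for
  weak derivatives: mollify, apply the classical product rule, and pass to the limit in the
  quadrature error only.\<close>

lemma x_quad_bound:
  fixes g h :: "nat \<Rightarrow> point \<Rightarrow> complex" and BG BH :: real
  assumes I: "finite I" and P: "finite P" "P \<noteq> {}" and B: "0 < BG" "0 < BH"
    and \<rho>: "\<And>u. u \<subseteq> I \<Longrightarrow> 0 < \<rho> u"
    and g: "\<And>p. p \<in> P \<Longrightarrow> continuous_on (unit_cube I) (g p)"
    and faces: "\<And>p y j. p \<in> P \<Longrightarrow> y \<in> unit_cube I \<Longrightarrow> j \<in> I \<Longrightarrow> g p (y(j := 0)) = g p (y(j := 1))"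
    and gw: "\<And>p \<nu>. p \<in> P \<Longrightarrow> \<nu> \<in> (\<Pi>\<^sub>E j\<in>I. {0..\<omega>}) \<Longrightarrow> \<exists>w\<in>Lq 4 (cube_measure I).
      has_weak_deriv True I \<nu> (g p) w \<and> (LINT y|cube_measure I. cmod (w y) ^ 4) \<le> BG ^ 4"
    and h: "\<And>p. p \<in> P \<Longrightarrow> Lq_class 4 I UNIV BH (\<lambda>_. \<omega>) (h p)" "\<And>p. p \<in> P \<Longrightarrow> torus_periodic I (h p)"
    and pts: "\<And>k. k \<in> {1..N} \<Longrightarrow> pts k \<in> unit_cube I"
  shows "ennreal (cmod (quad_error I N pts (\<lambda>x. of_real (\<Sum>p\<in>P. (cmod (g p x - h p x))\<^sup>2)))) \<le>
    ennreal (card P * (2 ^ sum (\<lambda>_. \<omega>) I * (2 * (BG + BH) * (2 * (BG + BH)))) * sqrt (\<Sum>u\<in>Pow I. 1 / \<rho> u)) *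
      worst_case_error True I \<omega> \<rho> N pts"
proof -
  define m where "m n p x = mollify I n (\<lambda>_. 0) (g p) x - h p x" for n p x
  define V where "V n x = (\<Sum>p\<in>P. m n p x * cnj (m n p x))" for n x
  define v where "v x = complex_of_real (\<Sum>p\<in>P. (cmod (g p x - h p x))\<^sup>2)" for x
  let ?C = "2 * (BG + BH)"
  let ?B = "card P * (2 ^ sum (\<lambda>_. \<omega>) I * (?C * ?C))"
  have C: "0 < ?C" using B by simp
  have cP: "0 < real (card P)" using P by (simp add: card_gt_0_iff)
  have Bpos: "0 < ?B" using C cP by simp
  have m4: "Lq_class 4 I UNIV ?C (\<lambda>_. \<omega>) (m n p)" if p: "p \<in> P" for n p
    unfolding m_def
    by (rule Lq_class_diff[OF I mollify_Lq_class[OF I integrable_cube_continuous[OF I g[OF p]] gw[OF p]] h(1)[OF p]])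
       (use B in auto)
  have m2: "Lq_class 2 I UNIV (2 ^ sum (\<lambda>_. \<omega>) I * (?C * ?C)) (\<lambda>_. \<omega>) (\<lambda>x. m n p x * cnj (m n p x))"
    if p: "p \<in> P" for n p
    by (rule Lq_class_mult[OF I m4[OF p] Lq_class_cnj[OF I m4[OF p]] C C])
  have V2: "Lq_class 2 I UNIV ?B (\<lambda>_. \<omega>) (V n)" for n
    unfolding V_def by (rule Lq_class_sum[OF I P m2]) (use C in auto)
  have "torus_periodic I (m n p)" if p: "p \<in> P" for n p
    using mollify_periodic[OF I, of n "g p"] h(2)[OF p] by (simp add: m_def torus_periodic_def)
  then have Vper: "torus_periodic I (V n)" for n
    unfolding V_def torus_periodic_def by (auto intro!: sum.cong)
  \<comment> \<open>The bound is free of \<open>n\<close>, because mollification does not enlarge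
    the L_4 bounds of the derivatives; this is what allows the limit.\<close>
  have bound: "ennreal (cmod (quad_error I N pts (V n))) \<le>
      ennreal (?B * sqrt (\<Sum>u\<in>Pow I. 1 / \<rho> u)) * worst_case_error True I \<omega> \<rho> N pts" for n
    by (rule quad_error_le_wce[OF I subset_UNIV V2 _ \<rho> Bpos]) (simp add: Vper)
  have mc: "continuous_on (unit_cube I) (m n p)" if "p \<in> P" for n p
    using diff_class_bound[OF m4[OF that]] by (simp add: Lq_bounded_def)
  have hc: "continuous_on (unit_cube I) (h p)" if "p \<in> P" for p
    using diff_class_bound[OF h(1)[OF that]] by (simp add: Lq_bounded_def)
  have "\<forall>p. \<exists>b. p \<in> P \<longrightarrow> (\<forall>n. \<forall>x\<in>unit_cube I. cmod (m n p x) \<le> b)"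
  proof (intro allI)
    fix p
    show "\<exists>b. p \<in> P \<longrightarrow> (\<forall>n. \<forall>x\<in>unit_cube I. cmod (m n p x) \<le> b)"
    proof (cases "p \<in> P")
      case True
      from bounded_on_cube[OF g[OF True]] obtain b1 where b1: "\<And>x. x \<in> unit_cube I \<Longrightarrow> norm (g p x) \<le> b1" by blast
      from bounded_on_cube[OF hc[OF True]] obtain b2 where b2: "\<And>x. x \<in> unit_cube I \<Longrightarrow> norm (h p x) \<le> b2" by blast
      have "cmod (m n p x) \<le> b1 + b2" if "x \<in> unit_cube I" for n x
      proof -
        have "cmod (m n p x) \<le> cmod (mollify I n (\<lambda>_. 0) (g p) x) + cmod (h p x)"
          unfolding m_def by (rule norm_triangle_ineq4)
        also have "\<dots> \<le> b1 + b2" by (intro add_mono mollify_le[OF I g[OF True]] b1 b2 that)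
        finally show ?thesis .
      qed
      then show ?thesis by blast
    qed simp
  qed
  then obtain b where b: "\<forall>p. p \<in> P \<longrightarrow> (\<forall>n. \<forall>x\<in>unit_cube I. cmod (m n p x) \<le> b p)"
    by (rule choice[THEN exE])
  have Vb: "cmod (V n x) \<le> (\<Sum>p\<in>P. b p * b p)" if "x \<in> unit_cube I" for n x
  proof -
    have "cmod (V n x) \<le> (\<Sum>p\<in>P. cmod (m n p x) * cmod (m n p x))"
      unfolding V_def using norm_sum[of "\<lambda>p. m n p x * cnj (m n p x)" P] by (simp add: norm_mult)
    also have "\<dots> \<le> (\<Sum>p\<in>P. b p * b p)"
      by (rule sum_mono) (use b that in \<open>auto intro!: mult_mono order_trans[OF norm_ge_zero]\<close>)
    finally show ?thesis .
  qed
  have Vm: "V n \<in> borel_measurable (cube_measure I)" for n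
    unfolding V_def by (intro borel_measurable_cube continuous_on_sum continuous_on_mult continuous_on_cnj mc)
  have lim: "(\<lambda>n. V n x) \<longlonglongrightarrow> v x" if x: "x \<in> unit_cube I" for x
  proof -
    have "(\<lambda>n. V n x) \<longlonglongrightarrow> (\<Sum>p\<in>P. (g p x - h p x) * cnj (g p x - h p x))"
      unfolding V_def m_def
      by (intro tendsto_sum tendsto_mult tendsto_cnj tendsto_diff tendsto_const mollify_tendsto[OF _ I x g] faces)
    also have "(\<Sum>p\<in>P. (g p x - h p x) * cnj (g p x - h p x)) = v x"
      unfolding v_def of_real_sum complex_norm_square ..
    finally show ?thesis .
  qed
  have "(\<lambda>n. quad_error I N pts (V n)) \<longlonglongrightarrow> quad_error I N pts v"
    by (rule quad_error_tendsto[OF I pts Vm Vb lim])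
  then have "(\<lambda>n. ennreal (cmod (quad_error I N pts (V n)))) \<longlonglongrightarrow> ennreal (cmod (quad_error I N pts v))"
    by (intro tendsto_ennrealI tendsto_norm)
  from LIMSEQ_le_const2[OF this] bound show ?thesis unfolding v_def by blast
qed

subsection \<open>Square integrable functions\<close>

definition L2n :: "'a measure \<Rightarrow> ('a \<Rightarrow> complex) \<Rightarrow> real" where
  "L2n M f = sqrt (LINT x|M. (cmod (f x))\<^sup>2)"

lemma Lq_norm_2: "Lq_norm 2 M f = L2n M f"
  unfolding Lq_norm_def L2n_def by (simp add: powr_half_sqrt integral_nonneg)

lemma L2n_nonneg: "0 \<le> L2n M f"
  by (simp add: L2n_def)

lemma Lq2_add: "f \<in> Lq 2 M \<Longrightarrow> g \<in> Lq 2 M \<Longrightarrow> (\<lambda>x. f x + g x) \<in> Lq 2 M"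
proof -
  assume f: "f \<in> Lq 2 M" and g: "g \<in> Lq 2 M"
  have fm[measurable]: "f \<in> borel_measurable M" "g \<in> borel_measurable M"
    and i: "integrable M (\<lambda>x. (cmod (f x))\<^sup>2)" "integrable M (\<lambda>x. (cmod (g x))\<^sup>2)"
    using f g by (auto simp: Lq_def)
  have le: "(cmod (u + v))\<^sup>2 \<le> 2 * (cmod u)\<^sup>2 + 2 * (cmod v)\<^sup>2" for u v
  proof -
    have "(cmod (u + v))\<^sup>2 \<le> (cmod u + cmod v)\<^sup>2" by (intro power_mono norm_triangle_ineq) simp
    also have "\<dots> \<le> 2 * (cmod u)\<^sup>2 + 2 * (cmod v)\<^sup>2"
      using zero_le_power2[of "cmod u - cmod v"] by (simp add: power2_eq_square algebra_simps)
    finally show ?thesis .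
  qed
  have "integrable M (\<lambda>x. (cmod (f x + g x))\<^sup>2)"
    by (rule Bochner_Integration.integrable_bound[of M "\<lambda>x. 2 * (cmod (f x))\<^sup>2 + 2 * (cmod (g x))\<^sup>2"])
       (use i le in \<open>auto intro!: AE_I2\<close>)
  then show ?thesis by (simp add: Lq_def)
qed

lemma Lq2_cmult: "f \<in> Lq 2 M \<Longrightarrow> (\<lambda>x. c * f x) \<in> Lq 2 M"
  by (auto simp: Lq_def norm_mult power_mult_distrib)

lemma Lq2_minus: "f \<in> Lq 2 M \<Longrightarrow> g \<in> Lq 2 M \<Longrightarrow> (\<lambda>x. f x - g x) \<in> Lq 2 M"
  using Lq2_add[of f M "\<lambda>x. (-1) * g x"] Lq2_cmult[of g M "-1"] by simp

lemma Lq2_divide: "f \<in> Lq 2 M \<Longrightarrow> (\<lambda>x. f x / c) \<in> Lq 2 M"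
  using Lq2_cmult[of f M "inverse c"] by (simp add: divide_inverse mult.commute)

lemma L2n_cmult: "L2n M (\<lambda>x. c * f x) = cmod c * L2n M f"
  by (simp add: L2n_def norm_mult power_mult_distrib real_sqrt_mult)

lemma L2_integrable_mult:
  assumes "f \<in> Lq 2 M" "g \<in> Lq 2 M"
  shows "integrable M (\<lambda>x. f x * cnj (g x))" "integrable M (\<lambda>x. cmod (f x) * cmod (g x))"
proof -
  have fm: "f \<in> borel_measurable M" "g \<in> borel_measurable M"
    and i: "integrable M (\<lambda>x. (cmod (f x))\<^sup>2)" "integrable M (\<lambda>x. (cmod (g x))\<^sup>2)"
    using assms by (auto simp: Lq_def)
  have le: "a * b \<le> a\<^sup>2 + b\<^sup>2" if "0 \<le> a" "0 \<le> b" for a b :: real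
    using zero_le_power2[of "a - b"] mult_nonneg_nonneg[OF that] by (simp add: power2_diff)
  have gc: "(\<lambda>x. cnj (g x)) \<in> borel_measurable M"
    by (rule measurable_compose[OF fm(2)]) (rule borel_measurable_continuous_onI, intro continuous_intros)
  show "integrable M (\<lambda>x. f x * cnj (g x))"
    by (rule Bochner_Integration.integrable_bound[of M "\<lambda>x. (cmod (f x))\<^sup>2 + (cmod (g x))\<^sup>2"])
       (use i le fm gc in \<open>auto intro!: AE_I2 simp: norm_mult\<close>)
  then have "integrable M (\<lambda>x. cmod (f x * cnj (g x)))" by (rule integrable_norm)
  then show "integrable M (\<lambda>x. cmod (f x) * cmod (g x))" by (simp add: norm_mult)
qed

text \<open>From the nonnegative quadratic polynomial t^2 a - 2 t b + c, evaluated at its minimum t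
  = b/a when a > 0.\<close>

lemma L2_Cauchy_Schwarz:
  assumes f: "f \<in> Lq 2 M" and g: "g \<in> Lq 2 M"
  shows "(LINT x|M. cmod (f x) * cmod (g x)) \<le> L2n M f * L2n M g"
    and "cmod (LINT x|M. f x * cnj (g x)) \<le> L2n M f * L2n M g"
proof -
  let ?a = "LINT x|M. (cmod (f x))\<^sup>2" and ?b = "LINT x|M. cmod (f x) * cmod (g x)" and ?c = "LINT x|M. (cmod (g x))\<^sup>2"
  have i: "integrable M (\<lambda>x. (cmod (f x))\<^sup>2)" "integrable M (\<lambda>x. (cmod (g x))\<^sup>2)"
    using f g by (auto simp: Lq_def)
  note ib = L2_integrable_mult(2)[OF f g]
  have q: "0 \<le> t\<^sup>2 * ?a - 2 * t * ?b + ?c" for t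
  proof -
    have "0 \<le> (LINT x|M. (t * cmod (f x) - cmod (g x))\<^sup>2)" by simp
    also have "(LINT x|M. (t * cmod (f x) - cmod (g x))\<^sup>2) =
        (LINT x|M. t\<^sup>2 * (cmod (f x))\<^sup>2 - 2 * t * (cmod (f x) * cmod (g x)) + (cmod (g x))\<^sup>2)"
      by (intro Bochner_Integration.integral_cong refl) (simp add: power2_eq_square algebra_simps)
    also have "\<dots> = t\<^sup>2 * ?a - 2 * t * ?b + ?c" using i ib by simp
    finally show ?thesis .
  qed
  have nn: "0 \<le> ?a" "0 \<le> ?b" "0 \<le> ?c" by (simp_all add: integral_nonneg)
  have "?b\<^sup>2 \<le> ?a * ?c"
  proof (cases "?a = 0")
    case True
    have "?b = 0"
    proof (rule ccontr)
      assume "?b \<noteq> 0"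
      \<comment> \<open>When a = 0 the polynomial is linear and takes the value -1 at this
        point.\<close>
      then show False using q[of "(?c + 1) / (2 * ?b)"] nn(3) True by simp
    qed
    then show ?thesis using True by simp
  next
    case False
    have a: "0 < ?a" by (rule le_neq_trans[OF nn(1) not_sym[OF False]])
    have "0 \<le> ?a * ((?b / ?a)\<^sup>2 * ?a - 2 * (?b / ?a) * ?b + ?c)" using q[of "?b / ?a"] a by (intro mult_nonneg_nonneg) auto
    also have "\<dots> = ?a * ?c - ?b\<^sup>2" using a by (simp add: field_simps power2_eq_square)
    finally show ?thesis by simp
  qed
  then have "sqrt (?b\<^sup>2) \<le> sqrt (?a * ?c)" by (rule real_sqrt_le_mono)
  then show 1: "?b \<le> L2n M f * L2n M g" using nn by (simp add: L2n_def real_sqrt_mult)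
  have "cmod (LINT x|M. f x * cnj (g x)) \<le> (LINT x|M. cmod (f x * cnj (g x)))" by (rule integral_norm_bound)
  also have "\<dots> = ?b" by (simp add: norm_mult)
  finally show "cmod (LINT x|M. f x * cnj (g x)) \<le> L2n M f * L2n M g" using 1 by linarith
qed

lemma L2n_triangle:
  assumes f: "f \<in> Lq 2 M" and g: "g \<in> Lq 2 M"
  shows "L2n M (\<lambda>x. f x + g x) \<le> L2n M f + L2n M g"
proof -
  have i: "integrable M (\<lambda>x. (cmod (f x))\<^sup>2)" "integrable M (\<lambda>x. (cmod (g x))\<^sup>2)"
    "integrable M (\<lambda>x. (cmod (f x + g x))\<^sup>2)"
    using f g Lq2_add[OF f g] by (auto simp: Lq_def)
  note ib = L2_integrable_mult(2)[OF f g]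
  have sq: "(LINT x|M. (cmod (h x))\<^sup>2) = (L2n M h)\<^sup>2" for h
    by (simp add: L2n_def integral_nonneg)
  have "(LINT x|M. (cmod (f x + g x))\<^sup>2) \<le> (LINT x|M. (cmod (f x))\<^sup>2 + 2 * (cmod (f x) * cmod (g x)) + (cmod (g x))\<^sup>2)"
  proof (rule integral_mono[OF i(3)])
    show "integrable M (\<lambda>x. (cmod (f x))\<^sup>2 + 2 * (cmod (f x) * cmod (g x)) + (cmod (g x))\<^sup>2)" using i ib by simp
    show "(cmod (f x + g x))\<^sup>2 \<le> (cmod (f x))\<^sup>2 + 2 * (cmod (f x) * cmod (g x)) + (cmod (g x))\<^sup>2" for x
    proof -
      have "(cmod (f x + g x))\<^sup>2 \<le> (cmod (f x) + cmod (g x))\<^sup>2" by (intro power_mono norm_triangle_ineq) simp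
      then show ?thesis by (simp add: power2_sum mult.assoc)
    qed
  qed
  also have "\<dots> = (L2n M f)\<^sup>2 + 2 * (LINT x|M. cmod (f x) * cmod (g x)) + (L2n M g)\<^sup>2"
    using i ib by (simp add: sq)
  also have "\<dots> \<le> (L2n M f + L2n M g)\<^sup>2"
    using L2_Cauchy_Schwarz(1)[OF f g] by (simp add: power2_sum)
  finally show ?thesis
    unfolding L2n_def[of M "\<lambda>x. f x + g x"] by (rule real_le_lsqrt[rotated]) (simp_all add: L2n_nonneg)
qed

lemma L2n_triangle_minus:
  assumes f: "f \<in> Lq 2 M" and g: "g \<in> Lq 2 M"
  shows "L2n M (\<lambda>x. f x - g x) \<le> L2n M f + L2n M g"
  using L2n_triangle[OF f Lq2_cmult[OF g, of "-1"]] L2n_cmult[of M "-1" g] by simp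

subsection \<open>Derivatives in the parameter with values in \<open>L\<^sub>2(D)\<close>\<close>

text \<open>As in the regularity assumption on the target, functions lie in L_2(D) for every y over
  \<open>U\<close>, while the norm is bounded only for y in the unit cube.\<close>

definition L2_bounded :: "nat set \<Rightarrow> nat set \<Rightarrow> real set \<Rightarrow> real \<Rightarrow> (point \<Rightarrow> point \<Rightarrow> complex) \<Rightarrow> bool" where
  "L2_bounded D I U B H \<longleftrightarrow> (\<forall>y\<in>cube_on I U. (\<lambda>x. H x y) \<in> Lq 2 (cube_measure D)) \<and>
     (\<forall>y\<in>unit_cube I. L2n (cube_measure D) (\<lambda>x. H x y) \<le> B)"

definition L2_deriv :: "nat set \<Rightarrow> nat set \<Rightarrow> real set \<Rightarrow> nat \<Rightarrow> (point \<Rightarrow> point \<Rightarrow> complex) \<Rightarrow> (point \<Rightarrow> point \<Rightarrow> complex) \<Rightarrow> bool" where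
  "L2_deriv D I U j H H' \<longleftrightarrow> (\<forall>y\<in>cube_on I U.
     ((\<lambda>t. L2n (cube_measure D) (\<lambda>x. (H x (y(j := t)) - H x y) / of_real (t - y j) - H' x y)) \<longlongrightarrow> 0)
       (at (y j) within U))"

abbreviation L2_class where
  "L2_class D I U \<equiv> diff_class (L2_bounded D I U) (L2_deriv D I U) I"

lemma L2_boundedD: "L2_bounded D I U B H \<Longrightarrow> y \<in> cube_on I U \<Longrightarrow> (\<lambda>x. H x y) \<in> Lq 2 (cube_measure D)"
  by (simp add: L2_bounded_def)

lemma L2_boundedD2: "L2_bounded D I U B H \<Longrightarrow> y \<in> unit_cube I \<Longrightarrow> L2n (cube_measure D) (\<lambda>x. H x y) \<le> B"
  by (simp add: L2_bounded_def)

lemma L2_derivD: "L2_deriv D I U j H H' \<Longrightarrow> y \<in> cube_on I U \<Longrightarrow>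
    ((\<lambda>t. L2n (cube_measure D) (\<lambda>x. (H x (y(j := t)) - H x y) / of_real (t - y j) - H' x y)) \<longlongrightarrow> 0) (at (y j) within U)"
  by (simp add: L2_deriv_def)

text \<open>Quantitative product rule for the inner product. The defect of the difference quotient
  splits into the defect of the first factor, that of the second, and the increment a1 - a against
  b'; this increment is h times the first quotient. Each part is estimated by
  Cauchy-Schwarz.\<close>

lemma L2_inner_quotient:
  fixes h :: real
  assumes L: "a1 \<in> Lq 2 M" "a \<in> Lq 2 M" "a' \<in> Lq 2 M" "b1 \<in> Lq 2 M" "b \<in> Lq 2 M" "b' \<in> Lq 2 M" and h: "h \<noteq> 0"
  defines "e1 \<equiv> L2n M (\<lambda>x. (a1 x - a x) / of_real h - a' x)" and "e2 \<equiv> L2n M (\<lambda>x. (b1 x - b x) / of_real h - b' x)"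
  shows "cmod (((LINT x|M. a1 x * cnj (b1 x)) - (LINT x|M. a x * cnj (b x))) / of_real h -
      ((LINT x|M. a' x * cnj (b x)) + (LINT x|M. a x * cnj (b' x)))) \<le>
    e1 * L2n M b + (L2n M a + \<bar>h\<bar> * (e1 + L2n M a')) * e2 + \<bar>h\<bar> * (e1 + L2n M a') * L2n M b'"
proof -
  let ?q1 = "\<lambda>x. (a1 x - a x) / of_real h - a' x" and ?q2 = "\<lambda>x. (b1 x - b x) / of_real h - b' x"
  let ?d = "\<lambda>x. a1 x - a x"
  have q: "?q1 \<in> Lq 2 M" "?q2 \<in> Lq 2 M" "?d \<in> Lq 2 M" by (intro Lq2_minus Lq2_divide L)+
  have pt: "(a1 x * cnj (b1 x) - a x * cnj (b x)) / of_real h - (a' x * cnj (b x) + a x * cnj (b' x)) =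
      ?q1 x * cnj (b x) + a1 x * cnj (?q2 x) + ?d x * cnj (b' x)" for x
    using h by (simp add: divide_simps) (simp add: algebra_simps)
  note i = L2_integrable_mult(1)
  have "((LINT x|M. a1 x * cnj (b1 x)) - (LINT x|M. a x * cnj (b x))) / of_real h -
      ((LINT x|M. a' x * cnj (b x)) + (LINT x|M. a x * cnj (b' x))) =
      (LINT x|M. (a1 x * cnj (b1 x) - a x * cnj (b x)) / of_real h - (a' x * cnj (b x) + a x * cnj (b' x)))"
    by (simp only: Bochner_Integration.integral_add Bochner_Integration.integral_diff Bochner_Integration.integrable_add
        Bochner_Integration.integrable_diff integrable_divide_zero integral_divide_zero i[OF L(1,4)] i[OF L(2,5)] i[OF L(3,5)] i[OF L(2,6)])
  also have "\<dots> = (LINT x|M. ?q1 x * cnj (b x)) + (LINT x|M. a1 x * cnj (?q2 x)) + (LINT x|M. ?d x * cnj (b' x))"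
    unfolding pt using i[OF q(1) L(5)] i[OF L(1) q(2)] i[OF q(3) L(6)]
    by (simp only: Bochner_Integration.integral_add Bochner_Integration.integrable_add)
  finally have "cmod (((LINT x|M. a1 x * cnj (b1 x)) - (LINT x|M. a x * cnj (b x))) / of_real h -
      ((LINT x|M. a' x * cnj (b x)) + (LINT x|M. a x * cnj (b' x)))) =
    cmod ((LINT x|M. ?q1 x * cnj (b x)) + (LINT x|M. a1 x * cnj (?q2 x)) + (LINT x|M. ?d x * cnj (b' x)))"
    by (rule arg_cong)
  also have "\<dots> \<le> cmod (LINT x|M. ?q1 x * cnj (b x)) + cmod (LINT x|M. a1 x * cnj (?q2 x)) + cmod (LINT x|M. ?d x * cnj (b' x))"
    by (rule order_trans[OF norm_triangle_ineq add_right_mono[OF norm_triangle_ineq]])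
  also have "\<dots> \<le> e1 * L2n M b + L2n M a1 * e2 + L2n M ?d * L2n M b'"
    unfolding e1_def e2_def
    by (rule add_mono[OF add_mono[OF L2_Cauchy_Schwarz(2)[OF q(1) L(5)] L2_Cauchy_Schwarz(2)[OF L(1) q(2)]]
          L2_Cauchy_Schwarz(2)[OF q(3) L(6)]])
  also have "\<dots> \<le> e1 * L2n M b + (L2n M a + \<bar>h\<bar> * (e1 + L2n M a')) * e2 + \<bar>h\<bar> * (e1 + L2n M a') * L2n M b'"
  proof -
    have "?d = (\<lambda>x. of_real h * (?q1 x + a' x))" using h by (auto simp: field_simps)
    then have "L2n M ?d = \<bar>h\<bar> * L2n M (\<lambda>x. ?q1 x + a' x)" using L2n_cmult[of M "of_real h" "\<lambda>x. ?q1 x + a' x"] by simp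
    also have "\<dots> \<le> \<bar>h\<bar> * (e1 + L2n M a')"
      unfolding e1_def by (rule mult_left_mono[OF L2n_triangle[OF q(1) L(3)] abs_ge_zero])
    finally have d: "L2n M ?d \<le> \<bar>h\<bar> * (e1 + L2n M a')" .
    have "L2n M a1 = L2n M (\<lambda>x. a x + ?d x)" by simp
    also have "\<dots> \<le> L2n M a + L2n M ?d" by (rule L2n_triangle[OF L(2) q(3)])
    finally have "L2n M a1 \<le> L2n M a + \<bar>h\<bar> * (e1 + L2n M a')" using d by linarith
    then show ?thesis using d
      by (intro add_mono order_refl mult_right_mono) (simp_all add: e2_def L2n_nonneg)
  qed
  finally show ?thesis .
qed

lemma L2_deriv_inner:
  assumes j: "j \<in> I" and b: "L2_bounded D I U B H1" "L2_bounded D I U B' H1'" "L2_bounded D I U C H2" "L2_bounded D I U C' H2'"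
    and d: "L2_deriv D I U j H1 H1'" "L2_deriv D I U j H2 H2'"
  shows "pw_deriv one_point I U j (\<lambda>_ y. LINT x|cube_measure D. H1 x y * cnj (H2 x y))
    (\<lambda>_ y. (LINT x|cube_measure D. H1' x y * cnj (H2 x y)) + (LINT x|cube_measure D. H1 x y * cnj (H2' x y)))"
proof (rule pw_derivI)
  fix y assume y: "y \<in> cube_on I U"
  let ?M = "cube_measure D" and ?F = "at (y j) within U"
  let ?S = "\<lambda>t. LINT x|?M. H1 x (y(j := t)) * cnj (H2 x (y(j := t)))"
  let ?S' = "(LINT x|?M. H1' x y * cnj (H2 x y)) + (LINT x|?M. H1 x y * cnj (H2' x y))"
  define e1 where "e1 t = L2n ?M (\<lambda>x. (H1 x (y(j := t)) - H1 x y) / of_real (t - y j) - H1' x y)" for t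
  define e2 where "e2 t = L2n ?M (\<lambda>x. (H2 x (y(j := t)) - H2 x y) / of_real (t - y j) - H2' x y)" for t
  let ?n = "\<lambda>H. L2n ?M (\<lambda>x. H x y)"
  define E where "E t = e1 t * ?n H2 + (?n H1 + \<bar>t - y j\<bar> * (e1 t + ?n H1')) * e2 t + \<bar>t - y j\<bar> * (e1 t + ?n H1') * ?n H2'" for t
  have lim: "(e1 \<longlongrightarrow> 0) ?F" "(e2 \<longlongrightarrow> 0) ?F"
    unfolding e1_def e2_def by (rule L2_derivD[OF d(1) y] L2_derivD[OF d(2) y])+
  have lh: "((\<lambda>t. \<bar>t - y j\<bar>) \<longlongrightarrow> \<bar>y j - y j\<bar>) ?F" by (intro tendsto_intros)
  have "(E \<longlongrightarrow> 0 * ?n H2 + (?n H1 + \<bar>y j - y j\<bar> * (0 + ?n H1')) * 0 + \<bar>y j - y j\<bar> * (0 + ?n H1') * ?n H2') ?F"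
    unfolding E_def by (intro tendsto_add tendsto_mult tendsto_const lim lh)
  then have E: "(E \<longlongrightarrow> 0) ?F" by simp
  have "((\<lambda>t. (?S t - ?S (y j)) / of_real (t - y j) - ?S') \<longlongrightarrow> 0) ?F"
  proof (rule Lim_null_comparison[OF _ E])
    show "\<forall>\<^sub>F t in ?F. norm ((?S t - ?S (y j)) / of_real (t - y j) - ?S') \<le> E t"
      unfolding eventually_at_filter
    proof (rule always_eventually, intro allI impI)
      fix t assume t: "t \<noteq> y j" "t \<in> U"
      note y' = cube_on_upd[OF y j t(2)]
      show "norm ((?S t - ?S (y j)) / of_real (t - y j) - ?S') \<le> E t"
        unfolding E_def e1_def e2_def fun_upd_triv
        by (rule L2_inner_quotient) (use t L2_boundedD[OF b(1) y'] L2_boundedD[OF b(1) y] L2_boundedD[OF b(2) y]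
              L2_boundedD[OF b(3) y'] L2_boundedD[OF b(3) y] L2_boundedD[OF b(4) y] in simp_all)
    qed
  qed
  then show "(?S has_vector_derivative ?S') ?F"
    unfolding has_vector_derivative_iff_quotient by (simp only: LIM_zero_iff)
qed

text \<open>The abstract Leibniz rule with the inner product of L_2(D) as bilinear operation.
  L_2(D)-valued derivatives become ordinary partial derivatives of a scalar function of y, and
  pointwise differentiability of the target in y is never invoked.\<close>

lemma L2_class_inner:
  assumes I: "finite I" and U: "{0..1} \<subseteq> U" and H: "L2_class D I U B \<mu> H1" "L2_class D I U C \<mu> H2" and B: "0 \<le> B" "0 \<le> C"
  shows "pw_class one_point I U {0..1} (2 ^ sum \<mu> I * (B * C)) \<mu> (\<lambda>_ y. LINT x|cube_measure D. H1 x y * cnj (H2 x y))"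
proof (rule diff_class_mult[OF I H B, where a = "\<lambda>f g x y. f x y + g x y"
      and m = "\<lambda>H1 H2 _ y. LINT x|cube_measure D. H1 x y * cnj (H2 x y)"])
  fix f g assume f: "L2_bounded D I U B f" and g: "L2_bounded D I U C g"
  have "cmod (LINT x|cube_measure D. f x y * cnj (g x y)) \<le> B * C" if y: "y \<in> cube_on I {0..1}" for y
  proof -
    have y1: "y \<in> unit_cube I" using y by (simp add: unit_cube_def)
    then have y2: "y \<in> cube_on I U" using unit_cube_sub_cube_on[OF U] by blast
    have "cmod (LINT x|cube_measure D. f x y * cnj (g x y)) \<le> L2n (cube_measure D) (\<lambda>x. f x y) * L2n (cube_measure D) (\<lambda>x. g x y)"
      by (rule L2_Cauchy_Schwarz(2)[OF L2_boundedD[OF f y2] L2_boundedD[OF g y2]])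
    also have "\<dots> \<le> B * C" by (intro mult_mono L2_boundedD2[OF f y1] L2_boundedD2[OF g y1] L2n_nonneg B)
    finally show ?thesis .
  qed
  then show "pw_bounded one_point I U {0..1} (B * C) (\<lambda>_ y. LINT x|cube_measure D. f x y * cnj (g x y))"
    by (simp add: pw_bounded_def)
next
  fix j f f' g g'
  assume "j \<in> I" "L2_bounded D I U B f" "L2_bounded D I U B f'" "L2_bounded D I U C g" "L2_bounded D I U C g'"
    "L2_deriv D I U j f f'" "L2_deriv D I U j g g'"
  then show "pw_deriv one_point I U j (\<lambda>_ y. LINT x|cube_measure D. f x y * cnj (g x y))
     (\<lambda>_ y. (LINT x|cube_measure D. f' x y * cnj (g x y)) + (LINT x|cube_measure D. f x y * cnj (g' x y)))"
    by (intro L2_deriv_inner)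
qed (rule pw_bounded_add pw_deriv_add pw_bounded_mono; assumption)+

lemma L2_class_diff:
  assumes I: "finite I" and U: "{0..1} \<subseteq> U" and H: "L2_class D I U B \<mu> f" "L2_class D I U C \<mu> g"
  shows "L2_class D I U (B + C) \<mu> (\<lambda>x y. f x y - g x y)"
proof (rule diff_class_coinduct[OF I, where X = "\<lambda>\<mu> h. \<exists>f g. L2_class D I U B \<mu> f \<and> L2_class D I U C \<mu> g \<and> h = (\<lambda>x y. f x y - g x y)"])
  fix \<mu> h assume "\<exists>f g. L2_class D I U B \<mu> f \<and> L2_class D I U C \<mu> g \<and> h = (\<lambda>x y. f x y - g x y)"
  then obtain f g where f: "L2_class D I U B \<mu> f" and g: "L2_class D I U C \<mu> g" and h: "h = (\<lambda>x y. f x y - g x y)" by blast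
  note fb = diff_class_bound[OF f] and gb = diff_class_bound[OF g]
  let ?M = "cube_measure D"
  have "L2_bounded D I U (B + C) h"
    unfolding L2_bounded_def h
  proof (intro conjI ballI)
    fix y assume "y \<in> cube_on I U"
    then show "(\<lambda>x. f x y - g x y) \<in> Lq 2 ?M" by (intro Lq2_minus L2_boundedD[OF fb] L2_boundedD[OF gb])
  next
    fix y assume y: "y \<in> unit_cube I"
    then have y2: "y \<in> cube_on I U" using unit_cube_sub_cube_on[OF U] by blast
    show "L2n ?M (\<lambda>x. f x y - g x y) \<le> B + C"
      by (rule order_trans[OF L2n_triangle_minus[OF L2_boundedD[OF fb y2] L2_boundedD[OF gb y2]]
            add_mono[OF L2_boundedD2[OF fb y] L2_boundedD2[OF gb y]]])
  qed
  moreover have "\<exists>h'. L2_deriv D I U j h h' \<and> (\<exists>f g. L2_class D I U B (\<mu>(j := \<mu> j - 1)) f \<and>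
      L2_class D I U C (\<mu>(j := \<mu> j - 1)) g \<and> h' = (\<lambda>x y. f x y - g x y))" if j: "j \<in> I" "0 < \<mu> j" for j
  proof -
    obtain f' where f': "L2_deriv D I U j f f'" "L2_class D I U B (\<mu>(j := \<mu> j - 1)) f'"
      using diff_class_deriv[OF f j] by blast
    obtain g' where g': "L2_deriv D I U j g g'" "L2_class D I U C (\<mu>(j := \<mu> j - 1)) g'"
      using diff_class_deriv[OF g j] by blast
    note fb' = diff_class_bound[OF f'(2)] and gb' = diff_class_bound[OF g'(2)]
    have "L2_deriv D I U j h (\<lambda>x y. f' x y - g' x y)"
      unfolding L2_deriv_def h
    proof
      fix y assume y: "y \<in> cube_on I U"
      let ?q = "\<lambda>f f' t x. (f x (y(j := t)) - f x y) / of_real (t - y j) - f' x y"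
      have E: "((\<lambda>t. L2n ?M (?q f f' t) + L2n ?M (?q g g' t)) \<longlongrightarrow> 0) (at (y j) within U)"
        using tendsto_add[OF L2_derivD[OF f'(1) y] L2_derivD[OF g'(1) y]] by simp
      show "((\<lambda>t. L2n ?M (\<lambda>x. (f x (y(j := t)) - g x (y(j := t)) - (f x y - g x y)) / of_real (t - y j) - (f' x y - g' x y))) \<longlongrightarrow> 0) (at (y j) within U)"
      proof (rule Lim_null_comparison[OF _ E], unfold eventually_at_filter, rule always_eventually, intro allI impI)
        fix t assume t: "t \<noteq> y j" "t \<in> U"
        note y' = cube_on_upd[OF y j(1) t(2)]
        have "(\<lambda>x. (f x (y(j := t)) - g x (y(j := t)) - (f x y - g x y)) / of_real (t - y j) - (f' x y - g' x y)) =
          (\<lambda>x. ?q f f' t x - ?q g g' t x)" by (simp add: diff_divide_distrib add_divide_distrib algebra_simps)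
        moreover have "?q f f' t \<in> Lq 2 ?M" "?q g g' t \<in> Lq 2 ?M"
          by (intro Lq2_minus Lq2_divide L2_boundedD[OF fb y'] L2_boundedD[OF fb y] L2_boundedD[OF gb y'] L2_boundedD[OF gb y]
               L2_boundedD[OF fb' y] L2_boundedD[OF gb' y])+
        ultimately show "norm (L2n ?M (\<lambda>x. (f x (y(j := t)) - g x (y(j := t)) - (f x y - g x y)) / of_real (t - y j) - (f' x y - g' x y)))
            \<le> L2n ?M (?q f f' t) + L2n ?M (?q g g' t)"
          using L2n_triangle_minus[of "?q f f' t" ?M "?q g g' t"] by (simp add: L2n_nonneg)
      qed
    qed
    with f'(2) g'(2) show ?thesis by blast
  qed
  ultimately show "L2_bounded D I U (B + C) h \<and> (\<forall>j\<in>I. 0 < \<mu> j \<longrightarrow> (\<exists>h'. L2_deriv D I U j h h' \<and>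
     (\<exists>f g. L2_class D I U B (\<mu>(j := \<mu> j - 1)) f \<and> L2_class D I U C (\<mu>(j := \<mu> j - 1)) g \<and> h' = (\<lambda>x y. f x y - g x y))))"
    by blast
qed (use H in blast)

lemma Lq_2_bounded:
  assumes "finite D" "f \<in> borel_measurable (cube_measure D)" "\<And>x. x \<in> unit_cube D \<Longrightarrow> cmod (f x) \<le> B" "0 \<le> B"
  shows "f \<in> Lq 2 (cube_measure D)" "L2n (cube_measure D) f \<le> B"
proof -
  have m: "(\<lambda>x. (cmod (f x))\<^sup>2) \<in> borel_measurable (cube_measure D)" using assms(2) by measurable
  have le: "norm ((cmod (f x))\<^sup>2) \<le> B\<^sup>2" if "x \<in> unit_cube D" for x
    using power_mono[OF assms(3)[OF that], of 2] by simp
  show "f \<in> Lq 2 (cube_measure D)"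
    unfolding Lq_def using assms(2) integrable_cube_bounded[OF assms(1) m le] by simp
  have "norm (LINT x|cube_measure D. (cmod (f x))\<^sup>2) \<le> B\<^sup>2"
    by (rule norm_integral_cube_le[OF assms(1) le]) simp_all
  then show "L2n (cube_measure D) f \<le> B"
    unfolding L2n_def using assms(4) by (intro real_le_lsqrt) (simp_all add: integral_nonneg)
qed

text \<open>For the network, pointwise derivatives with uniform bounds are L_2(D)-derivatives: the
  defect of the quotient is at most 2 B and tends to 0 pointwise, so its L_2 norm tends to 0 by
  dominated convergence.\<close>

lemma pw_class_L2:
  assumes I: "finite I" and D: "finite D" and U: "{0..1} \<subseteq> U" "convex U" and B: "0 \<le> B"
    and H: "pw_class (cube_measure D) I U U B \<mu> H"
  shows "L2_class D I U B \<mu> H"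
proof (rule diff_class_map[OF I H, where T = "\<lambda>f. f"])
  let ?M = "cube_measure D"
  fix f assume f: "pw_bounded ?M I U U B f"
  have *: "(\<lambda>x. f x y) \<in> borel_measurable ?M" "\<And>x. x \<in> unit_cube D \<Longrightarrow> cmod (f x y) \<le> B" if "y \<in> cube_on I U" for y
    using pw_bounded_measurable[OF f that] pw_bounded_le[OF f _ that] by simp_all
  show "L2_bounded D I U B f"
    unfolding L2_bounded_def using Lq_2_bounded[OF D * B] unit_cube_sub_cube_on[OF U(1)] by blast
next
  let ?M = "cube_measure D"
  fix j f f' assume j: "j \<in> I" and f: "pw_bounded ?M I U U B f" and f': "pw_bounded ?M I U U B f'" and d: "pw_deriv ?M I U j f f'"
  show "L2_deriv D I U j f f'"
    unfolding L2_deriv_def tendsto_at_iff_sequentially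
  proof (intro ballI allI impI)
    fix y and T :: "nat \<Rightarrow> real" assume y: "y \<in> cube_on I U" and T: "\<forall>n. T n \<in> U - {y j}" "T \<longlonglongrightarrow> y j"
    let ?q = "\<lambda>n x. (f x (y(j := T n)) - f x y) / of_real (T n - y j) - f' x y"
    have qm: "?q n \<in> borel_measurable ?M" for n
      using T(1) by (intro borel_measurable_diff borel_measurable_divide borel_measurable_const
          pw_bounded_measurable[OF f] pw_bounded_measurable[OF f'] cube_on_upd[OF y j] y) auto
    have q2m: "(\<lambda>x. (cmod (?q n x))\<^sup>2) \<in> borel_measurable ?M" for n
      by (rule borel_measurable_power[OF measurable_compose[OF qm]]) (rule borel_measurable_continuous_onI, intro continuous_intros)
    have qb: "cmod (?q n x) \<le> 2 * B" if x: "x \<in> unit_cube D" for n x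
    proof -
      have "cmod (?q n x) \<le> cmod ((f x (y(j := T n)) - f x y) / of_real (T n - y j)) + cmod (f' x y)"
        by (rule norm_triangle_ineq4)
      also have "\<dots> \<le> B + B"
        using norm_quotient_le[OF d f' U(2) _ y j, of x "T n"] pw_bounded_le[OF f' _ y, of x] x T(1)
        by (intro add_mono) auto
      finally show ?thesis by simp
    qed
    have "(\<lambda>n. LINT x|?M. (cmod (?q n x))\<^sup>2) \<longlonglongrightarrow> (LINT x|?M. 0)"
    proof (rule integral_dominated_convergence[where w = "\<lambda>_. (2 * B)\<^sup>2"])
      show "integrable ?M (\<lambda>_. (2 * B)\<^sup>2)" by (rule integrable_cube_continuous[OF D continuous_on_const])
      show "AE x in ?M. (\<lambda>n. (cmod (?q n x))\<^sup>2) \<longlonglongrightarrow> 0"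
      proof (rule AE_I2)
        fix x assume "x \<in> space ?M"
        then have "((\<lambda>t. f x (y(j := t))) has_vector_derivative f' x y) (at (y j) within U)"
          by (rule pw_derivE[OF d _ y])
        then have "(\<lambda>n. (f x (y(j := T n)) - f x y) / of_real (T n - y j)) \<longlonglongrightarrow> f' x y"
          using T unfolding has_vector_derivative_iff_quotient tendsto_at_iff_sequentially by (auto simp: o_def)
        then have "(\<lambda>n. (cmod (?q n x))\<^sup>2) \<longlonglongrightarrow> (cmod (f' x y - f' x y))\<^sup>2"
          by (intro tendsto_power tendsto_norm tendsto_diff tendsto_const)
        then show "(\<lambda>n. (cmod (?q n x))\<^sup>2) \<longlonglongrightarrow> 0" by simp
      qed
      show "AE x in ?M. norm ((cmod (?q n x))\<^sup>2) \<le> (2 * B)\<^sup>2" for n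
        using power_mono[OF qb, of _ n 2] by (intro AE_I2) simp
    qed (rule borel_measurable_const q2m)+
    then have "(\<lambda>n. L2n ?M (?q n)) \<longlonglongrightarrow> sqrt 0" unfolding L2n_def by (intro tendsto_real_sqrt) simp
    then show "((\<lambda>t. L2n ?M (\<lambda>x. (f x (y(j := t)) - f x y) / of_real (t - y j) - f' x y)) \<circ> T) \<longlonglongrightarrow> 0"
      by (simp add: o_def)
  qed
qed

text \<open>The witness family \<open>g \<nu>\<close> is itself the invariant. The class is obtained
  for its member of order 0, which agrees with \<open>V\<close> on the cube of D but may differ
  outside it.\<close>

lemma regular_in_y_class:
  assumes "regular_in_y d s U V bnd"
  shows "\<exists>B g. 0 < B \<and> (\<forall>y\<in>cube_on {1..s} U. \<forall>x\<in>unit_cube {1..d}. g x y = V x y) \<and> L2_class {1..d} {1..s} U B \<mu> g"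
proof -
  let ?I = "{1..s}" and ?M = "cube_measure {1..d}"
  from assms[unfolded regular_in_y_def] obtain g where
    g0: "\<forall>y\<in>cube_on ?I U. \<forall>x\<in>unit_cube {1..d}. g (\<lambda>j\<in>?I. 0) x y = V x y" and
    gL: "\<forall>\<nu>\<in>(\<Pi>\<^sub>E j\<in>?I. UNIV). (\<forall>y\<in>cube_on ?I U. (\<lambda>x. g \<nu> x y) \<in> Lq 2 ?M \<and> (\<forall>j\<in>?I.
       ((\<lambda>t. Lq_norm 2 ?M (\<lambda>x. (g \<nu> x (y(j := t)) - g \<nu> x y) / of_real (t - y j) - g (\<nu>(j := Suc (\<nu> j))) x y)) \<longlongrightarrow> 0)
         (at (y j) within U))) \<and>
       (\<forall>y\<in>unit_cube ?I. Lq_norm 2 ?M (\<lambda>x. g \<nu> x y) \<le> bnd \<nu>)"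
    by (elim exE conjE) (rule that)
  \<comment> \<open>Only multiindices of total order at most \<open>N\<close> occur; extensional
    ones with entries up to \<open>N\<close> form a finite set, over which the bounds can be
    summed.\<close>
  define N where "N = sum \<mu> ?I"
  define B where "B = 1 + (\<Sum>\<nu>\<in>(\<Pi>\<^sub>E j\<in>?I. {0..N}). \<bar>bnd \<nu>\<bar>)"
  have B: "0 < B" unfolding B_def by (intro add_pos_nonneg sum_nonneg) auto
  have fin: "finite (\<Pi>\<^sub>E j\<in>?I. {0..N})" by (intro finite_PiE) auto
  have bB: "bnd \<nu> \<le> B" if \<nu>: "\<nu> \<in> (\<Pi>\<^sub>E j\<in>?I. UNIV)" "sum \<nu> ?I \<le> N" for \<nu>
  proof -
    have "\<nu> j \<le> N" if "j \<in> ?I" for j using member_le_sum[OF that, of \<nu>] \<nu>(2) by simp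
    then have "\<nu> \<in> (\<Pi>\<^sub>E j\<in>?I. {0..N})" using \<nu>(1) by (auto simp: PiE_iff)
    then have "\<bar>bnd \<nu>\<bar> \<le> (\<Sum>\<nu>\<in>(\<Pi>\<^sub>E j\<in>?I. {0..N}). \<bar>bnd \<nu>\<bar>)" by (intro member_le_sum fin) auto
    then show ?thesis unfolding B_def by linarith
  qed
  have c: "L2_class {1..d} ?I U B \<mu> (g (\<lambda>j\<in>?I. 0))"
  proof (rule diff_class_coinduct[where X = "\<lambda>\<kappa> H. \<exists>\<nu>\<in>(\<Pi>\<^sub>E j\<in>?I. UNIV). H = g \<nu> \<and> sum \<nu> ?I + sum \<kappa> ?I \<le> N"])
    show "\<exists>\<nu>\<in>(\<Pi>\<^sub>E j\<in>?I. UNIV). g (\<lambda>j\<in>?I. 0) = g \<nu> \<and> sum \<nu> ?I + sum \<mu> ?I \<le> N"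
      by (rule bexI[of _ "\<lambda>j\<in>?I. 0"]) (auto simp: N_def)
    fix \<kappa> H assume "\<exists>\<nu>\<in>(\<Pi>\<^sub>E j\<in>?I. UNIV). H = g \<nu> \<and> sum \<nu> ?I + sum \<kappa> ?I \<le> N"
    then obtain \<nu> where \<nu>: "\<nu> \<in> (\<Pi>\<^sub>E j\<in>?I. UNIV)" "H = g \<nu>" "sum \<nu> ?I + sum \<kappa> ?I \<le> N" by blast
    note gn = bspec[OF gL \<nu>(1)]
    have le: "bnd \<nu> \<le> B" by (rule bB[OF \<nu>(1)]) (use \<nu>(3) in simp)
    have "L2_bounded {1..d} ?I U B H"
      unfolding L2_bounded_def \<nu>(2) Lq_norm_2[symmetric]
      by (intro conjI ballI; rule conjunct1[OF bspec[OF conjunct1[OF gn]]] order_trans[OF bspec[OF conjunct2[OF gn]] le]; assumption)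
    moreover have "\<exists>f'. L2_deriv {1..d} ?I U j H f' \<and> (\<exists>\<nu>\<in>(\<Pi>\<^sub>E j\<in>?I. UNIV). f' = g \<nu> \<and> sum \<nu> ?I + sum (\<kappa>(j := \<kappa> j - 1)) ?I \<le> N)"
      if j: "j \<in> ?I" "0 < \<kappa> j" for j
    proof (intro exI[of _ "g (\<nu>(j := Suc (\<nu> j)))"] conjI bexI[of _ "\<nu>(j := Suc (\<nu> j))"])
      show "L2_deriv {1..d} ?I U j H (g (\<nu>(j := Suc (\<nu> j))))"
        unfolding L2_deriv_def \<nu>(2) Lq_norm_2[symmetric]
        by (intro ballI, rule bspec[OF conjunct2[OF bspec[OF conjunct1[OF gn]]] j(1)])
      show "\<nu>(j := Suc (\<nu> j)) \<in> (\<Pi>\<^sub>E j\<in>?I. UNIV)" using \<nu>(1) j(1) by (auto simp: PiE_def extensional_def)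
      have "sum (\<nu>(j := Suc (\<nu> j))) ?I = Suc (sum \<nu> ?I)"
        using sum_upd_less[of ?I j "\<nu>(j := Suc (\<nu> j))"] j(1) by simp
      moreover have "sum \<kappa> ?I = Suc (sum (\<kappa>(j := \<kappa> j - 1)) ?I)"
        using sum_upd_less[of ?I j \<kappa>] j by simp
      ultimately show "sum (\<nu>(j := Suc (\<nu> j))) ?I + sum (\<kappa>(j := \<kappa> j - 1)) ?I \<le> N" using \<nu>(3) by simp
    qed (rule refl)
    ultimately show "L2_bounded {1..d} ?I U B H \<and> (\<forall>j\<in>?I. 0 < \<kappa> j \<longrightarrow> (\<exists>f'. L2_deriv {1..d} ?I U j H f' \<and>
        (\<exists>\<nu>\<in>(\<Pi>\<^sub>E j\<in>?I. UNIV). f' = g \<nu> \<and> sum \<nu> ?I + sum (\<kappa>(j := \<kappa> j - 1)) ?I \<le> N)))"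
      by (intro conjI ballI impI)
  qed simp
  show ?thesis by (intro exI[of _ B] exI[of _ "g (\<lambda>j\<in>?I. 0)"] conjI B g0 c)
qed

text \<open>Integrating out x turns the squared error into a sum of inner products in L_2(D). The
  second claim, a bound free of the points, is what remains available when no useful quadrature
  estimate exists.\<close>

lemma y_quad_bound:
  fixes G g H :: "nat \<Rightarrow> point \<Rightarrow> point \<Rightarrow> complex" and BG BH :: real
  assumes I: "finite I" and D: "finite D" and P: "finite P" "P \<noteq> {}" and U: "{0..1} \<subseteq> U" "convex U" and B: "0 < BG" "0 < BH"
    and \<gamma>: "\<And>u. u \<subseteq> I \<Longrightarrow> 0 < \<gamma> u"
    and g: "\<And>p. p \<in> P \<Longrightarrow> L2_class D I U BG (\<lambda>_. Suc \<alpha>) (g p)"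
    and gG: "\<And>p x y. p \<in> P \<Longrightarrow> x \<in> unit_cube D \<Longrightarrow> y \<in> cube_on I U \<Longrightarrow> g p x y = G p x y"
    and H: "\<And>p. p \<in> P \<Longrightarrow> pw_class (cube_measure D) I U U BH (\<lambda>_. Suc \<alpha>) (H p)"
    and per: "per \<Longrightarrow> U = UNIV"
      "\<And>p x y j. per \<Longrightarrow> p \<in> P \<Longrightarrow> x \<in> unit_cube D \<Longrightarrow> y \<in> cube_on I UNIV \<Longrightarrow> j \<in> I \<Longrightarrow> G p x (y(j := y j + 1)) = G p x y"
      "\<And>p x y j. per \<Longrightarrow> p \<in> P \<Longrightarrow> x \<in> unit_cube D \<Longrightarrow> y \<in> cube_on I UNIV \<Longrightarrow> j \<in> I \<Longrightarrow> H p x (y(j := y j + 1)) = H p x y"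
    and pts: "\<And>k. k \<in> {1..N} \<Longrightarrow> pts k \<in> unit_cube I"
  defines "F \<equiv> \<lambda>y. LINT x|cube_measure D. (\<Sum>p\<in>P. (cmod (G p x y - H p x y))\<^sup>2)"
    and "K \<equiv> card P * (2 ^ sum (\<lambda>_. Suc \<alpha>) I * ((BG + BH) * (BG + BH)))"
  shows "ennreal (cmod (quad_error I N pts (\<lambda>y. of_real (F y)))) \<le>
      ennreal (K * sqrt (\<Sum>u\<in>Pow I. 1 / \<gamma> u)) * worst_case_error per I \<alpha> \<gamma> N pts"
    and "\<And>y. y \<in> unit_cube I \<Longrightarrow> F y \<le> K"
proof -
  \<comment> \<open>Built from the representatives \<open>g\<close>, for which derivatives are
    known. It agrees with the integral formed with \<open>G\<close> for all y over \<open>U\<close>,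
    in particular at every quadrature point.\<close>
  define F0 where "F0 y = (\<Sum>p\<in>P. LINT x|cube_measure D. (g p x y - H p x y) * cnj (g p x y - H p x y))" for y
  have K: "0 < K" using P B unfolding K_def by (simp add: card_gt_0_iff)
  have Hc: "L2_class D I U BH (\<lambda>_. Suc \<alpha>) (H p)" if "p \<in> P" for p
    by (rule pw_class_L2[OF I D U _ H[OF that]]) (use B in simp)
  have d: "L2_class D I U (BG + BH) (\<lambda>_. Suc \<alpha>) (\<lambda>x y. g p x y - H p x y)" if "p \<in> P" for p
    by (rule L2_class_diff[OF I U(1) g[OF that] Hc[OF that]])
  have "pw_class one_point I U {0..1} (\<Sum>p\<in>P. 2 ^ sum (\<lambda>_. Suc \<alpha>) I * ((BG + BH) * (BG + BH))) (\<lambda>_. Suc \<alpha>)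
      (\<lambda>_ y. \<Sum>p\<in>P. LINT x|cube_measure D. (g p x y - H p x y) * cnj (g p x y - H p x y))"
    by (rule pw_class_sum[OF I P(1) L2_class_inner[OF I U(1) d d]]) (use B in simp_all)
  then have c: "pw_class one_point I U {0..1} K (\<lambda>_. Suc \<alpha>) (\<lambda>_. F0)"
    unfolding K_def F0_def by simp
  have L: "Lq_class 2 I U K (\<lambda>_. \<alpha>) F0" by (rule pw_class_Lq[OF I c _ U(1)]) (use K in simp_all)
  have slice: "(\<lambda>x. g p x y - H p x y) \<in> Lq 2 (cube_measure D)" if "p \<in> P" "y \<in> cube_on I U" for p y
    by (rule L2_boundedD[OF diff_class_bound[OF d[OF that(1)]] that(2)])
  have F0: "F0 y = of_real (F y)" if y: "y \<in> cube_on I U" for y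
  proof -
    have i: "integrable (cube_measure D) (\<lambda>x. (cmod (g p x y - H p x y))\<^sup>2)" if "p \<in> P" for p
      using slice[OF that y] by (simp add: Lq_def)
    have "F y = (LINT x|cube_measure D. (\<Sum>p\<in>P. (cmod (g p x y - H p x y))\<^sup>2))"
      unfolding F_def by (intro Bochner_Integration.integral_cong refl sum.cong) (use gG y in simp)
    also have "\<dots> = (\<Sum>p\<in>P. LINT x|cube_measure D. (cmod (g p x y - H p x y))\<^sup>2)"
      by (rule Bochner_Integration.integral_sum[OF i])
    also have "of_real \<dots> = F0 y"
      unfolding F0_def of_real_sum integral_complex_of_real[symmetric] complex_norm_square ..
    finally show ?thesis by simp
  qed
  have sub: "y \<in> cube_on I U" if "y \<in> unit_cube I" for y using unit_cube_sub_cube_on[OF U(1)] that by blast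
  have periodic: "torus_periodic I F0" if per
    unfolding torus_periodic_def
  proof (intro ballI)
    fix j y assume j: "j \<in> I" and y: "y \<in> cube_on I UNIV"
    have "F (y(j := y j + 1)) = F y"
      unfolding F_def by (intro Bochner_Integration.integral_cong refl sum.cong) (use per(2,3)[OF \<open>per\<close> _ _ y j] in simp)
    then show "F0 (y(j := y j + 1)) = F0 y"
      using F0[of y] F0[of "y(j := y j + 1)"] cube_on_upd[OF y j UNIV_I, of "y j + 1"] y per(1)[OF that] by simp
  qed
  have "quad_error I N pts (\<lambda>y. of_real (F y)) = quad_error I N pts F0"
    unfolding quad_error_def using F0 sub pts
    by (intro arg_cong2[where f = "(-)"] arg_cong2[where f = "(/)"] refl Bochner_Integration.integral_cong sum.cong) simp_all
  then show "ennreal (cmod (quad_error I N pts (\<lambda>y. of_real (F y)))) \<le>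
      ennreal (K * sqrt (\<Sum>u\<in>Pow I. 1 / \<gamma> u)) * worst_case_error per I \<alpha> \<gamma> N pts"
    using quad_error_le_wce[where per = per, OF I U(1) L _ \<gamma> K] per(1) periodic by simp
  show "F y \<le> K" if y: "y \<in> unit_cube I" for y
  proof -
    have "cmod (F0 y) \<le> K"
      using pw_bounded_le[OF diff_class_bound[OF c], of "()" y] y unfolding unit_cube_def by simp
    then show ?thesis using F0[OF sub[OF y]] by simp
  qed
qed

subsection \<open>Lattice rules\<close>

lemma lattice_point_measurable:
  "(\<lambda>\<Delta>. lattice_point I N w \<Delta>) \<in> borel_measurable (cube_measure I)"
proof (rule measurable_coordinatewise_then_product, rule measurable_coordinatewise_then_product)
  fix k j
  show "(\<lambda>\<Delta>. lattice_point I N w \<Delta> k j) \<in> borel_measurable (cube_measure I)"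
  proof (cases "j \<in> I")
    case True
    have "frac \<in> borel_measurable (borel :: real measure)" unfolding frac_def by measurable
    moreover have "(\<lambda>\<Delta>. real k * of_int (w j) / real N + \<Delta> j) \<in> borel_measurable (cube_measure I)"
      by (intro borel_measurable_add borel_measurable_const measurable_cube_component)
    ultimately have "(\<lambda>\<Delta>. frac (real k * of_int (w j) / real N + \<Delta> j)) \<in> borel_measurable (cube_measure I)"
      by (rule measurable_compose[rotated])
    then show ?thesis using True by (simp add: lattice_point_def)
  qed (simp add: lattice_point_def)
qed

text \<open>As a supremum of functions that are continuous in the quadrature points, the worst case error is
  lower semicontinuous in these points.\<close>

lemma worst_case_error_measurable:
  "(\<lambda>\<Delta>. worst_case_error per I \<alpha> \<gamma> N (lattice_point I N w \<Delta>)) \<in> borel_measurable (cube_measure I)"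
proof (rule borel_measurableI_greater)
  fix c :: ennreal
  define V where "V = {v \<in> mixed_space per I \<alpha>. mixed_norm per I \<alpha> \<gamma> v \<le> 1}"
  define e where "e v t = ennreal (cmod ((LINT y|cube_measure I. v y) - (\<Sum>k=1..N. v (t k)) / of_nat N))"
    for v :: "point \<Rightarrow> complex" and t :: "nat \<Rightarrow> point"
  define S where "S = {t :: nat \<Rightarrow> point. \<forall>k. t k \<in> unit_cube I}"
  have "\<exists>O1. open O1 \<and> O1 \<inter> S = e v -` {c<..} \<inter> S" if v: "v \<in> V" for v
  proof -
    have vc: "continuous_on (unit_cube I) v" using v by (simp add: V_def mixed_space_def)
    have "continuous_on S (\<lambda>t. v (t k))" for k
      by (rule continuous_on_compose2[OF vc continuous_on_subset[OF continuous_on_product_coordinates subset_UNIV]])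
        (auto simp: S_def)
    then have "continuous_on S (e v)"
      unfolding e_def divide_inverse
      by (intro continuous_on_ennreal continuous_on_norm continuous_on_diff continuous_on_const continuous_on_mult continuous_on_sum)
    then show ?thesis unfolding continuous_on_open_invariant by (rule allE[of _ "{c<..}"]) auto
  qed
  then obtain Op where Op: "\<And>v. v \<in> V \<Longrightarrow> open (Op v) \<and> Op v \<inter> S = e v -` {c<..} \<inter> S" by metis
  define O2 where "O2 = (\<Union>v\<in>V. Op v)"
  have O2: "open O2" unfolding O2_def using Op by blast
  have S: "lattice_point I N w \<Delta> \<in> S" for \<Delta> by (simp add: S_def lattice_point_in_cube)
  have "c < worst_case_error per I \<alpha> \<gamma> N (lattice_point I N w \<Delta>) \<longleftrightarrow> lattice_point I N w \<Delta> \<in> O2" for \<Delta>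
  proof -
    have "c < worst_case_error per I \<alpha> \<gamma> N (lattice_point I N w \<Delta>) \<longleftrightarrow> (\<exists>v\<in>V. c < e v (lattice_point I N w \<Delta>))"
      unfolding worst_case_error_def less_SUP_iff V_def e_def ..
    also have "\<dots> \<longleftrightarrow> lattice_point I N w \<Delta> \<in> O2" unfolding O2_def using Op S by blast
    finally show ?thesis .
  qed
  then have "{\<Delta> \<in> space (cube_measure I). c < worst_case_error per I \<alpha> \<gamma> N (lattice_point I N w \<Delta>)} =
      (\<lambda>\<Delta>. lattice_point I N w \<Delta>) -` O2 \<inter> space (cube_measure I)" by auto
  also have "\<dots> \<in> sets (cube_measure I)"
    by (rule measurable_sets[OF lattice_point_measurable]) (use O2 in simp)
  finally show "{\<Delta> \<in> space (cube_measure I). c < worst_case_error per I \<alpha> \<gamma> N (lattice_point I N w \<Delta>)} \<in> sets (cube_measure I)" .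
qed

lemma zeta_pos: "1 < t \<Longrightarrow> 0 < zeta t"
proof -
  assume t: "1 < t"
  have "summable (\<lambda>k. real k powr (- t))" using t by (simp add: summable_real_powr_iff)
  then have "summable (\<lambda>k. real (Suc k) powr (- t))" by (subst summable_Suc_iff)
  then have "summable (\<lambda>k. 1 / real (Suc k) powr t)" by (simp only: powr_minus_divide)
  then show ?thesis unfolding zeta_def by (rule suminf_pos) simp
qed

text \<open>Splits off the number of points. The remaining value for one point depends on the
  weights and the exponent but on no generating vector, and so can enter a uniform constant.\<close>

lemma lattice_bound_decay:
  assumes "0 < lam" "N \<ge> 1" "0 \<le> c"
  shows "lattice_bound I N \<gamma> lam c = lattice_bound I 1 \<gamma> lam c * real N powr (- (1 / (2 * lam)))"
proof -
  define S where "S = (\<Sum>u\<in>Pow I - {{}}. \<gamma> u powr lam * c ^ card u)"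
  have S: "0 \<le> S" unfolding S_def using assms(3) by (intro sum_nonneg) simp
  have "lattice_bound I N \<gamma> lam c = (2 * S * inverse (real N)) powr (1 / (2 * lam))"
    by (simp add: lattice_bound_def S_def field_simps)
  also have "\<dots> = (2 * S) powr (1 / (2 * lam)) * inverse (real N) powr (1 / (2 * lam))"
    by (rule powr_mult)
  finally show ?thesis using assms(2) by (simp add: lattice_bound_def S_def powr_minus inverse_powr)
qed

lemma good_lattice_decay:
  assumes g: "good_lattice I \<alpha> \<gamma> N z" and lam: "1 / (2 * real \<alpha>) < lam" "lam \<le> 1" and "\<alpha> \<ge> 1" "N \<ge> 1"
  defines "c \<equiv> 2 * zeta (2 * \<alpha> * lam) / (2 * pi) powr (2 * \<alpha> * lam)"
  shows "worst_case_error True I \<alpha> \<gamma> N (lattice_point I N z (\<lambda>_. 0)) \<le>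
    ennreal (lattice_bound I 1 \<gamma> lam c * real N powr (- (1 / (2 * lam))))"
proof -
  have "1 < 2 * real \<alpha> * lam" using lam assms(4) by (simp add: field_simps)
  then have "0 \<le> c" using zeta_pos[of "2 * real \<alpha> * lam"] unfolding c_def by simp
  moreover have "0 < lam" by (rule le_less_trans[OF _ lam(1)]) simp
  ultimately show ?thesis
    using g lam unfolding good_lattice_def c_def[symmetric] by (simp flip: lattice_bound_decay[OF _ \<open>N \<ge> 1\<close>] add: c_def)
qed

lemma good_shifted_lattice_decay:
  assumes g: "good_shifted_lattice I \<gamma> N w" and lam: "1 / 2 < lam" "lam \<le> 1" and "N \<ge> 1"
  defines "c \<equiv> 2 * zeta (2 * lam) * 2 powr lam / (2 * pi) powr (2 * lam)"
  shows "(\<integral>\<^sup>+\<Delta>. (worst_case_error False I 1 \<gamma> N (lattice_point I N w \<Delta>))\<^sup>2 \<partial>cube_measure I)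
    \<le> (ennreal (lattice_bound I 1 \<gamma> lam c * real N powr (- (1 / (2 * lam)))))\<^sup>2"
proof -
  have "0 \<le> c" using zeta_pos[of "2 * lam"] lam unfolding c_def by simp
  moreover have "0 < lam" using lam by simp
  ultimately show ?thesis
    using g lam unfolding good_shifted_lattice_def by (simp flip: lattice_bound_decay[OF _ \<open>N \<ge> 1\<close>] add: c_def)
qed

text \<open>Positivity rests on 2 \<omega> \<lambda> = \<omega>/(\<omega> - \<epsilon>) > 1, where
  the zeta series converges to a positive number.\<close>

lemma rho_weight_pos:
  assumes "\<omega> \<ge> 1" "0 < \<epsilon>" "\<epsilon> < 1 / 2" "0 < Tt"
  shows "0 < rho_weight \<omega> \<epsilon> Tt u"
proof -
  have "1 < 2 * real \<omega> * (1 / (2 * (real \<omega> - \<epsilon>)))" using assms by (simp add: field_simps)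
  then have "0 < zeta (2 * real \<omega> * (1 / (2 * (real \<omega> - \<epsilon>))))" by (rule zeta_pos)
  then show ?thesis unfolding rho_weight_def Let_def using assms(4) by simp
qed

text \<open>Again 2 \<lambda> > 1: it equals 1/(1 - \<delta>) in the first regime, and 2 p/(2 - p)
  exceeds 1 precisely for p > 2/3 in the second.\<close>

lemma gamma_affine_pos:
  assumes "u \<subseteq> {1..s}" "\<forall>j\<ge>1. 0 < \<beta> j" "0 < T" "0 < pstar" "pstar < 1" "0 < \<delta>" "\<delta> < 1 / 2"
  shows "0 < gamma_affine T \<beta> pstar \<delta> u"
proof -
  define lam where "lam = (if pstar \<le> 2 / 3 then 1 / (2 - 2 * \<delta>) else pstar / (2 - pstar))"
  have "1 < 2 * lam" using assms(4-7) unfolding lam_def by (simp add: field_simps)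
  then have z: "0 < zeta (2 * lam)" by (rule zeta_pos)
  have "0 < (\<Prod>j\<in>u. sqrt ((2 * pi) powr (2 * lam) / (2 * zeta (2 * lam) * 2 powr lam)) * (T * \<beta> j))"
    by (rule prod_pos) (use z assms(1-3) in \<open>auto intro!: mult_pos_pos divide_pos_pos\<close>)
  then have "fact (card u + 1) * (\<Prod>j\<in>u. sqrt ((2 * pi) powr (2 * lam) / (2 * zeta (2 * lam) * 2 powr lam)) * (T * \<beta> j)) \<noteq> 0"
    by simp
  then show ?thesis unfolding gamma_affine_def Let_def lam_def[symmetric] by simp
qed

text \<open>The floor of x + 1/2 exceeds x - 1/2. With x = 1/p the right-hand side is 1/(2
  \<lambda>) for \<lambda> = p/(2 - p), so this \<lambda> is an admissible exponent for smoothness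
  \<alpha>.\<close>

lemma alpha_chebyshev_gt:
  assumes "0 < pstar" "pstar < 1"
  shows "1 / pstar - 1 / 2 < real (alpha_chebyshev pstar)" "1 \<le> alpha_chebyshev pstar"
proof -
  have "1 \<le> 1 / pstar" using assms by simp
  then have "1 \<le> \<lfloor>1 / pstar + 1 / 2\<rfloor>" by (simp add: le_floor_iff)
  then have "real (alpha_chebyshev pstar) = of_int \<lfloor>1 / pstar + 1 / 2\<rfloor>" "1 \<le> alpha_chebyshev pstar"
    unfolding alpha_chebyshev_def by (simp_all add: le_nat_iff)
  then show "1 / pstar - 1 / 2 < real (alpha_chebyshev pstar)" "1 \<le> alpha_chebyshev pstar"
    using floor_correct[of "1 / pstar + 1 / 2"] by linarith+
qed

lemma gamma_chebyshev_pos: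
  assumes "u \<subseteq> {1..s}" "\<forall>j\<ge>1. 0 < \<beta> j" "0 < T" "0 < pstar" "pstar < 1"
  shows "0 < gamma_chebyshev T \<beta> pstar u"
proof -
  define \<alpha> lam where "\<alpha> = alpha_chebyshev pstar" and "lam = pstar / (2 - pstar)"
  note \<alpha> = alpha_chebyshev_gt[OF assms(4,5), folded \<alpha>_def]
  have fu: "finite u" using assms(1) finite_subset by blast
  have "1 < 2 * real \<alpha> * lam" using \<alpha>(1) assms(4,5) unfolding lam_def by (simp add: field_simps)
  then have z: "0 < zeta (2 * real \<alpha> * lam)" by (rule zeta_pos)
  define t where "t k = (fact ((\<Sum>j\<in>u. k j) + 1) *
      (\<Prod>j\<in>u. (T * \<beta> j) ^ k j * real (Stirling \<alpha> (k j)) / sqrt (2 * zeta (2 * real \<alpha> * lam)))) powr (2 / (1 + lam))" for k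
  have "0 < sum t (\<Pi>\<^sub>E j\<in>u. {0..\<alpha>})"
  proof (rule sum_pos2)
    show "finite (\<Pi>\<^sub>E j\<in>u. {0..\<alpha>})" using fu by (intro finite_PiE) auto
    \<comment> \<open>Stirling numbers with second argument 0 vanish, so single terms may be zero;
      the multiindex with all entries 1 gives a positive term, as
      \<open>Stirling \<alpha> 1 = 1\<close> for \<alpha> \<ge> 1.\<close>
    show "(\<lambda>j\<in>u. 1) \<in> (\<Pi>\<^sub>E j\<in>u. {0..\<alpha>})" using \<alpha>(2) by auto
    have "0 < (\<Prod>j\<in>u. (T * \<beta> j) ^ (\<lambda>j\<in>u. 1) j * real (Stirling \<alpha> ((\<lambda>j\<in>u. 1) j)) / sqrt (2 * zeta (2 * real \<alpha> * lam)))"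
    proof (rule prod_pos)
      fix j assume "j \<in> u"
      moreover have "Stirling \<alpha> 1 = 1" using \<alpha>(2) by (cases \<alpha>) (simp, simp only: One_nat_def Stirling_1)
      ultimately show "0 < (T * \<beta> j) ^ (\<lambda>j\<in>u. 1) j * real (Stirling \<alpha> ((\<lambda>j\<in>u. 1) j)) / sqrt (2 * zeta (2 * real \<alpha> * lam))"
        using assms(1-3) z by (auto intro!: mult_pos_pos divide_pos_pos)
    qed
    then show "0 < t (\<lambda>j\<in>u. 1)" unfolding t_def by (simp only: powr_gt_zero) (simp add: less_imp_neq[symmetric])
  qed (simp add: t_def)
  then show ?thesis
    unfolding gamma_chebyshev_def Let_def \<alpha>_def[symmetric] lam_def[symmetric] t_def by simp
qed

subsection \<open>Bounds on the network\<close>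

text \<open>\<open>sup_norm\<close> is a supremum of reals and says something about the values only
  if they are bounded above. Boundedness comes from the base point \<open>y0\<close>, where each
  component is bounded in x, and from the slopes in y.\<close>

lemma sup_norm_bound:
  assumes H: "\<And>p. p \<in> {1..du} \<Longrightarrow> slope_class (cube_measure {1..d}) {1..s} U K \<mu> (H p)"
    and \<mu>: "\<And>j. j \<in> {1..s} \<Longrightarrow> 0 < \<mu> j" and U: "{0..1} \<subseteq> U" "convex U" and K: "0 \<le> K"
    and p: "p \<in> {1..du}" and x: "x \<in> unit_cube {1..d}" and y: "y \<in> unit_cube {1..s}"
  shows "cmod (H p x y) \<le> sup_norm d s du H"
proof -
  define y0 :: point where "y0 = (\<lambda>j\<in>{1..s}. 0)"
  have y0: "y0 \<in> unit_cube {1..s}" by (simp add: y0_def unit_cube_def)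
  note sub = subsetD[OF unit_cube_sub_cube_on[OF U(1)]]
  have "\<exists>b. \<forall>x\<in>unit_cube {1..d}. cmod (H q x y0) \<le> b" if "q \<in> {1..du}" for q
    using H[OF that] sub[OF y0] unfolding slope_class_def space_cube by (elim conjE) (drule bspec, assumption, elim conjE)
  then have "\<forall>q. \<exists>b. q \<in> {1..du} \<longrightarrow> (\<forall>x\<in>unit_cube {1..d}. cmod (H q x y0) \<le> b)" by blast
  from choice[OF this] obtain b where b: "\<And>q x. q \<in> {1..du} \<Longrightarrow> x \<in> unit_cube {1..d} \<Longrightarrow> cmod (H q x y0) \<le> b q"
    by blast
  have le: "cmod (H q x y) \<le> b q + K * real s" if q: "q \<in> {1..du}" and x: "x \<in> unit_cube {1..d}" and y: "y \<in> unit_cube {1..s}" for q x y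
  proof -
    have "cmod (H q x y - H q x y0) \<le> K * (\<Sum>j\<in>{1..s}. \<bar>y j - y0 j\<bar>)"
      by (rule slope_class_increment_le[OF finite_atLeastAtMost H[OF q] \<mu> U(2) _ sub[OF y0] sub[OF y]]) (use x in simp_all)
    also have "\<dots> \<le> K * (\<Sum>j\<in>{1..s}. 1)"
      by (intro mult_left_mono sum_mono K) (use unit_cubeD[OF y] in \<open>auto simp: y0_def\<close>)
    finally have "cmod (H q x y - H q x y0) \<le> K * real s" by simp
    then show ?thesis using b[OF q x] norm_triangle_sub[of "H q x y" "H q x y0"] by linarith
  qed
  let ?m = "\<lambda>x y. Max ((\<lambda>p. cmod (H p x y)) ` {1..du})"
  have ne: "{1..du} \<noteq> {}" using p by auto
  have "bdd_above ((\<lambda>(x, y). ?m x y) ` (unit_cube {1..d} \<times> unit_cube {1..s}))"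
  proof (rule bdd_aboveI2, clarify)
    fix x y assume xy: "x \<in> unit_cube {1..d}" "y \<in> unit_cube {1..s}"
    have "cmod (H q x y) \<le> Max ((\<lambda>q. b q + K * real s) ` {1..du})" if "q \<in> {1..du}" for q
      by (rule order_trans[OF le[OF that xy] Max_ge]) (use that in auto)
    then show "?m x y \<le> Max ((\<lambda>q. b q + K * real s) ` {1..du})"
      using ne by (intro Max.boundedI) auto
  qed
  from cSUP_upper[OF _ this, of "(x, y)"] x y have "?m x y \<le> sup_norm d s du H"
    unfolding sup_norm_def by simp
  moreover have "cmod (H p x y) \<le> ?m x y" using p by (intro Max_ge) auto
  ultimately show ?thesis by simp
qed

lemma norm_le_mat_norm_inf:
  assumes "i \<in> {1..nr}" "j \<in> {1..nc}"
  shows "norm (B i j) \<le> mat_norm_inf nr nc B"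
proof -
  have "norm (B i j) \<le> (\<Sum>j=1..nc. norm (B i j))" using assms(2) by (intro member_le_sum) auto
  also have "\<dots> \<le> mat_norm_inf nr nc B" unfolding mat_norm_inf_def using assms(1) by (intro Max_ge) auto
  finally show ?thesis .
qed

lemma mat_norm_inf_nonneg: "nr \<ge> 1 \<Longrightarrow> 0 \<le> mat_norm_inf nr nc B"
proof -
  assume "nr \<ge> 1"
  then have "(\<Sum>j=1..nc. norm (B 1 j)) \<le> mat_norm_inf nr nc B"
    unfolding mat_norm_inf_def by (intro Max_ge) auto
  then show ?thesis by (rule order_trans[rotated]) (simp add: sum_nonneg)
qed

lemma admissible_params_bounded:
  fixes P Q :: real
  assumes A: "finite A" and dims: "\<forall>l\<in>{1..L + 1}. dims l \<ge> 1"
    and W: "\<forall>l\<in>{1..L}. mat_norm_inf (dims (l + 1)) (dims l) (weight \<theta> l) +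
          (\<Sum>k\<in>A. mat_norm_inf (dims (l + 1)) (dims l) (kernel_coeff \<theta> l k)) \<le> R l"
    and P: "mat_norm_inf (dims 1) 1 (lift_mat \<theta>) \<le> P"
    and Q: "mat_norm_inf du (dims (L + 1)) (proj_mat \<theta>) \<le> Q"
  shows "params_bounded A L du dims R P Q \<theta>"
  unfolding params_bounded_def
proof (intro conjI ballI)
  fix l i j assume l: "l \<in> {1..L}" and i: "i \<in> {1..dims (l + 1)}" and j: "j \<in> {1..dims l}"
  let ?n = "mat_norm_inf (dims (l + 1)) (dims l)"
  have d: "1 \<le> dims (l + 1)" using dims l by auto
  have k: "0 \<le> ?n (kernel_coeff \<theta> l k)" for k by (rule mat_norm_inf_nonneg[OF d])
  have sk: "0 \<le> (\<Sum>k\<in>A. ?n (kernel_coeff \<theta> l k))" by (intro sum_nonneg k)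
  have w: "0 \<le> ?n (weight \<theta> l)" by (rule mat_norm_inf_nonneg[OF d])
  have R: "?n (weight \<theta> l) + (\<Sum>k\<in>A. ?n (kernel_coeff \<theta> l k)) \<le> R l" using W l by blast
  show "\<bar>weight \<theta> l i j\<bar> \<le> R l"
    using norm_le_mat_norm_inf[OF i j, of "weight \<theta> l"] sk R by simp
  fix h assume "h \<in> A"
  then have "?n (kernel_coeff \<theta> l h) \<le> (\<Sum>k\<in>A. ?n (kernel_coeff \<theta> l k))"
    by (intro member_le_sum[where f = "\<lambda>k. ?n (kernel_coeff \<theta> l k)"] A k)
  then show "cmod (kernel_coeff \<theta> l h i j) \<le> R l"
    using norm_le_mat_norm_inf[OF i j, of "kernel_coeff \<theta> l h"] w R by simp
next
  fix i assume "i \<in> {1..dims 1}"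
  then show "\<bar>lift_mat \<theta> i 1\<bar> \<le> P" using norm_le_mat_norm_inf[of i "dims 1" 1 1 "lift_mat \<theta>"] P by simp
next
  fix p j assume "p \<in> {1..du}" "j \<in> {1..dims (L + 1)}"
  then show "\<bar>proj_mat \<theta> p j\<bar> \<le> Q" using norm_le_mat_norm_inf[of p du j "dims (L + 1)" "proj_mat \<theta>"] Q by simp
qed

text \<open>Reduction to the unit cube one coordinate at a time, so that bounds known on the cube
  hold on the whole space.\<close>

lemma torus_periodic_frac:
  assumes I: "finite I" and f: "torus_periodic I f" and y: "y \<in> cube_on I UNIV"
  shows "f (\<lambda>j\<in>I. frac (y j)) = f y"
proof -
  define z where "z u = (\<lambda>j\<in>I. if j \<in> u then frac (y j) else y j)" for u
  have "f (z u) = f y" if "u \<subseteq> I" for u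
    using finite_subset[OF that I] that
  proof (induction u rule: finite_induct)
    case empty
    have "z {} = y" using y by (auto simp: z_def PiE_def extensional_restrict)
    then show ?case by simp
  next
    case (insert j u)
    have j: "j \<in> I" using insert.prems by simp
    have zu: "z u \<in> cube_on I UNIV" by (simp add: z_def)
    have "f ((z u)(j := t + 1)) = f ((z u)(j := t))" for t
      using torus_periodicD[OF f j cube_on_upd[OF zu j UNIV_I, of t]] by simp
    then have "f ((z u)(j := frac (y j))) = f ((z u)(j := y j))"
      by (rule periodic_frac[of "\<lambda>t. f ((z u)(j := t))"])
    moreover have "(z u)(j := frac (y j)) = z (insert j u)" "(z u)(j := y j) = z u"
      using j insert.hyps(2) by (auto simp: z_def fun_eq_iff)
    ultimately show ?case using insert by simp
  qed
  from this[OF order_refl] show ?thesis by (simp add: z_def cong: restrict_cong)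
qed

lemma torus_periodic_bound:
  assumes "finite I" "torus_periodic I f" "y \<in> cube_on I UNIV" "\<And>y. y \<in> unit_cube I \<Longrightarrow> cmod (f y) \<le> B"
  shows "cmod (f y) \<le> B"
proof -
  have "(\<lambda>j\<in>I. frac (y j)) \<in> unit_cube I" by (simp add: unit_cube_def less_imp_le[OF frac_lt_1])
  then show ?thesis using assms(4) torus_periodic_frac[OF assms(1-3)] by metis
qed

lemma fourier_char_periodic: "torus_periodic {1..d} (fourier_char d h)"
  unfolding torus_periodic_def
proof (intro ballI)
  fix j and y :: point assume j: "j \<in> {1..d}"
  have "(\<Sum>p=1..d. of_int (h p) * (y(j := y j + 1)) p) = (\<Sum>p=1..d. of_int (h p) * y p + (if p = j then of_int (h j) else 0))"
    by (intro sum.cong refl) (simp add: algebra_simps)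
  also have "\<dots> = (\<Sum>p=1..d. of_int (h p) * y p) + of_int (h j)" using j by (simp add: sum.distrib)
  finally have "fourier_char d h (y(j := y j + 1)) = fourier_char d h y * cis (2 * pi * of_int (h j))"
    by (simp only: fourier_char_def cis_mult distrib_left)
  also have "cis (2 * pi * of_int (h j)) = 1" by (rule cis_multiple_2pi) simp
  finally show "fourier_char d h (y(j := y j + 1)) = fourier_char d h y" by (simp only: mult_1_right)
qed

lemma fno_hidden_periodic:
  assumes "torus_periodic {1..d} a"
  shows "torus_periodic {1..d} (\<lambda>x. fno_hidden d A dims FC \<sigma> \<theta> l a x i)"
proof (induction l arbitrary: i)
  case 0
  then show ?case using assms by (simp add: torus_periodic_def)
next
  case (Suc l)
  note IH = Suc[unfolded torus_periodic_def, THEN bspec, THEN bspec]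
  note fc = fourier_char_periodic[unfolded torus_periodic_def, THEN bspec, THEN bspec]
  show ?case unfolding torus_periodic_def fno_hidden.simps fno_layer_def
    by (intro ballI) (simp only: IH fc)
qed

lemma fno_periodic:
  assumes "torus_periodic {1..d} (\<lambda>x. a x y)"
  shows "torus_periodic {1..d} (\<lambda>x. fno d A L dims FC \<sigma> a \<theta> p x y)"
  unfolding torus_periodic_def fno_def
  by (intro ballI) (simp only: torus_periodicD[OF fno_hidden_periodic[OF assms]])

text \<open>A sup bound on the unit cube extends to the whole space by periodicity and, with the
  slopes, completes the bounds on all derivatives; one order is then spent on continuity.\<close>

lemma slope_class_Lq:
  assumes I: "finite I" and f: "slope_class one_point I UNIV K (\<lambda>j. Suc (\<mu> j)) (\<lambda>_. f)" "torus_periodic I f"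
    and C: "\<And>y. y \<in> unit_cube I \<Longrightarrow> cmod (f y) \<le> C" "K \<le> C" "0 \<le> C"
  shows "Lq_class q I UNIV C \<mu> f"
proof -
  have "pw_bounded one_point I UNIV UNIV C (\<lambda>_. f)"
    unfolding pw_bounded_def using torus_periodic_bound[OF I f(2) _ C(1)] by simp
  then have "pw_class one_point I UNIV UNIV C (\<lambda>j. Suc (\<mu> j)) (\<lambda>_. f)"
    by (rule slope_class_pw[OF f(1) _ C(2) I])
  then have "pw_class one_point I UNIV {0..1} C (\<lambda>j. Suc (\<mu> j)) (\<lambda>_. f)"
    by (rule diff_class_map[OF I, where T = "\<lambda>f. f"]) (auto simp: pw_bounded_def)
  then show ?thesis by (rule pw_class_Lq[OF I]) (use C(3) in simp_all)
qed

subsection \<open>Generalization and training error\<close>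

lemma quad_error_of_real:
  "quad_error I N pts (\<lambda>x. of_real (f x)) = of_real ((LINT x|cube_measure I. f x) - (\<Sum>k=1..N. f (pts k)) / real N)"
  unfolding quad_error_def by simp

text \<open>The errors are added for the squares, and subadditivity of the square root separates
  them at the end. Every spatial error is bounded by the same \<open>e2\<close>, hence so is their
  average.\<close>

lemma gen_error_le_train_error:
  fixes du :: nat and G H :: "nat \<Rightarrow> point \<Rightarrow> point \<Rightarrow> complex"
  defines "v \<equiv> \<lambda>y x. \<Sum>p=1..du. (cmod (G p x y - H p x y))\<^sup>2"
  assumes n: "n \<ge> 1" and tol: "0 \<le> tol" "train_error du n m ys xs G H \<le> tol"
    and e1: "cmod (quad_error {1..s} n ys (\<lambda>y. of_real (LINT x|cube_measure {1..d}. v y x))) \<le> e1"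
    and e2: "\<And>i. i \<in> {1..n} \<Longrightarrow> cmod (quad_error {1..d} m xs (\<lambda>x. of_real (v (ys i) x))) \<le> e2"
  shows "gen_error d s du G H \<le> tol + sqrt e1 + sqrt e2"
proof -
  define F where "F y = (LINT x|cube_measure {1..d}. v y x)" for y
  define W where "W i = (\<Sum>k=1..m. v (ys i) (xs k)) / real m" for i
  have "cmod (of_real ((LINT y|cube_measure {1..s}. F y) - (\<Sum>i=1..n. F (ys i)) / real n)) \<le> e1"
    using e1 unfolding quad_error_of_real F_def .
  then have E1: "\<bar>(LINT y|cube_measure {1..s}. F y) - (\<Sum>i=1..n. F (ys i)) / real n\<bar> \<le> e1"
    by (simp only: norm_of_real)
  have E2: "\<bar>F (ys i) - W i\<bar> \<le> e2" if "i \<in> {1..n}" for i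
  proof -
    have "cmod (of_real (F (ys i) - W i)) \<le> e2" using e2[OF that] unfolding quad_error_of_real F_def W_def .
    then show ?thesis by (simp only: norm_of_real)
  qed
  have e2pos: "0 \<le> e2" using E2[of 1] n by auto
  have "sqrt (1 / real n * (\<Sum>i=1..n. W i)) \<le> tol"
    using tol(2) unfolding train_error_def W_def v_def by simp
  then have t: "1 / real n * (\<Sum>i=1..n. W i) \<le> tol\<^sup>2" by (rule sqrt_le_D)
  have "(\<Sum>i=1..n. F (ys i)) \<le> (\<Sum>i=1..n. W i + e2)"
  proof (rule sum_mono)
    fix i assume "i \<in> {1..n}"
    from E2[OF this] show "F (ys i) \<le> W i + e2" by linarith
  qed
  also have "\<dots> = (\<Sum>i=1..n. W i) + real n * e2" by (simp add: sum.distrib)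
  finally have "(\<Sum>i=1..n. F (ys i)) / real n \<le> ((\<Sum>i=1..n. W i) + real n * e2) / real n" by (rule divide_right_mono) simp
  also have "\<dots> = 1 / real n * (\<Sum>i=1..n. W i) + e2" using n by (simp add: field_simps)
  finally have "(LINT y|cube_measure {1..s}. F y) \<le> tol\<^sup>2 + e1 + e2" using t E1 by linarith
  then have "gen_error d s du G H \<le> sqrt (tol\<^sup>2 + e1 + e2)"
    unfolding gen_error_def F_def v_def by (rule real_sqrt_le_mono)
  also have "\<dots> \<le> sqrt (tol\<^sup>2 + e1) + sqrt e2" using tol(1) E1 e2pos by (intro sqrt_add_le_add_sqrt) auto
  also have "\<dots> \<le> sqrt (tol\<^sup>2) + sqrt e1 + sqrt e2" using E1 by (intro add_right_mono sqrt_add_le_add_sqrt) auto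
  finally show ?thesis using tol(1) by simp
qed

text \<open>Replaces the bounds for the individual multiindices, finitely many, by one constant that
  serves all \<open>v\<close> alike, in particular all slices of the target.\<close>

lemma regular_in_x_bound:
  "\<exists>B>0. \<forall>v. regular_in_x d \<omega> v Ct Tt \<longrightarrow> continuous_on (unit_cube {1..d}) v \<and>
     (\<forall>y\<in>unit_cube {1..d}. \<forall>j\<in>{1..d}. v (y(j := 0)) = v (y(j := 1))) \<and>
     (\<forall>\<nu>\<in>(\<Pi>\<^sub>E j\<in>{1..d}. {0..\<omega>}). \<exists>w\<in>Lq 4 (cube_measure {1..d}). has_weak_deriv True {1..d} \<nu> v w \<and>
        (LINT y|cube_measure {1..d}. cmod (w y) ^ 4) \<le> B ^ 4)"
proof -
  let ?M = "cube_measure {1..d}" and ?S = "\<Pi>\<^sub>E j\<in>{1..d}. {0..\<omega>}"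
  define bnd where "bnd \<nu> = Ct * (2 * pi) ^ (\<Sum>j=1..d. \<nu> j) * fact (\<Sum>j=1..d. \<nu> j) * Tt ^ (\<Sum>j=1..d. \<nu> j)" for \<nu> :: "nat \<Rightarrow> nat"
  define B where "B = 1 + (\<Sum>\<nu>\<in>?S. \<bar>bnd \<nu>\<bar>)"
  have B: "0 < B" unfolding B_def by (intro add_pos_nonneg sum_nonneg) auto
  have fin: "finite ?S" by (intro finite_PiE) auto
  have bB: "bnd \<nu> \<le> B" if "\<nu> \<in> ?S" for \<nu>
    using member_le_sum[OF that, of "\<lambda>\<nu>. \<bar>bnd \<nu>\<bar>"] fin unfolding B_def by simp
  have "\<exists>w\<in>Lq 4 ?M. has_weak_deriv True {1..d} \<nu> v w \<and> (LINT y|?M. cmod (w y) ^ 4) \<le> B ^ 4"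
    if v: "regular_in_x d \<omega> v Ct Tt" and \<nu>: "\<nu> \<in> ?S" for v \<nu>
  proof -
    from v \<nu> obtain w where w: "w \<in> Lq 4 ?M" "has_weak_deriv True {1..d} \<nu> v w" "Lq_norm 4 ?M w \<le> bnd \<nu>"
      unfolding regular_in_x_def bnd_def Let_def by blast
    have nn: "0 \<le> (LINT y|?M. cmod (w y) ^ 4)" by (rule Bochner_Integration.integral_nonneg) simp
    have "(LINT y|?M. cmod (w y) ^ 4) = Lq_norm 4 ?M w ^ 4"
      unfolding Lq_norm_def using nn by (subst powr_realpow'[symmetric]) (simp_all add: powr_powr)
    also have "\<dots> \<le> B ^ 4"
      using w(3) bB[OF \<nu>] by (intro power_mono) (auto simp: Lq_norm_def)
    finally show ?thesis using w by blast
  qed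
  moreover have "continuous_on (unit_cube {1..d}) v \<and> (\<forall>y\<in>unit_cube {1..d}. \<forall>j\<in>{1..d}. v (y(j := 0)) = v (y(j := 1)))"
    if "regular_in_x d \<omega> v Ct Tt" for v
    using that unfolding regular_in_x_def mixed_space_def by simp
  ultimately show ?thesis using B by (intro exI[of _ B]) simp
qed

text \<open>If a frequency in \<open>A\<close> is aliased to zero by the lattice, its Fourier character is integrated with error 1.\<close>

lemma aliasing_wce:
  assumes A: "finite A" and \<rho>: "\<And>u. u \<subseteq> {1..d} \<Longrightarrow> 0 < \<rho> u"
  shows "\<exists>K\<ge>0. \<forall>m\<ge>1. \<forall>z. (\<forall>h\<in>A. (\<exists>p\<in>{1..d}. h p \<noteq> 0) \<longrightarrow>
      fourier_coeff_app d m (lattice_point {1..d} m z (\<lambda>_. 0)) (\<lambda>_. 1) h = 0) \<or>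
    1 \<le> ennreal K * worst_case_error True {1..d} \<omega> \<rho> m (lattice_point {1..d} m z (\<lambda>_. 0))"
proof -
  let ?I = "{1..d}"
  let ?c = "\<lambda>h. fourier_char d (\<lambda>p. - h p)"
  have "\<exists>k\<ge>0. pw_class one_point ?I UNIV UNIV k (\<lambda>_. Suc \<omega>) (\<lambda>_. ?c h)" for h
    by (rule fourier_char_pw_class)
  then obtain k where k: "\<And>h. 0 \<le> k h" "\<And>h. pw_class one_point ?I UNIV UNIV (k h) (\<lambda>_. Suc \<omega>) (\<lambda>_. ?c h)" by metis
  \<comment> \<open>The additional 1 makes the bound positive, as the comparison with the worst case
    error requires.\<close>
  have c: "Lq_class 2 ?I UNIV (k h + 1) (\<lambda>_. \<omega>) (?c h)" for h
  proof -
    have "pw_class one_point ?I UNIV {0..1} (k h + 1) (\<lambda>_. Suc \<omega>) (\<lambda>_. ?c h)"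
      by (rule diff_class_map[OF _ pw_class_mono[where C = "k h + 1", OF _ k(2)], where T = "\<lambda>f. f"]) (auto simp: pw_bounded_def)
    then show ?thesis by (rule pw_class_Lq[rotated]) (use k(1) in simp_all)
  qed
  define Z where "Z = sqrt (\<Sum>u\<in>Pow ?I. 1 / \<rho> u)"
  have Z: "0 \<le> Z" unfolding Z_def using \<rho> by (intro real_sqrt_ge_zero sum_nonneg) (auto simp: less_imp_le)
  define K where "K = (\<Sum>h\<in>A. (k h + 1) * Z)"
  have K: "0 \<le> K" unfolding K_def using k(1) Z by (intro sum_nonneg mult_nonneg_nonneg) (auto intro: add_nonneg_nonneg)
  show ?thesis
  proof (intro exI[of _ K] conjI allI impI K)
    fix m :: nat and z assume m: "1 \<le> m"
    let ?pts = "lattice_point ?I m z (\<lambda>_. 0)"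
    have "1 \<le> ennreal K * worst_case_error True ?I \<omega> \<rho> m ?pts"
      if h: "h \<in> A" "p \<in> ?I" "h p \<noteq> 0" and ne: "fourier_coeff_app d m ?pts (\<lambda>_. 1) h \<noteq> 0" for h p
    proof -
      \<comment> \<open>The character average over the lattice is 0 or 1, so if it is not 0 it is 1,
        while the exact integral is 0.\<close>
      have "(\<Sum>k=1..m. ?c h (?pts k)) / of_nat m = 1"
        using fourier_char_lattice_sum[OF m, of d "\<lambda>p. - h p" z] ne by (simp add: fourier_coeff_app_def)
      moreover have "(LINT x|cube_measure ?I. ?c h x) = 0"
        using fourier_coeff_one[of p d h] h by (simp add: fourier_coeff_def)
      ultimately have q: "quad_error ?I m ?pts (?c h) = - 1" by (simp add: quad_error_def)
      have Kle: "(k h + 1) * Z \<le> K"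
        unfolding K_def using k(1) Z
        by (intro member_le_sum[where f = "\<lambda>h. (k h + 1) * Z"] h A) (auto intro!: mult_nonneg_nonneg add_nonneg_nonneg)
      have "ennreal (cmod (quad_error ?I m ?pts (?c h))) \<le> ennreal ((k h + 1) * Z) * worst_case_error True ?I \<omega> \<rho> m ?pts"
        unfolding Z_def
        by (rule quad_error_le_wce[OF _ _ c _ \<rho>]) (use k(1)[of h] fourier_char_periodic in simp_all)
      then have "1 \<le> ennreal ((k h + 1) * Z) * worst_case_error True ?I \<omega> \<rho> m ?pts" by (simp add: q)
      also have "\<dots> \<le> ennreal K * worst_case_error True ?I \<omega> \<rho> m ?pts"
        by (intro mult_right_mono ennreal_leI Kle) simp
      finally show ?thesis .
    qed
    then show "(\<forall>h\<in>A. (\<exists>p\<in>?I. h p \<noteq> 0) \<longrightarrow> fourier_coeff_app d m ?pts (\<lambda>_. 1) h = 0) \<or>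
      1 \<le> ennreal K * worst_case_error True ?I \<omega> \<rho> m ?pts" by blast
  qed
qed

subsection \<open>Networks on affine and Chebyshev fields\<close>

text \<open>Covers both fields at once: \<phi> is the univariate function of each parameter, and
  \<open>per\<close> decides between the torus and the cube. \<open>P\<close> and \<open>Q\<close>
  are entrywise thresholds, \<open>b\<close> and \<open>b'\<close> bound the derivatives of \<sigma>
  and \<phi>.\<close>

locale field_network =
  fixes d L du s \<omega> :: nat and dims :: "nat \<Rightarrow> nat" and r h and A :: "(nat \<Rightarrow> int) set" and \<eta> P Q C :: real
    and \<sigma> :: "real \<Rightarrow> real" and R b :: "nat \<Rightarrow> real" and \<phi> :: "real \<Rightarrow> real" and b' :: "nat \<Rightarrow> real"
    and per :: bool and U :: "real set" and a
  assumes du: "du \<ge> 1" and A: "finite A"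
    and \<sigma>: "smooth \<sigma>" "\<And>k t. k \<ge> 1 \<Longrightarrow> \<bar>(deriv ^^ k) \<sigma> t\<bar> \<le> b k"
    and R: "\<And>l. l \<ge> 1 \<Longrightarrow> 0 \<le> R l" and P: "0 \<le> P" and Q: "0 \<le> Q" and C: "0 < C"
    and \<phi>: "smooth \<phi>" "\<And>k t. k \<ge> 1 \<Longrightarrow> \<bar>(deriv ^^ k) \<phi> t\<bar> \<le> b' k" "\<And>t. 0 \<le> t \<Longrightarrow> t \<le> 1 \<Longrightarrow> \<bar>\<phi> t\<bar> \<le> 1"
    and U: "U = (if per then UNIV else {0..1})" and \<phi>_per: "\<And>t. per \<Longrightarrow> \<phi> (t + 1) = \<phi> t"
    and a: "a = (\<lambda>x y. basis_fun d \<eta> r h 0 x + (\<Sum>j=1..s. of_real (\<phi> (y j)) * basis_fun d \<eta> r h j x))"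
begin

abbreviation net :: "((point \<Rightarrow> complex) \<Rightarrow> (nat \<Rightarrow> int) \<Rightarrow> complex) \<Rightarrow> fno_params \<Rightarrow> nat \<Rightarrow> point \<Rightarrow> point \<Rightarrow> complex" where
  "net FC \<theta> \<equiv> fno d A L dims FC \<sigma> a \<theta>"

definition feasible :: "((point \<Rightarrow> complex) \<Rightarrow> (nat \<Rightarrow> int) \<Rightarrow> complex) \<Rightarrow> fno_params \<Rightarrow> bool" where
  "feasible FC \<theta> \<longleftrightarrow> (\<forall>h\<in>A. averaging {1..d} (\<lambda>v. FC v h)) \<and> params_bounded A L du dims R P Q \<theta> \<and>
     sup_norm d s du (net FC \<theta>) \<le> C"

lemma U': "{0..1} \<subseteq> U" "convex U" by (simp_all add: U)

lemma net_periodic_y: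
  assumes "per" "j \<in> {1..s}"
  shows "net FC \<theta> p x (y(j := y j + 1)) = net FC \<theta> p x y"
proof -
  have "a x (y(j := y j + 1)) = a x y" for x
    unfolding a using \<phi>_per[OF assms(1), of "y j"] by (intro arg_cong2[where f = "(+)"] refl sum.cong) simp
  then show ?thesis unfolding fno_def by (simp only:)
qed

lemma net_periodic_x: "torus_periodic {1..d} (\<lambda>x. net FC \<theta> p x y)"
proof (rule fno_periodic)
  have "basis_fun d \<eta> r h j (x(i := x i + 1)) = basis_fun d \<eta> r h j x" if "i \<in> {1..d}" "x \<in> cube_on {1..d} UNIV" for i j x
    by (simp only: basis_fun_def torus_periodicD[OF fourier_char_periodic that])
  then show "torus_periodic {1..d} (\<lambda>x. a x y)" unfolding torus_periodic_def a by (intro ballI) (simp only:)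
qed

text \<open>Slopes come from the layers, the size from the sup norm. The latter is known on the unit
  cube and extends to the whole space by periodicity in y when \<open>U\<close> is the real
  line.\<close>

lemma net_y: "\<exists>K>0. \<forall>FC \<theta>. feasible FC \<theta> \<longrightarrow>
    (\<forall>p\<in>{1..du}. pw_class (cube_measure {1..d}) {1..s} U U K (\<lambda>_. Suc \<alpha>) (net FC \<theta> p)) \<and>
    (\<forall>p\<in>{1..du}. \<forall>x\<in>unit_cube {1..d}. \<forall>y\<in>cube_on {1..s} U. cmod (net FC \<theta> p x y) \<le> C)"
proof -
  obtain B where B: "0 \<le> B" "slope_class (cube_measure {1..d}) {1..s} U B (\<lambda>_. Suc \<alpha>) a"
    unfolding a using field_slope_y[OF \<phi>(1,2)] by blast
  have "\<exists>K\<ge>0. \<forall>\<theta> FC. params_bounded A L du dims R P Q \<theta> \<longrightarrow> (\<forall>h\<in>A. averaging {1..d} (\<lambda>v. FC v h)) \<longrightarrow>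
       (\<forall>p\<in>{1..du}. slope_class (cube_measure {1..d}) {1..s} U K (\<lambda>_. Suc \<alpha>) (net FC \<theta> p))"
    by (rule fno_slope_y[where b = b and Ba = B]) (use A U' \<sigma> R P B Q in simp_all)
  then obtain K where K: "0 \<le> K" and K2: "\<forall>\<theta> FC. params_bounded A L du dims R P Q \<theta> \<longrightarrow>
      (\<forall>h\<in>A. averaging {1..d} (\<lambda>v. FC v h)) \<longrightarrow>
      (\<forall>p\<in>{1..du}. slope_class (cube_measure {1..d}) {1..s} U K (\<lambda>_. Suc \<alpha>) (net FC \<theta> p))"
    by (elim exE conjE) (rule that)
  note K2 = K2[THEN spec, THEN spec, THEN mp, THEN mp, THEN bspec]
  show ?thesis
  proof (intro exI[of _ "K + C"] conjI allI impI)
    show "0 < K + C" using K C by simp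
    fix FC \<theta> assume f: "feasible FC \<theta>"
    have sl: "slope_class (cube_measure {1..d}) {1..s} U K (\<lambda>_. Suc \<alpha>) (net FC \<theta> p)" if "p \<in> {1..du}" for p
      using f that unfolding feasible_def by (elim conjE) (rule K2)
    have C1: "cmod (net FC \<theta> p x y) \<le> C" if "p \<in> {1..du}" "x \<in> unit_cube {1..d}" "y \<in> unit_cube {1..s}" for p x y
    proof -
      have "cmod (net FC \<theta> p x y) \<le> sup_norm d s du (net FC \<theta>)"
        by (rule sup_norm_bound[where H = "net FC \<theta>" and K = K and \<mu> = "\<lambda>_. Suc \<alpha>" and U = U]) (use sl U' K that in simp_all)
      also have "\<dots> \<le> C" using f unfolding feasible_def by (elim conjE)
      finally show ?thesis .
    qed
    have C2: "cmod (net FC \<theta> p x y) \<le> C" if p: "p \<in> {1..du}" and x: "x \<in> unit_cube {1..d}" and y: "y \<in> cube_on {1..s} U" for p x y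
    proof (cases per)
      case True
      have "torus_periodic {1..s} (\<lambda>y. net FC \<theta> p x y)"
        unfolding torus_periodic_def using net_periodic_y[OF True] by blast
      then show ?thesis by (rule torus_periodic_bound[OF finite_atLeastAtMost _ _ C1[OF p x]]) (use y True U in simp_all)
    next
      case False
      then show ?thesis using C1[OF p x, of y] y by (simp add: U unit_cube_def)
    qed
    show "\<forall>p\<in>{1..du}. pw_class (cube_measure {1..d}) {1..s} U U (K + C) (\<lambda>_. Suc \<alpha>) (net FC \<theta> p)"
    proof
      fix p assume p: "p \<in> {1..du}"
      have "pw_bounded (cube_measure {1..d}) {1..s} U U (K + C) (net FC \<theta> p)"
        unfolding pw_bounded_def
      proof (intro conjI ballI)
        fix y assume "y \<in> cube_on {1..s} U"
        then show "(\<lambda>x. net FC \<theta> p x y) \<in> borel_measurable (cube_measure {1..d})"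
          using sl[OF p] unfolding slope_class_def by blast
        fix x assume "x \<in> space (cube_measure {1..d})"
        with C2[OF p, of x y] K \<open>y \<in> cube_on {1..s} U\<close> show "cmod (net FC \<theta> p x y) \<le> K + C" by simp
      qed
      then show "pw_class (cube_measure {1..d}) {1..s} U U (K + C) (\<lambda>_. Suc \<alpha>) (net FC \<theta> p)"
        by (rule slope_class_pw[OF sl[OF p]]) (use C in simp_all)
    qed
    show "\<forall>p\<in>{1..du}. \<forall>x\<in>unit_cube {1..d}. \<forall>y\<in>cube_on {1..s} U. cmod (net FC \<theta> p x y) \<le> C"
      using C2 by blast
  qed
qed

text \<open>The side condition says that the Fourier functional annihilates constants at nonzero
  frequencies; under it the biases do not disturb the derivatives in x. The bound is uniform over y
  because the coefficients of the field are.\<close>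

lemma net_x: "\<exists>K>0. \<forall>FC \<theta>. feasible FC \<theta> \<longrightarrow> (\<forall>h\<in>A. (\<exists>p\<in>{1..d}. h p \<noteq> 0) \<longrightarrow> FC (\<lambda>_. 1) h = 0) \<longrightarrow>
    (\<forall>p\<in>{1..du}. \<forall>y\<in>unit_cube {1..s}. Lq_class 4 {1..d} UNIV K (\<lambda>_. \<omega>) (\<lambda>x. net FC \<theta> p x y))"
proof -
  from field_slope_x[where s = s and d = d and \<mu> = "\<lambda>_. Suc \<omega>" and \<eta> = \<eta> and r = r and h = h] obtain B where B: "0 \<le> B"
    "\<forall>c :: nat \<Rightarrow> real. (\<forall>j\<in>{1..s}. \<bar>c j\<bar> \<le> 1) \<longrightarrow> slope_class one_point {1..d} UNIV B (\<lambda>_. Suc \<omega>)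
      (\<lambda>_ x. basis_fun d \<eta> r h 0 x + (\<Sum>j=1..s. of_real (c j) * basis_fun d \<eta> r h j x))"
    by (elim exE conjE) (rule that)
  have "\<exists>K\<ge>0. \<forall>\<theta> FC a y. params_bounded A L du dims R P Q \<theta> \<longrightarrow> (\<forall>h\<in>A. averaging {1..d} (\<lambda>v. FC v h)) \<longrightarrow>
       (\<forall>h\<in>A. (\<exists>p\<in>{1..d}. h p \<noteq> 0) \<longrightarrow> FC (\<lambda>_. 1) h = 0) \<longrightarrow>
       slope_class one_point {1..d} UNIV B (\<lambda>_. Suc \<omega>) (\<lambda>_ x. a x y) \<longrightarrow>
       (\<forall>p\<in>{1..du}. slope_class one_point {1..d} UNIV K (\<lambda>_. Suc \<omega>) (\<lambda>_ x. fno d A L dims FC \<sigma> a \<theta> p x y))"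
    by (rule fno_slope_x[where b = b and Ba = B]) (use A \<sigma> R P B(1) Q in simp_all)
  then obtain K where K: "0 \<le> K" and K2: "\<forall>\<theta> FC a y. params_bounded A L du dims R P Q \<theta> \<longrightarrow>
       (\<forall>h\<in>A. averaging {1..d} (\<lambda>v. FC v h)) \<longrightarrow>
       (\<forall>h\<in>A. (\<exists>p\<in>{1..d}. h p \<noteq> 0) \<longrightarrow> FC (\<lambda>_. 1) h = 0) \<longrightarrow>
       slope_class one_point {1..d} UNIV B (\<lambda>_. Suc \<omega>) (\<lambda>_ x. a x y) \<longrightarrow>
       (\<forall>p\<in>{1..du}. slope_class one_point {1..d} UNIV K (\<lambda>_. Suc \<omega>) (\<lambda>_ x. fno d A L dims FC \<sigma> a \<theta> p x y))"
    by (elim exE conjE) (rule that)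
  note K2 = K2[THEN spec, THEN spec, THEN spec, THEN spec, THEN mp, THEN mp, THEN mp, THEN mp, THEN bspec]
  from net_y[of 0] obtain K' where K': "\<And>FC \<theta>. feasible FC \<theta> \<Longrightarrow>
    (\<forall>p\<in>{1..du}. \<forall>x\<in>unit_cube {1..d}. \<forall>y\<in>cube_on {1..s} U. cmod (net FC \<theta> p x y) \<le> C)" by meson
  show ?thesis
  proof (intro exI[of _ "K + C"] conjI allI impI ballI)
    show "0 < K + C" using K C by simp
    fix FC \<theta> p y
    assume f: "feasible FC \<theta>" and al: "\<forall>h\<in>A. (\<exists>p\<in>{1..d}. h p \<noteq> 0) \<longrightarrow> FC (\<lambda>_. 1) h = 0"
      and p: "p \<in> {1..du}" and y: "y \<in> unit_cube {1..s}"
    have "\<bar>\<phi> (y j)\<bar> \<le> 1" if "j \<in> {1..s}" for j using \<phi>(3) unit_cubeD[OF y that] by simp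
    then have ac: "slope_class one_point {1..d} UNIV B (\<lambda>_. Suc \<omega>) (\<lambda>_ x. a x y)"
      unfolding a by (intro B(2)[THEN spec, THEN mp]) simp
    have sl: "slope_class one_point {1..d} UNIV K (\<lambda>_. Suc \<omega>) (\<lambda>_ x. net FC \<theta> p x y)"
      using f p al ac unfolding feasible_def by (elim conjE) (rule K2)
    show "Lq_class 4 {1..d} UNIV (K + C) (\<lambda>_. \<omega>) (\<lambda>x. net FC \<theta> p x y)"
    proof (rule slope_class_Lq[OF _ sl net_periodic_x])
      fix x assume "x \<in> unit_cube {1..d}"
      then have "cmod (net FC \<theta> p x y) \<le> C" using K'[OF f] p y unit_cube_sub_cube_on[OF U'(1)] by blast
      then show "cmod (net FC \<theta> p x y) \<le> K + C" using K by simp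
    qed (use K C in simp_all)
  qed
qed

text \<open>The minimum with \<open>K\<close> keeps the expression finite even if the worst case
  error is infinite for some shift, so it can be converted to a real number without losing the
  bound. The second part is the trivial bound on the generalization error.\<close>

lemma y_error:
  assumes G: "\<forall>p\<in>{1..du}. regular_in_y d s U (G p) bnd" "per \<Longrightarrow> \<forall>p\<in>{1..du}. periodic_in_y d s (G p)"
    and \<gamma>: "\<And>u. u \<subseteq> {1..s} \<Longrightarrow> 0 < \<gamma> u"
  shows "\<exists>K\<ge>0. \<forall>n\<ge>1. \<forall>pts FC \<theta>. (\<forall>k\<in>{1..n}. pts k \<in> unit_cube {1..s}) \<longrightarrow> feasible FC \<theta> \<longrightarrow>
    cmod (quad_error {1..s} n pts (\<lambda>y. of_real (LINT x|cube_measure {1..d}. (\<Sum>p=1..du. (cmod (G p x y - net FC \<theta> p x y))\<^sup>2))))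
      \<le> enn2real (min (ennreal K) (ennreal K * worst_case_error per {1..s} \<alpha> \<gamma> n pts)) \<and>
    gen_error d s du G (net FC \<theta>) \<le> sqrt K"
proof -
  let ?I = "{1..s}" and ?D = "{1..d}"
  have "\<forall>p. \<exists>B. \<exists>g. p \<in> {1..du} \<longrightarrow> 0 < B \<and> (\<forall>y\<in>cube_on ?I U. \<forall>x\<in>unit_cube ?D. g x y = G p x y) \<and>
      L2_class ?D ?I U B (\<lambda>_. Suc \<alpha>) g"
  proof
    fix p show "\<exists>B g. p \<in> {1..du} \<longrightarrow> 0 < B \<and> (\<forall>y\<in>cube_on ?I U. \<forall>x\<in>unit_cube ?D. g x y = G p x y) \<and>
      L2_class ?D ?I U B (\<lambda>_. Suc \<alpha>) g"
    proof (cases "p \<in> {1..du}")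
      case True
      from regular_in_y_class[OF bspec[OF G(1) True], of "\<lambda>_. Suc \<alpha>"] show ?thesis
        by (elim exE) (intro exI impI)
    next
      case False
      then show ?thesis by - (intro exI impI, erule notE, assumption)
    qed
  qed
  from choice[OF this] obtain B where "\<forall>p. \<exists>g. p \<in> {1..du} \<longrightarrow> 0 < B p \<and>
    (\<forall>y\<in>cube_on ?I U. \<forall>x\<in>unit_cube ?D. g x y = G p x y) \<and> L2_class ?D ?I U (B p) (\<lambda>_. Suc \<alpha>) g"
    by (elim exE) (rule that)
  from choice[OF this] obtain g where g: "\<forall>p. p \<in> {1..du} \<longrightarrow> 0 < B p \<and>
    (\<forall>y\<in>cube_on ?I U. \<forall>x\<in>unit_cube ?D. g p x y = G p x y) \<and> L2_class ?D ?I U (B p) (\<lambda>_. Suc \<alpha>) (g p)"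
    by (elim exE) (rule that)
  note g = g[THEN spec, THEN mp]
  define BG where "BG = sum B {1..du}"
  have BG: "0 < BG" unfolding BG_def using du conjunct1[OF g] by (intro sum_pos) auto
  have gc: "L2_class ?D ?I U BG (\<lambda>_. Suc \<alpha>) (g p)" if p: "p \<in> {1..du}" for p
  proof (rule diff_class_map[OF _ conjunct2[OF conjunct2[OF g[OF p]]], where T = "\<lambda>f. f"])
    have le: "B p \<le> BG" unfolding BG_def using conjunct1[OF g] p by (intro member_le_sum) (auto simp: less_imp_le)
    fix f assume "L2_bounded ?D ?I U (B p) f"
    then show "L2_bounded ?D ?I U BG f" unfolding L2_bounded_def using le by (meson order_trans)
  qed simp_all
  from net_y[of \<alpha>] obtain BH where BH: "0 < BH" and H: "\<And>FC \<theta>. feasible FC \<theta> \<Longrightarrow>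
    (\<forall>p\<in>{1..du}. pw_class (cube_measure ?D) ?I U U BH (\<lambda>_. Suc \<alpha>) (net FC \<theta> p))" by blast
  define K1 where "K1 = real (card {1..du}) * (2 ^ sum (\<lambda>_. Suc \<alpha>) ?I * ((BG + BH) * (BG + BH)))"
  define Z where "Z = sqrt (\<Sum>u\<in>Pow ?I. 1 / \<gamma> u)"
  have K1: "0 \<le> K1" unfolding K1_def using BG BH by simp
  have Z: "0 \<le> Z" unfolding Z_def using \<gamma> by (intro real_sqrt_ge_zero sum_nonneg) (auto simp: less_imp_le)
  define K where "K = 2 * K1 + K1 * Z"
  have K: "0 \<le> K" "K1 \<le> K" "2 * K1 \<le> K" "K1 * Z \<le> K" unfolding K_def using K1 Z by simp_all
  show ?thesis
  proof (intro exI[of _ K] conjI allI impI K(1))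
    fix n :: nat and pts FC \<theta>
    assume n: "1 \<le> n" and pts: "\<forall>k\<in>{1..n}. pts k \<in> unit_cube ?I" and f: "feasible FC \<theta>"
    define F where "F y = (LINT x|cube_measure ?D. (\<Sum>p=1..du. (cmod (G p x y - net FC \<theta> p x y))\<^sup>2))" for y
    have gG: "g p x y = G p x y" if "p \<in> {1..du}" "x \<in> unit_cube ?D" "y \<in> cube_on ?I U" for p x y
      using g[OF that(1)] that(2,3) by blast
    have perG: "G p x (y(j := y j + 1)) = G p x y"
      if "per" "p \<in> {1..du}" "x \<in> unit_cube ?D" "y \<in> cube_on ?I UNIV" "j \<in> ?I" for p x y j
      using G(2)[OF that(1)] that(2-5) unfolding periodic_in_y_def by blast
    have perU: "U = UNIV" if "per" using that U by simp
    have ne: "{1..du} \<noteq> {}" using du by simp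
    have perH: "net FC \<theta> p x (y(j := y j + 1)) = net FC \<theta> p x y"
      if "per" "p \<in> {1..du}" "x \<in> unit_cube ?D" "y \<in> cube_on ?I UNIV" "j \<in> ?I" for p x y j
      by (rule net_periodic_y[OF that(1,5)])
    note fin = finite_atLeastAtMost
    have pts': "pts k \<in> unit_cube ?I" if "k \<in> {1..n}" for k using pts that by blast
    note H' = bspec[OF H[OF f]]
    have yq1: "ennreal (cmod (quad_error ?I n pts (\<lambda>y. of_real (F y)))) \<le> ennreal (K1 * Z) * worst_case_error per ?I \<alpha> \<gamma> n pts"
      unfolding F_def K1_def Z_def
      by (rule y_quad_bound(1)[where U = U and g = g]) (fact fin ne U' BG BH \<gamma> gc gG H' perU perG perH pts')+
    have yq2: "F y \<le> K1" if "y \<in> unit_cube ?I" for y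
      unfolding F_def K1_def
      by (rule y_quad_bound(2)[where U = U and g = g and N = n and pts = pts and per = per and \<gamma> = \<gamma>])
        (fact fin ne U' BG BH \<gamma> gc gG H' perU perG perH pts' that)+
    have F: "0 \<le> F y" "F y \<le> K1" if "y \<in> unit_cube ?I" for y
      using yq2[OF that] unfolding F_def by (auto intro!: Bochner_Integration.integral_nonneg sum_nonneg)
    have LF: "0 \<le> (LINT y|cube_measure ?I. F y)" "(LINT y|cube_measure ?I. F y) \<le> K1"
      using norm_integral_cube_le[of ?I F K1] F K1 by (auto intro!: Bochner_Integration.integral_nonneg)
    have "(\<Sum>k=1..n. F (pts k)) \<le> (\<Sum>k=1..n. K1)" using F(2) pts by (intro sum_mono) blast
    then have "(\<Sum>k=1..n. F (pts k)) / real n \<le> K1" using n by (simp add: divide_simps mult.commute)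
    moreover have "0 \<le> (\<Sum>k=1..n. F (pts k)) / real n" using F(1) pts by (intro divide_nonneg_nonneg sum_nonneg) auto
    ultimately have "\<bar>(LINT y|cube_measure ?I. F y) - (\<Sum>k=1..n. F (pts k)) / real n\<bar> \<le> K" using LF K by linarith
    then have "cmod (quad_error ?I n pts (\<lambda>y. of_real (F y))) \<le> K" unfolding quad_error_of_real norm_of_real .
    moreover have "ennreal (cmod (quad_error ?I n pts (\<lambda>y. of_real (F y)))) \<le> ennreal K * worst_case_error per ?I \<alpha> \<gamma> n pts"
      by (rule order_trans[OF yq1]) (intro mult_right_mono ennreal_leI K(4), simp)
    ultimately have "ennreal (cmod (quad_error ?I n pts (\<lambda>y. of_real (F y)))) \<le>
        min (ennreal K) (ennreal K * worst_case_error per ?I \<alpha> \<gamma> n pts)" by (simp add: ennreal_leI)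
    then have "enn2real (ennreal (cmod (quad_error ?I n pts (\<lambda>y. of_real (F y))))) \<le>
        enn2real (min (ennreal K) (ennreal K * worst_case_error per ?I \<alpha> \<gamma> n pts))"
      by (rule enn2real_mono) (simp add: min_less_iff_disj)
    then show "cmod (quad_error ?I n pts (\<lambda>y. of_real (LINT x|cube_measure ?D. (\<Sum>p=1..du. (cmod (G p x y - net FC \<theta> p x y))\<^sup>2)))) \<le>
        enn2real (min (ennreal K) (ennreal K * worst_case_error per ?I \<alpha> \<gamma> n pts))" unfolding F_def by simp
    show "gen_error d s du G (net FC \<theta>) \<le> sqrt K"
      unfolding gen_error_def F_def[symmetric] using LF(2) K(2) by simp
  qed
qed

end

context field_network
begin

text \<open>Applied at each parameter point separately; the constant is the same for all y, so
  averaging over the points costs nothing.\<close>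

lemma x_error:
  assumes G: "\<forall>p\<in>{1..du}. \<forall>y\<in>unit_cube {1..s}. regular_in_x d \<omega> (\<lambda>x. G p x y) Ct Tt"
    and \<rho>: "\<And>u. u \<subseteq> {1..d} \<Longrightarrow> 0 < \<rho> u"
  shows "\<exists>K\<ge>0. \<forall>m pts FC \<theta>. \<forall>y\<in>unit_cube {1..s}. (\<forall>k\<in>{1..m}. pts k \<in> unit_cube {1..d}) \<longrightarrow> feasible FC \<theta> \<longrightarrow>
      (\<forall>h\<in>A. (\<exists>p\<in>{1..d}. h p \<noteq> 0) \<longrightarrow> FC (\<lambda>_. 1) h = 0) \<longrightarrow>
    ennreal (cmod (quad_error {1..d} m pts (\<lambda>x. of_real (\<Sum>p=1..du. (cmod (G p x y - net FC \<theta> p x y))\<^sup>2))))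
      \<le> ennreal K * worst_case_error True {1..d} \<omega> \<rho> m pts"
proof -
  let ?D = "{1..d}"
  from regular_in_x_bound[of d \<omega> Ct Tt] obtain BG where BG: "0 < BG" and g0: "\<forall>v. regular_in_x d \<omega> v Ct Tt \<longrightarrow>
     continuous_on (unit_cube ?D) v \<and> (\<forall>y\<in>unit_cube ?D. \<forall>j\<in>?D. v (y(j := 0)) = v (y(j := 1))) \<and>
     (\<forall>\<nu>\<in>(\<Pi>\<^sub>E j\<in>?D. {0..\<omega>}). \<exists>w\<in>Lq 4 (cube_measure ?D). has_weak_deriv True ?D \<nu> v w \<and>
        (LINT y|cube_measure ?D. cmod (w y) ^ 4) \<le> BG ^ 4)"
    by (elim exE conjE) (rule that)
  from net_x obtain BH where BH: "0 < BH" and h0: "\<forall>FC \<theta>. feasible FC \<theta> \<longrightarrow>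
      (\<forall>h\<in>A. (\<exists>p\<in>?D. h p \<noteq> 0) \<longrightarrow> FC (\<lambda>_. 1) h = 0) \<longrightarrow>
      (\<forall>p\<in>{1..du}. \<forall>y\<in>unit_cube {1..s}. Lq_class 4 ?D UNIV BH (\<lambda>_. \<omega>) (\<lambda>x. net FC \<theta> p x y))"
    by (elim exE conjE) (rule that)
  define K where "K = real (card {1..du}) * (2 ^ sum (\<lambda>_. \<omega>) ?D * (2 * (BG + BH) * (2 * (BG + BH)))) * sqrt (\<Sum>u\<in>Pow ?D. 1 / \<rho> u)"
  have K: "0 \<le> K" unfolding K_def using BG BH \<rho>
    by (intro mult_nonneg_nonneg real_sqrt_ge_zero sum_nonneg) (auto simp: less_imp_le)
  show ?thesis
  proof (intro exI[of _ K] conjI K allI ballI impI)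
    fix m :: nat and pts :: "nat \<Rightarrow> point" and FC \<theta> and y :: point
    assume y: "y \<in> unit_cube {1..s}" and pts: "\<forall>k\<in>{1..m}. pts k \<in> unit_cube ?D" and f: "feasible FC \<theta>"
      and al: "\<forall>h\<in>A. (\<exists>p\<in>?D. h p \<noteq> 0) \<longrightarrow> FC (\<lambda>_. 1) h = 0"
    note gp = g0[THEN spec, THEN mp, OF bspec[OF bspec[OF G] y]]
    note gc = conjunct1[OF gp] and gf = bspec[OF bspec[OF conjunct1[OF conjunct2[OF gp]]]] and gw = bspec[OF conjunct2[OF conjunct2[OF gp]]]
    note hc = bspec[OF bspec[OF h0[THEN spec, THEN spec, THEN mp, THEN mp, OF f al]] y]
    have ne: "{1..du} \<noteq> {}" using du by simp
    have perx: "torus_periodic ?D (\<lambda>x. net FC \<theta> p x y)" if "p \<in> {1..du}" for p by (rule net_periodic_x)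
    have pts': "pts k \<in> unit_cube ?D" if "k \<in> {1..m}" for k using pts that by blast
    show "ennreal (cmod (quad_error ?D m pts (\<lambda>x. of_real (\<Sum>p=1..du. (cmod (G p x y - net FC \<theta> p x y))\<^sup>2))))
      \<le> ennreal K * worst_case_error True ?D \<omega> \<rho> m pts"
      unfolding K_def
      by (rule x_quad_bound) (fact finite_atLeastAtMost ne BG BH \<rho> gc gf gw hc perx pts')+
  qed
qed

text \<open>Keeps the parametric worst case error explicit for arbitrary points, since the shifted
  and the unshifted lattice use it differently. Only the spatial error is already converted into a
  rate.\<close>

lemma network_error:
  fixes \<epsilon> Tt :: real
  assumes Gx: "\<forall>p\<in>{1..du}. \<forall>y\<in>unit_cube {1..s}. regular_in_x d \<omega> (\<lambda>x. G p x y) Ct Tt"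
    and Gy: "\<forall>p\<in>{1..du}. regular_in_y d s U (G p) bnd" "per \<Longrightarrow> \<forall>p\<in>{1..du}. periodic_in_y d s (G p)"
    and \<gamma>: "\<And>u. u \<subseteq> {1..s} \<Longrightarrow> 0 < \<gamma> u"
    and \<omega>: "\<omega> \<ge> 1" and \<epsilon>: "0 < \<epsilon>" "\<epsilon> < 1 / 2" and Tt: "0 < Tt"
  shows "\<exists>K\<ge>0. \<forall>n\<ge>1. \<forall>pts. (\<forall>k\<in>{1..n}. pts k \<in> unit_cube {1..s}) \<longrightarrow>
    (\<forall>m\<ge>1. \<forall>z. good_lattice {1..d} \<omega> (rho_weight \<omega> \<epsilon> Tt) m z \<longrightarrow>
     (\<forall>FC\<in>{fourier_coeff d, fourier_coeff_app d m (lattice_point {1..d} m z (\<lambda>_. 0))}. \<forall>\<theta> tol.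
        params_bounded A L du dims R P Q \<theta> \<longrightarrow> sup_norm d s du (net FC \<theta>) \<le> C \<longrightarrow> 0 < tol \<longrightarrow>
        train_error du n m pts (lattice_point {1..d} m z (\<lambda>_. 0)) G (net FC \<theta>) \<le> tol \<longrightarrow>
        gen_error d s du G (net FC \<theta>) \<le>
          tol + sqrt (enn2real (min (ennreal K) (ennreal K * worst_case_error per {1..s} \<alpha> \<gamma> n pts))) +
          K * real m powr (- (\<omega> - \<epsilon>) / 2)))"
proof -
  let ?D = "{1..d}" and ?I = "{1..s}"
  let ?\<rho> = "rho_weight \<omega> \<epsilon> Tt"
  have \<rho>: "0 < ?\<rho> u" for u by (rule rho_weight_pos[OF \<omega> \<epsilon> Tt])
  \<comment> \<open>The exponent used in the weights; its rate 1/(2 \<lambda>) is \<omega> -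
    \<epsilon>, and \<epsilon> > 0 makes it admissible.\<close>
  define lam where "lam = 1 / (2 * (real \<omega> - \<epsilon>))"
  have \<omega>\<epsilon>: "1 / 2 < real \<omega> - \<epsilon>" using \<omega> \<epsilon> by simp
  have lam: "1 / (2 * real \<omega>) < lam" "lam \<le> 1" "1 / (2 * lam) = real \<omega> - \<epsilon>"
    using \<omega> \<epsilon> \<omega>\<epsilon> unfolding lam_def by (simp_all add: field_simps)
  define Lx where "Lx = lattice_bound ?D 1 ?\<rho> lam (2 * zeta (2 * real \<omega> * lam) / (2 * pi) powr (2 * real \<omega> * lam))"
  have Lx: "0 \<le> Lx" unfolding Lx_def lattice_bound_def by simp
  have "\<exists>K\<ge>0. \<forall>n\<ge>1. \<forall>pts FC \<theta>.
    (\<forall>k\<in>{1..n}. pts k \<in> unit_cube ?I) \<longrightarrow> feasible FC \<theta> \<longrightarrow>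
    cmod (quad_error ?I n pts (\<lambda>y. of_real (LINT x|cube_measure ?D. (\<Sum>p=1..du. (cmod (G p x y - net FC \<theta> p x y))\<^sup>2))))
      \<le> enn2real (min (ennreal K) (ennreal K * worst_case_error per ?I \<alpha> \<gamma> n pts)) \<and>
    gen_error d s du G (net FC \<theta>) \<le> sqrt K"
    by (rule y_error) (fact Gy \<gamma>)+
  then obtain Ky where Ky: "0 \<le> Ky" and y_err: "\<forall>n\<ge>1. \<forall>pts FC \<theta>.
    (\<forall>k\<in>{1..n}. pts k \<in> unit_cube ?I) \<longrightarrow> feasible FC \<theta> \<longrightarrow>
    cmod (quad_error ?I n pts (\<lambda>y. of_real (LINT x|cube_measure ?D. (\<Sum>p=1..du. (cmod (G p x y - net FC \<theta> p x y))\<^sup>2))))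
      \<le> enn2real (min (ennreal Ky) (ennreal Ky * worst_case_error per ?I \<alpha> \<gamma> n pts)) \<and>
    gen_error d s du G (net FC \<theta>) \<le> sqrt Ky"
    by (elim exE conjE) (rule that)
  from x_error[where \<rho> = ?\<rho>, OF Gx \<rho>] obtain Kx where Kx: "0 \<le> Kx" and x_err: "\<forall>m pts FC \<theta>. \<forall>y\<in>unit_cube ?I.
      (\<forall>k\<in>{1..m}. pts k \<in> unit_cube ?D) \<longrightarrow> feasible FC \<theta> \<longrightarrow>
      (\<forall>h\<in>A. (\<exists>p\<in>?D. h p \<noteq> 0) \<longrightarrow> FC (\<lambda>_. 1) h = 0) \<longrightarrow>
    ennreal (cmod (quad_error ?D m pts (\<lambda>x. of_real (\<Sum>p=1..du. (cmod (G p x y - net FC \<theta> p x y))\<^sup>2))))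
      \<le> ennreal Kx * worst_case_error True ?D \<omega> ?\<rho> m pts"
    by (elim exE conjE) (rule that)
  from aliasing_wce[where \<rho> = ?\<rho> and d = d and \<omega> = \<omega>, OF A \<rho>] obtain Ka where Ka: "0 \<le> Ka" and aliased: "\<forall>m\<ge>1. \<forall>z. (\<forall>h\<in>A. (\<exists>p\<in>?D. h p \<noteq> 0) \<longrightarrow>
      fourier_coeff_app d m (lattice_point ?D m z (\<lambda>_. 0)) (\<lambda>_. 1) h = 0) \<or>
    1 \<le> ennreal Ka * worst_case_error True ?D \<omega> ?\<rho> m (lattice_point ?D m z (\<lambda>_. 0))"
    by (elim exE conjE) (rule that)
  \<comment> \<open>The summands serve the parametric error, the spatial error in the regular case,
    and the aliased case.\<close>
  define K where "K = Ky + sqrt (Kx * Lx) + sqrt (Ky * (Ka * Lx))"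
  have K: "0 \<le> K" "Ky \<le> K" "sqrt (Kx * Lx) \<le> K" "sqrt (Ky * (Ka * Lx)) \<le> K"
    unfolding K_def using Ky Kx Ka Lx by simp_all
  show ?thesis
  proof (intro exI[of _ K] conjI K(1) allI ballI impI)
    fix n :: nat and pts :: "nat \<Rightarrow> point" and m :: nat and z FC \<theta> tol
    let ?xs = "lattice_point ?D m z (\<lambda>_. 0)"
    let ?wy = "worst_case_error per ?I \<alpha> \<gamma> n pts"
    assume n: "1 \<le> n" and pts: "\<forall>k\<in>{1..n}. pts k \<in> unit_cube ?I" and m: "1 \<le> m"
      and good: "good_lattice ?D \<omega> ?\<rho> m z" and FC: "FC \<in> {fourier_coeff d, fourier_coeff_app d m ?xs}"
      and \<theta>: "params_bounded A L du dims R P Q \<theta>" "sup_norm d s du (net FC \<theta>) \<le> C"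
      and tol: "0 < tol" and train: "train_error du n m pts ?xs G (net FC \<theta>) \<le> tol"
    have xs: "?xs k \<in> unit_cube ?D" for k by (rule lattice_point_in_cube)
    have "averaging ?D (\<lambda>v. FC v h)" for h
      using FC averaging_fourier_coeff averaging_fourier_coeff_app[OF m xs] by auto
    then have f: "feasible FC \<theta>" using \<theta> by (simp add: feasible_def)
    define e where "e = real m powr (- (real \<omega> - \<epsilon>))"
    have wx: "worst_case_error True ?D \<omega> ?\<rho> m ?xs \<le> ennreal (Lx * e)"
      using good_lattice_decay[OF good lam(1,2) \<omega> m] unfolding Lx_def[symmetric] lam(3) e_def .
    have e: "0 \<le> e" "sqrt e = real m powr (- (\<omega> - \<epsilon>) / 2)"
      unfolding e_def by (simp_all add: powr_half_sqrt[symmetric] powr_powr)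
    define E where "E = enn2real (min (ennreal K) (ennreal K * ?wy))"
    have E: "0 \<le> E" by (simp add: E_def)
    note ye = y_err[THEN spec, THEN mp, OF n, THEN spec, THEN spec, THEN spec, THEN mp, OF pts, THEN mp, OF f]
    have "gen_error d s du G (net FC \<theta>) \<le> tol + sqrt E + K * sqrt e"
    proof (cases "\<forall>h\<in>A. (\<exists>p\<in>?D. h p \<noteq> 0) \<longrightarrow> FC (\<lambda>_. 1) h = 0")
      case True
      have "enn2real (min (ennreal Ky) (ennreal Ky * ?wy)) \<le> E"
        unfolding E_def using K(1,2)
        by (intro enn2real_mono min.mono ennreal_leI mult_right_mono) (simp_all add: min_less_iff_disj)
      then have e1: "cmod (quad_error ?I n pts (\<lambda>y. of_real (LINT x|cube_measure ?D. (\<Sum>p=1..du. (cmod (G p x y - net FC \<theta> p x y))\<^sup>2)))) \<le> E"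
        using conjunct1[OF ye] by (rule order_trans[rotated])
      have e2: "cmod (quad_error ?D m ?xs (\<lambda>x. of_real (\<Sum>p=1..du. (cmod (G p x (pts i) - net FC \<theta> p x (pts i)))\<^sup>2))) \<le> Kx * Lx * e"
        if "i \<in> {1..n}" for i
      proof -
        have "ennreal (cmod (quad_error ?D m ?xs (\<lambda>x. of_real (\<Sum>p=1..du. (cmod (G p x (pts i) - net FC \<theta> p x (pts i)))\<^sup>2))))
            \<le> ennreal Kx * worst_case_error True ?D \<omega> ?\<rho> m ?xs"
          by (rule x_err[THEN spec, THEN spec, THEN spec, THEN spec, THEN bspec, THEN mp, THEN mp, THEN mp, OF bspec[OF pts that] ballI[OF xs] f True])
        also have "\<dots> \<le> ennreal Kx * ennreal (Lx * e)" by (intro mult_left_mono wx) simp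
        also have "\<dots> = ennreal (Kx * Lx * e)" using Kx by (simp add: ennreal_mult' mult.assoc)
        finally show ?thesis using Kx Lx e(1) by (simp add: ennreal_le_iff)
      qed
      have "gen_error d s du G (net FC \<theta>) \<le> tol + sqrt E + sqrt (Kx * Lx * e)"
        by (rule gen_error_le_train_error[OF n less_imp_le[OF tol] train e1 e2])
      also have "sqrt (Kx * Lx * e) \<le> K * sqrt e"
        using K(3) e(1) by (simp add: real_sqrt_mult mult_right_mono)
      finally show ?thesis by simp
    next
      case False
      \<comment> \<open>Exact coefficients of a constant vanish at nonzero frequencies, so only the
        lattice approximation can fail the condition.\<close>
      have "FC \<noteq> fourier_coeff d"
      proof
        assume "FC = fourier_coeff d"
        with False fourier_coeff_one show False by blast
      qed
      with FC have "FC = fourier_coeff_app d m ?xs" by simp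
      with False aliased[THEN spec, THEN mp, OF m, THEN spec, of z]
      have "1 \<le> ennreal Ka * worst_case_error True ?D \<omega> ?\<rho> m ?xs" by (elim disjE) simp_all
      also have "\<dots> \<le> ennreal Ka * ennreal (Lx * e)" by (intro mult_left_mono wx) simp
      also have "\<dots> = ennreal (Ka * Lx * e)" using Ka by (simp add: ennreal_mult' mult.assoc)
      \<comment> \<open>The lower bound on the worst case error and its decay contradict each other
        for large m; for the remaining m the decay factor is bounded below, and the trivial bound
        can be multiplied by it.\<close>
      finally have 1: "1 \<le> Ka * Lx * e" by simp
      have "gen_error d s du G (net FC \<theta>) \<le> sqrt Ky" by (rule conjunct2[OF ye])
      also have "\<dots> \<le> sqrt (Ky * (Ka * Lx) * e)"
        using mult_left_mono[OF 1 Ky] by (simp add: mult.assoc)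
      also have "\<dots> \<le> K * sqrt e" using K(4) e(1) by (simp add: real_sqrt_mult mult_right_mono)
      finally show ?thesis using tol E by (simp add: add_increasing)
    qed
    then show "gen_error d s du G (net FC \<theta>) \<le>
          tol + sqrt (enn2real (min (ennreal K) (ennreal K * ?wy))) + K * real m powr (- (\<omega> - \<epsilon>) / 2)"
      unfolding E_def e(2) .
  qed
qed

end

section \<open>The random shift and the final constants\<close>

lemma ennreal_le_one_plus_square: "(X :: ennreal) \<le> 1 + X\<^sup>2"
proof (cases "X \<le> 1")
  case True
  then show ?thesis by (rule order_trans) simp
next
  case False
  then have "X * 1 \<le> X * X" by (intro mult_left_mono) auto
  also have "\<dots> \<le> 1 + X\<^sup>2" by (simp add: power2_eq_square)
  finally show ?thesis by simp
qed

text \<open>With t = n^r the factor satisfies \<kappa> n^(-r/2) \<ge> sqrt E, so \<kappa> absorbs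
  the error for the given shift. Its square is at most 2 K^2 + 2 K t W, and t W \<le> 1 + (t W)^2
  reduces the mean to the second moment of the worst case error, the quantity that good generating
  vectors control.\<close>

lemma random_factor:
  fixes K Ly t :: real and W :: "point \<Rightarrow> ennreal"
  assumes I: "finite I" and W: "W \<in> borel_measurable (cube_measure I)"
    and W2: "(\<integral>\<^sup>+\<Delta>. (W \<Delta>)\<^sup>2 \<partial>cube_measure I) \<le> (ennreal (Ly / t))\<^sup>2"
    and K: "0 \<le> K" and Ly: "0 \<le> Ly" and t: "0 < t"
  defines "\<kappa> \<equiv> \<lambda>\<Delta>. K + sqrt (enn2real (min (ennreal K) (ennreal K * W \<Delta>)) * t)"
  shows "\<kappa> \<in> borel_measurable (cube_measure I)"
    and "(\<integral>\<^sup>+\<Delta>. ennreal ((\<kappa> \<Delta>)\<^sup>2) \<partial>cube_measure I) \<le> ennreal ((sqrt (2 * K\<^sup>2 + 2 * K * (1 + Ly\<^sup>2)))\<^sup>2)"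
proof -
  let ?M = "cube_measure I"
  note [measurable] = W
  show "\<kappa> \<in> borel_measurable ?M" unfolding \<kappa>_def by measurable
  have pt: "ennreal ((\<kappa> \<Delta>)\<^sup>2) \<le> ennreal (2 * K\<^sup>2) + ennreal (2 * K) * (1 + (ennreal t)\<^sup>2 * (W \<Delta>)\<^sup>2)" for \<Delta>
  proof -
    define E where "E = enn2real (min (ennreal K) (ennreal K * W \<Delta>))"
    have "min (ennreal K) (ennreal K * W \<Delta>) < top" by (simp add: min_less_iff_disj)
    then have "ennreal E = min (ennreal K) (ennreal K * W \<Delta>)" unfolding E_def by (rule ennreal_enn2real)
    then have E: "ennreal E \<le> ennreal K * W \<Delta>" by simp
    have E0: "0 \<le> E" by (simp add: E_def)
    have "(\<kappa> \<Delta>)\<^sup>2 \<le> 2 * K\<^sup>2 + 2 * (sqrt (E * t))\<^sup>2"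
      unfolding \<kappa>_def E_def[symmetric] power2_sum using sum_squares_bound[of K "sqrt (E * t)"] by linarith
    also have "(sqrt (E * t))\<^sup>2 = E * t" using E0 t by simp
    finally have "ennreal ((\<kappa> \<Delta>)\<^sup>2) \<le> ennreal (2 * K\<^sup>2 + 2 * (E * t))" by (rule ennreal_leI)
    also have "\<dots> = ennreal (2 * K\<^sup>2) + 2 * (ennreal t * ennreal E)"
      using E0 t by (simp add: ennreal_plus ennreal_mult mult.commute)
    also have "\<dots> \<le> ennreal (2 * K\<^sup>2) + 2 * (ennreal t * (ennreal K * W \<Delta>))"
      by (intro add_left_mono mult_left_mono E) simp_all
    also have "2 * (ennreal t * (ennreal K * W \<Delta>)) = ennreal (2 * K) * (ennreal t * W \<Delta>)"
      using K by (simp add: ennreal_mult ac_simps)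
    also have "\<dots> \<le> ennreal (2 * K) * (1 + (ennreal t * W \<Delta>)\<^sup>2)"
      by (intro mult_left_mono ennreal_le_one_plus_square) simp
    finally show ?thesis by (simp add: power_mult_distrib add_left_mono)
  qed
  have "(\<integral>\<^sup>+\<Delta>. ennreal ((\<kappa> \<Delta>)\<^sup>2) \<partial>?M) \<le>
      (\<integral>\<^sup>+\<Delta>. ennreal (2 * K\<^sup>2) + ennreal (2 * K) * (1 + (ennreal t)\<^sup>2 * (W \<Delta>)\<^sup>2) \<partial>?M)"
    by (intro nn_integral_mono pt)
  also have "\<dots> = ennreal (2 * K\<^sup>2) + ennreal (2 * K) * (1 + (ennreal t)\<^sup>2 * (\<integral>\<^sup>+\<Delta>. (W \<Delta>)\<^sup>2 \<partial>?M))"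
    by (simp add: nn_integral_add nn_integral_cmult emeasure_cube[OF I])
  also have "\<dots> \<le> ennreal (2 * K\<^sup>2) + ennreal (2 * K) * (1 + (ennreal t)\<^sup>2 * (ennreal (Ly / t))\<^sup>2)"
    by (intro add_left_mono mult_left_mono W2) simp_all
  also have "(ennreal t)\<^sup>2 * (ennreal (Ly / t))\<^sup>2 = ennreal (Ly\<^sup>2)"
    using Ly t by (simp add: power_mult_distrib[symmetric] ennreal_mult[symmetric] ennreal_power)
  also have "ennreal (2 * K\<^sup>2) + ennreal (2 * K) * (1 + ennreal (Ly\<^sup>2)) = ennreal (2 * K\<^sup>2 + 2 * K * (1 + Ly\<^sup>2))"
    using K by (simp add: ennreal_plus ennreal_mult flip: ennreal_1)
  also have "\<dots> = ennreal ((sqrt (2 * K\<^sup>2 + 2 * K * (1 + Ly\<^sup>2)))\<^sup>2)" using K by simp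
  finally show "(\<integral>\<^sup>+\<Delta>. ennreal ((\<kappa> \<Delta>)\<^sup>2) \<partial>?M) \<le> ennreal ((sqrt (2 * K\<^sup>2 + 2 * K * (1 + Ly\<^sup>2)))\<^sup>2)" .
qed

lemma deriv_funpow_minus_const:
  assumes "k \<ge> 1"
  shows "\<bar>(deriv ^^ k) (\<lambda>t. t - c) t\<bar> \<le> (1 :: real)"
proof -
  have c: "(deriv ^^ k) (\<lambda>_. 1 :: real) = (\<lambda>_. if k = 0 then 1 else 0)" for k
    by (induction k) simp_all
  have "deriv (\<lambda>t. t - c) = (\<lambda>_. 1 :: real)"
    by (intro ext DERIV_imp_deriv) (auto intro!: derivative_eq_intros)
  with assms show ?thesis by (cases k) (simp_all add: funpow_Suc_right c del: funpow.simps)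
qed

lemma Pi_R_pos:
  assumes "\<forall>l\<ge>1. 0 < R l" "0 < \<xi>" "0 < \<tau>"
  shows "0 < Pi_R \<xi> \<tau> R k"
  unfolding Pi_R_def using assms by (intro prod_pos) auto

lemma S_const_pos:
  assumes "\<forall>l\<ge>1. 0 < R l" "0 < \<xi>" "0 < \<tau>" "L \<ge> 1"
  shows "0 < S_const \<xi> \<tau> R L"
  unfolding S_const_def using assms Pi_R_pos[OF assms(1-3)] by (intro mult_pos_pos sum_pos) auto

theorem theorem5:
  fixes d L du s \<omega> :: nat
    and dims :: "nat \<Rightarrow> nat"
    and r :: "(nat \<Rightarrow> int) \<Rightarrow> real"
    and h :: "nat \<Rightarrow> nat \<Rightarrow> int"
    and A :: "(nat \<Rightarrow> int) set"
    and M \<eta> \<xi> \<tau> pstar C T Ct Tt \<epsilon> :: real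
    and \<psi> :: "nat \<Rightarrow> point \<Rightarrow> complex"
    and \<sigma> :: "real \<Rightarrow> real"
    and R \<beta> :: "nat \<Rightarrow> real"
    and G :: "nat \<Rightarrow> point \<Rightarrow> point \<Rightarrow> complex"
    and net :: "((point \<Rightarrow> complex) \<Rightarrow> (nat \<Rightarrow> int) \<Rightarrow> complex) \<Rightarrow>
                (point \<Rightarrow> point \<Rightarrow> complex) \<Rightarrow> fno_params \<Rightarrow>
                nat \<Rightarrow> point \<Rightarrow> point \<Rightarrow> complex"
    and xs :: "nat \<Rightarrow> (nat \<Rightarrow> int) \<Rightarrow> nat \<Rightarrow> point"
    and ys :: "nat \<Rightarrow> (nat \<Rightarrow> int) \<Rightarrow> point \<Rightarrow> nat \<Rightarrow> point"
    and admissible :: "(nat \<Rightarrow> point \<Rightarrow> point \<Rightarrow> complex) \<Rightarrow> fno_params \<Rightarrow> bool"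
  assumes "d \<ge> 1" "L \<ge> 1" "du \<ge> 1" "\<omega> \<ge> 1" "\<forall>l\<in>{1..L + 1}. dims l \<ge> 1"
    and r_pos: "\<forall>k\<in>(\<Pi>\<^sub>E p\<in>{1..d}. UNIV). r k > 0"
    and h_enum: "bij_betw h {1..} (\<Pi>\<^sub>E p\<in>{1..d}. UNIV)"
    and h_ordered: "\<forall>i j. 1 \<le> i \<and> i \<le> j \<longrightarrow> 1 / r (h i) \<ge> 1 / r (h j)"
    and "M > 0" and A_def: "A = {k\<in>(\<Pi>\<^sub>E p\<in>{1..d}. UNIV). r k \<le> M}" and "finite A"
    and s_def: "s = 2 * card A"
    and "\<eta> > 0" and psi_def: "\<psi> = basis_fun d \<eta> r h"
    and "smooth \<sigma>"
    and positive: "\<forall>l\<ge>1. R l > 0" "\<forall>j\<ge>1. \<beta> j > 0" "\<xi> > 0" "\<tau> > 0"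
                  "C > 0" "T > 0" "Ct > 0" "Tt > 0"
    and psi_bound: "\<forall>j\<in>{1..s}. \<forall>x\<in>unit_cube {1..d}. cmod (\<psi> j x) \<le> \<beta> j"
    and sigma_bound: "\<forall>k\<ge>1. \<forall>t. \<bar>(deriv ^^ k) \<sigma> t\<bar> \<le> \<xi> * \<tau> ^ k * fact k"
    and "0 < pstar" "pstar < 1" and beta_summable: "summable (\<lambda>j. \<beta> (Suc j) powr pstar)"
    and "0 < \<epsilon>" "\<epsilon> < 1 / 2"
    and G_regular: "\<forall>p\<in>{1..du}. \<forall>y\<in>unit_cube {1..s}. regular_in_x d \<omega> (\<lambda>x. G p x y) Ct Tt"
    and net_def: "net = (\<lambda>FC a \<theta>. fno d A L dims FC \<sigma> a \<theta>)"
    and xs_def: "xs = (\<lambda>m z. lattice_point {1..d} m z (\<lambda>_. 0))"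
    and ys_def: "ys = (\<lambda>n w \<Delta>. lattice_point {1..s} n w \<Delta>)"
    and admissible_def: "admissible = (\<lambda>H \<theta>.
       (\<forall>l\<in>{1..L}. mat_norm_inf (dims (l + 1)) (dims l) (weight \<theta> l) +
          (\<Sum>k\<in>A. mat_norm_inf (dims (l + 1)) (dims l) (kernel_coeff \<theta> l k)) \<le> R l) \<and>
       (let normP = mat_norm_inf (dims 1) 1 (lift_mat \<theta>);
            normQ = mat_norm_inf du (dims (L + 1)) (proj_mat \<theta>);
            normG = sup_norm d s du H
        in C_const \<xi> \<tau> R L normG normQ \<le> C \<and>
           normP * S_const \<xi> \<tau> R L \<le> T \<and>
           Ct_const \<xi> \<tau> R L normG normQ \<le> Ct \<and>
           St_const \<xi> \<tau> R L normP (J_const d \<eta> r A \<omega>) \<le> Tt))"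
  shows
    "(let a = affine_field s \<psi> in
      \<forall>\<delta>. 0 < \<delta> \<and> \<delta> < 1 / 2 \<longrightarrow>
        (\<exists>amin>0. \<forall>x\<in>unit_cube {1..d}. \<forall>y\<in>unit_cube {1..s}. Re (a x y) \<ge> amin) \<longrightarrow>
        (\<forall>p\<in>{1..du}. regular_in_y d s {0..1} (G p) (bound_affine s C T \<beta>)) \<longrightarrow>
        (let rate = min (1 - \<delta>) (1 / pstar - 1 / 2) in
         \<exists>K\<ge>0. \<forall>n\<ge>1. \<forall>w. good_shifted_lattice {1..s} (gamma_affine T \<beta> pstar \<delta>) n w \<longrightarrow>
           \<comment> \<open>The factor \<open>\<kappa> \<Delta>\<close> in front of the rate is random; its root mean square
              over the shift is bounded by \<open>K\<close>, independently of \<open>n\<close> and \<open>m\<close>.\<close>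
           (\<exists>\<kappa> \<in> borel_measurable (cube_measure {1..s}).
              (\<integral>\<^sup>+\<Delta>. ennreal ((\<kappa> \<Delta>)\<^sup>2) \<partial>cube_measure {1..s}) \<le> ennreal (K\<^sup>2) \<and>
              (\<forall>\<Delta>\<in>unit_cube {1..s}. \<forall>m\<ge>1. \<forall>z.
                 good_lattice {1..d} \<omega> (rho_weight \<omega> \<epsilon> Tt) m z \<longrightarrow>
                 (\<forall>FC\<in>{fourier_coeff d, fourier_coeff_app d m (xs m z)}. \<forall>\<theta> tol.
                    admissible (net FC a \<theta>) \<theta> \<longrightarrow> 0 < tol \<and> tol < 1 \<longrightarrow>
                    train_error du n m (ys n w \<Delta>) (xs m z) G (net FC a \<theta>) \<le> tol \<longrightarrow>
                    gen_error d s du G (net FC a \<theta>) \<le>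
                      tol + \<kappa> \<Delta> * (real n powr (- rate / 2) + real m powr (- (\<omega> - \<epsilon>) / 2)))))))
     \<and>
     (let a = chebyshev_field s \<psi> in
        (\<exists>amin>0. \<forall>x\<in>unit_cube {1..d}. \<forall>y\<in>unit_cube {1..s}. Re (a x y) \<ge> amin) \<longrightarrow>
        (\<forall>p\<in>{1..du}. periodic_in_y d s (G p) \<and>
           regular_in_y d s UNIV (G p) (bound_chebyshev s C T \<beta>)) \<longrightarrow>
        (let rate = 1 / pstar - 1 / 2 in
         \<exists>K\<ge>0. \<forall>n\<ge>1. \<forall>w.
           good_lattice {1..s} (alpha_chebyshev pstar) (gamma_chebyshev T \<beta> pstar) n w \<longrightarrow>
           (\<forall>m\<ge>1. \<forall>z. good_lattice {1..d} \<omega> (rho_weight \<omega> \<epsilon> Tt) m z \<longrightarrow>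
              (\<forall>FC\<in>{fourier_coeff d, fourier_coeff_app d m (xs m z)}. \<forall>\<theta> tol.
                 admissible (net FC a \<theta>) \<theta> \<longrightarrow> 0 < tol \<and> tol < 1 \<longrightarrow>
                 train_error du n m (ys n w (\<lambda>_. 0)) (xs m z) G (net FC a \<theta>) \<le> tol \<longrightarrow>
                 gen_error d s du G (net FC a \<theta>) \<le>
                   tol + K * (real n powr (- rate / 2) + real m powr (- (\<omega> - \<epsilon>) / 2))))))"
proof -
  let ?D = "{1..d}" and ?I = "{1..s}"
  define S0 Pi0 where "S0 = S_const \<xi> \<tau> R L" and "Pi0 = Pi_R \<xi> \<tau> R L"
  have pos: "0 < S0" "0 < Pi0"
    unfolding S0_def Pi0_def using S_const_pos[OF positive(1,3,4) \<open>L \<ge> 1\<close>] Pi_R_pos[OF positive(1,3,4)] by simp_all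
  \<comment> \<open>Obtained by solving the admissibility conditions on the norms of P and Q for
    these norms; the quotients are positive and free of \<theta>.\<close>
  define P Q where "P = T / S0" and "Q = C * S0 / Pi0"
  have PQ: "0 \<le> P" "0 \<le> Q" unfolding P_def Q_def using pos positive(5,6) by simp_all
  have adm: "params_bounded A L du dims R P Q \<theta>" "sup_norm d s du H \<le> C" if "admissible H \<theta>" for H \<theta>
  proof -
    let ?nP = "mat_norm_inf (dims 1) 1 (lift_mat \<theta>)" and ?nQ = "mat_norm_inf du (dims (L + 1)) (proj_mat \<theta>)"
    have W: "\<forall>l\<in>{1..L}. mat_norm_inf (dims (l + 1)) (dims l) (weight \<theta> l) +
          (\<Sum>k\<in>A. mat_norm_inf (dims (l + 1)) (dims l) (kernel_coeff \<theta> l k)) \<le> R l"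
      and C1: "max (sup_norm d s du H) (?nQ * (Pi0 / S0)) \<le> C" and T1: "?nP * S0 \<le> T"
      using that unfolding admissible_def C_const_def Let_def S0_def Pi0_def by simp_all
    show "params_bounded A L du dims R P Q \<theta>"
      by (rule admissible_params_bounded[OF \<open>finite A\<close> \<open>\<forall>l\<in>{1..L + 1}. dims l \<ge> 1\<close> W])
        (use C1 T1 pos in \<open>simp_all add: P_def Q_def field_simps\<close>)
    show "sup_norm d s du H \<le> C" using C1 by simp
  qed
  have R0: "0 \<le> R l" if "l \<ge> 1" for l using positive(1) that by (simp add: less_imp_le)
  have \<sigma>b: "\<bar>(deriv ^^ k) \<sigma> t\<bar> \<le> \<xi> * \<tau> ^ k * fact k" if "k \<ge> 1" for k t using sigma_bound that by blast
  show ?thesis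
  proof (intro conjI)
    define a where "a = affine_field s \<psi>"
    \<comment> \<open>All derivatives of t - 1/2 of order at least 1 are 0 or 1, so the constant 1
      bounds them.\<close>
    interpret aff: field_network d L du s \<omega> dims r h A \<eta> P Q C \<sigma> R "\<lambda>k. \<xi> * \<tau> ^ k * fact k"
      "\<lambda>t. t - 1 / 2" "\<lambda>_. 1" False "{0..1}" a
    proof
      show "smooth (\<lambda>t. t - 1 / 2)" using smooth_affine[of 1 "- 1 / 2"] by simp
      show "a = (\<lambda>x y. basis_fun d \<eta> r h 0 x + (\<Sum>j=1..s. of_real (y j - 1 / 2) * basis_fun d \<eta> r h j x))"
        unfolding a_def affine_field_def psi_def by (rule ext)+ simp
    qed (use assms(3) \<open>finite A\<close> \<open>smooth \<sigma>\<close> \<sigma>b R0 PQ positive(5) deriv_funpow_minus_const in \<open>simp_all add: abs_le_iff\<close>)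
    show "let a = affine_field s \<psi> in
      \<forall>\<delta>. 0 < \<delta> \<and> \<delta> < 1 / 2 \<longrightarrow>
        (\<exists>amin>0. \<forall>x\<in>unit_cube {1..d}. \<forall>y\<in>unit_cube {1..s}. Re (a x y) \<ge> amin) \<longrightarrow>
        (\<forall>p\<in>{1..du}. regular_in_y d s {0..1} (G p) (bound_affine s C T \<beta>)) \<longrightarrow>
        (let rate = min (1 - \<delta>) (1 / pstar - 1 / 2) in
         \<exists>K\<ge>0. \<forall>n\<ge>1. \<forall>w. good_shifted_lattice {1..s} (gamma_affine T \<beta> pstar \<delta>) n w \<longrightarrow>
           (\<exists>\<kappa> \<in> borel_measurable (cube_measure {1..s}).
              (\<integral>\<^sup>+\<Delta>. ennreal ((\<kappa> \<Delta>)\<^sup>2) \<partial>cube_measure {1..s}) \<le> ennreal (K\<^sup>2) \<and>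
              (\<forall>\<Delta>\<in>unit_cube {1..s}. \<forall>m\<ge>1. \<forall>z.
                 good_lattice {1..d} \<omega> (rho_weight \<omega> \<epsilon> Tt) m z \<longrightarrow>
                 (\<forall>FC\<in>{fourier_coeff d, fourier_coeff_app d m (xs m z)}. \<forall>\<theta> tol.
                    admissible (net FC a \<theta>) \<theta> \<longrightarrow> 0 < tol \<and> tol < 1 \<longrightarrow>
                    train_error du n m (ys n w \<Delta>) (xs m z) G (net FC a \<theta>) \<le> tol \<longrightarrow>
                    gen_error d s du G (net FC a \<theta>) \<le>
                      tol + \<kappa> \<Delta> * (real n powr (- rate / 2) + real m powr (- (\<omega> - \<epsilon>) / 2))))))"
      unfolding Let_def a_def[symmetric]
    proof (intro allI impI)
      fix \<delta> :: real assume \<delta>: "0 < \<delta> \<and> \<delta> < 1 / 2" and Gy: "\<forall>p\<in>{1..du}. regular_in_y d s {0..1} (G p) (bound_affine s C T \<beta>)"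
      define rate where "rate = min (1 - \<delta>) (1 / pstar - 1 / 2)"
      let ?\<gamma> = "gamma_affine T \<beta> pstar \<delta>"
      have \<gamma>: "0 < ?\<gamma> u" if "u \<subseteq> ?I" for u
        by (rule gamma_affine_pos[OF that positive(2,6) \<open>0 < pstar\<close> \<open>pstar < 1\<close>]) (use \<delta> in simp_all)
      have "\<exists>K\<ge>0. \<forall>n\<ge>1. \<forall>pts. (\<forall>k\<in>{1..n}. pts k \<in> unit_cube ?I) \<longrightarrow>
        (\<forall>m\<ge>1. \<forall>z. good_lattice ?D \<omega> (rho_weight \<omega> \<epsilon> Tt) m z \<longrightarrow>
         (\<forall>FC\<in>{fourier_coeff d, fourier_coeff_app d m (lattice_point ?D m z (\<lambda>_. 0))}. \<forall>\<theta> tol.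
            params_bounded A L du dims R P Q \<theta> \<longrightarrow> sup_norm d s du (aff.net FC \<theta>) \<le> C \<longrightarrow> 0 < tol \<longrightarrow>
            train_error du n m pts (lattice_point ?D m z (\<lambda>_. 0)) G (aff.net FC \<theta>) \<le> tol \<longrightarrow>
            gen_error d s du G (aff.net FC \<theta>) \<le>
              tol + sqrt (enn2real (min (ennreal K) (ennreal K * worst_case_error False ?I 1 ?\<gamma> n pts))) +
              K * real m powr (- (\<omega> - \<epsilon>) / 2)))"
        by (rule aff.network_error[OF G_regular Gy _ _ \<open>\<omega> \<ge> 1\<close> \<open>0 < \<epsilon>\<close> \<open>\<epsilon> < 1 / 2\<close> positive(8)]) (use \<gamma> in simp_all)
      then obtain K where K: "0 \<le> K" and err: "\<forall>n\<ge>1. \<forall>pts. (\<forall>k\<in>{1..n}. pts k \<in> unit_cube ?I) \<longrightarrow>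
        (\<forall>m\<ge>1. \<forall>z. good_lattice ?D \<omega> (rho_weight \<omega> \<epsilon> Tt) m z \<longrightarrow>
         (\<forall>FC\<in>{fourier_coeff d, fourier_coeff_app d m (lattice_point ?D m z (\<lambda>_. 0))}. \<forall>\<theta> tol.
            params_bounded A L du dims R P Q \<theta> \<longrightarrow> sup_norm d s du (aff.net FC \<theta>) \<le> C \<longrightarrow> 0 < tol \<longrightarrow>
            train_error du n m pts (lattice_point ?D m z (\<lambda>_. 0)) G (aff.net FC \<theta>) \<le> tol \<longrightarrow>
            gen_error d s du G (aff.net FC \<theta>) \<le>
              tol + sqrt (enn2real (min (ennreal K) (ennreal K * worst_case_error False ?I 1 ?\<gamma> n pts))) +
              K * real m powr (- (\<omega> - \<epsilon>) / 2)))"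
        by (elim exE conjE) (rule that)
      \<comment> \<open>For p \<le> 2/3 the rate 1/(2 \<lambda>) is 1 - \<delta>, the smaller term
        of the minimum. For p > 2/3 it is 1/p - 1/2, possibly more than 1 - \<delta>, so only an
        inequality with \<open>rate\<close> holds.\<close>
      define lam where "lam = (if pstar \<le> 2 / 3 then 1 / (2 - 2 * \<delta>) else pstar / (2 - pstar))"
      have "1 / (2 * lam) = (if pstar \<le> 2 / 3 then 1 - \<delta> else 1 / pstar - 1 / 2)"
        using \<open>0 < pstar\<close> \<open>pstar < 1\<close> \<delta> by (simp add: lam_def field_simps)
      then have lam3: "rate \<le> 1 / (2 * lam)" by (simp add: rate_def)
      have lam: "1 / 2 < lam" "lam \<le> 1"
        using \<delta> \<open>0 < pstar\<close> \<open>pstar < 1\<close> by (auto simp: lam_def field_simps)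
      define Ly where "Ly = lattice_bound ?I 1 ?\<gamma> lam (2 * zeta (2 * lam) * 2 powr lam / (2 * pi) powr (2 * lam))"
      have Ly: "0 \<le> Ly" unfolding Ly_def lattice_bound_def by simp
      show "\<exists>K\<ge>0. \<forall>n\<ge>1. \<forall>w. good_shifted_lattice ?I ?\<gamma> n w \<longrightarrow>
           (\<exists>\<kappa> \<in> borel_measurable (cube_measure ?I).
              (\<integral>\<^sup>+\<Delta>. ennreal ((\<kappa> \<Delta>)\<^sup>2) \<partial>cube_measure ?I) \<le> ennreal (K\<^sup>2) \<and>
              (\<forall>\<Delta>\<in>unit_cube ?I. \<forall>m\<ge>1. \<forall>z.
                 good_lattice ?D \<omega> (rho_weight \<omega> \<epsilon> Tt) m z \<longrightarrow>
                 (\<forall>FC\<in>{fourier_coeff d, fourier_coeff_app d m (xs m z)}. \<forall>\<theta> tol.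
                    admissible (net FC a \<theta>) \<theta> \<longrightarrow> 0 < tol \<and> tol < 1 \<longrightarrow>
                    train_error du n m (ys n w \<Delta>) (xs m z) G (net FC a \<theta>) \<le> tol \<longrightarrow>
                    gen_error d s du G (net FC a \<theta>) \<le>
                      tol + \<kappa> \<Delta> * (real n powr (- min (1 - \<delta>) (1 / pstar - 1 / 2) / 2) + real m powr (- (\<omega> - \<epsilon>) / 2)))))"
        unfolding rate_def[symmetric]
      proof (intro exI[of _ "sqrt (2 * K\<^sup>2 + 2 * K * (1 + Ly\<^sup>2))"] conjI allI impI)
        show "0 \<le> sqrt (2 * K\<^sup>2 + 2 * K * (1 + Ly\<^sup>2))" using K by simp
        fix n :: nat and w assume n: "1 \<le> n" and good: "good_shifted_lattice ?I ?\<gamma> n w"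
        define W where "W \<Delta> = worst_case_error False ?I 1 ?\<gamma> n (lattice_point ?I n w \<Delta>)" for \<Delta>
        \<comment> \<open>The normalization under which t times the worst case error has second
          moment at most \<open>Ly\<^sup>2\<close>, for every n.\<close>
        define t where "t = real n powr rate"
        have t: "0 < t" using n by (simp add: t_def)
        have nr: "real n powr (- (1 / (2 * lam))) \<le> real n powr (- rate)" using lam3 n by (intro powr_mono) simp_all
        have "Ly / t = Ly * real n powr (- rate)" unfolding t_def powr_minus divide_inverse ..
        then have "Ly * real n powr (- (1 / (2 * lam))) \<le> Ly / t" using mult_left_mono[OF nr Ly] by (simp only:)
        then have "(ennreal (Ly * real n powr (- (1 / (2 * lam)))))\<^sup>2 \<le> (ennreal (Ly / t))\<^sup>2"
          by (intro power_mono ennreal_leI zero_le)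
        from order_trans[OF good_shifted_lattice_decay[OF good lam n, folded Ly_def W_def] this]
        have W2: "(\<integral>\<^sup>+\<Delta>. (W \<Delta>)\<^sup>2 \<partial>cube_measure ?I) \<le> (ennreal (Ly / t))\<^sup>2" .
        define \<kappa> where "\<kappa> \<Delta> = K + sqrt (enn2real (min (ennreal K) (ennreal K * W \<Delta>)) * t)" for \<Delta>
        note rf = random_factor[OF finite_atLeastAtMost worst_case_error_measurable[of False ?I 1 ?\<gamma> n w, folded W_def] W2 K Ly t,
            folded \<kappa>_def]
        show "\<exists>\<kappa> \<in> borel_measurable (cube_measure ?I).
              (\<integral>\<^sup>+\<Delta>. ennreal ((\<kappa> \<Delta>)\<^sup>2) \<partial>cube_measure ?I) \<le> ennreal ((sqrt (2 * K\<^sup>2 + 2 * K * (1 + Ly\<^sup>2)))\<^sup>2) \<and>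
              (\<forall>\<Delta>\<in>unit_cube ?I. \<forall>m\<ge>1. \<forall>z.
                 good_lattice ?D \<omega> (rho_weight \<omega> \<epsilon> Tt) m z \<longrightarrow>
                 (\<forall>FC\<in>{fourier_coeff d, fourier_coeff_app d m (xs m z)}. \<forall>\<theta> tol.
                    admissible (net FC a \<theta>) \<theta> \<longrightarrow> 0 < tol \<and> tol < 1 \<longrightarrow>
                    train_error du n m (ys n w \<Delta>) (xs m z) G (net FC a \<theta>) \<le> tol \<longrightarrow>
                    gen_error d s du G (net FC a \<theta>) \<le>
                      tol + \<kappa> \<Delta> * (real n powr (- rate / 2) + real m powr (- (\<omega> - \<epsilon>) / 2))))"
        proof (intro bexI[of _ \<kappa>] conjI rf ballI allI impI)
          fix \<Delta> and m :: nat and z FC \<theta> and tol :: real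
          assume m: "1 \<le> m" and gl: "good_lattice ?D \<omega> (rho_weight \<omega> \<epsilon> Tt) m z"
            and FC: "FC \<in> {fourier_coeff d, fourier_coeff_app d m (xs m z)}"
            and ad: "admissible (net FC a \<theta>) \<theta>" and tol: "0 < tol \<and> tol < 1"
            and train: "train_error du n m (ys n w \<Delta>) (xs m z) G (net FC a \<theta>) \<le> tol"
          define E where "E = enn2real (min (ennreal K) (ennreal K * W \<Delta>))"
          have E: "0 \<le> E" by (simp add: E_def)
          have "gen_error d s du G (net FC a \<theta>) \<le> tol + sqrt E + K * real m powr (- (\<omega> - \<epsilon>) / 2)"
            unfolding net_def E_def W_def
            by (rule err[THEN spec, THEN mp, OF n, THEN spec, THEN mp, OF ballI[OF lattice_point_in_cube], THEN spec, THEN mp, OF m,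
                  THEN spec, THEN mp, OF gl, THEN bspec, OF FC[unfolded xs_def], THEN spec, THEN spec, THEN mp, OF adm(1)[OF ad],
                  THEN mp, OF adm(2)[OF ad, unfolded net_def], THEN mp, OF conjunct1[OF tol], THEN mp, OF train[unfolded net_def xs_def ys_def]])
          also have "\<dots> \<le> tol + \<kappa> \<Delta> * (real n powr (- rate / 2) + real m powr (- (\<omega> - \<epsilon>) / 2))"
          proof -
            \<comment> \<open>Because of this identity the product of \<kappa> and the rates
              contains sqrt E as one of its four summands; two others supply the terms with K, and
              what is left is nonnegative.\<close>
            have st: "sqrt t * real n powr (- rate / 2) = 1"
              using n unfolding t_def by (simp add: powr_half_sqrt[symmetric] powr_powr powr_add[symmetric])
            have "\<kappa> \<Delta> * (real n powr (- rate / 2) + real m powr (- (\<omega> - \<epsilon>) / 2)) =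
              K * real n powr (- rate / 2) + sqrt E * (sqrt t * real n powr (- rate / 2)) +
              K * real m powr (- (\<omega> - \<epsilon>) / 2) + sqrt E * sqrt t * real m powr (- (\<omega> - \<epsilon>) / 2)"
              unfolding \<kappa>_def E_def[symmetric] by (simp only: real_sqrt_mult algebra_simps)
            moreover have "0 \<le> K * real n powr (- rate / 2)" "0 \<le> sqrt E * sqrt t * real m powr (- (\<omega> - \<epsilon>) / 2)"
              using K E t by simp_all
            ultimately show ?thesis unfolding st by simp
          qed
          finally show "gen_error d s du G (net FC a \<theta>) \<le>
            tol + \<kappa> \<Delta> * (real n powr (- rate / 2) + real m powr (- (\<omega> - \<epsilon>) / 2))" .
        qed
      qed
    qed
  next
    define a where "a = chebyshev_field s \<psi>"
    have "\<exists>B. \<forall>t. \<bar>(deriv ^^ k) (\<lambda>t. sin (2 * pi * t)) t\<bar> \<le> B" for k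
    proof -
      have "sin (2 * pi * (t + 1)) = sin (2 * pi * t)" for t using sin_periodic[of "2 * pi * t"] by (simp add: distrib_left)
      from periodic_smooth_bounded[OF smooth_sin_2pi this, of k] show ?thesis by blast
    qed
    then obtain b' where b': "\<And>k t. \<bar>(deriv ^^ k) (\<lambda>t. sin (2 * pi * t)) t\<bar> \<le> b' k" by metis
    interpret cheb: field_network d L du s \<omega> dims r h A \<eta> P Q C \<sigma> R "\<lambda>k. \<xi> * \<tau> ^ k * fact k"
      "\<lambda>t. sin (2 * pi * t)" b' True UNIV a
    proof
      show "sin (2 * pi * (t + 1)) = sin (2 * pi * t)" for t using sin_periodic[of "2 * pi * t"] by (simp add: distrib_left)
      show "a = (\<lambda>x y. basis_fun d \<eta> r h 0 x + (\<Sum>j=1..s. of_real (sin (2 * pi * y j)) * basis_fun d \<eta> r h j x))"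
        unfolding a_def chebyshev_field_def psi_def by (rule ext)+ simp
    qed (use assms(3) \<open>finite A\<close> \<open>smooth \<sigma>\<close> \<sigma>b R0 PQ positive(5) b' smooth_sin_2pi in simp_all)
    \<comment> \<open>Here 1/(2 \<lambda>) is exactly the stated rate, and the rounding in \<alpha>
      is just enough for \<lambda> > 1/(2 \<alpha>).\<close>
    define \<alpha> lam rate where "\<alpha> = alpha_chebyshev pstar" and "lam = pstar / (2 - pstar)" and "rate = 1 / pstar - 1 / 2"
    let ?\<gamma> = "gamma_chebyshev T \<beta> pstar"
    note \<alpha> = alpha_chebyshev_gt[OF \<open>0 < pstar\<close> \<open>pstar < 1\<close>, folded \<alpha>_def]
    have lam: "1 / (2 * real \<alpha>) < lam" "lam \<le> 1" "1 / (2 * lam) = rate"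
      using \<alpha> \<open>0 < pstar\<close> \<open>pstar < 1\<close> unfolding lam_def rate_def by (simp_all add: field_simps)
    have \<gamma>: "0 < ?\<gamma> u" if "u \<subseteq> ?I" for u
      by (rule gamma_chebyshev_pos[OF that positive(2,6) \<open>0 < pstar\<close> \<open>pstar < 1\<close>])
    show "let a = chebyshev_field s \<psi> in
        (\<exists>amin>0. \<forall>x\<in>unit_cube {1..d}. \<forall>y\<in>unit_cube {1..s}. Re (a x y) \<ge> amin) \<longrightarrow>
        (\<forall>p\<in>{1..du}. periodic_in_y d s (G p) \<and>
           regular_in_y d s UNIV (G p) (bound_chebyshev s C T \<beta>)) \<longrightarrow>
        (let rate = 1 / pstar - 1 / 2 in
         \<exists>K\<ge>0. \<forall>n\<ge>1. \<forall>w.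
           good_lattice {1..s} (alpha_chebyshev pstar) (gamma_chebyshev T \<beta> pstar) n w \<longrightarrow>
           (\<forall>m\<ge>1. \<forall>z. good_lattice {1..d} \<omega> (rho_weight \<omega> \<epsilon> Tt) m z \<longrightarrow>
              (\<forall>FC\<in>{fourier_coeff d, fourier_coeff_app d m (xs m z)}. \<forall>\<theta> tol.
                 admissible (net FC a \<theta>) \<theta> \<longrightarrow> 0 < tol \<and> tol < 1 \<longrightarrow>
                 train_error du n m (ys n w (\<lambda>_. 0)) (xs m z) G (net FC a \<theta>) \<le> tol \<longrightarrow>
                 gen_error d s du G (net FC a \<theta>) \<le>
                   tol + K * (real n powr (- rate / 2) + real m powr (- (\<omega> - \<epsilon>) / 2)))))"
      unfolding Let_def a_def[symmetric] rate_def[symmetric] \<alpha>_def[symmetric]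
    proof (intro impI)
      assume "\<forall>p\<in>{1..du}. periodic_in_y d s (G p) \<and> regular_in_y d s UNIV (G p) (bound_chebyshev s C T \<beta>)"
      then have Gp: "\<forall>p\<in>{1..du}. periodic_in_y d s (G p)"
        and Gy: "\<forall>p\<in>{1..du}. regular_in_y d s UNIV (G p) (bound_chebyshev s C T \<beta>)" by simp_all
      have "\<exists>K\<ge>0. \<forall>n\<ge>1. \<forall>pts. (\<forall>k\<in>{1..n}. pts k \<in> unit_cube ?I) \<longrightarrow>
        (\<forall>m\<ge>1. \<forall>z. good_lattice ?D \<omega> (rho_weight \<omega> \<epsilon> Tt) m z \<longrightarrow>
         (\<forall>FC\<in>{fourier_coeff d, fourier_coeff_app d m (lattice_point ?D m z (\<lambda>_. 0))}. \<forall>\<theta> tol.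
            params_bounded A L du dims R P Q \<theta> \<longrightarrow> sup_norm d s du (cheb.net FC \<theta>) \<le> C \<longrightarrow> 0 < tol \<longrightarrow>
            train_error du n m pts (lattice_point ?D m z (\<lambda>_. 0)) G (cheb.net FC \<theta>) \<le> tol \<longrightarrow>
            gen_error d s du G (cheb.net FC \<theta>) \<le>
              tol + sqrt (enn2real (min (ennreal K) (ennreal K * worst_case_error True ?I \<alpha> ?\<gamma> n pts))) +
              K * real m powr (- (\<omega> - \<epsilon>) / 2)))"
        by (rule cheb.network_error[OF G_regular Gy Gp _ \<open>\<omega> \<ge> 1\<close> \<open>0 < \<epsilon>\<close> \<open>\<epsilon> < 1 / 2\<close> positive(8)]) (use \<gamma> in simp_all)
      then obtain K where K: "0 \<le> K" and err: "\<forall>n\<ge>1. \<forall>pts. (\<forall>k\<in>{1..n}. pts k \<in> unit_cube ?I) \<longrightarrow>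
        (\<forall>m\<ge>1. \<forall>z. good_lattice ?D \<omega> (rho_weight \<omega> \<epsilon> Tt) m z \<longrightarrow>
         (\<forall>FC\<in>{fourier_coeff d, fourier_coeff_app d m (lattice_point ?D m z (\<lambda>_. 0))}. \<forall>\<theta> tol.
            params_bounded A L du dims R P Q \<theta> \<longrightarrow> sup_norm d s du (cheb.net FC \<theta>) \<le> C \<longrightarrow> 0 < tol \<longrightarrow>
            train_error du n m pts (lattice_point ?D m z (\<lambda>_. 0)) G (cheb.net FC \<theta>) \<le> tol \<longrightarrow>
            gen_error d s du G (cheb.net FC \<theta>) \<le>
              tol + sqrt (enn2real (min (ennreal K) (ennreal K * worst_case_error True ?I \<alpha> ?\<gamma> n pts))) +
              K * real m powr (- (\<omega> - \<epsilon>) / 2)))"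
        by (elim exE conjE) (rule that)
      define Ly where "Ly = lattice_bound ?I 1 ?\<gamma> lam (2 * zeta (2 * real \<alpha> * lam) / (2 * pi) powr (2 * real \<alpha> * lam))"
      have Ly: "0 \<le> Ly" unfolding Ly_def lattice_bound_def by simp
      \<comment> \<open>Without a shift the worst case error decays deterministically, so sqrt E is
        at most sqrt(K Ly) n^(-r/2), and one constant covers both rates.\<close>
      define K' where "K' = K + sqrt (K * Ly)"
      have K': "0 \<le> K'" "K \<le> K'" "sqrt (K * Ly) \<le> K'" unfolding K'_def using K Ly by simp_all
      show "\<exists>K\<ge>0. \<forall>n\<ge>1. \<forall>w. good_lattice ?I \<alpha> ?\<gamma> n w \<longrightarrow>
           (\<forall>m\<ge>1. \<forall>z. good_lattice ?D \<omega> (rho_weight \<omega> \<epsilon> Tt) m z \<longrightarrow>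
              (\<forall>FC\<in>{fourier_coeff d, fourier_coeff_app d m (xs m z)}. \<forall>\<theta> tol.
                 admissible (net FC a \<theta>) \<theta> \<longrightarrow> 0 < tol \<and> tol < 1 \<longrightarrow>
                 train_error du n m (ys n w (\<lambda>_. 0)) (xs m z) G (net FC a \<theta>) \<le> tol \<longrightarrow>
                 gen_error d s du G (net FC a \<theta>) \<le>
                   tol + K * (real n powr (- rate / 2) + real m powr (- (\<omega> - \<epsilon>) / 2))))"
      proof (intro exI[of _ K'] conjI allI ballI impI K'(1))
        fix n m :: nat and w z FC \<theta> and tol :: real
        assume n: "1 \<le> n" and good: "good_lattice ?I \<alpha> ?\<gamma> n w" and m: "1 \<le> m"
          and gl: "good_lattice ?D \<omega> (rho_weight \<omega> \<epsilon> Tt) m z"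
          and FC: "FC \<in> {fourier_coeff d, fourier_coeff_app d m (xs m z)}"
          and ad: "admissible (net FC a \<theta>) \<theta>" and tol: "0 < tol \<and> tol < 1"
          and train: "train_error du n m (ys n w (\<lambda>_. 0)) (xs m z) G (net FC a \<theta>) \<le> tol"
        let ?W = "worst_case_error True ?I \<alpha> ?\<gamma> n (lattice_point ?I n w (\<lambda>_. 0))"
        define E where "E = enn2real (min (ennreal K) (ennreal K * ?W))"
        have err1: "gen_error d s du G (net FC a \<theta>) \<le> tol + sqrt E + K * real m powr (- (\<omega> - \<epsilon>) / 2)"
          unfolding net_def E_def
          by (rule err[THEN spec, THEN mp, OF n, THEN spec, THEN mp, OF ballI[OF lattice_point_in_cube], THEN spec, THEN mp, OF m,
                THEN spec, THEN mp, OF gl, THEN bspec, OF FC[unfolded xs_def], THEN spec, THEN spec, THEN mp, OF adm(1)[OF ad],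
                THEN mp, OF adm(2)[OF ad, unfolded net_def], THEN mp, OF conjunct1[OF tol], THEN mp, OF train[unfolded net_def xs_def ys_def]])
        have "?W \<le> ennreal (Ly * real n powr (- rate))"
          using good_lattice_decay[OF good lam(1,2) \<alpha>(2) n] unfolding Ly_def[symmetric] lam(3) .
        then have "min (ennreal K) (ennreal K * ?W) \<le> ennreal K * ennreal (Ly * real n powr (- rate))"
          by (intro order_trans[OF min.cobounded2] mult_left_mono) simp_all
        also have "\<dots> = ennreal (K * Ly * real n powr (- rate))" using K by (simp add: ennreal_mult' mult.assoc)
        finally have "E \<le> K * Ly * real n powr (- rate)"
          unfolding E_def using K Ly by (intro enn2real_leI) simp_all
        then have "sqrt E \<le> sqrt (K * Ly) * real n powr (- rate / 2)"
          by (drule_tac real_sqrt_le_mono) (simp add: real_sqrt_mult powr_half_sqrt[symmetric] powr_powr)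
        also have "\<dots> \<le> K' * real n powr (- rate / 2)" by (intro mult_right_mono K'(3)) simp
        finally have "sqrt E \<le> K' * real n powr (- rate / 2)" .
        moreover have "K * real m powr (- (\<omega> - \<epsilon>) / 2) \<le> K' * real m powr (- (\<omega> - \<epsilon>) / 2)"
          by (intro mult_right_mono K'(2)) simp
        ultimately show "gen_error d s du G (net FC a \<theta>) \<le>
          tol + K' * (real n powr (- rate / 2) + real m powr (- (\<omega> - \<epsilon>) / 2))"
          using err1 unfolding distrib_left by linarith
      qed
    qed
  qed
qed

end
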